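(* Let $n\ge 1$ and $1<r<\frac{d+1}{2}$. Then there is an isomorphism of schemes $R^{r,n}\simeq \mathrm{Gr}(n\cdot r,\,d-r)$.
   Context: $\Bbbk$ is an algebraically closed field of characteristic zero and $S=\Bbbk[x_1,\dots,x_n]$. $\mathrm{Quot}_d(\mathcal{O}_{\mathbb{A}^n}^{\oplus r})$ is the Quot scheme whose $\Bbbk$-points are equivalence classes of surjections of $S$-modules $S^{\oplus r}\twoheadrightarrow M$ with $\dim_{\Bbbk}M=d$. For such a point, $X_i\in\mathrm{End}_{\Bbbk}(M)$ denotes the action of $x_i$ on $M$. For an integer $k$, $S_k$ denotes the closed subset of $\mathrm{Quot}_d(\mathcal{O}_{\mathbb{A}^n}^{\oplus r})$ of points $[S^{\oplus r}\twoheadrightarrow M]$ such that all $X_i$ are traceless, $\dim(\bigcap_{i=1}^n\ker X_i)\ge d-k$, $\dim(\sum_{i=1}^n\mathrm{im}\,X_i)\le d-k$, and $X_iX_j=0$ for all $i,j=1,\dots,n$. For $1<r<\frac{d+1}{2}$ one puts $R^{r,n}:=S_r$, with its reduced scheme structure. $\mathrm{Gr}(a,b)$ denotes the Grassmannian of $b$-dimensional quotients of an $a$-dimensional vector space. *)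

theory Defs
  imports
    "HOL-Algebra.Ideal"
    "HOL-Algebra.Module"
    "Jordan_Normal_Form.Matrix_Kernel"
begin

text \<open>
  Schemes over a field \<open>'k\<close> are treated through their functors of points: a \<open>'k\<close>-scheme \<open>X\<close> is the
  functor \<open>A \<mapsto> X(A)\<close> on commutative \<open>'k\<close>-algebras, and an isomorphism of schemes is a natural
  isomorphism of functors.  The Quot scheme and the Grassmannian are the schemes representing the
  functors defined below.

  The algebras range over all those with carrier in a type \<open>'b\<close>, which stays a free type variable.
  The schemes concerned are of finite type, so they are determined by their values on finitely
  generated algebras; every finitely generated algebra over an infinite field \<open>'k\<close> has an
  isomorphic copy as soon as \<open>'k\<close> injects into \<open>'b\<close> (for instance \<open>'b = 'k\<close>).
\<close>


subsection \<open>Algebras and functors\<close>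

abbreviation k_algebra :: "('k::field, 'b) module \<Rightarrow> bool" where
  "k_algebra A \<equiv> Module.algebra class_ring A"

definition k_algebra_hom ::
    "('k::field, 'b) module \<Rightarrow> ('k, 'c) module \<Rightarrow> ('b \<Rightarrow> 'c) \<Rightarrow> bool" where
  "k_algebra_hom A B \<phi> \<longleftrightarrow> \<phi> \<in> Ring.ring_hom A B \<and>
     (\<forall>c. \<forall>a \<in> carrier A. \<phi> (c \<odot>\<^bsub>A\<^esub> a) = c \<odot>\<^bsub>B\<^esub> \<phi> a)"

definition base_algebra :: "('k::field, 'k) module" where
  "base_algebra =
     \<lparr>carrier = UNIV, mult = (*), one = 1, zero = 0, add = (+), smult = (*)\<rparr>"

definition structure_map :: "('k::field, 'b) module \<Rightarrow> 'k \<Rightarrow> 'b" where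
  "structure_map A c = c \<odot>\<^bsub>A\<^esub> \<one>\<^bsub>A\<^esub>"

record ('k, 'b, 'p) k_functor =
  points :: "('k, 'b) module \<Rightarrow> 'p set"
  pull :: "('k, 'b) module \<Rightarrow> ('k, 'b) module \<Rightarrow> ('b \<Rightarrow> 'b) \<Rightarrow> 'p \<Rightarrow> 'p"

definition scheme_iso ::
    "('k::field, 'b, 'p) k_functor \<Rightarrow> ('k, 'b, 'q) k_functor \<Rightarrow> bool" (infix \<open>\<simeq>\<^sub>S\<close> 50) where
  "F \<simeq>\<^sub>S G \<longleftrightarrow> (\<exists>\<eta>.
     (\<forall>A. k_algebra A \<longrightarrow> bij_betw (\<eta> A) (points F A) (points G A)) \<and>
     (\<forall>A B \<phi>. k_algebra A \<and> k_algebra B \<and> k_algebra_hom A B \<phi> \<longrightarrow>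
        (\<forall>\<xi> \<in> points F A. \<eta> B (pull F A B \<phi> \<xi>) = pull G A B \<phi> (\<eta> A \<xi>))))"

text \<open>
  A closed subscheme \<open>Z\<close> of \<open>F\<close>: for every \<open>\<xi> : Spec A \<rightarrow> F\<close> the fibre product \<open>Z \<times>\<^sub>F Spec A\<close> is the
  closed subscheme \<open>Spec (A/I)\<close> of \<open>Spec A\<close> for some ideal \<open>I\<close>.  Taking \<open>\<phi>\<close> to be the identity shows
  that \<open>Z\<close> is then stable under \<open>pull\<close>.
\<close>

definition closed_subscheme ::
    "('k::field, 'b, 'p) k_functor \<Rightarrow> (('k, 'b) module \<Rightarrow> 'p set) \<Rightarrow> bool" where
  "closed_subscheme F Z \<longleftrightarrow> (\<forall>A. k_algebra A \<longrightarrow> Z A \<subseteq> points F A \<and>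
     (\<forall>\<xi> \<in> points F A. \<exists>I. ideal I A \<and>
        (\<forall>B \<phi>. k_algebra B \<and> k_algebra_hom A B \<phi> \<longrightarrow>
           (pull F A B \<phi> \<xi> \<in> Z B \<longleftrightarrow> (\<forall>a \<in> I. \<phi> a = \<zero>\<^bsub>B\<^esub>)))))"


subsection \<open>Free modules and locally free quotients\<close>

text \<open>The free \<open>A\<close>-module on the set \<open>X\<close>; \<open>mult\<close> and \<open>one\<close> of the record play no role.\<close>

definition free_module :: "('k, 'b) module \<Rightarrow> 'i set \<Rightarrow> ('b, 'i \<Rightarrow> 'b) module" where
  "free_module A X =
     \<lparr>carrier = {f. (\<forall>x. f x \<in> carrier A) \<and> (\<forall>x. x \<notin> X \<longrightarrow> f x = \<zero>\<^bsub>A\<^esub>) \<and> finite {x. f x \<noteq> \<zero>\<^bsub>A\<^esub>}},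
      mult = undefined,
      one = undefined,
      zero = (\<lambda>x. \<zero>\<^bsub>A\<^esub>),
      add = (\<lambda>f g x. f x \<oplus>\<^bsub>A\<^esub> g x),
      smult = (\<lambda>a f x. a \<otimes>\<^bsub>A\<^esub> f x)\<rparr>"

text \<open>
  \<open>M/N\<close> is locally free of rank \<open>d\<close> over \<open>A\<close>: there are finitely many \<open>s\<close> generating the unit ideal
  such that \<open>(M/N)\<^sub>s\<close> is free of rank \<open>d\<close> over \<open>A\<^sub>s\<close>.  As \<open>s\<close> is a unit in \<open>A\<^sub>s\<close>, a basis of \<open>(M/N)\<^sub>s\<close> can
  be taken from the image of \<open>M\<close>; generation and independence are written out with denominators
  cleared.
\<close>

definition locally_free_quotient ::
    "('k, 'b) module \<Rightarrow> ('b, 'm) module \<Rightarrow> 'm set \<Rightarrow> nat \<Rightarrow> bool" where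
  "locally_free_quotient A M N d \<longleftrightarrow>
     (\<exists>T. finite T \<and> T \<subseteq> carrier A \<and> Idl\<^bsub>A\<^esub> T = carrier A \<and>
        (\<forall>s \<in> T. \<exists>b \<in> {..<d} \<rightarrow> carrier M.
           (\<forall>v \<in> carrier M. \<exists>e::nat. \<exists>c \<in> {..<d} \<rightarrow> carrier A.
              (s [^]\<^bsub>A\<^esub> e) \<odot>\<^bsub>M\<^esub> v \<ominus>\<^bsub>M\<^esub> (\<Oplus>\<^bsub>M\<^esub>i \<in> {..<d}. c i \<odot>\<^bsub>M\<^esub> b i) \<in> N) \<and>
           (\<forall>c \<in> {..<d} \<rightarrow> carrier A.
              (\<Oplus>\<^bsub>M\<^esub>i \<in> {..<d}. c i \<odot>\<^bsub>M\<^esub> b i) \<in> N \<longrightarrow>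
              (\<exists>e::nat. \<forall>i<d. (s [^]\<^bsub>A\<^esub> e) \<otimes>\<^bsub>A\<^esub> c i = \<zero>\<^bsub>A\<^esub>))))"

text \<open>
  Base change of the quotient \<open>A\<^sup>(\<^sup>X\<^sup>) / N\<close> along \<open>\<phi> : A \<rightarrow> B\<close>: the kernel of
  \<open>B\<^sup>(\<^sup>X\<^sup>) \<rightarrow> (A\<^sup>(\<^sup>X\<^sup>) / N) \<otimes>\<^sub>A B\<close> is the \<open>B\<close>-submodule generated by the image of \<open>N\<close>.
\<close>

definition base_change ::
    "('k, 'b) module \<Rightarrow> 'i set \<Rightarrow> ('c \<Rightarrow> 'b) \<Rightarrow> ('i \<Rightarrow> 'c) set \<Rightarrow> ('i \<Rightarrow> 'b) set" where
  "base_change B X \<phi> N =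
     \<Inter> {H. Module.submodule H B (free_module B X) \<and> (\<lambda>f. \<phi> \<circ> f) ` N \<subseteq> H}"


subsection \<open>The Grassmannian\<close>

text \<open>Equivalence classes of quotients are represented by the kernels.\<close>

definition Grassmannian :: "nat \<Rightarrow> nat \<Rightarrow> ('k::field, 'b, (nat \<Rightarrow> 'b) set) k_functor" where
  "Grassmannian a b =
     \<lparr>points = (\<lambda>A. {N. Module.submodule N A (free_module A {..<a}) \<and>
                        locally_free_quotient A (free_module A {..<a}) N b}),
      pull = (\<lambda>A B. base_change B {..<a})\<rparr>"


subsection \<open>The Quot scheme of points\<close>

text \<open>
  With \<open>S\<^sub>A = A[x\<^sub>0, \<dots>, x\<^sub>n\<^sub>-\<^sub>1]\<close>, the module \<open>S\<^sub>A\<^sup>r\<close> is \<open>A\<close>-free on the \<open>x\<^sup>m e\<^sub>j\<close>, where monomials \<open>m\<close> are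
  multisets of variable indices.
  Indices of variables and of the \<open>e\<^sub>j\<close> start at \<open>0\<close>.
\<close>

type_synonym 'b poly_tuple = "nat \<times> nat multiset \<Rightarrow> 'b"

definition quot_index :: "nat \<Rightarrow> nat \<Rightarrow> (nat \<times> nat multiset) set" where
  "quot_index n r = {..<r} \<times> {m. set_mset m \<subseteq> {..<n}}"

abbreviation poly_tuples :: "nat \<Rightarrow> nat \<Rightarrow> ('k, 'b) module \<Rightarrow> ('b, 'b poly_tuple) module" where
  "poly_tuples n r A \<equiv> free_module A (quot_index n r)"

definition var_mult :: "('k, 'b) module \<Rightarrow> nat \<Rightarrow> 'b poly_tuple \<Rightarrow> 'b poly_tuple" where
  "var_mult A i f = (\<lambda>(j, m). if i \<in># m then f (j, m - {#i#}) else \<zero>\<^bsub>A\<^esub>)"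

text \<open>
  \<open>A\<close>-points: \<open>S\<^sub>A\<close>-submodules \<open>N\<close> of \<open>S\<^sub>A\<^sup>r\<close> (that is, \<open>A\<close>-submodules stable under all \<open>x\<^sub>i\<close>) with
  \<open>S\<^sub>A\<^sup>r / N\<close> locally free of rank \<open>d\<close> over \<open>A\<close>.
\<close>

definition Quot :: "nat \<Rightarrow> nat \<Rightarrow> nat \<Rightarrow> ('k::field, 'b, 'b poly_tuple set) k_functor" where
  "Quot n r d =
     \<lparr>points = (\<lambda>A. {N. Module.submodule N A (poly_tuples n r A) \<and>
                        (\<forall>i<n. \<forall>f \<in> N. var_mult A i f \<in> N) \<and>
                        locally_free_quotient A (poly_tuples n r A) N d}),
      pull = (\<lambda>A B. base_change B (quot_index n r))\<rparr>"


subsection \<open>The loci \<open>S\<^sub>k\<close>\<close>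

text \<open>
  A surjection \<open>q : S\<^sup>r \<rightarrow> M\<close> with kernel \<open>N\<close>, for \<open>M = 'k\<^sup>d\<close> with \<open>x\<^sub>i\<close> acting by the matrix \<open>X\<^sub>i\<close>.
\<close>

definition quot_surjection ::
    "nat \<Rightarrow> nat \<Rightarrow> nat \<Rightarrow> 'k::field poly_tuple set \<Rightarrow> ('k poly_tuple \<Rightarrow> 'k vec) \<Rightarrow> (nat \<Rightarrow> 'k mat) \<Rightarrow> bool"
  where
  "quot_surjection n r d N q X \<longleftrightarrow>
     (let F = poly_tuples n r (base_algebra :: ('k, 'k) module) in
      q ` carrier F = carrier_vec d \<and>
      (\<forall>f \<in> carrier F. \<forall>g \<in> carrier F. q (f \<oplus>\<^bsub>F\<^esub> g) = q f + q g) \<and>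
      (\<forall>c. \<forall>f \<in> carrier F. q (c \<odot>\<^bsub>F\<^esub> f) = c \<cdot>\<^sub>v q f) \<and>
      {f \<in> carrier F. q f = 0\<^sub>v d} = N \<and>
      (\<forall>i<n. X i \<in> carrier_mat d d \<and>
         (\<forall>f \<in> carrier F. q (var_mult base_algebra i f) = X i *\<^sub>v q f)))"

definition subspace_dim :: "nat \<Rightarrow> 'k::field vec set \<Rightarrow> nat" where
  "subspace_dim d W = vectorspace.dim class_ring (module_vec TYPE('k) d\<lparr>carrier := W\<rparr>)"

definition common_kernel :: "nat \<Rightarrow> nat \<Rightarrow> (nat \<Rightarrow> 'k::field mat) \<Rightarrow> 'k vec set" where
  "common_kernel n d X = carrier_vec d \<inter> (\<Inter>i<n. mat_kernel (X i))"

definition image_sum :: "nat \<Rightarrow> nat \<Rightarrow> (nat \<Rightarrow> 'k::field mat) \<Rightarrow> 'k vec set" where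
  "image_sum n d X =
     {finsum_vec TYPE('k) d (\<lambda>i. X i *\<^sub>v w i) {..<n} | w. w \<in> {..<n} \<rightarrow> carrier_vec d}"

definition S_locus :: "nat \<Rightarrow> nat \<Rightarrow> nat \<Rightarrow> int \<Rightarrow> 'k::field poly_tuple set set" where
  "S_locus n r d k =
     {N \<in> points (Quot n r d) base_algebra. \<exists>q X. quot_surjection n r d N q X \<and>
        (\<forall>i<n. (\<Sum>j<d. X i $$ (j, j)) = 0) \<and>
        int (subspace_dim d (common_kernel n d X)) \<ge> int d - k \<and>
        int (subspace_dim d (image_sum n d X)) \<le> int d - k \<and>
        (\<forall>i<n. \<forall>j<n. X i * X j = 0\<^sub>m d d)}"

text \<open>
  The reduced scheme structure on (the closure of) a set \<open>P\<close> of \<open>'k\<close>-points of the Quot scheme is the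
  smallest closed subscheme containing \<open>P\<close>.  That a \<open>'k\<close>-point \<open>\<xi>\<close> lies on \<open>Z\<close> is expressed by
  pulling \<open>\<xi>\<close> back to all \<open>'k\<close>-algebras with carrier in \<open>'b\<close>, because \<open>'k\<close> itself is not one of them
  (its carrier has type \<open>'k\<close>).
\<close>

definition contains_k_points ::
    "nat \<Rightarrow> nat \<Rightarrow> (('k::field, 'b) module \<Rightarrow> 'b poly_tuple set set) \<Rightarrow> 'k poly_tuple set set \<Rightarrow> bool"
  where
  "contains_k_points n r Z P \<longleftrightarrow>
     (\<forall>\<xi> \<in> P. \<forall>A. k_algebra A \<longrightarrow> base_change A (quot_index n r) (structure_map A) \<xi> \<in> Z A)"

definition reduced_subscheme ::
    "nat \<Rightarrow> nat \<Rightarrow> nat \<Rightarrow> 'k::field poly_tuple set set \<Rightarrow> ('k, 'b, 'b poly_tuple set) k_functor" where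
  "reduced_subscheme n r d P =
     \<lparr>points = (\<lambda>A. {\<xi> \<in> points (Quot n r d) A.
                     \<forall>Z. closed_subscheme (Quot n r d) Z \<and> contains_k_points n r Z P \<longrightarrow> \<xi> \<in> Z A}),
      pull = pull (Quot n r d)\<rparr>"

definition R_scheme :: "nat \<Rightarrow> nat \<Rightarrow> nat \<Rightarrow> ('k::field, 'b, 'b poly_tuple set) k_functor" where
  "R_scheme n r d = reduced_subscheme n r d (S_locus n r d (int r))"

end

theory Submission
  imports Defs "HOL-Algebra.UnivPoly" "HOL-Algebra.QuotRing"
begin

text \<open>
  For a point of \<open>S\<^sub>r\<close> with module \<open>M\<close>, the sum of the images of the \<open>X\<^sub>i\<close> has dimension at most \<open>d - r\<close>, so the
  \<open>r\<close> generators are independent modulo it, and \<open>X\<^sub>i X\<^sub>j = 0\<close> kills all monomials of degree at least two.  So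
  the kernel of \<open>S\<^sup>r \<rightarrow> M\<close> has no terms of degree zero, contains everything of degree at least two, and is
  determined by its linear part, a subspace \<open>N\<close> of \<open>'k\<^bsup>nr\<^esup>\<close> of codimension \<open>d - r\<close>.  Conversely every such
  \<open>N\<close> lifts to a point of \<open>S\<^sub>r\<close>.  The two conditions on the kernel cut out closed subschemes of the Quot
  scheme, hence hold for all \<open>A\<close>-points of the reduced structure, which embeds \<open>R\<^bsup>r,n\<^esup>\<close> into the Grassmannian.
  Over the standard charts of the Grassmannian, which are affine spaces, a closed subscheme containing all
  \<open>'k\<close>-points contains all \<open>A\<close>-points because \<open>'k\<close> is infinite; as the charts cover, the embedding is onto.
\<close>

section \<open>Saturations and radicals\<close>

text \<open>The reduced structure is the intersection of all closed subschemes through the given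
  points. Bounding it from above takes closed subschemes with explicit ideals; bounding it from
  below means coping with an arbitrary closed \<open>Z\<close>, known only through the ideals of its
  pullbacks. These are tested on \<open>A[x]\<close> and \<open>A_s\<close>, but functors see only
  algebras with carrier in the fixed type \<open>'b\<close>. So both are coded inside
  \<open>'b\<close>: a nonzero algebra contains an infinite field, hence has room for finite
  sequences of its elements. The zero ring is treated apart. Quotients are only locally free, and
  neither quotient modules nor localised modules nor tensor products are formed. Equality in
  \<open>M/N\<close> is a difference in \<open>N\<close>; statements over \<open>A_s\<close> are
  made over \<open>A\<close> with denominators cleared; and an ideal is the unit ideal if for each
  \<open>s\<close> of a cover it contains a divisor of a power of \<open>s\<close>. These divisors,
  the elements that become units in \<open>A_s\<close>, form \<open>saturation R s\<close>. The main
  tool is the exchange of a single local basis vector, at the price of refining the cover.\<close>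

definition saturation :: "('a, 'm) ring_scheme \<Rightarrow> 'a \<Rightarrow> 'a set" where
  "saturation R s = {x \<in> carrier R. \<exists>y \<in> carrier R. \<exists>e::nat. y \<otimes>\<^bsub>R\<^esub> x = s [^]\<^bsub>R\<^esub> e}"

context cring
begin

lemma saturation_closed: "x \<in> saturation R s \<Longrightarrow> x \<in> carrier R"
  by (simp add: saturation_def)

lemma pow_saturation: "s \<in> carrier R \<Longrightarrow> s [^] (e::nat) \<in> saturation R s"
  unfolding saturation_def by (auto intro!: bexI[of _ "\<one>"] exI[of _ e])

lemma self_saturation: "s \<in> carrier R \<Longrightarrow> s \<in> saturation R s"
  using pow_saturation[of s 1] by simp

lemma one_saturation: "s \<in> carrier R \<Longrightarrow> \<one> \<in> saturation R s"
  using pow_saturation[of s 0] by simp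

lemma mult_saturation:
  assumes s: "s \<in> carrier R" and "x \<in> saturation R s" "y \<in> saturation R s"
  shows "x \<otimes> y \<in> saturation R s"
proof -
  from assms obtain u e v f where *: "x \<in> carrier R" "y \<in> carrier R" "u \<in> carrier R" "v \<in> carrier R"
    "u \<otimes> x = s [^] (e::nat)" "v \<otimes> y = s [^] (f::nat)" by (auto simp: saturation_def)
  have "(u \<otimes> v) \<otimes> (x \<otimes> y) = (u \<otimes> x) \<otimes> (v \<otimes> y)" using *(1-4) by (simp add: m_ac)
  also have "\<dots> = s [^] (e + f)" using * s by (simp add: nat_pow_mult)
  finally show ?thesis using * unfolding saturation_def by blast
qed

lemma saturation_Units:
  assumes s: "s \<in> Units R" and x: "x \<in> saturation R s"
  shows "x \<in> Units R"
proof -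
  obtain y e where *: "x \<in> carrier R" "y \<in> carrier R" "y \<otimes> x = s [^] (e::nat)" using x by (auto simp: saturation_def)
  have u: "y \<otimes> x \<in> Units R" unfolding *(3) using s by (induction e) auto
  let ?w = "inv (y \<otimes> x) \<otimes> y"
  have "?w \<otimes> x = \<one>" using u * by (simp add: m_assoc)
  moreover have "?w \<in> carrier R" using u * by simp
  ultimately show ?thesis using * unfolding Units_def by (auto intro!: bexI[of _ ?w] simp: m_comm)
qed

text \<open>Shrinking \<open>D(s)\<close> to \<open>D(sc)\<close> keeps every denominator already in
  use and makes \<open>c\<close> a new one. This is why denominators range over the saturation and
  not just over the powers of \<open>s\<close>.\<close>

lemma saturation_mult_left:
  assumes "s \<in> carrier R" "c \<in> carrier R"
  shows "saturation R s \<subseteq> saturation R (s \<otimes> c)" and "c \<in> saturation R (s \<otimes> c)"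
proof
  fix x assume "x \<in> saturation R s"
  then obtain u e where *: "x \<in> carrier R" "u \<in> carrier R" "u \<otimes> x = s [^] (e::nat)"
    by (auto simp: saturation_def)
  have "(u \<otimes> c [^] e) \<otimes> x = (u \<otimes> x) \<otimes> c [^] e" using *(1,2) assms by (simp add: m_ac)
  also have "\<dots> = (s \<otimes> c) [^] e" using * assms by (simp add: nat_pow_distrib)
  finally show "x \<in> saturation R (s \<otimes> c)" using * assms unfolding saturation_def
    by (auto intro!: bexI[of _ "u \<otimes> c [^] e"])
next
  show "c \<in> saturation R (s \<otimes> c)" using assms unfolding saturation_def
    by (auto intro!: bexI[of _ s] exI[of _ "1::nat"])
qed

text \<open>Expanding one factor of \<open>(x + y)^k\<close> at a time raises the exponent of
  \<open>x\<close> or of \<open>y\<close>. The claim is generalised by the factor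
  \<open>x^a y^b\<close> already split off, which replaces the binomial theorem. When
  \<open>k\<close> reaches \<open>0\<close>, the sum \<open>a + b\<close> is at least
  \<open>m + n\<close>, so one of the two exponents is large enough.\<close>

lemma radical_sum:
  assumes I: "ideal I R" and x: "x \<in> carrier R" "x [^] (m::nat) \<in> I" and y: "y \<in> carrier R" "y [^] (n::nat) \<in> I"
  shows "(x \<oplus> y) [^] (m + n) \<in> I"
proof -
  interpret I: ideal I R by fact
  have "m + n \<le> a + b + k \<Longrightarrow> (x [^] a \<otimes> y [^] b) \<otimes> (x \<oplus> y) [^] k \<in> I" for a b k :: nat
  proof (induction k arbitrary: a b)
    case 0
    then consider "m \<le> a" | "n \<le> b" by linarith
    then have "x [^] a \<otimes> y [^] b \<in> I"
    proof cases
      case 1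
      then have "x [^] a = x [^] m \<otimes> x [^] (a - m)" using x by (simp add: nat_pow_mult)
      then show ?thesis using x y by (simp add: I.I_r_closed)
    next
      case 2
      then have "y [^] b = y [^] n \<otimes> y [^] (b - n)" using y by (simp add: nat_pow_mult)
      then show ?thesis using x y by (simp add: I.I_r_closed I.I_l_closed)
    qed
    then show ?case using x y by simp
  next
    case (Suc k)
    have "(x [^] a \<otimes> y [^] b) \<otimes> (x \<oplus> y) [^] Suc k
      = (x [^] Suc a \<otimes> y [^] b) \<otimes> (x \<oplus> y) [^] k \<oplus> (x [^] a \<otimes> y [^] Suc b) \<otimes> (x \<oplus> y) [^] k"
      using x y by (simp add: l_distr r_distr m_ac)
    moreover have "(x [^] Suc a \<otimes> y [^] b) \<otimes> (x \<oplus> y) [^] k \<in> I"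
      "(x [^] a \<otimes> y [^] Suc b) \<otimes> (x \<oplus> y) [^] k \<in> I" using Suc.prems Suc.IH[of "Suc a" b] Suc.IH[of a "Suc b"] by auto
    ultimately show ?case using I.a_closed by metis
  qed
  from this[of 0 0 "m + n"] show ?thesis using x y by simp
qed

text \<open>Geometrically: the sets \<open>D(s)\<close>, \<open>s \<in> T\<close>, cover \<open>Spec R\<close>, so \<open>V(I)\<close> is empty as soon as it misses
  each of them.\<close>

lemma ideal_eq_carrier_local:
  assumes I: "ideal I R" and T: "T \<subseteq> carrier R" "Idl T = carrier R"
    and loc: "\<And>s. s \<in> T \<Longrightarrow> \<exists>x \<in> saturation R s. x \<in> I"
  shows "I = carrier R"
proof -
  interpret I: ideal I R by fact
  \<comment> \<open>The radical of \<open>I\<close> contains each \<open>s \<in> T\<close>, since a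
    multiple of an element of \<open>I\<close> is a power of \<open>s\<close>. So it contains
    \<open>1\<close>, and \<open>1\<close> in the radical is \<open>1\<close> in
    \<open>I\<close>.\<close>
  let ?r = "{x \<in> carrier R. \<exists>e::nat. x [^] e \<in> I}"
  have "ideal ?r R"
  proof (rule idealI)
    show "ring R" by unfold_locales
    show "subgroup ?r (add_monoid R)"
    proof (rule add.subgroupI)
      show "?r \<noteq> {}" using I.zero_closed by (auto intro!: exI[of _ \<zero>] exI[of _ "1::nat"])
      fix a assume a: "a \<in> ?r"
      then obtain e where e: "a [^] (e::nat) \<in> I" by auto
      have "(\<ominus> a) [^] e = (\<ominus> \<one>) [^] e \<otimes> a [^] e"
        using a by (subst nat_pow_distrib[symmetric]) (auto simp: l_minus)
      then have "(\<ominus> a) [^] e \<in> I" using e I.I_l_closed by simp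
      then show "\<ominus> a \<in> ?r" using a by auto
      fix b assume b: "b \<in> ?r"
      then show "a \<oplus> b \<in> ?r" using a radical_sum[OF I] by blast
    qed auto
  next
    fix a x assume a: "a \<in> ?r" and x: "x \<in> carrier R"
    then obtain e where e: "a [^] (e::nat) \<in> I" by auto
    have "(x \<otimes> a) [^] e = x [^] e \<otimes> a [^] e" using a x by (simp add: nat_pow_distrib)
    then have "(x \<otimes> a) [^] e \<in> I" using x e I.I_l_closed by simp
    then show "x \<otimes> a \<in> ?r" using a x by auto
    then show "a \<otimes> x \<in> ?r" using a x by (simp add: m_comm)
  qed
  moreover have "T \<subseteq> ?r"
  proof
    fix s assume s: "s \<in> T"
    from loc[OF s] obtain x y e where "x \<in> I" "y \<in> carrier R" "y \<otimes> x = s [^] (e::nat)"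
      by (auto simp: saturation_def)
    then have "s [^] e \<in> I" using I.I_l_closed by metis
    then show "s \<in> ?r" using s T by auto
  qed
  ultimately have "\<one> \<in> ?r" using genideal_minimal[of ?r T] T by auto
  then have "\<one> \<in> I" by simp
  then show ?thesis by (rule I.one_imp_carrier)
qed

text \<open>Quasi-compactness of the spectrum: the ideals generated by finite subsets of
  \<open>S\<close> form a directed family, so their union \<open>?I\<close> is an ideal; it contains
  \<open>S\<close>, hence \<open>1\<close>. Thanks to it a cover can be written as the set of all
  good \<open>s\<close> and made finite only where finiteness counts.\<close>

lemma genideal_finite_subset:
  assumes S: "S \<subseteq> carrier R" "Idl S = carrier R"
  shows "\<exists>T. finite T \<and> T \<subseteq> S \<and> Idl T = carrier R"
proof -
  let ?I = "{x. \<exists>T. finite T \<and> T \<subseteq> S \<and> x \<in> Idl T}"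
  have idT: "ideal (Idl T) R" if "T \<subseteq> S" for T using that S by (intro genideal_ideal) auto
  have mono: "Idl T \<subseteq> Idl U" if "T \<subseteq> U" "U \<subseteq> S" for T U using that S by (intro subset_Idl_subset) auto
  have "ideal ?I R"
  proof (rule idealI)
    show "ring R" by unfold_locales
    show "subgroup ?I (add_monoid R)"
    proof (rule add.subgroupI)
      show "?I \<subseteq> carrier R" using ideal.Icarr[OF idT] by auto
      have "\<zero> \<in> Idl {}" by (rule additive_subgroup.zero_closed[OF ideal.axioms(1)[OF idT]]) simp
      then have "finite {} \<and> {} \<subseteq> S \<and> \<zero> \<in> Idl {}" by simp
      then show "?I \<noteq> {}" by blast
    next
      fix a assume "a \<in> ?I"
      then obtain T where T: "finite T" "T \<subseteq> S" "a \<in> Idl T" by auto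
      then have "(\<ominus> \<one>) \<otimes> a \<in> Idl T" by (intro ideal.I_l_closed[OF idT]) auto
      moreover have "(\<ominus> \<one>) \<otimes> a = \<ominus> a" using ideal.Icarr[OF idT[OF T(2)] T(3)] by (simp add: l_minus)
      ultimately show "\<ominus> a \<in> ?I" using T by auto
    next
      fix a b assume "a \<in> ?I" "b \<in> ?I"
      then obtain T U where "finite T" "T \<subseteq> S" "a \<in> Idl T" "finite U" "U \<subseteq> S" "b \<in> Idl U" by auto
      moreover from this have "a \<in> Idl (T \<union> U)" "b \<in> Idl (T \<union> U)" using mono[of T "T \<union> U"] mono[of U "T \<union> U"] by auto
      moreover from calculation have "a \<oplus> b \<in> Idl (T \<union> U)"
        using additive_subgroup.a_closed[OF ideal.axioms(1)[OF idT[of "T \<union> U"]]] by blast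
      moreover from calculation have "finite (T \<union> U) \<and> T \<union> U \<subseteq> S" by blast
      ultimately show "a \<oplus> b \<in> ?I" by blast
    qed
  next
    fix a x assume "a \<in> ?I" "x \<in> carrier R"
    then obtain T where T: "finite T" "T \<subseteq> S" "a \<in> Idl T" and x: "x \<in> carrier R" by auto
    then show "x \<otimes> a \<in> ?I" "a \<otimes> x \<in> ?I"
      using ideal.I_l_closed[OF idT[OF T(2)] T(3) x] ideal.I_r_closed[OF idT[OF T(2)] T(3) x] by blast+
  qed
  moreover have "S \<subseteq> ?I"
  proof
    fix s assume "s \<in> S"
    then show "s \<in> ?I" using genideal_self'[of s] S by (auto intro!: exI[of _ "{s}"])
  qed
  ultimately have "\<one> \<in> ?I" using genideal_minimal[of ?I S] S by auto
  then obtain T where T: "finite T" "T \<subseteq> S" "\<one> \<in> Idl T" by auto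
  then show ?thesis using ideal.one_imp_carrier[OF idT[OF T(2)]] by blast
qed

end

lemma ring_hom_saturation:
  assumes "cring A" "cring B" and \<phi>: "\<phi> \<in> Ring.ring_hom A B" and s: "s \<in> carrier A" and x: "x \<in> saturation A s"
  shows "\<phi> x \<in> saturation B (\<phi> s)"
proof -
  interpret \<phi>: ring_hom_cring A B \<phi> using assms by (simp add: ring_hom_cring_def ring_hom_cring_axioms_def)
  from x obtain u e where *: "x \<in> carrier A" "u \<in> carrier A" "u \<otimes>\<^bsub>A\<^esub> x = s [^]\<^bsub>A\<^esub> (e::nat)"
    by (auto simp: saturation_def)
  have "\<phi> u \<otimes>\<^bsub>B\<^esub> \<phi> x = \<phi> s [^]\<^bsub>B\<^esub> e" using * s by (metis \<phi>.hom_mult \<phi>.hom_pow)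
  then show ?thesis using * unfolding saturation_def by auto
qed

text \<open>Covers pull back to covers: the preimage of the ideal generated by the image of
  \<open>T\<close> is an ideal containing \<open>T\<close>.\<close>

lemma ring_hom_genideal_carrier:
  assumes "cring A" "cring B" and \<phi>: "\<phi> \<in> Ring.ring_hom A B" and T: "T \<subseteq> carrier A" "Idl\<^bsub>A\<^esub> T = carrier A"
  shows "Idl\<^bsub>B\<^esub> (\<phi> ` T) = carrier B"
proof -
  interpret \<phi>: ring_hom_ring A B \<phi> using assms
    by (simp add: ring_hom_ring_def ring_hom_ring_axioms_def cring_def)
  have sub: "\<phi> ` T \<subseteq> carrier B" using T by auto
  have id: "ideal (Idl\<^bsub>B\<^esub> (\<phi> ` T)) B" using \<phi>.S.genideal_ideal[OF sub] .
  have "ideal {r \<in> carrier A. \<phi> r \<in> Idl\<^bsub>B\<^esub> (\<phi> ` T)} A"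
    using \<phi>.ideal_vimage[OF id] .
  then have "Idl\<^bsub>A\<^esub> T \<subseteq> {r \<in> carrier A. \<phi> r \<in> Idl\<^bsub>B\<^esub> (\<phi> ` T)}"
    using T \<phi>.S.genideal_self[OF sub] by (intro \<phi>.R.genideal_minimal) auto
  then have "\<one>\<^bsub>A\<^esub> \<in> {r \<in> carrier A. \<phi> r \<in> Idl\<^bsub>B\<^esub> (\<phi> ` T)}" using T by auto
  then show ?thesis using ideal.one_imp_carrier[OF id] by simp
qed

section \<open>Bases after localisation\<close>

abbreviation lin_comb :: "('a, 'm, 'y) module_scheme \<Rightarrow> 'i set \<Rightarrow> ('i \<Rightarrow> 'a) \<Rightarrow> ('i \<Rightarrow> 'm) \<Rightarrow> 'm" where
  "lin_comb M J c b \<equiv> (\<Oplus>\<^bsub>M\<^esub>i \<in> J. c i \<odot>\<^bsub>M\<^esub> b i)"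

text \<open>The classes of the \<open>b i\<close> form a basis of \<open>(M/N)_s\<close> over
  \<open>R_s\<close>, with denominators cleared. Compared with the condition inside
  \<open>locally_free_quotient\<close>, denominators may be any divisors of powers of
  \<open>s\<close>, and the index set \<open>J\<close> is arbitrary, so that single vectors can be
  exchanged or removed without renumbering.\<close>

definition basis_at ::
    "('a, 'x) ring_scheme \<Rightarrow> ('a, 'm, 'y) module_scheme \<Rightarrow> 'm set \<Rightarrow> 'a \<Rightarrow> 'i set \<Rightarrow> ('i \<Rightarrow> 'm) \<Rightarrow> bool" where
  "basis_at R M N s J b \<longleftrightarrow> b \<in> J \<rightarrow> carrier M \<and>
     (\<forall>v \<in> carrier M. \<exists>x \<in> saturation R s. \<exists>c \<in> J \<rightarrow> carrier R. x \<odot>\<^bsub>M\<^esub> v \<ominus>\<^bsub>M\<^esub> lin_comb M J c b \<in> N) \<and>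
     (\<forall>c \<in> J \<rightarrow> carrier R. lin_comb M J c b \<in> N \<longrightarrow>
        (\<exists>x \<in> saturation R s. \<forall>i \<in> J. x \<otimes>\<^bsub>R\<^esub> c i = \<zero>\<^bsub>R\<^esub>))"

lemma basis_at_closed: "basis_at R M N s J b \<Longrightarrow> i \<in> J \<Longrightarrow> b i \<in> carrier M"
  by (auto simp: basis_at_def)

lemma basis_at_funcset: "basis_at R M N s J b \<Longrightarrow> b \<in> J \<rightarrow> carrier M"
  by (auto simp: basis_at_def)

section \<open>Linear combinations of a family of vectors\<close>

context Module.module
begin

lemma lin_comb_closed [simp, intro]:
  "c \<in> J \<rightarrow> carrier R \<Longrightarrow> b \<in> J \<rightarrow> carrier M \<Longrightarrow> lin_comb M J c b \<in> carrier M"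
  by (rule M.finsum_closed) auto

lemma lin_comb_cong:
  assumes "b \<in> J \<rightarrow> carrier M" "c' \<in> J \<rightarrow> carrier R" "\<And>i. i \<in> J \<Longrightarrow> c i = c' i" "\<And>i. i \<in> J \<Longrightarrow> b i = b' i"
  shows "lin_comb M J c b = lin_comb M J c' b'"
proof (rule M.finsum_cong')
  show "(\<lambda>i. c' i \<odot>\<^bsub>M\<^esub> b' i) \<in> J \<rightarrow> carrier M"
  proof (rule Pi_I)
    fix i assume i: "i \<in> J"
    have "b' i \<in> carrier M" "c' i \<in> carrier R" using i assms(1,2) assms(4)[OF i, symmetric] by auto
    then show "c' i \<odot>\<^bsub>M\<^esub> b' i \<in> carrier M" by simp
  qed
qed (use assms in auto)

lemma lin_comb_zero:
  "b \<in> J \<rightarrow> carrier M \<Longrightarrow> (\<And>i. i \<in> J \<Longrightarrow> c i = \<zero>) \<Longrightarrow> lin_comb M J c b = \<zero>\<^bsub>M\<^esub>"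
  by (rule M.add.finprod_one_eqI) (auto simp: Pi_iff)

lemma lin_comb_add:
  assumes "c \<in> J \<rightarrow> carrier R" "c' \<in> J \<rightarrow> carrier R" "b \<in> J \<rightarrow> carrier M"
  shows "lin_comb M J (\<lambda>i. c i \<oplus> c' i) b = lin_comb M J c b \<oplus>\<^bsub>M\<^esub> lin_comb M J c' b"
proof -
  have "lin_comb M J (\<lambda>i. c i \<oplus> c' i) b = (\<Oplus>\<^bsub>M\<^esub>i\<in>J. c i \<odot>\<^bsub>M\<^esub> b i \<oplus>\<^bsub>M\<^esub> c' i \<odot>\<^bsub>M\<^esub> b i)"
    using assms by (intro M.finsum_cong') (auto simp: Pi_iff smult_l_distr)
  also have "\<dots> = lin_comb M J c b \<oplus>\<^bsub>M\<^esub> lin_comb M J c' b"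
    using assms by (intro M.finsum_addf) auto
  finally show ?thesis .
qed

lemma lin_comb_smult:
  assumes "finite J" "a \<in> carrier R" "c \<in> J \<rightarrow> carrier R" "b \<in> J \<rightarrow> carrier M"
  shows "lin_comb M J (\<lambda>i. a \<otimes> c i) b = a \<odot>\<^bsub>M\<^esub> lin_comb M J c b"
proof -
  have "a \<odot>\<^bsub>M\<^esub> lin_comb M J c b = (\<Oplus>\<^bsub>M\<^esub>i\<in>J. a \<odot>\<^bsub>M\<^esub> (c i \<odot>\<^bsub>M\<^esub> b i))"
    using assms by (intro finsum_smult_ldistr) auto
  also have "\<dots> = lin_comb M J (\<lambda>i. a \<otimes> c i) b"
    using assms by (intro M.finsum_cong') (auto simp: Pi_iff smult_assoc1)
  finally show ?thesis by simp
qed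

lemma smult_minus_one: "x \<in> carrier M \<Longrightarrow> (\<ominus> \<one>) \<odot>\<^bsub>M\<^esub> x = \<ominus>\<^bsub>M\<^esub> x"
  by (simp add: smult_l_minus)

lemma lin_comb_diff:
  assumes "finite J" "c \<in> J \<rightarrow> carrier R" "c' \<in> J \<rightarrow> carrier R" "b \<in> J \<rightarrow> carrier M"
  shows "lin_comb M J (\<lambda>i. c i \<ominus> c' i) b = lin_comb M J c b \<ominus>\<^bsub>M\<^esub> lin_comb M J c' b"
proof -
  have "lin_comb M J (\<lambda>i. c i \<ominus> c' i) b = lin_comb M J (\<lambda>i. c i \<oplus> (\<ominus> \<one>) \<otimes> c' i) b"
    using assms by (intro lin_comb_cong) (auto simp: Pi_iff R.minus_eq R.l_minus)
  also have "\<dots> = lin_comb M J c b \<oplus>\<^bsub>M\<^esub> (\<ominus> \<one>) \<odot>\<^bsub>M\<^esub> lin_comb M J c' b"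
    using assms by (subst lin_comb_add) (auto simp: lin_comb_smult)
  also have "\<dots> = lin_comb M J c b \<ominus>\<^bsub>M\<^esub> lin_comb M J c' b"
    using assms by (simp add: smult_minus_one M.minus_eq)
  finally show ?thesis .
qed

lemma lin_comb_remove:
  assumes "finite J" "i \<in> J" "c \<in> J \<rightarrow> carrier R" "b \<in> J \<rightarrow> carrier M"
  shows "lin_comb M J c b = c i \<odot>\<^bsub>M\<^esub> b i \<oplus>\<^bsub>M\<^esub> lin_comb M (J - {i}) c b"
proof -
  have "J = insert i (J - {i})" using assms by auto
  then have "lin_comb M J c b = lin_comb M (insert i (J - {i})) c b" by simp
  also have "\<dots> = c i \<odot>\<^bsub>M\<^esub> b i \<oplus>\<^bsub>M\<^esub> lin_comb M (J - {i}) c b"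
    using assms by (intro M.finsum_insert) auto
  finally show ?thesis .
qed

lemma lin_comb_single:
  assumes "finite J" "i \<in> J" "a \<in> carrier R" "b \<in> J \<rightarrow> carrier M"
  shows "lin_comb M J (\<lambda>l. if l = i then a else \<zero>) b = a \<odot>\<^bsub>M\<^esub> b i"
proof -
  have "lin_comb M J (\<lambda>l. if l = i then a else \<zero>) b = a \<odot>\<^bsub>M\<^esub> b i \<oplus>\<^bsub>M\<^esub> lin_comb M (J - {i}) (\<lambda>l. if l = i then a else \<zero>) b"
    using assms by (subst lin_comb_remove[of J i]) auto
  also have "lin_comb M (J - {i}) (\<lambda>l. if l = i then a else \<zero>) b = \<zero>\<^bsub>M\<^esub>"
    using assms by (intro lin_comb_zero) auto
  finally show ?thesis using assms by (simp add: Pi_iff)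
qed

lemma smult_diff:
  "a \<in> carrier R \<Longrightarrow> x \<in> carrier M \<Longrightarrow> y \<in> carrier M \<Longrightarrow> a \<odot>\<^bsub>M\<^esub> (x \<ominus>\<^bsub>M\<^esub> y) = a \<odot>\<^bsub>M\<^esub> x \<ominus>\<^bsub>M\<^esub> a \<odot>\<^bsub>M\<^esub> y"
  by (simp add: M.minus_eq smult_r_distr smult_r_minus)

end

section \<open>Local bases of a quotient: coordinates, exchange and removal of vectors\<close>

locale module_with_submodule = Module.module R M for R (structure) and M (structure) +
  fixes N assumes sub: "Module.submodule N R M"
begin

lemmas subE = submoduleE[OF sub]

lemma sub_closed: "x \<in> N \<Longrightarrow> x \<in> carrier M" using subE(1) by auto

lemma sub_zero: "\<zero>\<^bsub>M\<^esub> \<in> N"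
proof -
  obtain x where x: "x \<in> N" using subE(2) by auto
  then have "\<zero> \<odot>\<^bsub>M\<^esub> x \<in> N" using subE(4) by blast
  then show ?thesis using x sub_closed by simp
qed

lemma sub_diff: "x \<in> N \<Longrightarrow> y \<in> N \<Longrightarrow> x \<ominus>\<^bsub>M\<^esub> y \<in> N"
  unfolding M.minus_eq using subE by blast

definition mod_eq (infix \<open>\<doteq>\<close> 50) where "u \<doteq> v \<longleftrightarrow> u \<ominus>\<^bsub>M\<^esub> v \<in> N"

lemma mod_eq_refl [simp]: "u \<in> carrier M \<Longrightarrow> u \<doteq> u"
  by (simp add: mod_eq_def M.minus_eq M.r_neg sub_zero)

lemma mod_eq_sym: "u \<doteq> v \<Longrightarrow> u \<in> carrier M \<Longrightarrow> v \<in> carrier M \<Longrightarrow> v \<doteq> u"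
proof -
  assume a: "u \<doteq> v" "u \<in> carrier M" "v \<in> carrier M"
  then have "\<ominus>\<^bsub>M\<^esub> (u \<ominus>\<^bsub>M\<^esub> v) \<in> N" using subE(3) by (simp add: mod_eq_def)
  moreover have "\<ominus>\<^bsub>M\<^esub> (u \<ominus>\<^bsub>M\<^esub> v) = v \<ominus>\<^bsub>M\<^esub> u"
    using a by (simp add: M.minus_eq M.minus_add M.a_comm)
  ultimately show ?thesis by (simp add: mod_eq_def)
qed

lemma mod_eq_trans: 
  assumes "u \<doteq> v" "v \<doteq> w" "u \<in> carrier M" "v \<in> carrier M" "w \<in> carrier M" shows "u \<doteq> w"
proof -
  have "(u \<ominus>\<^bsub>M\<^esub> v) \<oplus>\<^bsub>M\<^esub> (v \<ominus>\<^bsub>M\<^esub> w) \<in> N" using assms subE(5) by (simp add: mod_eq_def)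
  moreover have "(u \<ominus>\<^bsub>M\<^esub> v) \<oplus>\<^bsub>M\<^esub> (v \<ominus>\<^bsub>M\<^esub> w) = u \<ominus>\<^bsub>M\<^esub> w"
    using assms by (simp add: M.minus_eq M.a_assoc M.r_neg1 M.r_neg2)
  ultimately show ?thesis by (simp add: mod_eq_def)
qed

lemma mod_eq_add:
  assumes "u \<doteq> v" "u' \<doteq> v'" "u \<in> carrier M" "v \<in> carrier M" "u' \<in> carrier M" "v' \<in> carrier M"
  shows "u \<oplus>\<^bsub>M\<^esub> u' \<doteq> v \<oplus>\<^bsub>M\<^esub> v'"
proof -
  have "(u \<ominus>\<^bsub>M\<^esub> v) \<oplus>\<^bsub>M\<^esub> (u' \<ominus>\<^bsub>M\<^esub> v') \<in> N" using assms subE(5) by (simp add: mod_eq_def)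
  moreover have "(u \<ominus>\<^bsub>M\<^esub> v) \<oplus>\<^bsub>M\<^esub> (u' \<ominus>\<^bsub>M\<^esub> v') = (u \<oplus>\<^bsub>M\<^esub> u') \<ominus>\<^bsub>M\<^esub> (v \<oplus>\<^bsub>M\<^esub> v')"
    using assms by (simp add: M.minus_eq M.minus_add M.a_ac)
  ultimately show ?thesis by (simp add: mod_eq_def)
qed

lemma mod_eq_smult:
  assumes "u \<doteq> v" "a \<in> carrier R" "u \<in> carrier M" "v \<in> carrier M"
  shows "a \<odot>\<^bsub>M\<^esub> u \<doteq> a \<odot>\<^bsub>M\<^esub> v"
  using assms subE(4)[of a "u \<ominus>\<^bsub>M\<^esub> v"] by (simp add: mod_eq_def smult_diff)

lemma mod_eq_in: "u \<doteq> v \<Longrightarrow> u \<in> carrier M \<Longrightarrow> v \<in> N \<Longrightarrow> u \<in> N"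
proof -
  assume a: "u \<doteq> v" "u \<in> carrier M" "v \<in> N"
  then have "(u \<ominus>\<^bsub>M\<^esub> v) \<oplus>\<^bsub>M\<^esub> v \<in> N" using subE(5) by (simp add: mod_eq_def)
  then show ?thesis using a sub_closed by (simp add: M.minus_eq M.a_assoc M.l_neg)
qed

lemma basis_atI:
  assumes "b \<in> J \<rightarrow> carrier M"
    and "\<And>v. v \<in> carrier M \<Longrightarrow> \<exists>x \<in> saturation R s. \<exists>c \<in> J \<rightarrow> carrier R. x \<odot>\<^bsub>M\<^esub> v \<doteq> lin_comb M J c b"
    and "\<And>c. c \<in> J \<rightarrow> carrier R \<Longrightarrow> lin_comb M J c b \<in> N \<Longrightarrow> \<exists>x \<in> saturation R s. \<forall>i \<in> J. x \<otimes> c i = \<zero>"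
  shows "basis_at R M N s J b"
  unfolding basis_at_def mod_eq_def[symmetric]
  by (intro conjI ballI impI; (rule assms; assumption))

lemma basis_at_span:
  assumes "basis_at R M N s J b" "v \<in> carrier M"
  obtains x c where "x \<in> saturation R s" "x \<in> carrier R" "c \<in> J \<rightarrow> carrier R" "x \<odot>\<^bsub>M\<^esub> v \<doteq> lin_comb M J c b"
proof -
  from assms have "\<exists>x \<in> saturation R s. \<exists>c \<in> J \<rightarrow> carrier R. x \<odot>\<^bsub>M\<^esub> v \<doteq> lin_comb M J c b"
    by (simp add: basis_at_def mod_eq_def)
  then obtain x c where "x \<in> saturation R s" "c \<in> J \<rightarrow> carrier R" "x \<odot>\<^bsub>M\<^esub> v \<doteq> lin_comb M J c b"
    by (elim bexE)
  then show ?thesis using saturation_closed by (intro that[of x c])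
qed

lemma basis_at_indep:
  assumes "basis_at R M N s J b" "c \<in> J \<rightarrow> carrier R" "lin_comb M J c b \<in> N"
  obtains x where "x \<in> saturation R s" "x \<in> carrier R" "\<And>i. i \<in> J \<Longrightarrow> x \<otimes> c i = \<zero>"
proof -
  from assms have "\<exists>x \<in> saturation R s. \<forall>i \<in> J. x \<otimes> c i = \<zero>"
    by (simp add: basis_at_def)
  then obtain x where "x \<in> saturation R s" "\<forall>i \<in> J. x \<otimes> c i = \<zero>"
    by (elim bexE)
  then show ?thesis using saturation_closed by (intro that[of x]) simp_all
qed

lemma basis_at_indep_eq:
  assumes "basis_at R M N s J b" "finite J" "c \<in> J \<rightarrow> carrier R" "c' \<in> J \<rightarrow> carrier R" "lin_comb M J c b \<doteq> lin_comb M J c' b"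
  obtains x where "x \<in> saturation R s" "x \<in> carrier R" "\<And>i. i \<in> J \<Longrightarrow> x \<otimes> c i = x \<otimes> c' i"
proof -
  have "lin_comb M J (\<lambda>i. c i \<ominus> c' i) b \<in> N"
    using assms basis_at_funcset[OF assms(1)] by (simp add: lin_comb_diff mod_eq_def)
  then obtain x where x: "x \<in> saturation R s" "x \<in> carrier R" "\<And>i. i \<in> J \<Longrightarrow> x \<otimes> (c i \<ominus> c' i) = \<zero>"
    using basis_at_indep[OF assms(1), of "\<lambda>i. c i \<ominus> c' i"] assms by (auto simp: Pi_iff)
  have "x \<otimes> c i = x \<otimes> c' i" if "i \<in> J" for i
  proof -
    have "x \<otimes> c i \<ominus> x \<otimes> c' i = \<zero>" using x(3)[OF that] x(2) that assms
      by (auto simp: Pi_iff R.minus_eq R.r_distr R.r_minus)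
    then show ?thesis using x(2) that assms by (simp add: Pi_iff)
  qed
  with x show ?thesis using that by blast
qed

text \<open>When \<open>b\<close> is a local basis, this is the preimage in \<open>M\<close> of the
  vectors of \<open>(M/N)_s\<close> whose coordinates at \<open>J'\<close> lie in \<open>I\<close>;
  sums are brought to the common denominator \<open>x \<otimes> y\<close>. It serves to extend a
  condition on coordinates from generators to all vectors: with \<open>J'\<close> empty for
  spanning, with a single index when covers are refined, and with all of \<open>J\<close> when
  ideals are glued.\<close>

lemma span_submodule:
  assumes s: "s \<in> carrier R" and J: "finite J" and b: "b \<in> J \<rightarrow> carrier M" and I: "ideal I R"
    and J': "J' \<subseteq> J"
  shows "Module.submodule {v \<in> carrier M. \<exists>x \<in> saturation R s. \<exists>c \<in> J \<rightarrow> carrier R. (\<forall>i\<in>J'. c i \<in> I) \<and> x \<odot>\<^bsub>M\<^esub> v \<doteq> lin_comb M J c b} R M"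
    (is "Module.submodule ?W R M")
proof -
  interpret I: ideal I R by fact
  have WI: "v \<in> ?W" if "v \<in> carrier M" "x \<in> saturation R s" "c \<in> J \<rightarrow> carrier R" "\<forall>i\<in>J'. c i \<in> I" "x \<odot>\<^bsub>M\<^esub> v \<doteq> lin_comb M J c b" for v x c
    using that by (intro CollectI conjI bexI[of _ x] bexI[of _ c])
  have smult: "a \<odot>\<^bsub>M\<^esub> v \<in> ?W" if "a \<in> carrier R" "v \<in> ?W" for a v
  proof -
    from that obtain x c where v: "v \<in> carrier M" "x \<in> saturation R s" "c \<in> J \<rightarrow> carrier R" "\<forall>i\<in>J'. c i \<in> I" "x \<odot>\<^bsub>M\<^esub> v \<doteq> lin_comb M J c b" by auto
    note x = saturation_closed[OF v(2)]
    have "x \<odot>\<^bsub>M\<^esub> (a \<odot>\<^bsub>M\<^esub> v) = a \<odot>\<^bsub>M\<^esub> (x \<odot>\<^bsub>M\<^esub> v)" using that v x by (simp add: smult_assoc1[symmetric] R.m_comm)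
    also have "\<dots> \<doteq> a \<odot>\<^bsub>M\<^esub> lin_comb M J c b" using that v x b by (intro mod_eq_smult) auto
    also have "a \<odot>\<^bsub>M\<^esub> lin_comb M J c b = lin_comb M J (\<lambda>i. a \<otimes> c i) b" using that v b J by (simp add: lin_comb_smult)
    finally have "x \<odot>\<^bsub>M\<^esub> (a \<odot>\<^bsub>M\<^esub> v) \<doteq> lin_comb M J (\<lambda>i. a \<otimes> c i) b" .
    moreover have "(\<lambda>i. a \<otimes> c i) \<in> J \<rightarrow> carrier R" "\<forall>i\<in>J'. a \<otimes> c i \<in> I" using v that I.I_l_closed by auto
    ultimately show ?thesis using v(1,2) that(1) by (intro WI[of _ x]) auto
  qed
  show ?thesis
  proof (rule submoduleI)
    have "(\<lambda>i. \<zero>) \<in> J \<rightarrow> carrier R" by auto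
    moreover have "\<one> \<odot>\<^bsub>M\<^esub> \<zero>\<^bsub>M\<^esub> \<doteq> lin_comb M J (\<lambda>i. \<zero>) b" using b by (subst lin_comb_zero) auto
    ultimately show "\<zero>\<^bsub>M\<^esub> \<in> ?W" using one_saturation[OF s] I.zero_closed by (intro WI[of _ \<one>]) auto
    show "\<And>a x. a \<in> carrier R \<Longrightarrow> x \<in> ?W \<Longrightarrow> a \<odot>\<^bsub>M\<^esub> x \<in> ?W" by (rule smult)
    show "\<ominus>\<^bsub>M\<^esub> x \<in> ?W" if x: "x \<in> ?W" for x
    proof -
      have "(\<ominus> \<one>) \<odot>\<^bsub>M\<^esub> x \<in> ?W" by (rule smult[OF _ x]) simp
      then show ?thesis using smult_minus_one[of x] x by simp
    qed
    fix v w assume "v \<in> ?W" "w \<in> ?W"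
    then obtain x c y d where v: "v \<in> carrier M" "x \<in> saturation R s" "c \<in> J \<rightarrow> carrier R" "\<forall>i\<in>J'. c i \<in> I" "x \<odot>\<^bsub>M\<^esub> v \<doteq> lin_comb M J c b"
     and w: "w \<in> carrier M" "y \<in> saturation R s" "d \<in> J \<rightarrow> carrier R" "\<forall>i\<in>J'. d i \<in> I" "y \<odot>\<^bsub>M\<^esub> w \<doteq> lin_comb M J d b" by auto
    note x = saturation_closed[OF v(2)] and y = saturation_closed[OF w(2)]
    have "(x \<otimes> y) \<odot>\<^bsub>M\<^esub> (v \<oplus>\<^bsub>M\<^esub> w) = y \<odot>\<^bsub>M\<^esub> (x \<odot>\<^bsub>M\<^esub> v) \<oplus>\<^bsub>M\<^esub> x \<odot>\<^bsub>M\<^esub> (y \<odot>\<^bsub>M\<^esub> w)"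
      using v w x y by (simp add: smult_r_distr smult_assoc1[symmetric] R.m_comm)
    also have "\<dots> \<doteq> y \<odot>\<^bsub>M\<^esub> lin_comb M J c b \<oplus>\<^bsub>M\<^esub> x \<odot>\<^bsub>M\<^esub> lin_comb M J d b"
      using v w x y b by (intro mod_eq_add mod_eq_smult) auto
    also have "\<dots> = lin_comb M J (\<lambda>i. y \<otimes> c i \<oplus> x \<otimes> d i) b"
      using v w x y b J by (subst lin_comb_add) (auto simp: lin_comb_smult Pi_iff)
    finally have "(x \<otimes> y) \<odot>\<^bsub>M\<^esub> (v \<oplus>\<^bsub>M\<^esub> w) \<doteq> lin_comb M J (\<lambda>i. y \<otimes> c i \<oplus> x \<otimes> d i) b" .
    moreover have "(\<lambda>i. y \<otimes> c i \<oplus> x \<otimes> d i) \<in> J \<rightarrow> carrier R" using v(3) w(3) x y by (auto simp: Pi_iff)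
    moreover have "\<forall>i\<in>J'. y \<otimes> c i \<oplus> x \<otimes> d i \<in> I"
      using v w x y I.I_l_closed I.a_closed by simp
    moreover have "x \<otimes> y \<in> saturation R s" using v w s by (simp add: mult_saturation)
    ultimately show "v \<oplus>\<^bsub>M\<^esub> w \<in> ?W" using v(1) w(1) by (intro WI[of _ "x \<otimes> y"]) auto
  qed auto
qed

text \<open>If the \<open>i\<close>-th coordinates of all generators lie in \<open>I\<close> up to
  the factor \<open>s\<close>, then so does that of every vector, in particular that of
  \<open>b i\<close>, which is \<open>1\<close>. So \<open>I\<close> becomes the unit ideal on
  \<open>D(s)\<close>. The factor \<open>s\<close> in the last premise matches the basis at
  \<open>s \<otimes> c i\<close> that an exchange produces.\<close>

lemma basis_at_span_in_ideal:
  assumes B: "basis_at R M N s J b" and s: "s \<in> carrier R" and J: "finite J" and i: "i \<in> J"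
    and U: "\<And>H. Module.submodule H R M \<Longrightarrow> U \<subseteq> H \<Longrightarrow> H = carrier M" and UM: "U \<subseteq> carrier M"
    and I: "ideal I R"
    and *: "\<And>u x c. u \<in> U \<Longrightarrow> x \<in> saturation R s \<Longrightarrow> c \<in> J \<rightarrow> carrier R \<Longrightarrow> x \<odot>\<^bsub>M\<^esub> u \<doteq> lin_comb M J c b \<Longrightarrow> s \<otimes> c i \<in> I"
  shows "\<exists>x \<in> saturation R s. x \<in> I"
proof -
  note b = basis_at_funcset[OF B]
  interpret I: ideal I R by fact
  let ?W = "{v \<in> carrier M. \<exists>x \<in> saturation R s. \<exists>c \<in> J \<rightarrow> carrier R. (\<forall>i\<in>{i}. c i \<in> I) \<and> x \<odot>\<^bsub>M\<^esub> v \<doteq> lin_comb M J c b}"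
  have "?W = carrier M"
  proof (rule U)
    show "Module.submodule ?W R M" using span_submodule[OF s J b I, of "{i}"] i by simp
    show "U \<subseteq> ?W"
    proof
      fix u assume u: "u \<in> U"
      then have uM: "u \<in> carrier M" using UM by auto
      obtain x c where x: "x \<in> saturation R s" "x \<in> carrier R" and c: "c \<in> J \<rightarrow> carrier R" "x \<odot>\<^bsub>M\<^esub> u \<doteq> lin_comb M J c b"
        using basis_at_span[OF B uM] .
      have "(s \<otimes> x) \<odot>\<^bsub>M\<^esub> u = s \<odot>\<^bsub>M\<^esub> (x \<odot>\<^bsub>M\<^esub> u)" using s x uM by (simp add: smult_assoc1)
      also have "\<dots> \<doteq> s \<odot>\<^bsub>M\<^esub> lin_comb M J c b" using s x uM c b by (intro mod_eq_smult) auto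
      also have "\<dots> = lin_comb M J (\<lambda>i. s \<otimes> c i) b" using s c b J by (simp add: lin_comb_smult)
      finally have "(s \<otimes> x) \<odot>\<^bsub>M\<^esub> u \<doteq> lin_comb M J (\<lambda>i. s \<otimes> c i) b" .
      moreover have "s \<otimes> x \<in> saturation R s" using s x by (simp add: mult_saturation self_saturation)
      moreover have "(\<lambda>i. s \<otimes> c i) \<in> J \<rightarrow> carrier R" using s c by auto
      moreover have "s \<otimes> c i \<in> I" using * u x c by blast
      ultimately show "u \<in> ?W" using uM
        by (intro CollectI conjI bexI[of _ "s \<otimes> x"] bexI[of _ "\<lambda>i. s \<otimes> c i"]) auto
    qed
  qed
  then have "b i \<in> ?W" using basis_at_closed[OF B i] by simp
  then obtain x c where x: "x \<in> saturation R s" and c: "c \<in> J \<rightarrow> carrier R" "c i \<in> I" "x \<odot>\<^bsub>M\<^esub> b i \<doteq> lin_comb M J c b"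
    by auto
  note xR = saturation_closed[OF x]
  \<comment> \<open>Two coordinate vectors of \<open>x\<close> times \<open>b i\<close>: the obvious
    one, with entry \<open>x\<close> at \<open>i\<close>, and \<open>c\<close>, whose entry at
    \<open>i\<close> lies in \<open>I\<close>. They agree after multiplication by a denominator
    \<open>y\<close>, which puts \<open>y \<otimes> x\<close> into \<open>I\<close>.\<close>
  have e: "lin_comb M J (\<lambda>l. if l = i then x else \<zero>) b \<doteq> lin_comb M J c b"
    using c(3) i xR b J by (simp add: lin_comb_single)
  have f: "(\<lambda>l. if l = i then x else \<zero>) \<in> J \<rightarrow> carrier R" using xR by auto
  obtain y where y: "y \<in> saturation R s" "y \<in> carrier R" "\<And>l. l \<in> J \<Longrightarrow> y \<otimes> (if l = i then x else \<zero>) = y \<otimes> c l"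
    using basis_at_indep_eq[OF B J f c(1) e] by metis
  have "y \<otimes> x = y \<otimes> c i" using y(3)[OF i] by simp
  then have "y \<otimes> x \<in> I" using c(2) y(2) I.I_l_closed by simp
  moreover have "y \<otimes> x \<in> saturation R s" using s x y(1) by (simp add: mult_saturation)
  ultimately show ?thesis by (rule bexI)
qed

text \<open>The exchange lemma of Steinitz: on \<open>D(s c_i)\<close> the coefficient of
  \<open>b i\<close> in \<open>u\<close> is invertible, so \<open>b i\<close> can be expressed by
  \<open>u\<close> and the other vectors. Localising at \<open>s \<otimes> c i\<close> takes the
  place of the assumption, made over a field, that this coefficient is nonzero.\<close>

lemma basis_at_exchange:
  assumes B: "basis_at R M N s J b" and s: "s \<in> carrier R" and J: "finite J" and i: "i \<in> J"
    and u: "u \<in> carrier M" and x: "x \<in> saturation R s" and c: "c \<in> J \<rightarrow> carrier R" "x \<odot>\<^bsub>M\<^esub> u \<doteq> lin_comb M J c b"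
  shows "basis_at R M N (s \<otimes> c i) J (b(i := u))"
proof -
  note b = basis_at_funcset[OF B]
  let ?b = "b(i := u)" and ?K = "J - {i}" and ?t = "s \<otimes> c i"
  have ci: "c i \<in> carrier R" using c i by auto
  have t: "?t \<in> carrier R" using s ci by auto
  note xR = saturation_closed[OF x]
  have bi: "b i \<in> carrier M" using b i by auto
  have bK: "b \<in> ?K \<rightarrow> carrier M" using b by auto
  have cK: "c \<in> ?K \<rightarrow> carrier R" using c by auto
  have K: "finite ?K" using J by auto
  have b': "?b \<in> J \<rightarrow> carrier M" using b u by auto
  have split': "lin_comb M J a ?b = a i \<odot>\<^bsub>M\<^esub> u \<oplus>\<^bsub>M\<^esub> lin_comb M ?K a b" if a: "a \<in> J \<rightarrow> carrier R" for a
  proof -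
    have "lin_comb M ?K a b = lin_comb M ?K a ?b" using a bK by (intro lin_comb_cong) auto
    moreover have "lin_comb M J a ?b = a i \<odot>\<^bsub>M\<^esub> ?b i \<oplus>\<^bsub>M\<^esub> lin_comb M ?K a ?b" by (rule lin_comb_remove[OF J i a b'])
    ultimately show ?thesis by simp
  qed
  have sat: "saturation R s \<subseteq> saturation R ?t" "c i \<in> saturation R ?t" using saturation_mult_left[OF s ci] by auto
  show ?thesis
  proof (rule basis_atI)
    show "?b \<in> J \<rightarrow> carrier M" by (rule b')
  next
    fix v assume v: "v \<in> carrier M"
    obtain y a where y: "y \<in> saturation R s" "y \<in> carrier R" and a: "a \<in> J \<rightarrow> carrier R" "y \<odot>\<^bsub>M\<^esub> v \<doteq> lin_comb M J a b"
      using basis_at_span[OF B v] .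
    have ai: "a i \<in> carrier R" using a i by auto
    have aK: "a \<in> ?K \<rightarrow> carrier R" using a by auto
    \<comment> \<open>Multiply \<open>y v = \<Sum> a_j b_j\<close> by \<open>c_i\<close> and replace
      \<open>c_i b_i\<close> by \<open>x u\<close> minus the other terms of
      \<open>\<Sum> c_j b_j\<close>.\<close>
    let ?a = "\<lambda>j. if j = i then a i \<otimes> x else c i \<otimes> a j \<ominus> a i \<otimes> c j"
    have a': "?a \<in> J \<rightarrow> carrier R" using a c ai ci xR by (auto simp: Pi_iff)
    have "(c i \<otimes> y) \<odot>\<^bsub>M\<^esub> v = c i \<odot>\<^bsub>M\<^esub> (y \<odot>\<^bsub>M\<^esub> v)" using ci y v by (simp add: smult_assoc1)
    also have "\<dots> \<doteq> c i \<odot>\<^bsub>M\<^esub> lin_comb M J a b" using ci y v a b by (intro mod_eq_smult) auto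
    finally have 1: "(c i \<otimes> y) \<odot>\<^bsub>M\<^esub> v \<doteq> c i \<odot>\<^bsub>M\<^esub> lin_comb M J a b" .
    have e1: "c i \<odot>\<^bsub>M\<^esub> lin_comb M J a b = a i \<odot>\<^bsub>M\<^esub> (c i \<odot>\<^bsub>M\<^esub> b i) \<oplus>\<^bsub>M\<^esub> lin_comb M ?K (\<lambda>j. c i \<otimes> a j) b"
      using lin_comb_remove[OF J i a(1) b] ci ai bi aK bK K
      by (simp add: smult_r_distr smult_assoc1[symmetric] lin_comb_smult m_comm)
    have "a i \<odot>\<^bsub>M\<^esub> (x \<odot>\<^bsub>M\<^esub> u) \<doteq> a i \<odot>\<^bsub>M\<^esub> lin_comb M J c b" using ai xR u c b by (intro mod_eq_smult) auto
    then have "lin_comb M ?K (\<lambda>j. c i \<otimes> a j \<ominus> a i \<otimes> c j) b \<oplus>\<^bsub>M\<^esub> a i \<odot>\<^bsub>M\<^esub> (x \<odot>\<^bsub>M\<^esub> u) \<doteq> lin_comb M ?K (\<lambda>j. c i \<otimes> a j \<ominus> a i \<otimes> c j) b \<oplus>\<^bsub>M\<^esub> a i \<odot>\<^bsub>M\<^esub> lin_comb M J c b"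
      using ai xR u c b aK cK bK ci by (intro mod_eq_add mod_eq_refl) (auto simp: Pi_iff)
    moreover have "lin_comb M ?K (\<lambda>j. c i \<otimes> a j \<ominus> a i \<otimes> c j) b \<oplus>\<^bsub>M\<^esub> a i \<odot>\<^bsub>M\<^esub> lin_comb M J c b = c i \<odot>\<^bsub>M\<^esub> lin_comb M J a b"
    proof -
      have "lin_comb M ?K (\<lambda>j. c i \<otimes> a j \<ominus> a i \<otimes> c j) b = lin_comb M ?K (\<lambda>j. c i \<otimes> a j) b \<ominus>\<^bsub>M\<^esub> a i \<odot>\<^bsub>M\<^esub> lin_comb M ?K c b"
        using ai ci aK cK bK K by (subst lin_comb_diff) (auto simp: lin_comb_smult Pi_iff)
      moreover have "a i \<odot>\<^bsub>M\<^esub> lin_comb M J c b = a i \<odot>\<^bsub>M\<^esub> (c i \<odot>\<^bsub>M\<^esub> b i) \<oplus>\<^bsub>M\<^esub> a i \<odot>\<^bsub>M\<^esub> lin_comb M ?K c b"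
        using lin_comb_remove[OF J i c(1) b] ai ci bi cK bK by (simp add: smult_r_distr)
      ultimately show ?thesis unfolding e1 using ai ci bi aK cK bK
        by (simp add: M.minus_eq M.a_ac Pi_iff M.r_neg1 M.r_neg2 M.r_neg M.l_neg)
    qed
    moreover have "lin_comb M J ?a ?b = lin_comb M ?K (\<lambda>j. c i \<otimes> a j \<ominus> a i \<otimes> c j) b \<oplus>\<^bsub>M\<^esub> a i \<odot>\<^bsub>M\<^esub> (x \<odot>\<^bsub>M\<^esub> u)"
    proof -
      have "lin_comb M ?K ?a b = lin_comb M ?K (\<lambda>j. c i \<otimes> a j \<ominus> a i \<otimes> c j) b"
        using ai ci aK cK bK by (intro lin_comb_cong) (auto simp: Pi_iff)
      then show ?thesis using split'[OF a'] ai xR u ci aK cK bK by (simp add: smult_assoc1 M.a_comm Pi_iff)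
    qed
    ultimately have 2: "lin_comb M J ?a ?b \<doteq> c i \<odot>\<^bsub>M\<^esub> lin_comb M J a b" by simp
    have "(c i \<otimes> y) \<odot>\<^bsub>M\<^esub> v \<doteq> lin_comb M J ?a ?b"
    proof (rule mod_eq_trans[OF 1 mod_eq_sym[OF 2]])
      show "c i \<odot>\<^bsub>M\<^esub> lin_comb M J a b \<in> carrier M" using a b ci by blast
      show "lin_comb M J ?a ?b \<in> carrier M" using a' b' by (rule lin_comb_closed)
      then show "lin_comb M J ?a ?b \<in> carrier M" .
      show "(c i \<otimes> y) \<odot>\<^bsub>M\<^esub> v \<in> carrier M" using ci y v by simp
      show "c i \<odot>\<^bsub>M\<^esub> lin_comb M J a b \<in> carrier M" using a b ci by blast
    qed
    moreover have "c i \<otimes> y \<in> saturation R ?t" using sat y t by (intro mult_saturation) auto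
    ultimately show "\<exists>x\<in>saturation R ?t. \<exists>c\<in>J \<rightarrow> carrier R. x \<odot>\<^bsub>M\<^esub> v \<doteq> lin_comb M J c ?b"
      using a' by (intro bexI[of _ "c i \<otimes> y"] bexI[of _ ?a])
  next
    fix a assume a: "a \<in> J \<rightarrow> carrier R" and N: "lin_comb M J a ?b \<in> N"
    have ai: "a i \<in> carrier R" using a i by auto
    have aK: "a \<in> ?K \<rightarrow> carrier R" using a by auto
    have xa: "(\<lambda>j. x \<otimes> a j) \<in> ?K \<rightarrow> carrier R" using aK xR by auto
    \<comment> \<open>The coefficients over \<open>b\<close> of \<open>x\<close> times the
      combination of the new vectors, after \<open>x u\<close> is replaced by
      \<open>\<Sum> c_j b_j\<close>; at \<open>i\<close> only \<open>a_i c_i\<close>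
      remains.\<close>
    let ?d = "\<lambda>j. a i \<otimes> c j \<oplus> (if j = i then \<zero> else x \<otimes> a j)"
    have d: "?d \<in> J \<rightarrow> carrier R" using a c ai xR by (auto simp: Pi_iff)
    have "x \<odot>\<^bsub>M\<^esub> lin_comb M J a ?b \<in> N" using N xR subE(4) by blast
    moreover have "x \<odot>\<^bsub>M\<^esub> lin_comb M J a ?b = a i \<odot>\<^bsub>M\<^esub> (x \<odot>\<^bsub>M\<^esub> u) \<oplus>\<^bsub>M\<^esub> lin_comb M ?K (\<lambda>j. x \<otimes> a j) b"
      using split'[OF a] ai u xR aK bK K by (simp add: smult_r_distr smult_assoc1[symmetric] m_comm lin_comb_smult)
    moreover have "a i \<odot>\<^bsub>M\<^esub> (x \<odot>\<^bsub>M\<^esub> u) \<oplus>\<^bsub>M\<^esub> lin_comb M ?K (\<lambda>j. x \<otimes> a j) b \<doteq> a i \<odot>\<^bsub>M\<^esub> lin_comb M J c b \<oplus>\<^bsub>M\<^esub> lin_comb M ?K (\<lambda>j. x \<otimes> a j) b"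
      using ai u xR c b xa bK by (intro mod_eq_add mod_eq_smult mod_eq_refl lin_comb_closed) auto
    moreover have "a i \<odot>\<^bsub>M\<^esub> lin_comb M J c b \<oplus>\<^bsub>M\<^esub> lin_comb M ?K (\<lambda>j. x \<otimes> a j) b = lin_comb M J ?d b"
    proof -
      have e: "(\<lambda>j. if j = i then \<zero> else x \<otimes> a j) \<in> J \<rightarrow> carrier R" using a xR by (auto simp: Pi_iff)
      have f: "(\<lambda>j. a i \<otimes> c j) \<in> J \<rightarrow> carrier R" using c ai by auto
      have "lin_comb M ?K (\<lambda>j. if j = i then \<zero> else x \<otimes> a j) b = lin_comb M ?K (\<lambda>j. x \<otimes> a j) b"
        using xa bK by (intro lin_comb_cong) auto
      then have "lin_comb M J (\<lambda>j. if j = i then \<zero> else x \<otimes> a j) b = lin_comb M ?K (\<lambda>j. x \<otimes> a j) b"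
        using lin_comb_remove[OF J i e b] bi xa bK by simp
      then show ?thesis using lin_comb_add[OF f e b] lin_comb_smult[OF J ai c(1) b] by simp
    qed
    ultimately have eqs: "a i \<odot>\<^bsub>M\<^esub> (x \<odot>\<^bsub>M\<^esub> u) \<oplus>\<^bsub>M\<^esub> lin_comb M ?K (\<lambda>j. x \<otimes> a j) b \<in> N"
      "a i \<odot>\<^bsub>M\<^esub> (x \<odot>\<^bsub>M\<^esub> u) \<oplus>\<^bsub>M\<^esub> lin_comb M ?K (\<lambda>j. x \<otimes> a j) b \<doteq> lin_comb M J ?d b" by simp_all
    have "lin_comb M J ?d b \<in> N"
      by (rule mod_eq_in[OF mod_eq_sym[OF eqs(2)] _ eqs(1)]) (use sub_closed[OF eqs(1)] lin_comb_closed[OF d b] in auto)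
    then obtain y where y: "y \<in> saturation R s" "y \<in> carrier R" "\<And>j. j \<in> J \<Longrightarrow> y \<otimes> ?d j = \<zero>"
      using basis_at_indep[OF B d] by metis
    have yi: "y \<otimes> (a i \<otimes> c i) = \<zero>" using y(3)[OF i] ai ci y(2) by simp
    \<comment> \<open>The relation at \<open>i\<close> says \<open>y a_i c_i = 0\<close>. Multiplied
      by \<open>c_i\<close>, the relation at another \<open>j\<close> loses its first summand for
      the same reason, so \<open>c_i y x\<close> kills all \<open>a_j\<close> at once.\<close>
    have "(c i \<otimes> (y \<otimes> x)) \<otimes> a j = \<zero>" if j: "j \<in> J" for j
    proof (cases "j = i")
      case True
      have "(c i \<otimes> (y \<otimes> x)) \<otimes> a i = x \<otimes> (y \<otimes> (a i \<otimes> c i))" using ci y(2) xR ai by (simp add: m_ac)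
      then show ?thesis using yi xR True by simp
    next
      case False
      have aj: "a j \<in> carrier R" "c j \<in> carrier R" using a c j by auto
      have "\<zero> = c i \<otimes> (y \<otimes> ?d j)" using y(3)[OF j] ci by simp
      also have "\<dots> = c j \<otimes> (y \<otimes> (a i \<otimes> c i)) \<oplus> (c i \<otimes> (y \<otimes> x)) \<otimes> a j"
        using False ci y(2) xR ai aj by (simp add: r_distr m_ac)
      finally show ?thesis using yi aj ci y(2) xR by simp
    qed
    moreover have "c i \<otimes> (y \<otimes> x) \<in> saturation R ?t" using sat y x s t by (intro mult_saturation) auto
    ultimately show "\<exists>x\<in>saturation R ?t. \<forall>j\<in>J. x \<otimes> a j = \<zero>"
      by (intro bexI[of _ "c i \<otimes> (y \<otimes> x)"] ballI)
  qed
qed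

text \<open>The premises say that \<open>N'\<close> is \<open>N\<close> plus the multiples of
  \<open>b i\<close>. Dividing out a basis vector leaves a basis indexed by the rest of
  \<open>J\<close>: a relation modulo \<open>N'\<close> becomes one modulo \<open>N\<close> by
  adding a coefficient at \<open>i\<close>.\<close>

lemma basis_at_quotient:
  assumes B: "basis_at R M N s J b" and s: "s \<in> carrier R" and J: "finite J" and i: "i \<in> J"
    and N': "Module.submodule N' R M" "N \<subseteq> N'" "b i \<in> N'" "\<And>w. w \<in> N' \<Longrightarrow> \<exists>a \<in> carrier R. w \<ominus>\<^bsub>M\<^esub> a \<odot>\<^bsub>M\<^esub> b i \<in> N"
  shows "basis_at R M N' s (J - {i}) b"
proof -
  interpret N': module_with_submodule R M N' 
    by (intro module_with_submodule.intro module_axioms module_with_submodule_axioms.intro N'(1))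
  note b = basis_at_funcset[OF B]
  have bi: "b i \<in> carrier M" using b i by auto
  let ?K = "J - {i}"
  have bK: "b \<in> ?K \<rightarrow> carrier M" using b by auto
  show ?thesis
  proof (rule N'.basis_atI)
    show "b \<in> ?K \<rightarrow> carrier M" using b by auto
  next
    fix v assume v: "v \<in> carrier M"
    obtain y a where y: "y \<in> saturation R s" "y \<in> carrier R" and a: "a \<in> J \<rightarrow> carrier R" "y \<odot>\<^bsub>M\<^esub> v \<doteq> lin_comb M J a b"
      using basis_at_span[OF B v] .
    have aK: "a \<in> ?K \<rightarrow> carrier R" and ai: "a i \<in> carrier R" using a i by auto
    have "N'.mod_eq (y \<odot>\<^bsub>M\<^esub> v) (lin_comb M J a b)"
      using a(2) unfolding mod_eq_def N'.mod_eq_def by (rule subsetD[OF N'(2)])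
    moreover have "N'.mod_eq (lin_comb M J a b) (lin_comb M ?K a b)"
    proof -
      have "lin_comb M J a b \<ominus>\<^bsub>M\<^esub> lin_comb M ?K a b = a i \<odot>\<^bsub>M\<^esub> b i"
        using lin_comb_remove[OF J i a(1) b] ai bi aK bK
        by (simp add: M.minus_eq M.a_assoc M.r_neg)
      then show ?thesis unfolding N'.mod_eq_def using N'(3) ai N'.subE(4) by simp
    qed
    ultimately have "N'.mod_eq (y \<odot>\<^bsub>M\<^esub> v) (lin_comb M ?K a b)"
      by (rule N'.mod_eq_trans) (use lin_comb_closed[OF a(1) b] lin_comb_closed[OF aK bK] smult_closed[OF y(2) v] in simp_all)
    then show "\<exists>x\<in>saturation R s. \<exists>c\<in>?K \<rightarrow> carrier R. N'.mod_eq (x \<odot>\<^bsub>M\<^esub> v) (lin_comb M ?K c b)"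
      using y aK by (intro bexI[of _ y] bexI[of _ a])
  next
    fix c assume c: "c \<in> ?K \<rightarrow> carrier R" and "lin_comb M ?K c b \<in> N'"
    then obtain a where a: "a \<in> carrier R" "lin_comb M ?K c b \<ominus>\<^bsub>M\<^esub> a \<odot>\<^bsub>M\<^esub> b i \<in> N" using N'(4) by blast
    let ?d = "\<lambda>j. if j = i then \<ominus> a else c j"
    have d: "?d \<in> J \<rightarrow> carrier R" using c a by (auto simp: Pi_iff)
    have "lin_comb M ?K ?d b = lin_comb M ?K c b" using c bK by (intro lin_comb_cong) auto
    then have "lin_comb M J ?d b = lin_comb M ?K c b \<ominus>\<^bsub>M\<^esub> a \<odot>\<^bsub>M\<^esub> b i"
      using lin_comb_remove[OF J i d b] a c bi bK by (simp add: smult_l_minus M.minus_eq M.a_comm)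
    then obtain x where x: "x \<in> saturation R s" "\<And>j. j \<in> J \<Longrightarrow> x \<otimes> ?d j = \<zero>"
      using basis_at_indep[OF B d] a by metis
    have "x \<otimes> c j = \<zero>" if "j \<in> ?K" for j using x(2)[of j] that by auto
    then show "\<exists>x\<in>saturation R s. \<forall>i\<in>?K. x \<otimes> c i = \<zero>" using x(1) by (intro bexI[of _ x] ballI)
  qed
qed

lemma basis_at_reindex:
  assumes B: "basis_at R M N s J b" and h: "bij_betw h J' J"
  shows "basis_at R M N s J' (b \<circ> h)"
proof -
  note b = basis_at_funcset[OF B]
  let ?g = "inv_into J' h"
  have g: "bij_betw ?g J J'" using h by (rule bij_betw_inv_into)
  have gh: "?g (h i) = i" if "i \<in> J'" for i using h that by (simp add: bij_betw_inv_into_left)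
  have hJ: "h i \<in> J" if "i \<in> J'" for i using h that bij_betwE by blast
  have gJ: "?g i \<in> J'" if "i \<in> J" for i using g that bij_betwE by blast
  have hg: "h (?g i) = i" if "i \<in> J" for i using h that by (simp add: bij_betw_inv_into_right)
  have eq: "lin_comb M J c b = lin_comb M J' (c \<circ> h) (b \<circ> h)" if "c \<in> J \<rightarrow> carrier R" for c
  proof -
    have "lin_comb M (h ` J') c b = (\<Oplus>\<^bsub>M\<^esub>i\<in>J'. c (h i) \<odot>\<^bsub>M\<^esub> b (h i))"
      using h that b by (intro M.finsum_reindex) (auto simp: bij_betw_def)
    then show ?thesis using h by (simp add: bij_betw_def)
  qed
  show ?thesis
  proof (rule basis_atI)
    show "b \<circ> h \<in> J' \<rightarrow> carrier M" using b hJ by auto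
  next
    fix v assume "v \<in> carrier M"
    then obtain y a where y: "y \<in> saturation R s" "y \<in> carrier R" and a: "a \<in> J \<rightarrow> carrier R" "y \<odot>\<^bsub>M\<^esub> v \<doteq> lin_comb M J a b"
      by (elim basis_at_span[OF B])
    then show "\<exists>x\<in>saturation R s. \<exists>c\<in>J' \<rightarrow> carrier R. x \<odot>\<^bsub>M\<^esub> v \<doteq> lin_comb M J' c (b \<circ> h)"
      using eq[OF a(1)] hJ by (intro bexI[OF _ y(1)] bexI[of _ "a \<circ> h"]) auto
  next
    fix c assume c: "c \<in> J' \<rightarrow> carrier R" and N: "lin_comb M J' c (b \<circ> h) \<in> N"
    have cg: "c \<circ> ?g \<in> J \<rightarrow> carrier R" using c gJ by auto
    have "lin_comb M J' (c \<circ> ?g \<circ> h) (b \<circ> h) = lin_comb M J' c (b \<circ> h)"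
      using c b hJ gh by (intro lin_comb_cong) auto
    then obtain x where x: "x \<in> saturation R s" "\<And>j. j \<in> J \<Longrightarrow> x \<otimes> (c \<circ> ?g) j = \<zero>"
      using basis_at_indep[OF B cg] eq[OF cg] N by metis
    have "x \<otimes> c j = \<zero>" if "j \<in> J'" for j using x(2)[OF hJ[OF that]] gh[OF that] by simp
    then show "\<exists>x\<in>saturation R s. \<forall>i\<in>J'. x \<otimes> c i = \<zero>" using x(1) by (intro bexI[of _ x] ballI)
  qed
qed

text \<open>The functional \<open>q i\<close> reads off the \<open>i\<close>-th coordinate with respect to the basis after
  localisation.\<close>

lemma basis_at_coordinates:
  assumes B: "basis_at R M N s J b" and s: "s \<in> carrier R" and J: "finite J"
    and L: "cring L" and \<chi>: "\<chi> \<in> Ring.ring_hom R L" and unit: "\<chi> s \<in> Units L"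
  shows "\<exists>q. (\<forall>i \<in> J. \<forall>v \<in> carrier M. q i v \<in> carrier L) \<and>
    (\<forall>i \<in> J. \<forall>v \<in> carrier M. \<forall>x \<in> carrier R. \<forall>c \<in> J \<rightarrow> carrier R. x \<odot>\<^bsub>M\<^esub> v \<doteq> lin_comb M J c b \<longrightarrow> \<chi> x \<otimes>\<^bsub>L\<^esub> q i v = \<chi> (c i)) \<and>
    (\<forall>i \<in> J. \<forall>v \<in> carrier M. \<forall>w \<in> carrier M. q i (v \<oplus>\<^bsub>M\<^esub> w) = q i v \<oplus>\<^bsub>L\<^esub> q i w) \<and>
    (\<forall>i \<in> J. \<forall>v \<in> carrier M. \<forall>a \<in> carrier R. q i (a \<odot>\<^bsub>M\<^esub> v) = \<chi> a \<otimes>\<^bsub>L\<^esub> q i v)"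
proof -
  note b = basis_at_funcset[OF B]
  interpret L: cring L by fact
  interpret \<chi>: ring_hom_cring R L \<chi> using \<chi> L by unfold_locales
  have unitx: "\<chi> x \<in> Units L" if "x \<in> saturation R s" for x
    by (rule L.saturation_Units[OF unit ring_hom_saturation[OF R.is_cring L \<chi> s that]])
  \<comment> \<open>A denominator and coordinates are chosen for each vector; \<open>char\<close>
    shows that their quotient in \<open>L\<close>, where denominators are units, does not depend on
    the choice. Additivity and linearity then follow by computing with other choices.\<close>
  let ?P = "\<lambda>v p. fst p \<in> saturation R s \<and> snd p \<in> J \<rightarrow> carrier R \<and> fst p \<odot>\<^bsub>M\<^esub> v \<doteq> lin_comb M J (snd p) b"
  define p where "p v = (SOME p. ?P v p)" for v
  define q where "q i v = inv\<^bsub>L\<^esub> (\<chi> (fst (p v))) \<otimes>\<^bsub>L\<^esub> \<chi> (snd (p v) i)" for i v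
  have p: "?P v (p v)" if v: "v \<in> carrier M" for v
  proof -
    obtain x c where "x \<in> saturation R s" "x \<in> carrier R" and c: "c \<in> J \<rightarrow> carrier R" "x \<odot>\<^bsub>M\<^esub> v \<doteq> lin_comb M J c b"
      using basis_at_span[OF B v] .
    then have "?P v (x, c)" by simp
    then have "\<exists>p. ?P v p" by (rule exI)
    then show ?thesis unfolding p_def by (rule someI_ex)
  qed
  have closed: "q i v \<in> carrier L" if "i \<in> J" "v \<in> carrier M" for i v
    using p[OF that(2)] that(1) unitx unfolding q_def by (auto simp: Pi_iff)
  have char: "\<chi> x \<otimes>\<^bsub>L\<^esub> q i v = \<chi> (c i)"
    if *: "i \<in> J" "v \<in> carrier M" "x \<in> carrier R" "c \<in> J \<rightarrow> carrier R" "x \<odot>\<^bsub>M\<^esub> v \<doteq> lin_comb M J c b" for i v x c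
  proof -
    obtain y d where pv: "p v = (y, d)" by fastforce
    with p[OF *(2)] have y: "y \<in> saturation R s" and d: "d \<in> J \<rightarrow> carrier R" "y \<odot>\<^bsub>M\<^esub> v \<doteq> lin_comb M J d b" by auto
    note yR = saturation_closed[OF y]
    have di: "d i \<in> carrier R" "c i \<in> carrier R" using d * by auto
    have "lin_comb M J (\<lambda>i. y \<otimes> c i) b = y \<odot>\<^bsub>M\<^esub> lin_comb M J c b" using yR * b J by (simp add: lin_comb_smult)
    also have "\<dots> \<doteq> y \<odot>\<^bsub>M\<^esub> (x \<odot>\<^bsub>M\<^esub> v)" using yR * b by (intro mod_eq_smult mod_eq_sym[OF *(5)]) auto
    also have "\<dots> = x \<odot>\<^bsub>M\<^esub> (y \<odot>\<^bsub>M\<^esub> v)" using yR * by (simp add: smult_assoc1[symmetric] m_comm)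
    finally have 1: "lin_comb M J (\<lambda>i. y \<otimes> c i) b \<doteq> x \<odot>\<^bsub>M\<^esub> (y \<odot>\<^bsub>M\<^esub> v)" .
    have "x \<odot>\<^bsub>M\<^esub> (y \<odot>\<^bsub>M\<^esub> v) \<doteq> x \<odot>\<^bsub>M\<^esub> lin_comb M J d b" using yR * b d by (intro mod_eq_smult) auto
    also have "\<dots> = lin_comb M J (\<lambda>i. x \<otimes> d i) b" using * b J d by (simp add: lin_comb_smult)
    finally have 2: "x \<odot>\<^bsub>M\<^esub> (y \<odot>\<^bsub>M\<^esub> v) \<doteq> lin_comb M J (\<lambda>i. x \<otimes> d i) b" .
    have yc: "(\<lambda>i. y \<otimes> c i) \<in> J \<rightarrow> carrier R" and xd: "(\<lambda>i. x \<otimes> d i) \<in> J \<rightarrow> carrier R" using yR * d by auto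
    have 3: "lin_comb M J (\<lambda>i. y \<otimes> c i) b \<doteq> lin_comb M J (\<lambda>i. x \<otimes> d i) b"
      by (rule mod_eq_trans[OF 1 2]) (use yc xd b yR * in auto)
    obtain z where z: "z \<in> saturation R s" "z \<in> carrier R" "\<And>i. i \<in> J \<Longrightarrow> z \<otimes> (y \<otimes> c i) = z \<otimes> (x \<otimes> d i)"
      using basis_at_indep_eq[OF B J yc xd 3] by metis
    have "\<chi> z \<otimes>\<^bsub>L\<^esub> (\<chi> y \<otimes>\<^bsub>L\<^esub> \<chi> (c i)) = \<chi> z \<otimes>\<^bsub>L\<^esub> (\<chi> x \<otimes>\<^bsub>L\<^esub> \<chi> (d i))"
      using z(3)[OF *(1)] z(2) yR di * by (metis \<chi>.hom_mult R.m_closed)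
    then have e: "\<chi> y \<otimes>\<^bsub>L\<^esub> \<chi> (c i) = \<chi> x \<otimes>\<^bsub>L\<^esub> \<chi> (d i)"
      using unitx[OF z(1)] yR di * by (simp add: L.Units_l_cancel)
    have uy: "\<chi> y \<in> Units L" by (rule unitx[OF y])
    have "\<chi> x \<otimes>\<^bsub>L\<^esub> q i v = inv\<^bsub>L\<^esub> (\<chi> y) \<otimes>\<^bsub>L\<^esub> (\<chi> x \<otimes>\<^bsub>L\<^esub> \<chi> (d i))"
      unfolding q_def pv using uy * di by (simp add: L.m_lcomm)
    also have "\<dots> = inv\<^bsub>L\<^esub> (\<chi> y) \<otimes>\<^bsub>L\<^esub> (\<chi> y \<otimes>\<^bsub>L\<^esub> \<chi> (c i))" using e by simp
    also have "\<dots> = \<chi> (c i)" using uy di yR by (simp add: L.m_assoc[symmetric])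
    finally show ?thesis .
  qed
  have add: "q i (v \<oplus>\<^bsub>M\<^esub> w) = q i v \<oplus>\<^bsub>L\<^esub> q i w" if *: "i \<in> J" "v \<in> carrier M" "w \<in> carrier M" for i v w
  proof -
    obtain x c where x: "x \<in> saturation R s" "x \<in> carrier R" and c: "c \<in> J \<rightarrow> carrier R" "x \<odot>\<^bsub>M\<^esub> v \<doteq> lin_comb M J c b"
      using basis_at_span[OF B *(2)] .
    obtain y d where y: "y \<in> saturation R s" "y \<in> carrier R" and d: "d \<in> J \<rightarrow> carrier R" "y \<odot>\<^bsub>M\<^esub> w \<doteq> lin_comb M J d b"
      using basis_at_span[OF B *(3)] .
    have di: "d i \<in> carrier R" "c i \<in> carrier R" using d c * by auto
    have "(x \<otimes> y) \<odot>\<^bsub>M\<^esub> (v \<oplus>\<^bsub>M\<^esub> w) = y \<odot>\<^bsub>M\<^esub> (x \<odot>\<^bsub>M\<^esub> v) \<oplus>\<^bsub>M\<^esub> x \<odot>\<^bsub>M\<^esub> (y \<odot>\<^bsub>M\<^esub> w)"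
      using * x y by (simp add: smult_r_distr smult_assoc1[symmetric] R.m_comm)
    also have "\<dots> \<doteq> y \<odot>\<^bsub>M\<^esub> lin_comb M J c b \<oplus>\<^bsub>M\<^esub> x \<odot>\<^bsub>M\<^esub> lin_comb M J d b"
      using * c d x y b by (intro mod_eq_add mod_eq_smult) auto
    also have "\<dots> = lin_comb M J (\<lambda>i. y \<otimes> c i \<oplus> x \<otimes> d i) b"
      using * c d x y b J by (subst lin_comb_add) (auto simp: lin_comb_smult Pi_iff)
    finally have "\<chi> (x \<otimes> y) \<otimes>\<^bsub>L\<^esub> q i (v \<oplus>\<^bsub>M\<^esub> w) = \<chi> (y \<otimes> c i \<oplus> x \<otimes> d i)"
      using * x y c d by (intro char) auto
    also have "\<dots> = \<chi> y \<otimes>\<^bsub>L\<^esub> (\<chi> x \<otimes>\<^bsub>L\<^esub> q i v) \<oplus>\<^bsub>L\<^esub> \<chi> x \<otimes>\<^bsub>L\<^esub> (\<chi> y \<otimes>\<^bsub>L\<^esub> q i w)"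
      using char[OF *(1,2) x(2) c] char[OF *(1,3) y(2) d] x y di by simp
    also have "\<dots> = \<chi> (x \<otimes> y) \<otimes>\<^bsub>L\<^esub> (q i v \<oplus>\<^bsub>L\<^esub> q i w)"
      using x y closed * by (simp add: L.r_distr L.m_ac)
    finally show ?thesis using unitx[of "x \<otimes> y"] mult_saturation[OF s x(1) y(1)] closed *
      by (simp add: L.Units_l_cancel)
  qed
  have smult: "q i (a \<odot>\<^bsub>M\<^esub> v) = \<chi> a \<otimes>\<^bsub>L\<^esub> q i v" if *: "i \<in> J" "v \<in> carrier M" "a \<in> carrier R" for i v a
  proof -
    obtain x c where x: "x \<in> saturation R s" "x \<in> carrier R" and c: "c \<in> J \<rightarrow> carrier R" "x \<odot>\<^bsub>M\<^esub> v \<doteq> lin_comb M J c b"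
      using basis_at_span[OF B *(2)] .
    have ci: "c i \<in> carrier R" using c * by auto
    have "x \<odot>\<^bsub>M\<^esub> (a \<odot>\<^bsub>M\<^esub> v) = a \<odot>\<^bsub>M\<^esub> (x \<odot>\<^bsub>M\<^esub> v)" using * x by (simp add: smult_assoc1[symmetric] R.m_comm)
    also have "\<dots> \<doteq> a \<odot>\<^bsub>M\<^esub> lin_comb M J c b" using * x b c by (intro mod_eq_smult) auto
    also have "\<dots> = lin_comb M J (\<lambda>i. a \<otimes> c i) b" using * b J c by (simp add: lin_comb_smult)
    finally have "\<chi> x \<otimes>\<^bsub>L\<^esub> q i (a \<odot>\<^bsub>M\<^esub> v) = \<chi> (a \<otimes> c i)" using * x c by (intro char) auto
    also have "\<dots> = \<chi> a \<otimes>\<^bsub>L\<^esub> (\<chi> x \<otimes>\<^bsub>L\<^esub> q i v)" using char[OF *(1,2) x(2) c] * ci by simp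
    also have "\<dots> = \<chi> x \<otimes>\<^bsub>L\<^esub> (\<chi> a \<otimes>\<^bsub>L\<^esub> q i v)" using x closed * by (simp add: L.m_lcomm)
    finally show ?thesis using unitx[OF x(1)] closed * by (simp add: L.Units_l_cancel)
  qed
  show ?thesis
    by (rule exI[of _ q]) (intro conjI ballI impI; (rule closed char add smult; assumption))
qed

end

text \<open>Trades the finite cover of the definition for the set of all \<open>s\<close> over which
  a basis exists: enlarging the set keeps the unit ideal, and a finite subcover can be recovered. A
  denominator \<open>x\<close> from the saturation is turned into a power of \<open>s\<close> by
  multiplying with its cofactor \<open>y\<close>. In this form covers can be refined without keeping
  track of finite sets.\<close>

lemma locally_free_quotient_iff:
  fixes A :: "('k, 'b) module" (structure)
  assumes "Module.module A M" and N: "Module.submodule N A M"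
  shows "locally_free_quotient A M N d \<longleftrightarrow>
    Idl\<^bsub>A\<^esub> {s \<in> carrier A. \<exists>b. basis_at A M N s {..<d} b} = carrier A"
proof -
  interpret module_with_submodule A M N using assms by (simp add: module_with_submodule_def module_with_submodule_axioms_def)
  let ?Q = "\<lambda>s b. (\<forall>v \<in> carrier M. \<exists>e::nat. \<exists>c \<in> {..<d} \<rightarrow> carrier A.
              (s [^]\<^bsub>A\<^esub> e) \<odot>\<^bsub>M\<^esub> v \<ominus>\<^bsub>M\<^esub> (\<Oplus>\<^bsub>M\<^esub>i \<in> {..<d}. c i \<odot>\<^bsub>M\<^esub> b i) \<in> N) \<and>
           (\<forall>c \<in> {..<d} \<rightarrow> carrier A.
              (\<Oplus>\<^bsub>M\<^esub>i \<in> {..<d}. c i \<odot>\<^bsub>M\<^esub> b i) \<in> N \<longrightarrow>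
              (\<exists>e::nat. \<forall>i<d. (s [^]\<^bsub>A\<^esub> e) \<otimes>\<^bsub>A\<^esub> c i = \<zero>\<^bsub>A\<^esub>))"
  have eq: "(\<exists>b \<in> {..<d} \<rightarrow> carrier M. ?Q s b) \<longleftrightarrow> (\<exists>b. basis_at A M N s {..<d} b)" if s: "s \<in> carrier A" for s
  proof
    assume "\<exists>b \<in> {..<d} \<rightarrow> carrier M. ?Q s b"
    then obtain b where b: "b \<in> {..<d} \<rightarrow> carrier M" "?Q s b" by blast
    have "basis_at A M N s {..<d} b"
    proof (rule basis_atI)
      show "b \<in> {..<d} \<rightarrow> carrier M" by (rule b)
    next
      fix v assume "v \<in> carrier M"
      then have "\<exists>e::nat. \<exists>c \<in> {..<d} \<rightarrow> carrier A. s [^] e \<odot>\<^bsub>M\<^esub> v \<doteq> lin_comb M {..<d} c b"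
        using b(2) by (simp add: mod_eq_def)
      then show "\<exists>x\<in>saturation A s. \<exists>c\<in>{..<d} \<rightarrow> carrier A. x \<odot>\<^bsub>M\<^esub> v \<doteq> lin_comb M {..<d} c b"
        using pow_saturation[OF s] by (elim exE) (rule bexI)
    next
      fix c assume "c \<in> {..<d} \<rightarrow> carrier A" "lin_comb M {..<d} c b \<in> N"
      then obtain e :: nat where "\<forall>i<d. s [^] e \<otimes> c i = \<zero>" using b(2) by auto
      then show "\<exists>x\<in>saturation A s. \<forall>i\<in>{..<d}. x \<otimes> c i = \<zero>"
        by (intro bexI[OF _ pow_saturation[OF s, of e]]) simp
    qed
    then show "\<exists>b. basis_at A M N s {..<d} b" by blast
  next
    assume "\<exists>b. basis_at A M N s {..<d} b"
    then obtain b where b: "basis_at A M N s {..<d} b" by blast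
    note bf = basis_at_funcset[OF b]
    have "?Q s b"
    proof (intro conjI ballI impI)
      fix v assume v: "v \<in> carrier M"
      obtain x c where x: "x \<in> saturation A s" "x \<in> carrier A" and c: "c \<in> {..<d} \<rightarrow> carrier A" "x \<odot>\<^bsub>M\<^esub> v \<doteq> lin_comb M {..<d} c b"
        using basis_at_span[OF b v] .
      then obtain y e where y: "y \<in> carrier A" "y \<otimes> x = s [^] (e::nat)" by (auto simp: saturation_def)
      have "s [^] e \<odot>\<^bsub>M\<^esub> v = y \<odot>\<^bsub>M\<^esub> (x \<odot>\<^bsub>M\<^esub> v)" using y x v by (simp add: smult_assoc1[symmetric])
      also have "\<dots> \<doteq> y \<odot>\<^bsub>M\<^esub> lin_comb M {..<d} c b" using y x v c bf by (intro mod_eq_smult) auto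
      also have "\<dots> = lin_comb M {..<d} (\<lambda>i. y \<otimes> c i) b" using y c bf by (simp add: lin_comb_smult)
      finally have "s [^] e \<odot>\<^bsub>M\<^esub> v \<ominus>\<^bsub>M\<^esub> lin_comb M {..<d} (\<lambda>i. y \<otimes> c i) b \<in> N" by (simp add: mod_eq_def)
      moreover have "(\<lambda>i. y \<otimes> c i) \<in> {..<d} \<rightarrow> carrier A" using y c by auto
      ultimately show "\<exists>e::nat. \<exists>c \<in> {..<d} \<rightarrow> carrier A.
              (s [^]\<^bsub>A\<^esub> e) \<odot>\<^bsub>M\<^esub> v \<ominus>\<^bsub>M\<^esub> (\<Oplus>\<^bsub>M\<^esub>i \<in> {..<d}. c i \<odot>\<^bsub>M\<^esub> b i) \<in> N"
        by (intro exI[of _ e] bexI[of _ "\<lambda>i. y \<otimes> c i"])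
    next
      fix c assume c: "c \<in> {..<d} \<rightarrow> carrier A" and N: "(\<Oplus>\<^bsub>M\<^esub>i \<in> {..<d}. c i \<odot>\<^bsub>M\<^esub> b i) \<in> N"
      obtain x where x: "x \<in> saturation A s" "x \<in> carrier A" "\<And>i. i \<in> {..<d} \<Longrightarrow> x \<otimes> c i = \<zero>"
        using basis_at_indep[OF b c N] by metis
      then obtain y e where y: "y \<in> carrier A" "y \<otimes> x = s [^] (e::nat)" by (auto simp: saturation_def)
      have "s [^] e \<otimes> c i = \<zero>" if "i < d" for i
      proof -
        have "s [^] e \<otimes> c i = y \<otimes> (x \<otimes> c i)" using y(1) x(2) c that by (simp add: y(2)[symmetric] m_assoc Pi_iff)
        then show ?thesis using x(3) that y by simp
      qed
      then show "\<exists>e::nat. \<forall>i<d. (s [^]\<^bsub>A\<^esub> e) \<otimes>\<^bsub>A\<^esub> c i = \<zero>\<^bsub>A\<^esub>" by (intro exI[of _ e]) simp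
    qed
    then show "\<exists>b \<in> {..<d} \<rightarrow> carrier M. ?Q s b" using bf by blast
  qed
  let ?S = "{s \<in> carrier A. \<exists>b. basis_at A M N s {..<d} b}"
  show ?thesis
  proof
    assume "locally_free_quotient A M N d"
    then obtain T where T: "T \<subseteq> carrier A" "Idl\<^bsub>A\<^esub> T = carrier A" "\<forall>s\<in>T. \<exists>b \<in> {..<d} \<rightarrow> carrier M. ?Q s b"
      unfolding locally_free_quotient_def by blast
    then have "T \<subseteq> ?S" using eq by blast
    then have "Idl\<^bsub>A\<^esub> T \<subseteq> Idl\<^bsub>A\<^esub> ?S" by (intro R.subset_Idl_subset) auto
    moreover have "Idl\<^bsub>A\<^esub> ?S \<subseteq> carrier A" by (rule R.genideal_minimal[OF R.oneideal]) auto
    ultimately show "Idl\<^bsub>A\<^esub> ?S = carrier A" using T by auto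
  next
    assume "Idl\<^bsub>A\<^esub> ?S = carrier A"
    then obtain T where T: "finite T" "T \<subseteq> ?S" "Idl\<^bsub>A\<^esub> T = carrier A"
      using R.genideal_finite_subset[of ?S] by auto
    then show "locally_free_quotient A M N d"
      unfolding locally_free_quotient_def using eq by (intro exI[of _ T]) blast
  qed
qed

section \<open>Free modules and pairings\<close>

lemma ring_hom_cringI':
  assumes "cring A" "cring B" "\<phi> \<in> Ring.ring_hom A B"
  shows "ring_hom_cring A B \<phi>"
  using assms by (simp add: ring_hom_cring_def ring_hom_cring_axioms_def)

lemma FactRing_zero: "\<zero>\<^bsub>R Quot I\<^esub> = I"
  by (simp add: FactRing_def)

text \<open>The localisation \<open>B\<^sub>s\<close> is realised as \<open>B[X]/(sX - 1)\<close>; if \<open>a = (sX - 1) f\<close> then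
  \<open>f\<^sub>n = -s\<^sup>n a\<close> for all \<open>n\<close>, so some \<open>s\<^sup>n a\<close> vanishes.\<close>

lemma exists_localization:
  fixes B :: "('b, 'm) ring_scheme"
  assumes B: "cring B" and s: "s \<in> carrier B"
  shows "\<exists>(L :: (nat \<Rightarrow> 'b) set ring) \<psi>. cring L \<and> \<psi> \<in> Ring.ring_hom B L \<and> \<psi> s \<in> Units L \<and>
    (\<forall>a \<in> carrier B. \<psi> a = \<zero>\<^bsub>L\<^esub> \<longrightarrow> (\<exists>e::nat. s [^]\<^bsub>B\<^esub> e \<otimes>\<^bsub>B\<^esub> a = \<zero>\<^bsub>B\<^esub>)) \<and>
    (\<exists>h. carrier L = h ` carrier (UP B))"
proof -
  interpret B: cring B by fact
  define P where "P = UP B"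
  interpret P: UP_cring B P by unfold_locales (simp add: P_def)
  define p where "p = monom P s 1 \<ominus>\<^bsub>P\<^esub> \<one>\<^bsub>P\<^esub>"
  define I where "I = PIdl\<^bsub>P\<^esub> p"
  have p: "p \<in> carrier P" using s by (simp add: p_def)
  interpret I: ideal I P unfolding I_def using P.P.cgenideal_ideal[OF p] .
  define L where "L = P Quot I"
  have L: "cring L" unfolding L_def using I.quotient_is_cring P.P.is_cring by blast
  interpret L: cring L by (rule L)
  have pr: "(+>\<^bsub>P\<^esub>) I \<in> Ring.ring_hom P L" unfolding L_def by (rule I.rcos_ring_hom)
  interpret pr: ring_hom_cring P L "(+>\<^bsub>P\<^esub>) I" by (intro ring_hom_cringI' P.P.is_cring L pr)
  define \<psi> where "\<psi> a = I +>\<^bsub>P\<^esub> monom P a 0" for a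
  have const: "(\<lambda>a. monom P a 0) \<in> Ring.ring_hom B P" by (rule P.const_ring_hom)
  have \<psi>: "\<psi> \<in> Ring.ring_hom B L"
    using ring_hom_trans[OF const pr] by (simp add: comp_def \<psi>_def[abs_def])
  have zero: "I +>\<^bsub>P\<^esub> f = \<zero>\<^bsub>L\<^esub> \<longleftrightarrow> f \<in> I" if "f \<in> carrier P" for f
  proof -
    have "\<zero>\<^bsub>L\<^esub> = I" unfolding L_def by (rule FactRing_zero)
    moreover have "I +>\<^bsub>P\<^esub> f = I \<longleftrightarrow> f \<in> I"
      by (rule iffI[OF I.rcos_const_imp_mem[OF that] P.P.a_rcos_zero[OF I.ideal_axioms]])
    ultimately show ?thesis by (rule ssubst)
  qed
  have unit: "\<psi> s \<in> Units L"
  proof -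
    let ?x = "monom P \<one>\<^bsub>B\<^esub> 1"
    have x: "?x \<in> carrier P" by simp
    have "p \<in> I" unfolding I_def by (rule P.P.cgenideal_self[OF p])
    then have "I +>\<^bsub>P\<^esub> p = \<zero>\<^bsub>L\<^esub>" using zero p by simp
    moreover have "monom P s 1 = monom P s 0 \<otimes>\<^bsub>P\<^esub> ?x" using s P.monom_mult[of s "\<one>\<^bsub>B\<^esub>" 0 1] by simp
    ultimately have "\<psi> s \<otimes>\<^bsub>L\<^esub> (I +>\<^bsub>P\<^esub> ?x) \<ominus>\<^bsub>L\<^esub> \<one>\<^bsub>L\<^esub> = \<zero>\<^bsub>L\<^esub>"
      using s x by (simp add: p_def \<psi>_def L.minus_eq P.P.minus_eq)
    then have "\<psi> s \<otimes>\<^bsub>L\<^esub> (I +>\<^bsub>P\<^esub> ?x) = \<one>\<^bsub>L\<^esub>" using s x by (simp add: \<psi>_def)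
    moreover have "\<psi> s \<in> carrier L" "I +>\<^bsub>P\<^esub> ?x \<in> carrier L" using s x pr.hom_closed by (simp_all add: \<psi>_def)
    ultimately show ?thesis unfolding Units_def by (metis (mono_tags, lifting) L.m_comm mem_Collect_eq)
  qed
  have ker: "\<exists>e::nat. s [^]\<^bsub>B\<^esub> e \<otimes>\<^bsub>B\<^esub> a = \<zero>\<^bsub>B\<^esub>" if a: "a \<in> carrier B" and "\<psi> a = \<zero>\<^bsub>L\<^esub>" for a
  proof -
    have "monom P a 0 \<in> I" using that zero by (simp add: \<psi>_def)
    then obtain f where f: "f \<in> carrier P" "monom P a 0 = f \<otimes>\<^bsub>P\<^esub> p" unfolding I_def cgenideal_def by auto
    have fc: "coeff P f n \<in> carrier B" for n using f by simp
    have "monom P a 0 = monom P s 1 \<otimes>\<^bsub>P\<^esub> f \<ominus>\<^bsub>P\<^esub> f"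
      using f s by (simp add: p_def P.P.minus_eq P.P.r_distr P.P.r_minus P.P.m_comm)
    then have e: "coeff P (monom P a 0) n = coeff P (monom P s 1 \<otimes>\<^bsub>P\<^esub> f) n \<ominus>\<^bsub>B\<^esub> coeff P f n" for n
      using f(1) s by simp
    have "coeff P (monom P s 1 \<otimes>\<^bsub>P\<^esub> f) 0 = \<zero>\<^bsub>B\<^esub>" using f(1) s by (simp add: P.coeff_mult del: P.monom_mult)
    with e[of 0] have f0: "coeff P f 0 = \<ominus>\<^bsub>B\<^esub> a" using a fc[of 0] by (simp add: B.minus_eq)
    have fS: "coeff P f (Suc n) = s \<otimes>\<^bsub>B\<^esub> coeff P f n" for n
    proof -
      have "coeff P (monom P s 1 \<otimes>\<^bsub>P\<^esub> f) (Suc n) = s \<otimes>\<^bsub>B\<^esub> coeff P f n"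
        using P.coeff_monom_mult[OF s f(1), of 1 n] by simp
      with e[of "Suc n"] have "\<zero>\<^bsub>B\<^esub> = s \<otimes>\<^bsub>B\<^esub> coeff P f n \<ominus>\<^bsub>B\<^esub> coeff P f (Suc n)" using a by simp
      then have "s \<otimes>\<^bsub>B\<^esub> coeff P f n \<ominus>\<^bsub>B\<^esub> coeff P f (Suc n) = \<zero>\<^bsub>B\<^esub>" by (rule sym)
      then have "s \<otimes>\<^bsub>B\<^esub> coeff P f n = coeff P f (Suc n)" using s fc[of n] fc[of "Suc n"] by simp
      then show ?thesis by (rule sym)
    qed
    have fn: "coeff P f n = \<ominus>\<^bsub>B\<^esub> (s [^]\<^bsub>B\<^esub> n \<otimes>\<^bsub>B\<^esub> a)" for n
    proof (induction n)
      case 0 then show ?case using f0 a by simp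
    next
      case (Suc n)
      have "coeff P f (Suc n) = s \<otimes>\<^bsub>B\<^esub> (\<ominus>\<^bsub>B\<^esub> (s [^]\<^bsub>B\<^esub> n \<otimes>\<^bsub>B\<^esub> a))" using fS Suc by simp
      also have "\<dots> = \<ominus>\<^bsub>B\<^esub> (s \<otimes>\<^bsub>B\<^esub> (s [^]\<^bsub>B\<^esub> n \<otimes>\<^bsub>B\<^esub> a))" using s a by (simp add: B.r_minus)
      also have "s \<otimes>\<^bsub>B\<^esub> (s [^]\<^bsub>B\<^esub> n \<otimes>\<^bsub>B\<^esub> a) = s [^]\<^bsub>B\<^esub> Suc n \<otimes>\<^bsub>B\<^esub> a" using s a by (simp add: B.m_ac)
      finally show ?case .
    qed
    \<comment> \<open>\<open>f\<close> is a polynomial, so beyond its degree the formula for its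
      coefficients yields the relation sought.\<close>
    have "coeff P f (Suc (deg B f)) = \<zero>\<^bsub>B\<^esub>" using f(1) by (intro P.deg_aboveD) auto
    then have "\<ominus>\<^bsub>B\<^esub> (s [^]\<^bsub>B\<^esub> Suc (deg B f) \<otimes>\<^bsub>B\<^esub> a) = \<zero>\<^bsub>B\<^esub>" using fn by simp
    then have "s [^]\<^bsub>B\<^esub> Suc (deg B f) \<otimes>\<^bsub>B\<^esub> a = \<zero>\<^bsub>B\<^esub>"
      using s a B.add.inv_eq_1_iff[of "s [^]\<^bsub>B\<^esub> Suc (deg B f) \<otimes>\<^bsub>B\<^esub> a"] by simp
    then show ?thesis by (rule exI)
  qed
  \<comment> \<open>This bounds the size of the localisation by that of the polynomial ring; it is
    what later lets the localisation be coded in the carrier type of \<open>B\<close>.\<close>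
  have car: "carrier L = (\<lambda>f. I +>\<^bsub>P\<^esub> f) ` carrier (UP B)"
    unfolding L_def FactRing_def A_RCOSETS_def' P_def by auto
  show ?thesis
    by (rule exI[of _ L], rule exI[of _ \<psi>], intro conjI L \<psi> unit ballI impI ker exI[of _ "\<lambda>f. I +>\<^bsub>P\<^esub> f"] car)
qed

section \<open>Free modules on a set and their linear functionals\<close>

lemma free_module_simps:
  "zero (free_module A X) = (\<lambda>x. \<zero>\<^bsub>A\<^esub>)"
  "add (free_module A X) f g = (\<lambda>x. f x \<oplus>\<^bsub>A\<^esub> g x)"
  "Module.smult (free_module A X) a f = (\<lambda>x. a \<otimes>\<^bsub>A\<^esub> f x)"
  by (simp_all add: free_module_def)

lemma free_module_carrier_iff:
  "f \<in> carrier (free_module A X) \<longleftrightarrow>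
    (\<forall>x. f x \<in> carrier A) \<and> (\<forall>x. x \<notin> X \<longrightarrow> f x = \<zero>\<^bsub>A\<^esub>) \<and> finite {x. f x \<noteq> \<zero>\<^bsub>A\<^esub>}"
  by (simp add: free_module_def)

lemma free_module_apply_closed [simp]:
  "f \<in> carrier (free_module A X) \<Longrightarrow> f x \<in> carrier A"
  by (simp add: free_module_carrier_iff)

definition unit_fun :: "('b, 'm) ring_scheme \<Rightarrow> 'i \<Rightarrow> 'i \<Rightarrow> 'b" where
  "unit_fun A y = (\<lambda>x. if x = y then \<one>\<^bsub>A\<^esub> else \<zero>\<^bsub>A\<^esub>)"

text \<open>The value at \<open>w\<close> of the linear functional whose values on the standard
  basis are given by \<open>Q\<close>. The sum runs over the support of \<open>w\<close> because
  index sets such as \<open>quot_index n r\<close> can be infinite.\<close>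

definition pairing :: "('b, 'm) ring_scheme \<Rightarrow> ('i \<Rightarrow> 'b) \<Rightarrow> ('i \<Rightarrow> 'b) \<Rightarrow> 'b" where
  "pairing A Q w = (\<Oplus>\<^bsub>A\<^esub>x \<in> {x. w x \<noteq> \<zero>\<^bsub>A\<^esub>}. Q x \<otimes>\<^bsub>A\<^esub> w x)"

lemma free_module_module:
  fixes R :: "('k, 'a) module"
  assumes "cring R"
  shows "Module.module R (free_module R X)"
proof -
  interpret A: cring R by fact
  let ?F = "free_module R X"
  have fin: "finite {x. f x \<oplus>\<^bsub>R\<^esub> g x \<noteq> \<zero>\<^bsub>R\<^esub>}"
    if "finite {x. f x \<noteq> \<zero>\<^bsub>R\<^esub>}" "finite {x. g x \<noteq> \<zero>\<^bsub>R\<^esub>}" for f g :: "'c \<Rightarrow> 'a"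
    by (rule finite_subset[OF _ finite_UnI[OF that]]) auto
  have fin2: "finite {x. a \<otimes>\<^bsub>R\<^esub> f x \<noteq> \<zero>\<^bsub>R\<^esub>}"
    if "a \<in> carrier R" "finite {x. f x \<noteq> \<zero>\<^bsub>R\<^esub>}" for f :: "'c \<Rightarrow> 'a" and a
    by (rule finite_subset[OF _ that(2)]) (use that(1) in auto)
  have ab: "abelian_group ?F"
  proof (rule abelian_groupI)
    fix f assume f: "f \<in> carrier ?F"
    have "finite {x. \<ominus>\<^bsub>R\<^esub> f x \<noteq> \<zero>\<^bsub>R\<^esub>}"
      by (rule finite_subset[of _ "{x. f x \<noteq> \<zero>\<^bsub>R\<^esub>}"]) (use f in \<open>auto simp: free_module_carrier_iff\<close>)
    then show "\<exists>y\<in>carrier ?F. y \<oplus>\<^bsub>?F\<^esub> f = \<zero>\<^bsub>?F\<^esub>"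
      using f by (intro bexI[of _ "\<lambda>x. \<ominus>\<^bsub>R\<^esub> f x"]) (auto simp: free_module_simps free_module_carrier_iff A.l_neg)
  qed (auto simp: free_module_simps free_module_carrier_iff A.a_ac fin)
  show ?thesis
    by (rule Module.moduleI[OF assms ab])
       (auto simp: free_module_simps free_module_carrier_iff A.l_distr A.r_distr A.m_assoc fin2)
qed

lemma free_module_a_inv:
  assumes A: "cring (A :: ('k, 'b) module)" and f: "f \<in> carrier (free_module A X)"
  shows "\<ominus>\<^bsub>free_module A X\<^esub> f = (\<lambda>x. \<ominus>\<^bsub>A\<^esub> f x)"
proof -
  interpret A: cring A by fact
  interpret F: Module.module A "free_module A X" by (rule free_module_module[OF A])
  have "\<ominus>\<^bsub>free_module A X\<^esub> f = (\<ominus>\<^bsub>A\<^esub> \<one>\<^bsub>A\<^esub>) \<odot>\<^bsub>free_module A X\<^esub> f" using f by (simp add: F.smult_minus_one)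
  also have "\<dots> = (\<lambda>x. \<ominus>\<^bsub>A\<^esub> f x)" using f by (auto simp: free_module_simps A.l_minus)
  finally show ?thesis .
qed

lemma free_module_minus:
  assumes A: "cring (A :: ('k, 'b) module)" and f: "f \<in> carrier (free_module A X)" "g \<in> carrier (free_module A X)"
  shows "f \<ominus>\<^bsub>free_module A X\<^esub> g = (\<lambda>x. f x \<ominus>\<^bsub>A\<^esub> g x)"
  using f by (simp add: a_minus_def free_module_a_inv[OF A] free_module_simps)

lemma free_module_finsum:
  assumes A: "cring (A :: ('k, 'b) module)" and g: "g \<in> J \<rightarrow> carrier (free_module A X)"
  shows "(\<Oplus>\<^bsub>free_module A X\<^esub>i\<in>J. g i) x = (\<Oplus>\<^bsub>A\<^esub>i\<in>J. g i x)"
proof -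
  interpret A: cring A by fact
  interpret F: Module.module A "free_module A X" by (rule free_module_module[OF A])
  show ?thesis using g
    proof (induction J rule: infinite_finite_induct)
    case (insert i J)
    then have "(\<lambda>i. g i x) \<in> J \<rightarrow> carrier A" "g i x \<in> carrier A" by (auto simp: Pi_iff)
    then show ?case using insert by (auto simp: free_module_simps Pi_iff)
  qed (auto simp: free_module_simps)
qed

lemma unit_fun_closed:
  assumes "cring (A :: ('k, 'b) module)" "x \<in> X"
  shows "unit_fun A x \<in> carrier (free_module A X)"
proof -
  interpret A: cring A by fact
  have "finite {y. unit_fun A x y \<noteq> \<zero>\<^bsub>A\<^esub>}" by (rule finite_subset[of _ "{x}"]) (auto simp: unit_fun_def)
  then show ?thesis using assms by (auto simp: free_module_carrier_iff unit_fun_def)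
qed

text \<open>Induction on a finite set containing the support, with \<open>f\<close> arbitrary: the
  entry at one index is set to zero and returned as a multiple of a basis vector. Only the basis
  vectors in the support are required to lie in \<open>H\<close>, which matters when
  \<open>H\<close> is known to contain just the monomials of some degrees.\<close>

lemma submodule_mem_units:
  assumes A: "cring (A :: ('k, 'b) module)" and H: "Module.submodule H A (free_module A X)"
    and f: "f \<in> carrier (free_module A X)" and unit: "\<And>x. f x \<noteq> \<zero>\<^bsub>A\<^esub> \<Longrightarrow> unit_fun A x \<in> H"
  shows "f \<in> H"
proof -
  interpret A: cring A by fact
  interpret F: Module.module A "free_module A X" by (rule free_module_module[OF A])
  interpret H: module_with_submodule A "free_module A X" H
    by (intro module_with_submodule.intro F.module_axioms module_with_submodule_axioms.intro H)
  have *: "f \<in> H" if "finite S" "f \<in> carrier (free_module A X)" "{x. f x \<noteq> \<zero>\<^bsub>A\<^esub>} \<subseteq> S"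
    "\<And>x. f x \<noteq> \<zero>\<^bsub>A\<^esub> \<Longrightarrow> unit_fun A x \<in> H" for S f
    using that
  proof (induction S arbitrary: f)
    case empty
    have "f = \<zero>\<^bsub>free_module A X\<^esub>" using empty.prems(2) by (auto simp: free_module_simps)
    then show ?case using H.sub_zero by simp
  next
    case (insert y S)
    show ?case
    proof (cases "f y = \<zero>\<^bsub>A\<^esub>")
      case True
      then have "{x. f x \<noteq> \<zero>\<^bsub>A\<^esub>} \<subseteq> S" using insert.prems(2) by auto
      then show ?thesis by (rule insert.IH[OF insert.prems(1)]) (rule insert.prems(3))
    next
      case False
      then have y: "unit_fun A y \<in> H" by (rule insert.prems(3))
      let ?g = "f(y := \<zero>\<^bsub>A\<^esub>)"
      have "finite {x. ?g x \<noteq> \<zero>\<^bsub>A\<^esub>}"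
        by (rule finite_subset[of _ "{x. f x \<noteq> \<zero>\<^bsub>A\<^esub>}"]) (use insert.prems(1) in \<open>auto simp: free_module_carrier_iff\<close>)
      then have g: "?g \<in> carrier (free_module A X)" using insert.prems(1) by (auto simp: free_module_carrier_iff)
      have sub: "{x. ?g x \<noteq> \<zero>\<^bsub>A\<^esub>} \<subseteq> S" using insert.prems(2) by auto
      have "unit_fun A x \<in> H" if "?g x \<noteq> \<zero>\<^bsub>A\<^esub>" for x
        using that by (intro insert.prems(3)) (simp split: if_splits)
      then have "?g \<in> H" by (rule insert.IH[OF g sub])
      moreover have "f y \<odot>\<^bsub>free_module A X\<^esub> unit_fun A y \<in> H" using y insert.prems(1) H.subE(4) by simp
      ultimately have "?g \<oplus>\<^bsub>free_module A X\<^esub> f y \<odot>\<^bsub>free_module A X\<^esub> unit_fun A y \<in> H" by (rule H.subE(5))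
      moreover have "?g \<oplus>\<^bsub>free_module A X\<^esub> f y \<odot>\<^bsub>free_module A X\<^esub> unit_fun A y = f"
        using insert.prems(1) by (auto simp: free_module_simps unit_fun_def)
      ultimately show ?thesis by simp
    qed
  qed
  have "finite {x. f x \<noteq> \<zero>\<^bsub>A\<^esub>}" using f by (simp add: free_module_carrier_iff)
  then show ?thesis by (rule *[OF _ f subset_refl]) (rule unit)
qed

lemma free_module_generated:
  assumes A: "cring (A :: ('k, 'b) module)" and H: "Module.submodule H A (free_module A X)"
    and unit: "\<And>x. x \<in> X \<Longrightarrow> unit_fun A x \<in> H"
  shows "H = carrier (free_module A X)"
proof
  show "H \<subseteq> carrier (free_module A X)"
    by (rule Module.module.submoduleE(1)[OF free_module_module[OF A] H])
  show "carrier (free_module A X) \<subseteq> H"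
  proof
    fix f assume f: "f \<in> carrier (free_module A X)"
    show "f \<in> H"
    proof (rule submodule_mem_units[OF A H f])
      fix x assume "f x \<noteq> \<zero>\<^bsub>A\<^esub>"
      then have "x \<in> X" using f unfolding free_module_carrier_iff by metis
      then show "unit_fun A x \<in> H" by (rule unit)
    qed
  qed
qed

context cring
begin

lemma pairing_superset:
  assumes "finite S" "{x. w x \<noteq> \<zero>} \<subseteq> S" "\<And>x. x \<in> S \<Longrightarrow> Q x \<in> carrier R" "\<And>x. x \<in> S \<Longrightarrow> w x \<in> carrier R"
  shows "pairing R Q w = (\<Oplus>x\<in>S. Q x \<otimes> w x)"
  unfolding pairing_def
  by (rule add.finprod_mono_neutral_cong_left) (use assms in auto)

end

locale free_pairing = cring L for L :: "('k, 'b) module" (structure) and X :: "'i set" and Q :: "'i \<Rightarrow> 'b" +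
  assumes Q: "\<And>x. x \<in> X \<Longrightarrow> Q x \<in> carrier L"
begin

lemma supp: "w \<in> carrier (free_module L X) \<Longrightarrow> finite {x. w x \<noteq> \<zero>}"
  "w \<in> carrier (free_module L X) \<Longrightarrow> {x. w x \<noteq> \<zero>} \<subseteq> X"
  by (auto simp: free_module_carrier_iff)

lemma pairing_closed [simp]:
  assumes w: "w \<in> carrier (free_module L X)"
  shows "pairing L Q w \<in> carrier L"
  unfolding pairing_def
proof (rule finsum_closed, rule Pi_I)
  fix x assume x: "x \<in> {x. w x \<noteq> \<zero>}"
  have "x \<in> X" by (rule subsetD[OF supp(2)[OF w] x])
  then show "Q x \<otimes> w x \<in> carrier L" using Q w by simp
qed

lemma pairing_add:
  assumes w: "v \<in> carrier (free_module L X)" "w \<in> carrier (free_module L X)"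
  shows "pairing L Q (\<lambda>x. v x \<oplus> w x) = pairing L Q v \<oplus> pairing L Q w"
proof -
  let ?S = "{x. v x \<noteq> \<zero>} \<union> {x. w x \<noteq> \<zero>}"
  have S: "finite ?S" "?S \<subseteq> X" using supp[OF w(1)] supp[OF w(2)] by auto
  have Q': "x \<in> ?S \<Longrightarrow> Q x \<in> carrier L" for x using S(2) Q by blast
  have e: "pairing L Q u = (\<Oplus>x\<in>?S. Q x \<otimes> u x)" if "{x. u x \<noteq> \<zero>} \<subseteq> ?S" "\<And>x. u x \<in> carrier L" for u
    using that by (intro pairing_superset S Q') auto
  have "pairing L Q (\<lambda>x. v x \<oplus> w x) = (\<Oplus>x\<in>?S. Q x \<otimes> (v x \<oplus> w x))" using w by (intro e) auto
  also have "\<dots> = (\<Oplus>x\<in>?S. Q x \<otimes> v x \<oplus> Q x \<otimes> w x)"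
    using w Q' by (intro finsum_cong') (auto simp: r_distr)
  also have "\<dots> = (\<Oplus>x\<in>?S. Q x \<otimes> v x) \<oplus> (\<Oplus>x\<in>?S. Q x \<otimes> w x)"
    using w Q' by (intro finsum_addf) auto
  also have "\<dots> = pairing L Q v \<oplus> pairing L Q w" using w by (simp add: e)
  finally show ?thesis .
qed

lemma pairing_smult:
  assumes w: "w \<in> carrier (free_module L X)" and a: "a \<in> carrier L"
  shows "pairing L Q (\<lambda>x. a \<otimes> w x) = a \<otimes> pairing L Q w"
proof -
  let ?S = "{x. w x \<noteq> \<zero>}"
  have Q': "x \<in> ?S \<Longrightarrow> Q x \<in> carrier L" for x using supp(2)[OF w] Q by blast
  have "pairing L Q (\<lambda>x. a \<otimes> w x) = (\<Oplus>x\<in>?S. Q x \<otimes> (a \<otimes> w x))"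
    using w a supp[OF w] Q' by (intro pairing_superset) auto
  also have "\<dots> = (\<Oplus>x\<in>?S. a \<otimes> (Q x \<otimes> w x))"
    using w a Q' by (intro finsum_cong') (auto simp: m_lcomm)
  also have "\<dots> = a \<otimes> pairing L Q w" unfolding pairing_def
    using w a supp[OF w] Q' by (intro finsum_rdistr[symmetric]) auto
  finally show ?thesis .
qed

lemma pairing_unit: "x \<in> X \<Longrightarrow> pairing L Q (unit_fun L x) = Q x"
proof -
  assume x: "x \<in> X"
  have "pairing L Q (unit_fun L x) = (\<Oplus>y\<in>{x}. Q y \<otimes> unit_fun L x y)"
    using x Q by (intro pairing_superset) (auto simp: unit_fun_def)
  also have "\<dots> = Q x" using x Q by (simp add: unit_fun_def)
  finally show ?thesis .
qed

lemma pairing_zero: "pairing L Q (\<lambda>x. \<zero>) = \<zero>"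
  by (simp add: pairing_def)

lemma pairing_minus:
  assumes "v \<in> carrier (free_module L X)" "w \<in> carrier (free_module L X)"
  shows "pairing L Q (v \<ominus>\<^bsub>free_module L X\<^esub> w) = pairing L Q v \<ominus> pairing L Q w"
proof -
  interpret F: Module.module L "free_module L X" by (rule free_module_module) unfold_locales
  have "v \<ominus>\<^bsub>free_module L X\<^esub> w = v \<oplus>\<^bsub>free_module L X\<^esub> (\<ominus> \<one>) \<odot>\<^bsub>free_module L X\<^esub> w"
    using assms by (simp add: F.smult_minus_one F.M.minus_eq)
  then have "pairing L Q (v \<ominus>\<^bsub>free_module L X\<^esub> w) = pairing L Q (v \<oplus>\<^bsub>free_module L X\<^esub> (\<ominus> \<one>) \<odot>\<^bsub>free_module L X\<^esub> w)"
    by simp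
  also have "\<dots> = pairing L Q v \<oplus> pairing L Q ((\<ominus> \<one>) \<odot>\<^bsub>free_module L X\<^esub> w)"
    unfolding free_module_simps(2) by (rule pairing_add) (use assms in auto)
  also have "pairing L Q ((\<ominus> \<one>) \<odot>\<^bsub>free_module L X\<^esub> w) = (\<ominus> \<one>) \<otimes> pairing L Q w"
    unfolding free_module_simps(3) by (rule pairing_smult) (use assms in auto)
  finally show ?thesis using assms by (simp add: l_minus minus_eq)
qed

lemma pairing_lin_comb:
  assumes J: "finite J" and c: "c \<in> J \<rightarrow> carrier L" and b: "b \<in> J \<rightarrow> carrier (free_module L X)"
  shows "pairing L Q (lin_comb (free_module L X) J c b) = (\<Oplus>i\<in>J. c i \<otimes> pairing L Q (b i))"
  using assms
proof (induction J)
  case empty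
  interpret F: Module.module L "free_module L X" by (rule free_module_module) unfold_locales
  show ?case by (simp add: free_module_simps pairing_zero)
next
  case (insert i J)
  interpret F: Module.module L "free_module L X" by (rule free_module_module) unfold_locales
  have c: "c i \<in> carrier L" "c \<in> J \<rightarrow> carrier L" and b: "b i \<in> carrier (free_module L X)" "b \<in> J \<rightarrow> carrier (free_module L X)"
    using insert by auto
  have "pairing L Q (lin_comb (free_module L X) (insert i J) c b)
     = pairing L Q (c i \<odot>\<^bsub>free_module L X\<^esub> b i \<oplus>\<^bsub>free_module L X\<^esub> lin_comb (free_module L X) J c b)"
    using insert c b by (subst F.finsum_insert) auto
  also have "\<dots> = pairing L Q (c i \<odot>\<^bsub>free_module L X\<^esub> b i) \<oplus> pairing L Q (lin_comb (free_module L X) J c b)"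
    unfolding free_module_simps(2) using F.lin_comb_closed[OF c(2) b(2)] F.smult_closed[OF c(1) b(1)]
    by (intro pairing_add) auto
  also have "pairing L Q (c i \<odot>\<^bsub>free_module L X\<^esub> b i) = c i \<otimes> pairing L Q (b i)"
    unfolding free_module_simps(3) by (rule pairing_smult[OF b(1) c(1)])
  finally show ?case using insert c b
    by (subst finsum_insert) (auto simp: Pi_iff)
qed

lemma pairing_kernel_submodule:
  "Module.submodule {w \<in> carrier (free_module L X). pairing L Q w = \<zero>} L (free_module L X)"
proof -
  interpret F: Module.module L "free_module L X" by (rule free_module_module) unfold_locales
  have smult: "a \<odot>\<^bsub>free_module L X\<^esub> w \<in> {w \<in> carrier (free_module L X). pairing L Q w = \<zero>}"
    if "a \<in> carrier L" "w \<in> {w \<in> carrier (free_module L X). pairing L Q w = \<zero>}" for a w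
    using that F.smult_closed[of a w] pairing_smult[of w a] by (simp add: free_module_simps)
  show ?thesis
  proof (rule F.submoduleI)
    show "\<zero>\<^bsub>free_module L X\<^esub> \<in> {w \<in> carrier (free_module L X). pairing L Q w = \<zero>}"
      using F.M.zero_closed by (simp add: free_module_simps pairing_zero)
    show "\<ominus>\<^bsub>free_module L X\<^esub> w \<in> {w \<in> carrier (free_module L X). pairing L Q w = \<zero>}"
      if "w \<in> {w \<in> carrier (free_module L X). pairing L Q w = \<zero>}" for w
      using smult[of "\<ominus> \<one>" w] that by (simp add: F.smult_minus_one)
    show "v \<oplus>\<^bsub>free_module L X\<^esub> w \<in> {w \<in> carrier (free_module L X). pairing L Q w = \<zero>}"
      if "v \<in> {w \<in> carrier (free_module L X). pairing L Q w = \<zero>}" "w \<in> {w \<in> carrier (free_module L X). pairing L Q w = \<zero>}" for v w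
      using that F.M.a_closed[of v w] pairing_add[of v w] by (simp add: free_module_simps)
  qed (use smult in auto)
qed

end

text \<open>The scalar types and the carrier types of \<open>A\<close> and \<open>B\<close> are
  independent. The locale is applied to homomorphisms of algebras, to the structure map out of
  \<open>base_algebra\<close>, whose carrier is the field itself, and to maps into an auxiliary
  localisation that has no field of scalars.\<close>

locale scalar_extension = A: cring A + B: cring B
  for A :: "('k, 'a) module" and B :: "('l, 'b) module" +
  fixes \<phi> and X :: "'i set"
  assumes hom: "\<phi> \<in> Ring.ring_hom A B"
begin

sublocale ring_hom_cring A B \<phi>
  by (rule ring_hom_cringI') (unfold_locales, rule hom)

sublocale FA: Module.module A "free_module A X" by (rule free_module_module) unfold_locales
sublocale FB: Module.module B "free_module B X" by (rule free_module_module) unfold_locales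

lemma comp_closed:
  assumes "f \<in> carrier (free_module A X)" shows "\<phi> \<circ> f \<in> carrier (free_module B X)"
proof -
  have "finite {x. \<phi> (f x) \<noteq> \<zero>\<^bsub>B\<^esub>}"
    by (rule finite_subset[of _ "{x. f x \<noteq> \<zero>\<^bsub>A\<^esub>}"]) (use assms in \<open>auto simp: free_module_carrier_iff\<close>)
  then show ?thesis using assms by (auto simp: free_module_carrier_iff)
qed

lemma comp_add: "f \<in> carrier (free_module A X) \<Longrightarrow> g \<in> carrier (free_module A X) \<Longrightarrow>
    \<phi> \<circ> (f \<oplus>\<^bsub>free_module A X\<^esub> g) = (\<phi> \<circ> f) \<oplus>\<^bsub>free_module B X\<^esub> (\<phi> \<circ> g)"
  by (auto simp: free_module_simps)

lemma comp_smult: "f \<in> carrier (free_module A X) \<Longrightarrow> a \<in> carrier A \<Longrightarrow>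
    \<phi> \<circ> (a \<odot>\<^bsub>free_module A X\<^esub> f) = \<phi> a \<odot>\<^bsub>free_module B X\<^esub> (\<phi> \<circ> f)"
  by (auto simp: free_module_simps)

lemma comp_minus: "f \<in> carrier (free_module A X) \<Longrightarrow> g \<in> carrier (free_module A X) \<Longrightarrow>
    \<phi> \<circ> (f \<ominus>\<^bsub>free_module A X\<^esub> g) = (\<phi> \<circ> f) \<ominus>\<^bsub>free_module B X\<^esub> (\<phi> \<circ> g)"
  using comp_closed[of f] comp_closed[of g]
  by (auto simp: free_module_minus[OF A.is_cring] free_module_minus[OF B.is_cring] A.minus_eq B.minus_eq)

lemma comp_unit_fun: "\<phi> \<circ> unit_fun A x = unit_fun B x"
  by (auto simp: unit_fun_def)

lemma comp_lin_comb:
  assumes "finite J" "c \<in> J \<rightarrow> carrier A" "b \<in> J \<rightarrow> carrier (free_module A X)"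
  shows "\<phi> \<circ> lin_comb (free_module A X) J c b = lin_comb (free_module B X) J (\<phi> \<circ> c) (\<lambda>i. \<phi> \<circ> b i)"
  using assms
proof (induction J)
  case empty then show ?case by (auto simp: free_module_simps)
next
  case (insert i J)
  then have *: "c i \<in> carrier A" "c \<in> J \<rightarrow> carrier A" "b i \<in> carrier (free_module A X)" "b \<in> J \<rightarrow> carrier (free_module A X)"
    by auto
  have cl: "\<phi> \<circ> b j \<in> carrier (free_module B X)" "\<phi> (c j) \<in> carrier B" if "j \<in> insert i J" for j
    using that * comp_closed by auto
  have "\<phi> \<circ> lin_comb (free_module A X) (insert i J) c b
    = \<phi> \<circ> (c i \<odot>\<^bsub>free_module A X\<^esub> b i \<oplus>\<^bsub>free_module A X\<^esub> lin_comb (free_module A X) J c b)"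
    using insert * by (subst FA.finsum_insert) auto
  also have "\<dots> = (\<phi> \<circ> (c i \<odot>\<^bsub>free_module A X\<^esub> b i)) \<oplus>\<^bsub>free_module B X\<^esub> (\<phi> \<circ> lin_comb (free_module A X) J c b)"
    by (rule comp_add) (use * FA.lin_comb_closed[OF *(2,4)] in auto)
  also have "\<phi> \<circ> (c i \<odot>\<^bsub>free_module A X\<^esub> b i) = \<phi> (c i) \<odot>\<^bsub>free_module B X\<^esub> (\<phi> \<circ> b i)"
    using * by (intro comp_smult) auto
  also have "\<phi> \<circ> lin_comb (free_module A X) J c b = lin_comb (free_module B X) J (\<phi> \<circ> c) (\<lambda>i. \<phi> \<circ> b i)"
    using insert * by (intro insert.IH) auto
  also have "\<phi> (c i) \<odot>\<^bsub>free_module B X\<^esub> (\<phi> \<circ> b i) \<oplus>\<^bsub>free_module B X\<^esub> lin_comb (free_module B X) J (\<phi> \<circ> c) (\<lambda>i. \<phi> \<circ> b i)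
    = lin_comb (free_module B X) (insert i J) (\<phi> \<circ> c) (\<lambda>i. \<phi> \<circ> b i)"
    using insert(1,2) cl by (subst FB.finsum_insert) (simp_all add: Pi_iff)
  finally show ?case .
qed

lemma base_change_submodule:
  assumes N: "N \<subseteq> carrier (free_module A X)"
  shows "Module.submodule (base_change B X \<phi> N) B (free_module B X)"
proof -
  let ?S = "{H. Module.submodule H B (free_module B X) \<and> (\<lambda>f. \<phi> \<circ> f) ` N \<subseteq> H}"
  have ne: "carrier (free_module B X) \<in> ?S" using FB.carrier_is_submodule comp_closed N by auto
  have sub: "module_with_submodule B (free_module B X) H" if "H \<in> ?S" for H
    using that by (intro module_with_submodule.intro FB.module_axioms module_with_submodule_axioms.intro) simp
  show ?thesis unfolding base_change_def
  proof (rule FB.submoduleI)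
    show "\<Inter> ?S \<subseteq> carrier (free_module B X)" by (rule Inter_lower[OF ne])
    show "\<zero>\<^bsub>free_module B X\<^esub> \<in> \<Inter> ?S"
      by (rule InterI) (rule module_with_submodule.sub_zero[OF sub])
    show "\<ominus>\<^bsub>free_module B X\<^esub> v \<in> \<Inter> ?S" if "v \<in> \<Inter> ?S" for v
      by (rule InterI) (rule module_with_submodule.subE(3)[OF sub InterD[OF that]])
    show "v \<oplus>\<^bsub>free_module B X\<^esub> w \<in> \<Inter> ?S" if "v \<in> \<Inter> ?S" "w \<in> \<Inter> ?S" for v w
      by (rule InterI) (rule module_with_submodule.subE(5)[OF sub InterD[OF that(1)] InterD[OF that(2)]])
    show "a \<odot>\<^bsub>free_module B X\<^esub> v \<in> \<Inter> ?S" if "a \<in> carrier B" "v \<in> \<Inter> ?S" for a v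
      by (rule InterI) (rule module_with_submodule.subE(4)[OF sub that(1) InterD[OF that(2)]])
  qed
qed

lemma base_change_incl: "f \<in> N \<Longrightarrow> \<phi> \<circ> f \<in> base_change B X \<phi> N"
  unfolding base_change_def by auto

lemma base_change_minimal:
  "Module.submodule H B (free_module B X) \<Longrightarrow> (\<And>f. f \<in> N \<Longrightarrow> \<phi> \<circ> f \<in> H) \<Longrightarrow> base_change B X \<phi> N \<subseteq> H"
  unfolding base_change_def by auto

text \<open>A semilinear map is determined by its values on the standard basis, since the vectors
  where both sides agree form a submodule. So the functional on \<open>B^X\<close> with these values
  extends it along the base change; this replaces the universal property of the tensor
  product.\<close>

lemma semilinear_eq_pairing:
  assumes q: "\<And>v. v \<in> carrier (free_module A X) \<Longrightarrow> q v \<in> carrier B"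
    "\<And>v w. v \<in> carrier (free_module A X) \<Longrightarrow> w \<in> carrier (free_module A X) \<Longrightarrow> q (v \<oplus>\<^bsub>free_module A X\<^esub> w) = q v \<oplus>\<^bsub>B\<^esub> q w"
    "\<And>v a. v \<in> carrier (free_module A X) \<Longrightarrow> a \<in> carrier A \<Longrightarrow> q (a \<odot>\<^bsub>free_module A X\<^esub> v) = \<phi> a \<otimes>\<^bsub>B\<^esub> q v"
    and v: "v \<in> carrier (free_module A X)"
  shows "pairing B (\<lambda>x. q (unit_fun A x)) (\<phi> \<circ> v) = q v"
proof -
  interpret P: free_pairing B X "\<lambda>x. q (unit_fun A x)"
    by unfold_locales (rule q(1)[OF unit_fun_closed[OF A.is_cring]])
  let ?H = "{v \<in> carrier (free_module A X). pairing B (\<lambda>x. q (unit_fun A x)) (\<phi> \<circ> v) = q v}"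
  have smult: "a \<odot>\<^bsub>free_module A X\<^esub> v \<in> ?H" if a: "a \<in> carrier A" and v: "v \<in> ?H" for a v
  proof -
    have v': "v \<in> carrier (free_module A X)" "pairing B (\<lambda>x. q (unit_fun A x)) (\<phi> \<circ> v) = q v" using v by auto
    have "\<phi> \<circ> (a \<odot>\<^bsub>free_module A X\<^esub> v) = (\<lambda>x. \<phi> a \<otimes>\<^bsub>B\<^esub> (\<phi> \<circ> v) x)"
      using a v' by (auto simp: free_module_simps)
    then have "pairing B (\<lambda>x. q (unit_fun A x)) (\<phi> \<circ> (a \<odot>\<^bsub>free_module A X\<^esub> v))
      = pairing B (\<lambda>x. q (unit_fun A x)) (\<lambda>x. \<phi> a \<otimes>\<^bsub>B\<^esub> (\<phi> \<circ> v) x)" by simp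
    also have "\<dots> = \<phi> a \<otimes>\<^bsub>B\<^esub> pairing B (\<lambda>x. q (unit_fun A x)) (\<phi> \<circ> v)"
      by (rule P.pairing_smult[OF comp_closed[OF v'(1)]]) (use a in simp)
    finally show ?thesis using v' q(3)[OF v'(1) a] FA.smult_closed[OF a v'(1)] by simp
  qed
  have "?H = carrier (free_module A X)"
  proof (rule free_module_generated[OF A.is_cring])
    show "Module.submodule ?H A (free_module A X)"
    proof (rule FA.submoduleI)
      have "q (\<zero>\<^bsub>A\<^esub> \<odot>\<^bsub>free_module A X\<^esub> \<zero>\<^bsub>free_module A X\<^esub>) = \<phi> \<zero>\<^bsub>A\<^esub> \<otimes>\<^bsub>B\<^esub> q \<zero>\<^bsub>free_module A X\<^esub>"
        by (rule q(3)) auto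
      then have "q \<zero>\<^bsub>free_module A X\<^esub> = \<zero>\<^bsub>B\<^esub>" using q(1)[OF FA.M.zero_closed] by simp
      moreover have "\<phi> \<circ> \<zero>\<^bsub>free_module A X\<^esub> = (\<lambda>x. \<zero>\<^bsub>B\<^esub>)" by (auto simp: free_module_simps)
      ultimately show "\<zero>\<^bsub>free_module A X\<^esub> \<in> ?H" by (simp add: P.pairing_zero)
      show "\<ominus>\<^bsub>free_module A X\<^esub> v \<in> ?H" if "v \<in> ?H" for v
        using smult[of "\<ominus>\<^bsub>A\<^esub> \<one>\<^bsub>A\<^esub>" v] that by (simp add: FA.smult_minus_one)
      fix v w assume vw: "v \<in> ?H" "w \<in> ?H"
      then have v: "v \<in> carrier (free_module A X)" "pairing B (\<lambda>x. q (unit_fun A x)) (\<phi> \<circ> v) = q v"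
        and w: "w \<in> carrier (free_module A X)" "pairing B (\<lambda>x. q (unit_fun A x)) (\<phi> \<circ> w) = q w" by auto
      have "\<phi> \<circ> (v \<oplus>\<^bsub>free_module A X\<^esub> w) = (\<lambda>x. (\<phi> \<circ> v) x \<oplus>\<^bsub>B\<^esub> (\<phi> \<circ> w) x)"
        using v(1) w(1) by (auto simp: free_module_simps)
      then have "pairing B (\<lambda>x. q (unit_fun A x)) (\<phi> \<circ> (v \<oplus>\<^bsub>free_module A X\<^esub> w))
        = pairing B (\<lambda>x. q (unit_fun A x)) (\<lambda>x. (\<phi> \<circ> v) x \<oplus>\<^bsub>B\<^esub> (\<phi> \<circ> w) x)" by simp
      also have "\<dots> = q v \<oplus>\<^bsub>B\<^esub> q w"
        using P.pairing_add[OF comp_closed[OF v(1)] comp_closed[OF w(1)]] v(2) w(2) by simp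
      finally show "v \<oplus>\<^bsub>free_module A X\<^esub> w \<in> ?H" using q(2)[OF v(1) w(1)] v(1) w(1) by simp
    next
      show "a \<odot>\<^bsub>free_module A X\<^esub> x \<in> ?H" if "a \<in> carrier A" "x \<in> ?H" for a x using that by (rule smult)
    qed auto
    fix x assume x: "x \<in> X"
    then show "unit_fun A x \<in> ?H"
      using unit_fun_closed[OF A.is_cring x] by (simp add: comp_unit_fun P.pairing_unit)
  qed
  then have "v \<in> ?H" using v by simp
  then show ?thesis by simp
qed

end

section \<open>Base change of locally free quotients\<close>

context scalar_extension
begin

lemma mod_FA: "Module.submodule N A (free_module A X) \<Longrightarrow> module_with_submodule A (free_module A X) N"
  by (intro module_with_submodule.intro FA.module_axioms module_with_submodule_axioms.intro)

lemma mod_FB: "Module.submodule N B (free_module B X) \<Longrightarrow> module_with_submodule B (free_module B X) N"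
  by (intro module_with_submodule.intro FB.module_axioms module_with_submodule_axioms.intro)

lemma sub_FA: "Module.submodule N A (free_module A X) \<Longrightarrow> N \<subseteq> carrier (free_module A X)"
  by (rule FA.submoduleE(1))

lemma base_change_mod_eq:
  assumes "x \<ominus>\<^bsub>free_module A X\<^esub> y \<in> N" "x \<in> carrier (free_module A X)" "y \<in> carrier (free_module A X)"
  shows "(\<phi> \<circ> x) \<ominus>\<^bsub>free_module B X\<^esub> (\<phi> \<circ> y) \<in> base_change B X \<phi> N"
  using base_change_incl[OF assms(1)] assms(2,3) by (simp add: comp_minus)

text \<open>Spanning passes to \<open>B\<close> because the vectors spanned by the images form a
  submodule containing the standard basis of \<open>B^X\<close>. For independence, the coordinate
  functionals of the given basis, with values in a localisation \<open>L\<close> of \<open>B\<close>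
  at \<open>\<phi> s\<close>, are extended to \<open>B^X\<close>. They annihilate the base change of
  \<open>N\<close>, and applied to a combination they return its coefficients in \<open>L\<close>; a
  coefficient that vanishes in \<open>L\<close> is killed by a power of
  \<open>\<phi> s\<close>.\<close>

lemma basis_at_base_change:
  assumes N: "Module.submodule N A (free_module A X)" and b: "basis_at A (free_module A X) N s J b"
    and s: "s \<in> carrier A" and J: "finite J"
  shows "basis_at B (free_module B X) (base_change B X \<phi> N) (\<phi> s) J (\<lambda>i. \<phi> \<circ> b i)"
proof -
  let ?N = "base_change B X \<phi> N" and ?b = "\<lambda>i. \<phi> \<circ> b i"
  interpret N: module_with_submodule A "free_module A X" N by (rule mod_FA[OF N])
  have N': "Module.submodule ?N B (free_module B X)" by (rule base_change_submodule[OF sub_FA[OF N]])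
  interpret N': module_with_submodule B "free_module B X" ?N by (rule mod_FB[OF N'])
  note bA = basis_at_funcset[OF b]
  have bB: "?b \<in> J \<rightarrow> carrier (free_module B X)"
    by (rule Pi_I) (rule comp_closed[OF basis_at_closed[OF b]])
  have \<phi>s: "\<phi> s \<in> carrier B" using s by simp
  show ?thesis
  proof (rule N'.basis_atI[OF bB])
    fix v assume v: "v \<in> carrier (free_module B X)"
    let ?W = "{v \<in> carrier (free_module B X). \<exists>x \<in> saturation B (\<phi> s). \<exists>c \<in> J \<rightarrow> carrier B.
       (\<forall>i\<in>{}. c i \<in> carrier B) \<and> N'.mod_eq (x \<odot>\<^bsub>free_module B X\<^esub> v) (lin_comb (free_module B X) J c ?b)}"
    have "?W = carrier (free_module B X)"
    proof (rule free_module_generated[OF B.is_cring])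
      show "Module.submodule ?W B (free_module B X)"
        by (rule N'.span_submodule[OF \<phi>s J bB B.oneideal]) simp
      fix x assume x: "x \<in> X"
      note ux = unit_fun_closed[OF A.is_cring x] and uB = unit_fun_closed[OF B.is_cring x]
      obtain y c where y: "y \<in> saturation A s" "y \<in> carrier A" and c: "c \<in> J \<rightarrow> carrier A"
        "N.mod_eq (y \<odot>\<^bsub>free_module A X\<^esub> unit_fun A x) (lin_comb (free_module A X) J c b)"
        using N.basis_at_span[OF b ux] .
      have "(\<phi> \<circ> (y \<odot>\<^bsub>free_module A X\<^esub> unit_fun A x)) \<ominus>\<^bsub>free_module B X\<^esub> (\<phi> \<circ> lin_comb (free_module A X) J c b) \<in> ?N"
        using c(2) unfolding N.mod_eq_def
        by (rule base_change_mod_eq) (rule FA.smult_closed[OF y(2) ux] FA.lin_comb_closed[OF c(1) bA])+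
      moreover have "\<phi> \<circ> (y \<odot>\<^bsub>free_module A X\<^esub> unit_fun A x) = \<phi> y \<odot>\<^bsub>free_module B X\<^esub> unit_fun B x"
        using comp_smult[OF ux y(2)] by (simp add: comp_unit_fun)
      ultimately have "N'.mod_eq (\<phi> y \<odot>\<^bsub>free_module B X\<^esub> unit_fun B x) (lin_comb (free_module B X) J (\<phi> \<circ> c) ?b)"
        unfolding N'.mod_eq_def comp_lin_comb[OF J c(1) bA] by simp
      moreover have "\<phi> y \<in> saturation B (\<phi> s)"
        by (rule ring_hom_saturation[OF A.is_cring B.is_cring hom s y(1)])
      moreover have "\<phi> \<circ> c \<in> J \<rightarrow> carrier B" using c(1) by (simp add: Pi_iff)
      ultimately show "unit_fun B x \<in> ?W"
        by (intro CollectI conjI uB bexI[of _ "\<phi> y"] bexI[of _ "\<phi> \<circ> c"]) auto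
    qed
    then have "v \<in> ?W" using v by simp
    then show "\<exists>x\<in>saturation B (\<phi> s). \<exists>c\<in>J \<rightarrow> carrier B.
       N'.mod_eq (x \<odot>\<^bsub>free_module B X\<^esub> v) (lin_comb (free_module B X) J c ?b)" by simp
  next
    fix c assume c: "c \<in> J \<rightarrow> carrier B" and cN: "lin_comb (free_module B X) J c ?b \<in> ?N"
    obtain L0 :: "(nat \<Rightarrow> 'b) set ring" and \<psi> where L0: "cring L0" "\<psi> \<in> Ring.ring_hom B L0" "\<psi> (\<phi> s) \<in> Units L0"
      and ker: "\<forall>a \<in> carrier B. \<psi> a = \<zero>\<^bsub>L0\<^esub> \<longrightarrow> (\<exists>e::nat. \<phi> s [^]\<^bsub>B\<^esub> e \<otimes>\<^bsub>B\<^esub> a = \<zero>\<^bsub>B\<^esub>)"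
      using exists_localization[OF B.is_cring \<phi>s] by (elim exE conjE)
    \<comment> \<open>The localisation is a plain ring, while \<open>free_module\<close> takes an
      algebra record; a trivial action of the type \<open>unit\<close> fills the remaining field of
      the record.\<close>
    define L :: "(unit, (nat \<Rightarrow> 'b) set) module" where
      "L = \<lparr>carrier = carrier L0, mult = mult L0, one = one L0, zero = zero L0, add = add L0, smult = (\<lambda>_ a. a)\<rparr>"
    interpret L0: cring L0 by (rule L0(1))
    have L: "cring L"
    proof (rule cringI)
      show "abelian_group L"
        by (rule abelian_groupI) (auto simp: L_def L0.a_ac intro!: bexI[of _ "\<ominus>\<^bsub>L0\<^esub> _"] L0.l_neg)
      show "Group.comm_monoid L" by (rule comm_monoidI) (auto simp: L_def L0.m_ac)
    qed (simp add: L_def L0.l_distr)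
    have \<psi>: "\<psi> \<in> Ring.ring_hom B L" using L0(2) by (simp add: Ring.ring_hom_def L_def)
    have unit: "\<psi> (\<phi> s) \<in> Units L" using L0(3) by (simp add: Units_def L_def)
    interpret BL: scalar_extension B L \<psi> X
      by (intro scalar_extension.intro scalar_extension_axioms.intro L B.is_cring \<psi>)
    have \<chi>: "\<psi> \<circ> \<phi> \<in> Ring.ring_hom A L" by (rule ring_hom_trans[OF hom \<psi>])
    interpret AL: scalar_extension A L "\<psi> \<circ> \<phi>" X
      by (intro scalar_extension.intro scalar_extension_axioms.intro L A.is_cring \<chi>)
    have "(\<psi> \<circ> \<phi>) s \<in> Units L" using unit by simp
    from N.basis_at_coordinates[OF b s J L \<chi> this]
    obtain q where q: "\<forall>i \<in> J. \<forall>v \<in> carrier (free_module A X). q i v \<in> carrier L"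
      and char: "\<forall>i \<in> J. \<forall>v \<in> carrier (free_module A X). \<forall>x \<in> carrier A. \<forall>c \<in> J \<rightarrow> carrier A.
        N.mod_eq (x \<odot>\<^bsub>free_module A X\<^esub> v) (lin_comb (free_module A X) J c b) \<longrightarrow> (\<psi> \<circ> \<phi>) x \<otimes>\<^bsub>L\<^esub> q i v = (\<psi> \<circ> \<phi>) (c i)"
      and add: "\<forall>i \<in> J. \<forall>v \<in> carrier (free_module A X). \<forall>w \<in> carrier (free_module A X). q i (v \<oplus>\<^bsub>free_module A X\<^esub> w) = q i v \<oplus>\<^bsub>L\<^esub> q i w"
      and smult: "\<forall>i \<in> J. \<forall>v \<in> carrier (free_module A X). \<forall>a \<in> carrier A. q i (a \<odot>\<^bsub>free_module A X\<^esub> v) = (\<psi> \<circ> \<phi>) a \<otimes>\<^bsub>L\<^esub> q i v"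
      by (elim exE conjE)
    have "\<exists>x \<in> saturation B (\<phi> s). x \<otimes>\<^bsub>B\<^esub> c i = \<zero>\<^bsub>B\<^esub>" if i: "i \<in> J" for i
    proof -
      let ?Q = "\<lambda>x. q i (unit_fun A x)"
      note qi = q[rule_format, OF i] and addi = add[rule_format, OF i] and smulti = smult[rule_format, OF i]
        and chari = char[rule_format, OF i]
      interpret Q: free_pairing L X ?Q
        by unfold_locales (rule qi[OF unit_fun_closed[OF A.is_cring]])
      have pq: "pairing L ?Q ((\<psi> \<circ> \<phi>) \<circ> v) = q i v" if "v \<in> carrier (free_module A X)" for v
        by (rule AL.semilinear_eq_pairing[OF qi addi smulti that])
      \<comment> \<open>The kernel of the extended functional is a \<open>B\<close>-submodule; it
        contains the image of \<open>N\<close>, hence the whole base change.\<close>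
      let ?H = "{w \<in> carrier (free_module B X). pairing L ?Q (\<psi> \<circ> w) = \<zero>\<^bsub>L\<^esub>}"
      have Hs: "a \<odot>\<^bsub>free_module B X\<^esub> w \<in> ?H" if "a \<in> carrier B" "w \<in> ?H" for a w
      proof -
        have w: "w \<in> carrier (free_module B X)" "pairing L ?Q (\<psi> \<circ> w) = \<zero>\<^bsub>L\<^esub>" using that by auto
        have "pairing L ?Q (\<psi> \<circ> (a \<odot>\<^bsub>free_module B X\<^esub> w)) = pairing L ?Q (\<lambda>x. \<psi> a \<otimes>\<^bsub>L\<^esub> (\<psi> \<circ> w) x)"
          unfolding BL.comp_smult[OF w(1) that(1)] by (simp add: free_module_simps)
        also have "\<dots> = \<psi> a \<otimes>\<^bsub>L\<^esub> pairing L ?Q (\<psi> \<circ> w)"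
          by (rule Q.pairing_smult[OF BL.comp_closed[OF w(1)]]) (use that in simp)
        finally show ?thesis using w FB.smult_closed[OF that(1) w(1)] that(1) by simp
      qed
      have H: "Module.submodule ?H B (free_module B X)"
      proof (rule FB.submoduleI)
        show "?H \<subseteq> carrier (free_module B X)" by auto
        have "\<psi> \<circ> \<zero>\<^bsub>free_module B X\<^esub> = (\<lambda>x. \<zero>\<^bsub>L\<^esub>)" by (auto simp: free_module_simps)
        then show "\<zero>\<^bsub>free_module B X\<^esub> \<in> ?H" by (simp add: Q.pairing_zero)
        show "\<ominus>\<^bsub>free_module B X\<^esub> w \<in> ?H" if "w \<in> ?H" for w
          using Hs[OF _ that, of "\<ominus>\<^bsub>B\<^esub> \<one>\<^bsub>B\<^esub>"] that by (simp add: FB.smult_minus_one)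
        show "v \<oplus>\<^bsub>free_module B X\<^esub> w \<in> ?H" if "v \<in> ?H" "w \<in> ?H" for v w
        proof -
          have v: "v \<in> carrier (free_module B X)" "pairing L ?Q (\<psi> \<circ> v) = \<zero>\<^bsub>L\<^esub>" using that by auto
          have w: "w \<in> carrier (free_module B X)" "pairing L ?Q (\<psi> \<circ> w) = \<zero>\<^bsub>L\<^esub>" using that by auto
          have "pairing L ?Q (\<psi> \<circ> (v \<oplus>\<^bsub>free_module B X\<^esub> w)) = pairing L ?Q (\<lambda>x. (\<psi> \<circ> v) x \<oplus>\<^bsub>L\<^esub> (\<psi> \<circ> w) x)"
            unfolding BL.comp_add[OF v(1) w(1)] by (simp add: free_module_simps)
          also have "\<dots> = \<zero>\<^bsub>L\<^esub>"
            using Q.pairing_add[OF BL.comp_closed[OF v(1)] BL.comp_closed[OF w(1)]] v w by simp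
          finally show ?thesis using FB.M.a_closed[OF v(1) w(1)] by simp
        qed
        show "a \<odot>\<^bsub>free_module B X\<^esub> w \<in> ?H" if "a \<in> carrier B" "w \<in> ?H" for a w
          using that by (rule Hs)
      qed
      have "?N \<subseteq> ?H"
      proof (rule base_change_minimal[OF H])
        fix f assume f: "f \<in> N"
        have fF: "f \<in> carrier (free_module A X)" by (rule N.sub_closed[OF f])
        have "N.mod_eq (\<one>\<^bsub>A\<^esub> \<odot>\<^bsub>free_module A X\<^esub> f) (lin_comb (free_module A X) J (\<lambda>i. \<zero>\<^bsub>A\<^esub>) b)"
          using f fF bA N.sub_zero N.sub_diff[OF f N.sub_zero] by (simp add: FA.lin_comb_zero N.mod_eq_def)
        then have "(\<psi> \<circ> \<phi>) \<one>\<^bsub>A\<^esub> \<otimes>\<^bsub>L\<^esub> q i f = (\<psi> \<circ> \<phi>) \<zero>\<^bsub>A\<^esub>"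
          by (intro chari fF) auto
        moreover have "q i f \<in> carrier L" by (rule qi[OF fF])
        ultimately have "q i f = \<zero>\<^bsub>L\<^esub>" by simp
        then have "pairing L ?Q (\<psi> \<circ> (\<phi> \<circ> f)) = \<zero>\<^bsub>L\<^esub>" using pq[OF fF] by (simp add: comp_assoc)
        then show "\<phi> \<circ> f \<in> ?H" using comp_closed[OF fF] by simp
      qed
      then have "pairing L ?Q (\<psi> \<circ> lin_comb (free_module B X) J c ?b) = \<zero>\<^bsub>L\<^esub>" using cN by blast
      moreover have "pairing L ?Q (\<psi> \<circ> lin_comb (free_module B X) J c ?b) = \<psi> (c i)"
      proof -
        have qb: "q i (b l) = (if l = i then \<one>\<^bsub>L\<^esub> else \<zero>\<^bsub>L\<^esub>)" if l: "l \<in> J" for l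
        proof -
          let ?c = "\<lambda>j. if j = l then \<one>\<^bsub>A\<^esub> else \<zero>\<^bsub>A\<^esub>"
          have bl: "b l \<in> carrier (free_module A X)" by (rule basis_at_closed[OF b l])
          have cc: "?c \<in> J \<rightarrow> carrier A" by auto
          have "N.mod_eq (\<one>\<^bsub>A\<^esub> \<odot>\<^bsub>free_module A X\<^esub> b l) (lin_comb (free_module A X) J ?c b)"
            using FA.lin_comb_single[OF J l A.one_closed bA] bl by simp
          then have "(\<psi> \<circ> \<phi>) \<one>\<^bsub>A\<^esub> \<otimes>\<^bsub>L\<^esub> q i (b l) = (\<psi> \<circ> \<phi>) (?c i)"
            by (rule chari[OF bl A.one_closed cc])
          moreover have "q i (b l) \<in> carrier L" by (rule qi[OF bl])
          ultimately show ?thesis by (simp split: if_splits)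
        qed
        have \<psi>c: "\<psi> \<circ> c \<in> J \<rightarrow> carrier L" using c by (simp add: Pi_iff)
        have \<psi>b: "(\<lambda>i. \<psi> \<circ> ?b i) \<in> J \<rightarrow> carrier (free_module L X)"
          by (rule Pi_I) (rule BL.comp_closed[OF funcset_mem[OF bB]])
        have "pairing L ?Q (\<psi> \<circ> lin_comb (free_module B X) J c ?b)
          = (\<Oplus>\<^bsub>L\<^esub>l\<in>J. (\<psi> \<circ> c) l \<otimes>\<^bsub>L\<^esub> pairing L ?Q (\<psi> \<circ> ?b l))"
          unfolding BL.comp_lin_comb[OF J c bB] by (rule Q.pairing_lin_comb[OF J \<psi>c \<psi>b])
        also have "\<dots> = (\<Oplus>\<^bsub>L\<^esub>l\<in>J. if i = l then (\<psi> \<circ> c) l else \<zero>\<^bsub>L\<^esub>)"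
        proof (rule BL.B.finsum_cong')
          fix l assume l: "l \<in> J"
          have "pairing L ?Q (\<psi> \<circ> ?b l) = q i (b l)"
            using pq[OF basis_at_closed[OF b l]] by (simp add: comp_assoc)
          moreover have "(\<psi> \<circ> c) l \<in> carrier L" by (rule funcset_mem[OF \<psi>c l])
          ultimately show "(\<psi> \<circ> c) l \<otimes>\<^bsub>L\<^esub> pairing L ?Q (\<psi> \<circ> ?b l) = (if i = l then (\<psi> \<circ> c) l else \<zero>\<^bsub>L\<^esub>)"
            using qb[OF l] by simp
        qed (use \<psi>c in \<open>simp_all add: Pi_iff\<close>)
        also have "\<dots> = (\<psi> \<circ> c) i" by (rule BL.B.finsum_singleton[OF i J \<psi>c])
        finally show ?thesis by simp
      qed
      ultimately have "\<psi> (c i) = \<zero>\<^bsub>L0\<^esub>" by (simp add: L_def)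
      then obtain e :: nat where "\<phi> s [^]\<^bsub>B\<^esub> e \<otimes>\<^bsub>B\<^esub> c i = \<zero>\<^bsub>B\<^esub>" using ker c i by (auto simp: Pi_iff)
      then show ?thesis using B.pow_saturation[OF \<phi>s, of e] by (rule bexI)
    qed
    then obtain z where z: "\<And>i. i \<in> J \<Longrightarrow> z i \<in> saturation B (\<phi> s)" "\<And>i. i \<in> J \<Longrightarrow> z i \<otimes>\<^bsub>B\<^esub> c i = \<zero>\<^bsub>B\<^esub>" by metis
    \<comment> \<open>Each coefficient has its own denominator \<open>z i\<close>; their product
      serves all of them.\<close>
    have "\<exists>x \<in> saturation B (\<phi> s). \<forall>i\<in>K. x \<otimes>\<^bsub>B\<^esub> c i = \<zero>\<^bsub>B\<^esub>" if "finite K" "K \<subseteq> J" for K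
      using that
    proof (induction K)
      case empty then show ?case using B.one_saturation[OF \<phi>s] by auto
    next
      case (insert i K)
      then obtain x where x: "x \<in> saturation B (\<phi> s)" "\<forall>i\<in>K. x \<otimes>\<^bsub>B\<^esub> c i = \<zero>\<^bsub>B\<^esub>" by auto
      have i: "i \<in> J" using insert by auto
      note xB = B.saturation_closed[OF x(1)] and zB = B.saturation_closed[OF z(1)[OF i]]
      have cB: "c j \<in> carrier B" if "j \<in> insert i K" for j using c insert that by auto
      have "(x \<otimes>\<^bsub>B\<^esub> z i) \<otimes>\<^bsub>B\<^esub> c j = \<zero>\<^bsub>B\<^esub>" if j: "j \<in> insert i K" for j
      proof (cases "j = i")
        case True
        have "(x \<otimes>\<^bsub>B\<^esub> z i) \<otimes>\<^bsub>B\<^esub> c j = x \<otimes>\<^bsub>B\<^esub> (z i \<otimes>\<^bsub>B\<^esub> c i)" using True xB zB cB[OF j] by (simp add: B.m_assoc)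
        then show ?thesis using z(2)[OF i] xB by simp
      next
        case False
        have "(x \<otimes>\<^bsub>B\<^esub> z i) \<otimes>\<^bsub>B\<^esub> c j = z i \<otimes>\<^bsub>B\<^esub> (x \<otimes>\<^bsub>B\<^esub> c j)" using xB zB cB[OF j] by (simp add: B.m_ac)
        then show ?thesis using x(2) False j zB by simp
      qed
      then show ?case using B.mult_saturation[OF \<phi>s x(1) z(1)[OF i]] by (intro bexI[of _ "x \<otimes>\<^bsub>B\<^esub> z i"] ballI)
    qed
    from this[OF J subset_refl] show "\<exists>x \<in> saturation B (\<phi> s). \<forall>i\<in>J. x \<otimes>\<^bsub>B\<^esub> c i = \<zero>\<^bsub>B\<^esub>" .
  qed
qed

lemma locally_free_base_change:
  assumes N: "Module.submodule N A (free_module A X)" and f: "locally_free_quotient A (free_module A X) N d"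
  shows "locally_free_quotient B (free_module B X) (base_change B X \<phi> N) d"
proof -
  have N': "Module.submodule (base_change B X \<phi> N) B (free_module B X)" by (rule base_change_submodule[OF sub_FA[OF N]])
  let ?S = "{s \<in> carrier A. \<exists>b. basis_at A (free_module A X) N s {..<d} b}"
  let ?S' = "{s \<in> carrier B. \<exists>b. basis_at B (free_module B X) (base_change B X \<phi> N) s {..<d} b}"
  have "Idl\<^bsub>A\<^esub> ?S = carrier A" using f by (simp add: locally_free_quotient_iff[OF FA.module_axioms N])
  then have "Idl\<^bsub>B\<^esub> (\<phi> ` ?S) = carrier B"
    by (intro ring_hom_genideal_carrier[OF A.is_cring B.is_cring hom]) auto
  moreover have "\<phi> ` ?S \<subseteq> ?S'"
  proof
    fix t assume "t \<in> \<phi> ` ?S"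
    then obtain s b where s: "s \<in> carrier A" "t = \<phi> s" "basis_at A (free_module A X) N s {..<d} b" by auto
    have "basis_at B (free_module B X) (base_change B X \<phi> N) t {..<d} (\<lambda>i. \<phi> \<circ> b i)"
      unfolding s(2) by (rule basis_at_base_change[OF N s(3,1)]) simp
    then show "t \<in> ?S'" using s(1,2) by auto
  qed
  ultimately have "carrier B \<subseteq> Idl\<^bsub>B\<^esub> ?S'" using B.subset_Idl_subset[of ?S' "\<phi> ` ?S"] by auto
  moreover have "Idl\<^bsub>B\<^esub> ?S' \<subseteq> carrier B" by (rule B.genideal_minimal[OF B.oneideal]) auto
  ultimately show ?thesis unfolding locally_free_quotient_iff[OF FB.module_axioms N'] by (rule subset_antisym[rotated])
qed

end

section \<open>Polynomial and localised algebras\<close>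

lemma class_ring_cring: "cring (class_ring :: 'k::field ring)"
  using class_field[where 'a = 'k] by (simp add: field_def domain_def)

text \<open>Copies the ring \<open>R\<close> along an injection \<open>g\<close> of its carrier,
  with scalars acting through \<open>\<kappa>\<close>. Functors take only algebras with carrier in
  one fixed type, and the polynomial rings and localisations built from such an algebra live in
  other types.\<close>

definition transport_algebra ::
    "('u, 'm) ring_scheme \<Rightarrow> ('k \<Rightarrow> 'u) \<Rightarrow> ('u \<Rightarrow> 'b) \<Rightarrow> ('k, 'b) module" where
  "transport_algebra R \<kappa> g = (let h = inv_into (carrier R) g in
     \<lparr>carrier = g ` carrier R, mult = (\<lambda>a b. g (h a \<otimes>\<^bsub>R\<^esub> h b)), one = g \<one>\<^bsub>R\<^esub>,
      zero = g \<zero>\<^bsub>R\<^esub>, add = (\<lambda>a b. g (h a \<oplus>\<^bsub>R\<^esub> h b)), smult = (\<lambda>c a. g (\<kappa> c \<otimes>\<^bsub>R\<^esub> h a))\<rparr>)"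

lemma structure_map_ring_hom:
  assumes A: "k_algebra (A :: ('k::field, 'b) module)"
  shows "structure_map A \<in> Ring.ring_hom (class_ring :: 'k ring) A"
proof -
  interpret A: Module.algebra class_ring A by fact
  have closed: "structure_map A c \<in> carrier A" for c
    unfolding structure_map_def by (rule A.smult_closed) (simp_all add: class_ring_simps)
  show ?thesis
  proof (rule ring_hom_memI)
    fix c d :: 'k
    have "structure_map A c \<otimes>\<^bsub>A\<^esub> structure_map A d = c \<odot>\<^bsub>A\<^esub> (\<one>\<^bsub>A\<^esub> \<otimes>\<^bsub>A\<^esub> structure_map A d)"
      unfolding structure_map_def
      by (rule A.smult_assoc2) (use closed[of d] in \<open>simp_all add: class_ring_simps structure_map_def\<close>)
    also have "\<dots> = c \<odot>\<^bsub>A\<^esub> (d \<odot>\<^bsub>A\<^esub> \<one>\<^bsub>A\<^esub>)" using closed[of d] by (simp add: structure_map_def)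
    also have "\<dots> = structure_map A (c \<otimes>\<^bsub>class_ring\<^esub> d)"
      unfolding structure_map_def by (rule A.smult_assoc1[symmetric]) (simp_all add: class_ring_simps)
    finally show "structure_map A (c \<otimes>\<^bsub>class_ring\<^esub> d) = structure_map A c \<otimes>\<^bsub>A\<^esub> structure_map A d" by simp
    show "structure_map A (c \<oplus>\<^bsub>class_ring\<^esub> d) = structure_map A c \<oplus>\<^bsub>A\<^esub> structure_map A d"
      unfolding structure_map_def by (rule A.smult_l_distr) (simp_all add: class_ring_simps)
  next
    show "structure_map A \<one>\<^bsub>class_ring\<^esub> = \<one>\<^bsub>A\<^esub>"
      unfolding structure_map_def by (rule A.smult_one) simp
  qed (rule closed)
qed

lemma algebra_smult_structure_map:
  assumes A: "k_algebra (A :: ('k::field, 'b) module)" and a: "a \<in> carrier A"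
  shows "c \<odot>\<^bsub>A\<^esub> a = structure_map A c \<otimes>\<^bsub>A\<^esub> a"
proof -
  interpret A: Module.algebra class_ring A by fact
  have "structure_map A c \<otimes>\<^bsub>A\<^esub> a = c \<odot>\<^bsub>A\<^esub> (\<one>\<^bsub>A\<^esub> \<otimes>\<^bsub>A\<^esub> a)"
    unfolding structure_map_def by (rule A.smult_assoc2) (use a in \<open>simp_all add: class_ring_simps\<close>)
  then show ?thesis using a by simp
qed

lemma k_algebra_cring: "k_algebra A \<Longrightarrow> cring A"
  by (rule Module.algebra.M_cring)

lemma k_algebra_homI:
  assumes A: "k_algebra (A :: ('k::field, 'b) module)" and B: "k_algebra (B :: ('k, 'c) module)"
    and \<phi>: "\<phi> \<in> Ring.ring_hom A B" and str: "\<And>c. \<phi> (structure_map A c) = structure_map B c"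
  shows "k_algebra_hom A B \<phi>"
  unfolding k_algebra_hom_def
proof (intro conjI allI ballI)
  fix c a assume a: "a \<in> carrier A"
  have "structure_map A c \<in> carrier A" using ring_hom_closed[OF structure_map_ring_hom[OF A], of c] by (simp add: class_ring_simps)
  then have "\<phi> (structure_map A c \<otimes>\<^bsub>A\<^esub> a) = structure_map B c \<otimes>\<^bsub>B\<^esub> \<phi> a"
    using ring_hom_mult[OF \<phi> _ a] str by simp
  then show "\<phi> (c \<odot>\<^bsub>A\<^esub> a) = c \<odot>\<^bsub>B\<^esub> \<phi> a"
    using algebra_smult_structure_map[OF A a] algebra_smult_structure_map[OF B ring_hom_closed[OF \<phi> a]] by simp
qed (rule \<phi>)

locale algebra_transport =
  fixes R :: "('u, 'm) ring_scheme" and \<kappa> :: "'k::field \<Rightarrow> 'u" and g :: "'u \<Rightarrow> 'b"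
  assumes R: "cring R" and \<kappa>: "\<kappa> \<in> Ring.ring_hom (class_ring :: 'k ring) R" and g: "inj_on g (carrier R)"
begin

abbreviation "T \<equiv> transport_algebra R \<kappa> g"
abbreviation "h \<equiv> inv_into (carrier R) g"

sublocale R: cring R by (rule R)

lemma hg [simp]: "a \<in> carrier R \<Longrightarrow> h (g a) = a" using g by (simp add: inv_into_f_f)

lemma T_simps:
  "carrier T = g ` carrier R" "\<one>\<^bsub>T\<^esub> = g \<one>\<^bsub>R\<^esub>" "\<zero>\<^bsub>T\<^esub> = g \<zero>\<^bsub>R\<^esub>"
  "a \<otimes>\<^bsub>T\<^esub> b = g (h a \<otimes>\<^bsub>R\<^esub> h b)" "a \<oplus>\<^bsub>T\<^esub> b = g (h a \<oplus>\<^bsub>R\<^esub> h b)"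
  "c \<odot>\<^bsub>T\<^esub> a = g (\<kappa> c \<otimes>\<^bsub>R\<^esub> h a)"
  by (simp_all add: transport_algebra_def Let_def)

lemma T_cring: "cring T"
proof (rule cringI)
  show "abelian_group T"
  proof (rule abelian_groupI)
    fix x assume "x \<in> carrier T"
    then obtain a where "a \<in> carrier R" "x = g a" by (auto simp: T_simps)
    then show "\<exists>y\<in>carrier T. y \<oplus>\<^bsub>T\<^esub> x = \<zero>\<^bsub>T\<^esub>"
      by (intro bexI[of _ "g (\<ominus>\<^bsub>R\<^esub> a)"]) (simp_all add: T_simps R.l_neg)
  qed (auto simp: T_simps R.a_ac)
  show "Group.comm_monoid T"
    by (rule comm_monoidI) (auto simp: T_simps R.m_ac)
qed (auto simp: T_simps R.l_distr)

lemma \<kappa>_closed [simp]: "\<kappa> c \<in> carrier R"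
  using ring_hom_closed[OF \<kappa>] by (simp add: class_ring_simps)

lemma T_algebra: "k_algebra T"
proof (rule Module.algebraI[OF class_ring_cring T_cring])
  show "(a \<oplus>\<^bsub>class_ring\<^esub> b) \<odot>\<^bsub>T\<^esub> x = a \<odot>\<^bsub>T\<^esub> x \<oplus>\<^bsub>T\<^esub> b \<odot>\<^bsub>T\<^esub> x"
    if "a \<in> carrier class_ring" "b \<in> carrier class_ring" "x \<in> carrier T" for a b :: 'k and x
    using that ring_hom_add[OF \<kappa> that(1,2)] by (auto simp: T_simps R.l_distr)
  show "(a \<otimes>\<^bsub>class_ring\<^esub> b) \<odot>\<^bsub>T\<^esub> x = a \<odot>\<^bsub>T\<^esub> (b \<odot>\<^bsub>T\<^esub> x)"
    if "a \<in> carrier class_ring" "b \<in> carrier class_ring" "x \<in> carrier T" for a b :: 'k and x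
    using that ring_hom_mult[OF \<kappa> that(1,2)] by (auto simp: T_simps R.m_assoc)
qed (use ring_hom_one[OF \<kappa>] in \<open>auto simp: T_simps R.r_distr R.m_assoc\<close>)

lemma g_hom: "g \<in> Ring.ring_hom R T"
  by (rule ring_hom_memI) (auto simp: T_simps)

lemma h_hom: "h \<in> Ring.ring_hom T R"
  by (rule ring_hom_memI) (auto simp: T_simps)

lemma structure_map_T: "structure_map T c = g (\<kappa> c)"
  by (simp add: structure_map_def T_simps)

end

text \<open>A bijection of \<open>C \<times> C\<close> with \<open>C\<close>, iterated along a list,
  is injective on lists of equal length but loses the length; so the length is coded in front by an
  embedding of the naturals into \<open>C\<close>.\<close>

lemma inj_on_lists:
  fixes C :: "'b set"
  assumes "infinite C"
  shows "\<exists>e :: 'b list \<Rightarrow> 'b. inj_on e (lists C)"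
proof -
  obtain p where p: "bij_betw p (C \<times> C) C"
    using card_of_Times_same_infinite[OF assms] card_of_ordIso by blast
  obtain i :: "nat \<Rightarrow> 'b" where i: "inj i" "range i \<subseteq> C"
    using infinite_countable_subset[OF assms] by blast
  have pC: "p (x, y) \<in> C" if "x \<in> C" "y \<in> C" for x y
    using p that by (auto simp: bij_betw_def)
  have pinj: "x = x' \<and> y = y'" if "p (x, y) = p (x', y')" "x \<in> C" "y \<in> C" "x' \<in> C" "y' \<in> C" for x y x' y'
    using p that inj_onD[of p "C \<times> C" "(x, y)" "(x', y')"] by (auto simp: bij_betw_def)
  define f where "f = foldr (\<lambda>x a. p (x, a))"
  have fC: "f xs (i 0) \<in> C" if "xs \<in> lists C" for xs
    using that i(2) by (induction xs) (auto simp: f_def intro: pC)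
  have finj: "xs = ys" if "f xs (i 0) = f ys (i 0)" "length xs = length ys" "xs \<in> lists C" "ys \<in> lists C" for xs ys
    using that(2,1,3,4)
  proof (induction xs ys rule: list_induct2)
    case (Cons x xs y ys)
    then have "p (x, f xs (i 0)) = p (y, f ys (i 0))" by (simp add: f_def)
    then have "x = y \<and> f xs (i 0) = f ys (i 0)" using Cons.prems fC by (intro pinj) auto
    then show ?case using Cons by auto
  qed simp
  have "inj_on (\<lambda>xs. p (i (length xs), f xs (i 0))) (lists C)"
  proof (rule inj_onI)
    fix xs ys assume *: "xs \<in> lists C" "ys \<in> lists C" "p (i (length xs), f xs (i 0)) = p (i (length ys), f ys (i 0))"
    then have "i (length xs) = i (length ys) \<and> f xs (i 0) = f ys (i 0)" using i(2) fC by (intro pinj) auto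
    then show "xs = ys" using finj * i(1) by (auto dest: injD)
  qed
  then show ?thesis by (rule exI[of "\<lambda>e. inj_on e (lists C)"])
qed

text \<open>The sequence is recovered from the list of its values before the least index from which
  it equals \<open>z\<close>; the length of the list is that index.\<close>

lemma inj_on_eventually_constant:
  fixes C :: "'b set"
  assumes "infinite C"
  shows "\<exists>g :: (nat \<Rightarrow> 'b) \<Rightarrow> 'b. inj_on g {f. (\<forall>n. f n \<in> C) \<and> (\<exists>N. \<forall>n\<ge>N. f n = z)}"
proof -
  obtain e :: "'b list \<Rightarrow> 'b" where e: "inj_on e (lists C)" using inj_on_lists[OF assms] by blast
  define N where "N f = (LEAST N. \<forall>n\<ge>N. f n = z)" for f :: "nat \<Rightarrow> 'b"
  have N': "\<forall>n\<ge>N f. f n = z" if "\<exists>N. \<forall>n\<ge>N. f n = z" for f :: "nat \<Rightarrow> 'b"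
    unfolding N_def using that by (rule LeastI_ex[of "\<lambda>N. \<forall>n\<ge>N. f n = z"])
  have N: "f n = z" if "\<exists>N. \<forall>n\<ge>N. f n = z" "n \<ge> N f" for f :: "nat \<Rightarrow> 'b" and n
    using N'[OF that(1)] that(2) by simp
  have "inj_on (\<lambda>f. e (map f [0..<N f])) {f. (\<forall>n. f n \<in> C) \<and> (\<exists>N. \<forall>n\<ge>N. f n = z)}"
  proof (rule inj_onI)
    fix f f' assume f: "f \<in> {f. (\<forall>n. f n \<in> C) \<and> (\<exists>N. \<forall>n\<ge>N. f n = z)}"
      and f': "f' \<in> {f. (\<forall>n. f n \<in> C) \<and> (\<exists>N. \<forall>n\<ge>N. f n = z)}"
      and eq: "e (map f [0..<N f]) = e (map f' [0..<N f'])"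
    have m: "map f [0..<N f] = map f' [0..<N f']"
      by (rule inj_onD[OF e eq]) (use f f' in auto)
    then have NN: "N f = N f'" by (metis length_map length_upt minus_nat.diff_0)
    show "f = f'"
    proof
      fix n
      show "f n = f' n"
      proof (cases "n < N f")
        case True
        then show ?thesis using m NN by (metis (no_types, lifting) atLeastLessThan_iff map_eq_conv set_upt zero_le)
      next
        case False
        then show ?thesis using N[of f n] N[of f' n] f f' NN by auto
      qed
    qed
  qed
  then show ?thesis by (rule exI[of "\<lambda>g. inj_on g {f. (\<forall>n. f n \<in> C) \<and> (\<exists>N. \<forall>n\<ge>N. f n = z)}"])
qed

lemma inj_on_UP:
  assumes "cring A" "infinite (carrier A)"
  shows "\<exists>g :: (nat \<Rightarrow> 'b) \<Rightarrow> 'b. inj_on g (carrier (UP (A :: ('b, 'm) ring_scheme)))"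
proof -
  obtain g :: "(nat \<Rightarrow> 'b) \<Rightarrow> 'b" where g: "inj_on g {f. (\<forall>n. f n \<in> carrier A) \<and> (\<exists>N. \<forall>n\<ge>N. f n = \<zero>\<^bsub>A\<^esub>)}"
    using inj_on_eventually_constant[OF assms(2)] by blast
  have "carrier (UP A) \<subseteq> {f. (\<forall>n. f n \<in> carrier A) \<and> (\<exists>N. \<forall>n\<ge>N. f n = \<zero>\<^bsub>A\<^esub>)}"
  proof
    fix f assume "f \<in> carrier (UP A)"
    then have f: "f \<in> up A" by (simp add: UP_def)
    then obtain n where "bound \<zero>\<^bsub>A\<^esub> n f" by (auto simp: up_def)
    then have "\<forall>m\<ge>Suc n. f m = \<zero>\<^bsub>A\<^esub>" by (auto simp: bound_def)
    moreover have "\<forall>n. f n \<in> carrier A" using f by auto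
    ultimately show "f \<in> {f. (\<forall>n. f n \<in> carrier A) \<and> (\<exists>N. \<forall>n\<ge>N. f n = \<zero>\<^bsub>A\<^esub>)}" by blast
  qed
  then show ?thesis using inj_on_subset[OF g] by blast
qed

text \<open>In a nonzero algebra the structure map is injective, since a nonzero scalar is
  invertible and cannot become \<open>0\<close>; and a field of characteristic zero is infinite.
  This supplies the room for coding polynomials in the carrier.\<close>

lemma k_algebra_infinite:
  assumes A: "k_algebra (A :: ('k::field_char_0, 'b) module)" and "\<one>\<^bsub>A\<^esub> \<noteq> \<zero>\<^bsub>A\<^esub>"
  shows "infinite (carrier A)"
proof -
  interpret A: Module.algebra class_ring A by fact
  interpret AC: cring A by (rule A.M_cring)
  have closed: "structure_map A c \<in> carrier A" for c
    using ring_hom_closed[OF structure_map_ring_hom[OF A], of c] by (simp add: class_ring_simps)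
  have "inj (structure_map A)"
  proof (rule injI, rule ccontr)
    fix c d assume eq: "structure_map A c = structure_map A d" and ne: "c \<noteq> d"
    have m: "structure_map A (x * y) = structure_map A x \<otimes>\<^bsub>A\<^esub> structure_map A y" for x y
      using ring_hom_mult[OF structure_map_ring_hom[OF A], of x y] by (simp add: class_ring_simps)
    have a: "structure_map A (x + y) = structure_map A x \<oplus>\<^bsub>A\<^esub> structure_map A y" for x y
      using ring_hom_add[OF structure_map_ring_hom[OF A], of x y] by (simp add: class_ring_simps)
    have o: "structure_map A 1 = \<one>\<^bsub>A\<^esub>"
      using ring_hom_one[OF structure_map_ring_hom[OF A]] by (simp add: class_ring_simps)
    have "structure_map A (c - d) \<oplus>\<^bsub>A\<^esub> structure_map A d = structure_map A d"
      using a[of "c - d" d] eq by simp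
    then have z: "structure_map A (c - d) = \<zero>\<^bsub>A\<^esub>"
      using closed[of "c - d"] closed[of d] by (metis A.M.add.right_cancel A.M.l_zero A.M.zero_closed)
    have "\<one>\<^bsub>A\<^esub> = structure_map A ((1 / (c - d)) * (c - d))" using ne o by simp
    also have "\<dots> = structure_map A (1 / (c - d)) \<otimes>\<^bsub>A\<^esub> structure_map A (c - d)" by (rule m)
    also have "\<dots> = \<zero>\<^bsub>A\<^esub>" using z closed[of "1 / (c - d)"] by simp
    finally show False using assms(2) by simp
  qed
  then have "infinite (range (structure_map A))" using finite_imageD infinite_UNIV_char_0 by blast
  moreover have "range (structure_map A) \<subseteq> carrier A" using closed by auto
  ultimately show ?thesis using finite_subset by blast
qed

text \<open>Comparing the values at \<open>c\<close> and \<open>2c\<close> lowers the degree.\<close>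

lemma polynomial_function_zero:
  assumes A: "Module.module (class_ring :: 'k::field_char_0 ring) A" and a: "\<And>p. p < D \<Longrightarrow> a p \<in> carrier A"
    and zero: "\<And>c :: 'k. lin_comb A {..<D} (\<lambda>p. c ^ p) a = \<zero>\<^bsub>A\<^esub>" and p: "p < D"
  shows "a p = \<zero>\<^bsub>A\<^esub>"
  using a zero p
proof (induction D arbitrary: a p)
  case (Suc D)
  interpret A: Module.module class_ring A by fact
  have cr: "f \<in> S \<rightarrow> carrier (class_ring :: 'k ring)" for f :: "nat \<Rightarrow> 'k" and S by (simp add: class_ring_simps)
  have aS: "a \<in> {..<Suc D} \<rightarrow> carrier A" "a \<in> {..<D} \<rightarrow> carrier A" using Suc.prems(1) by auto
  have split: "lin_comb A {..<Suc D} c a = c D \<odot>\<^bsub>A\<^esub> a D \<oplus>\<^bsub>A\<^esub> lin_comb A {..<D} c a" for c :: "nat \<Rightarrow> 'k"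
    using A.lin_comb_remove[of "{..<Suc D}" D c a] aS cr by (simp add: lessThan_Suc)
  have low: "a p = \<zero>\<^bsub>A\<^esub>" if p: "p < D" for p
  proof -
    \<comment> \<open>The value at \<open>2c\<close> minus \<open>2^D\<close> times the value at
      \<open>c\<close> has coefficients \<open>(2^p - 2^D) a_p\<close>. The one at \<open>D\<close>
      vanishes, so the induction hypothesis applies; for \<open>p < D\<close> the factor is a
      nonzero scalar because the characteristic is zero.\<close>
    let ?k = "\<lambda>p. (2 :: 'k) ^ p - 2 ^ D"
    have "?k p \<odot>\<^bsub>A\<^esub> a p = \<zero>\<^bsub>A\<^esub>"
    proof (rule Suc.IH[where a = "\<lambda>p. ?k p \<odot>\<^bsub>A\<^esub> a p"])
      show "?k p \<odot>\<^bsub>A\<^esub> a p \<in> carrier A" if "p < D" for p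
        using Suc.prems(1)[of p] that by (intro A.smult_closed) (simp_all add: class_ring_simps)
      fix c :: 'k
      have "lin_comb A {..<D} (\<lambda>p. c ^ p) (\<lambda>p. ?k p \<odot>\<^bsub>A\<^esub> a p) = lin_comb A {..<D} (\<lambda>p. c ^ p * ?k p) a"
        by (rule A.finsum_cong') (use A.smult_assoc1 Suc.prems(1) A.smult_closed in \<open>simp_all add: class_ring_simps\<close>)
      also have "\<dots> = lin_comb A {..<Suc D} (\<lambda>p. c ^ p * ?k p) a"
        using split[of "\<lambda>p. c ^ p * ?k p"] A.smult_l_null[of "a D"] Suc.prems(1)[of D] A.lin_comb_closed[OF cr aS(2)]
        by (simp add: class_ring_simps)
      also have "\<dots> = lin_comb A {..<Suc D} (\<lambda>p. (2 * c) ^ p \<oplus>\<^bsub>class_ring\<^esub> (- (2 ^ D)) \<otimes>\<^bsub>class_ring\<^esub> c ^ p) a"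
        by (rule arg_cong[where f = "\<lambda>f. lin_comb A {..<Suc D} f a"]) (simp add: fun_eq_iff class_ring_simps algebra_simps power_mult_distrib)
      also have "\<dots> = lin_comb A {..<Suc D} (\<lambda>p. (2 * c) ^ p) a \<oplus>\<^bsub>A\<^esub> (- (2 ^ D)) \<odot>\<^bsub>A\<^esub> lin_comb A {..<Suc D} (\<lambda>p. c ^ p) a"
        by (subst A.lin_comb_add[OF cr cr aS(1)], subst A.lin_comb_smult[OF _ _ cr aS(1)]) (simp_all add: class_ring_simps)
      also have "\<dots> = \<zero>\<^bsub>A\<^esub>"
        unfolding Suc.prems(2) using A.smult_r_null[of "- (2 ^ D)"] by (simp add: class_ring_simps)
      finally show "lin_comb A {..<D} (\<lambda>p. c ^ p) (\<lambda>p. ?k p \<odot>\<^bsub>A\<^esub> a p) = \<zero>\<^bsub>A\<^esub>" .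
    qed (rule p)
    moreover have "?k p \<noteq> 0"
    proof -
      have "(2::nat) ^ p \<noteq> 2 ^ D" using p by simp
      then have "of_nat (2 ^ p) \<noteq> (of_nat (2 ^ D) :: 'k)" by (simp only: of_nat_eq_iff not_False_eq_True)
      then show ?thesis by simp
    qed
    moreover have "(1 / ?k p) \<odot>\<^bsub>A\<^esub> (?k p \<odot>\<^bsub>A\<^esub> a p) = (1 / ?k p * ?k p) \<odot>\<^bsub>A\<^esub> a p"
      using A.smult_assoc1[of "1 / ?k p" "?k p" "a p"] Suc.prems(1)[of p] p by (simp add: class_ring_simps)
    ultimately have "\<zero>\<^bsub>A\<^esub> = 1 \<odot>\<^bsub>A\<^esub> a p" using A.smult_r_null[of "1 / ?k p"] by (simp add: class_ring_simps)
    then show ?thesis using A.smult_one[of "a p"] Suc.prems(1)[of p] p by (simp add: class_ring_simps)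
  qed
  show ?case
  proof (cases "p = D")
    case True
    have "lin_comb A {..<D} (\<lambda>p. 1 ^ p) a = (\<Oplus>\<^bsub>A\<^esub>i\<in>{..<D}. \<zero>\<^bsub>A\<^esub>)"
      by (rule A.finsum_cong') (use low A.smult_r_null in \<open>simp_all add: class_ring_simps\<close>)
    then have "lin_comb A {..<Suc D} (\<lambda>p. 1 ^ p) a = 1 \<odot>\<^bsub>A\<^esub> a D"
      using split[of "\<lambda>p. 1 ^ p"] Suc.prems(1)[of D] A.smult_one[of "a D"] by (simp add: class_ring_simps)
    then show ?thesis using Suc.prems(2)[of 1] A.smult_one[of "a D"] Suc.prems(1)[of D] True by (simp add: class_ring_simps)
  next
    case False
    then show ?thesis using low Suc.prems(3) by simp
  qed
qed simp

text \<open>The polynomial ring \<open>A[x]\<close>, coded in the type \<open>'b\<close>, with its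
  evaluations. The last clause is where the infinitely many scalars enter: a polynomial over
  \<open>A\<close> that vanishes at all points of the field is zero. It lets a condition known at
  scalars be extended to a variable.\<close>

lemma exists_polynomial_algebra:
  assumes A: "k_algebra (A :: ('k::field_char_0, 'b) module)" and nz: "\<one>\<^bsub>A\<^esub> \<noteq> \<zero>\<^bsub>A\<^esub>"
  shows "\<exists>(U :: ('k, 'b) module) \<iota> x ev. k_algebra U \<and> k_algebra_hom A U \<iota> \<and> x \<in> carrier U \<and>
    (\<forall>t \<in> carrier A. k_algebra_hom U A (ev t) \<and> (\<forall>a \<in> carrier A. ev t (\<iota> a) = a) \<and> ev t x = t) \<and>
    (\<forall>u \<in> carrier U. (\<forall>c. ev (structure_map A c) u = \<zero>\<^bsub>A\<^esub>) \<longrightarrow> u = \<zero>\<^bsub>U\<^esub>)"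
proof -
  interpret A: Module.algebra class_ring A by fact
  have Ac: "cring A" by (rule A.M_cring)
  define P where "P = UP A"
  interpret AC: cring A by (rule Ac)
  interpret P: UP_cring A P by unfold_locales (simp add: P_def)
  have Pc: "cring P" by (rule P.UP_cring)
  obtain g :: "(nat \<Rightarrow> 'b) \<Rightarrow> 'b" where g: "inj_on g (carrier P)"
    using inj_on_UP[OF Ac k_algebra_infinite[OF A nz]] by (auto simp: P_def)
  have const: "(\<lambda>a. monom P a 0) \<in> Ring.ring_hom A P" by (rule P.const_ring_hom)
  let ?\<kappa> = "(\<lambda>a. monom P a 0) \<circ> structure_map A"
  have \<kappa>: "?\<kappa> \<in> Ring.ring_hom (class_ring :: 'k ring) P"
    by (rule ring_hom_trans[OF structure_map_ring_hom[OF A] const])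
  interpret T: algebra_transport P ?\<kappa> g by (rule algebra_transport.intro[OF Pc \<kappa> g])
  let ?U = "transport_algebra P ?\<kappa> g"
  let ?h = "inv_into (carrier P) g"
  have idhom: "ring_hom_cring A A id" by (rule ring_hom_cringI'[OF Ac Ac id_ring_hom])
  interpret E: UP_pre_univ_prop A A id P
    by (intro UP_pre_univ_prop.intro idhom P.UP_cring_axioms) (rule eq_reflection[OF P_def])
  define ev where "ev t = eval A A id t \<circ> ?h" for t
  define \<iota> where "\<iota> = g \<circ> (\<lambda>a. monom P a 0)"
  define x where "x = g (monom P \<one>\<^bsub>A\<^esub> 1)"
  have strA: "structure_map A c \<in> carrier A" for c
    using ring_hom_closed[OF structure_map_ring_hom[OF A], of c] by (simp add: class_ring_simps)
  have ev_hom: "ev t \<in> Ring.ring_hom ?U A" if "t \<in> carrier A" for t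
    unfolding ev_def using E.eval_ring_hom[OF that] T.h_hom by (rule ring_hom_trans[rotated])
  have ev_\<iota>: "ev t (\<iota> a) = a" if "t \<in> carrier A" "a \<in> carrier A" for t a
    using E.eval_const[OF that] that by (simp add: ev_def \<iota>_def)
  have ev_x: "ev t x = t" if "t \<in> carrier A" for t
    using E.eval_monom1[OF that] by (simp add: ev_def x_def)
  have \<iota>_str: "\<iota> (structure_map A c) = structure_map ?U c" for c
    by (simp add: \<iota>_def T.structure_map_T)
  have zero: "u = \<zero>\<^bsub>?U\<^esub>" if u: "u \<in> carrier ?U" and "\<And>c. ev (structure_map A c) u = \<zero>\<^bsub>A\<^esub>" for u
  proof -
    obtain f where f: "f \<in> carrier P" "u = g f" using u by (auto simp: T.T_simps)
    have fc: "coeff P f p \<in> carrier A" for p using f by simp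
    have pow: "structure_map A c [^]\<^bsub>A\<^esub> p = structure_map A (c ^ p)" for c p
    proof (induction p)
      case 0 then show ?case using ring_hom_one[OF structure_map_ring_hom[OF A]] by (simp add: class_ring_simps)
    next
      case (Suc p)
      then show ?case using ring_hom_mult[OF structure_map_ring_hom[OF A], of "c ^ p" c]
        by (simp add: class_ring_simps mult.commute)
    qed
    \<comment> \<open>Evaluation at a scalar is a combination of the coefficients with weights
      \<open>c^p\<close> in the field, the form in which \<open>polynomial_function_zero\<close>
      applies.\<close>
    have "lin_comb A {..<Suc (deg A f)} (\<lambda>p. c ^ p) (coeff P f) = \<zero>\<^bsub>A\<^esub>" for c
    proof -
      have "\<zero>\<^bsub>A\<^esub> = eval A A id (structure_map A c) f" using that(2)[of c] f by (simp add: ev_def)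
      also have "\<dots> = (\<Oplus>\<^bsub>A\<^esub>i\<in>{..deg A f}. coeff P f i \<otimes>\<^bsub>A\<^esub> structure_map A c [^]\<^bsub>A\<^esub> i)"
        using P.eval_on_carrier[OF f(1), of A id "structure_map A c"] by simp
      also have "\<dots> = (\<Oplus>\<^bsub>A\<^esub>i\<in>{..<Suc (deg A f)}. c ^ i \<odot>\<^bsub>A\<^esub> coeff P f i)"
      proof (rule A.M.finsum_cong')
        show "{..deg A f} = {..<Suc (deg A f)}" by auto
        show "(\<lambda>i. c ^ i \<odot>\<^bsub>A\<^esub> coeff P f i) \<in> {..<Suc (deg A f)} \<rightarrow> carrier A"
          by (rule Pi_I) (rule A.smult_closed; simp add: class_ring_simps fc)
        fix i
        show "coeff P f i \<otimes>\<^bsub>A\<^esub> structure_map A c [^]\<^bsub>A\<^esub> i = c ^ i \<odot>\<^bsub>A\<^esub> coeff P f i"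
          unfolding algebra_smult_structure_map[OF A fc] pow using fc strA by (rule comm_monoid.m_comm[OF cring.axioms(2)[OF Ac]])
      qed
      finally show ?thesis by simp
    qed
    then have "coeff P f p = \<zero>\<^bsub>A\<^esub>" if "p < Suc (deg A f)" for p
      by (rule polynomial_function_zero[OF A.module fc _ that])
    then have "f = \<zero>\<^bsub>P\<^esub>" using f(1) P.deg_aboveD[OF _ f(1)]
      by (intro P.up_eqI) (metis P.UP_zero_closed P.coeff_zero linorder_not_less not_less_eq less_Suc_eq_le, simp_all)
    then show ?thesis using f by (simp add: T.T_simps)
  qed
  show ?thesis
  proof (rule exI[of _ ?U], rule exI[of _ \<iota>], rule exI[of _ x], rule exI[of _ ev], intro conjI ballI impI)
    show "k_algebra ?U" by (rule T.T_algebra)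
    show "k_algebra_hom A ?U \<iota>"
      by (rule k_algebra_homI[OF A T.T_algebra _ \<iota>_str]) (unfold \<iota>_def, rule ring_hom_trans[OF const T.g_hom])
    show "x \<in> carrier ?U" by (simp add: x_def T.T_simps)
    show "k_algebra_hom ?U A (ev t)" if t: "t \<in> carrier A" for t
      by (rule k_algebra_homI[OF T.T_algebra A ev_hom[OF t]])
         (use ev_\<iota>[OF t strA] in \<open>simp add: \<iota>_str\<close>)
  qed (use ev_\<iota> ev_x zero in auto)
qed

text \<open>The localisation is an image of the polynomial ring, so choosing a polynomial over each
  element and coding that polynomial embeds it into \<open>'b\<close>. All that is kept is the
  invertibility of \<open>s\<close> and the control of the kernel.\<close>

lemma exists_localization_algebra:
  assumes A: "k_algebra (A :: ('k::field_char_0, 'b) module)" and nz: "\<one>\<^bsub>A\<^esub> \<noteq> \<zero>\<^bsub>A\<^esub>" and s: "s \<in> carrier A"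
  shows "\<exists>(L :: ('k, 'b) module) \<psi>. k_algebra L \<and> k_algebra_hom A L \<psi> \<and> \<psi> s \<in> Units L \<and>
    (\<forall>a \<in> carrier A. \<psi> a = \<zero>\<^bsub>L\<^esub> \<longrightarrow> (\<exists>e::nat. s [^]\<^bsub>A\<^esub> e \<otimes>\<^bsub>A\<^esub> a = \<zero>\<^bsub>A\<^esub>))"
proof -
  have Ac: "cring A" by (rule k_algebra_cring[OF A])
  obtain L0 :: "(nat \<Rightarrow> 'b) set ring" and \<psi> k where L0: "cring L0" and \<psi>: "\<psi> \<in> Ring.ring_hom A L0" and unit: "\<psi> s \<in> Units L0"
    and ker: "\<forall>a \<in> carrier A. \<psi> a = \<zero>\<^bsub>L0\<^esub> \<longrightarrow> (\<exists>e::nat. s [^]\<^bsub>A\<^esub> e \<otimes>\<^bsub>A\<^esub> a = \<zero>\<^bsub>A\<^esub>)"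
    and k: "carrier L0 = k ` carrier (UP A)"
    using exists_localization[OF Ac s] by (elim exE conjE)
  obtain g0 :: "(nat \<Rightarrow> 'b) \<Rightarrow> 'b" where g0: "inj_on g0 (carrier (UP A))"
    using inj_on_UP[OF Ac k_algebra_infinite[OF A nz]] by blast
  have "inj_on (inv_into (carrier (UP A)) k) (carrier L0)" unfolding k by (rule inj_on_inv_into) simp
  moreover have "inv_into (carrier (UP A)) k ` carrier L0 \<subseteq> carrier (UP A)" unfolding k by (auto intro: inv_into_into)
  ultimately have g: "inj_on (g0 \<circ> inv_into (carrier (UP A)) k) (carrier L0)"
    using g0 by (intro comp_inj_on) (auto intro: inj_on_subset)
  let ?g = "g0 \<circ> inv_into (carrier (UP A)) k"
  let ?\<kappa> = "\<psi> \<circ> structure_map A"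
  have \<kappa>: "?\<kappa> \<in> Ring.ring_hom (class_ring :: 'k ring) L0"
    by (rule ring_hom_trans[OF structure_map_ring_hom[OF A] \<psi>])
  interpret T: algebra_transport L0 ?\<kappa> ?g by (rule algebra_transport.intro[OF L0 \<kappa> g])
  let ?L = "transport_algebra L0 ?\<kappa> ?g"
  have \<psi>c: "\<psi> a \<in> carrier L0" if "a \<in> carrier A" for a using ring_hom_closed[OF \<psi> that] .
  have hom: "?g \<circ> \<psi> \<in> Ring.ring_hom A ?L" by (rule ring_hom_trans[OF \<psi> T.g_hom])
  show ?thesis
  proof (rule exI[of _ ?L], rule exI[of _ "?g \<circ> \<psi>"], intro conjI ballI impI)
    show "k_algebra ?L" by (rule T.T_algebra)
    show "k_algebra_hom A ?L (?g \<circ> \<psi>)"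
      by (rule k_algebra_homI[OF A T.T_algebra hom]) (simp add: T.structure_map_T)
    obtain y where y: "y \<in> carrier L0" "y \<otimes>\<^bsub>L0\<^esub> \<psi> s = \<one>\<^bsub>L0\<^esub>" "\<psi> s \<otimes>\<^bsub>L0\<^esub> y = \<one>\<^bsub>L0\<^esub>"
      using unit by (auto simp: Units_def)
    have ys: "?g y \<otimes>\<^bsub>?L\<^esub> (?g \<circ> \<psi>) s = \<one>\<^bsub>?L\<^esub>" "(?g \<circ> \<psi>) s \<otimes>\<^bsub>?L\<^esub> ?g y = \<one>\<^bsub>?L\<^esub>"
      using y ring_hom_mult[OF T.g_hom y(1) \<psi>c[OF s]] ring_hom_mult[OF T.g_hom \<psi>c[OF s] y(1)] ring_hom_one[OF T.g_hom]
      by simp_all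
    show "(?g \<circ> \<psi>) s \<in> Units ?L"
      unfolding Units_def using ys ring_hom_closed[OF T.g_hom y(1)] ring_hom_closed[OF hom s] by blast
    fix a assume a: "a \<in> carrier A" and "(?g \<circ> \<psi>) a = \<zero>\<^bsub>?L\<^esub>"
    then have "?g (\<psi> a) = ?g \<zero>\<^bsub>L0\<^esub>" by (simp add: T.T_simps)
    then have "\<psi> a = \<zero>\<^bsub>L0\<^esub>" by (rule inj_onD[OF g _ \<psi>c[OF a] T.R.zero_closed])
    then show "\<exists>e::nat. s [^]\<^bsub>A\<^esub> e \<otimes>\<^bsub>A\<^esub> a = \<zero>\<^bsub>A\<^esub>" using ker a by blast
  qed
qed

section \<open>Lifting submodules of \<open>A\<^bsup>nr\<^esup>\<close>\<close>

text \<open>Numbers the terms of degree one: the number \<open>p = i r + j\<close>, with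
  \<open>j < r\<close>, stands for \<open>x_i e_j\<close>. This identifies the part of degree one
  with \<open>A^{nr}\<close>, the space in which the Grassmannian is taken.\<close>

definition lin_index :: "nat \<Rightarrow> nat \<Rightarrow> nat \<times> nat multiset" where
  "lin_index r p = (p mod r, {#p div r#})"

definition lin_part :: "nat \<Rightarrow> 'b poly_tuple \<Rightarrow> nat \<Rightarrow> 'b" where
  "lin_part r f = (\<lambda>p. f (lin_index r p))"

definition lin_embed :: "('k, 'b) module \<Rightarrow> nat \<Rightarrow> nat \<Rightarrow> (nat \<Rightarrow> 'b) \<Rightarrow> 'b poly_tuple" where
  "lin_embed A n r v = (\<lambda>x. if x \<in> lin_index r ` {..<n * r} then v (inv_into {..<n * r} (lin_index r) x) else \<zero>\<^bsub>A\<^esub>)"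

text \<open>With \<open>N' = ker (A\<^bsup>nr\<^esup> \<rightarrow> Q)\<close>, this is the kernel of \<open>S\<^sub>A\<^sup>r \<rightarrow> A\<^sup>r \<oplus> Q\<close>, where the \<open>x\<^sub>i\<close> map \<open>A\<^sup>r\<close> to \<open>Q\<close> and kill \<open>Q\<close>.\<close>

definition lift_submodule :: "('k, 'b) module \<Rightarrow> nat \<Rightarrow> nat \<Rightarrow> (nat \<Rightarrow> 'b) set \<Rightarrow> 'b poly_tuple set" where
  "lift_submodule A n r N = {f \<in> carrier (poly_tuples n r A). (\<forall>j. f (j, {#}) = \<zero>\<^bsub>A\<^esub>) \<and> lin_part r f \<in> N}"

lemma lin_index_inj: "inj (lin_index r)"
  unfolding lin_index_def by (rule injI) (metis (no_types, lifting) div_mult_mod_eq fst_conv single_eq_single snd_conv)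

lemma lin_index_mem: "0 < r \<Longrightarrow> lin_index r p \<in> quot_index n r \<longleftrightarrow> p < n * r"
  by (simp add: lin_index_def quot_index_def div_less_iff_less_mult)

lemma quot_index_size_one:
  assumes "x \<in> quot_index n r" "size (snd x) = 1"
  obtains p where "p < n * r" "x = lin_index r p"
proof -
  obtain j m where x: "x = (j, m)" by fastforce
  obtain a where m: "m = {#a#}" using assms x size_1_singleton_mset by auto
  have ja: "j < r" "a < n" using assms x m by (auto simp: quot_index_def)
  have "lin_index r (a * r + j) = x" using ja by (simp add: lin_index_def x m)
  moreover have "a * r + j < n * r"
  proof -
    have "a * r + j < Suc a * r" using ja by simp
    also have "\<dots> \<le> n * r" using ja by (intro mult_le_mono1) simp
    finally show ?thesis .
  qed
  ultimately show ?thesis using that by metis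
qed

lemma lin_embed_lin_index: "p < n * r \<Longrightarrow> lin_embed A n r v (lin_index r p) = v p"
  unfolding lin_embed_def using inv_into_f_f[OF inj_on_subset[OF lin_index_inj], of "{..<n * r}" p r] by simp

lemma lin_embed_other: "x \<notin> lin_index r ` {..<n * r} \<Longrightarrow> lin_embed A n r v x = \<zero>\<^bsub>A\<^esub>"
  by (simp add: lin_embed_def)

lemma lin_embed_size: "size (snd x) \<noteq> 1 \<Longrightarrow> lin_embed A n r v x = \<zero>\<^bsub>A\<^esub>"
  by (rule lin_embed_other) (auto simp: lin_index_def)

lemma free_module_outside:
  assumes "f \<in> carrier (free_module A X)" "x \<notin> X" shows "f x = \<zero>\<^bsub>A\<^esub>"
proof -
  have "\<forall>x. x \<notin> X \<longrightarrow> f x = \<zero>\<^bsub>A\<^esub>" using assms(1) unfolding free_module_carrier_iff by (elim conjE)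
  then show ?thesis using assms(2) by blast
qed

locale tuple_space = cring A for A :: "('k, 'b) module" (structure) +
  fixes n r :: nat
  assumes r: "0 < r"
begin

abbreviation "FX \<equiv> poly_tuples n r A"
abbreviation "FY \<equiv> free_module A {..<n * r}"

sublocale FX: Module.module A FX by (rule free_module_module) unfold_locales
sublocale FY: Module.module A FY by (rule free_module_module) unfold_locales

lemma A_cring: "cring A" by unfold_locales

lemma mod_FX: "Module.submodule N A FX \<Longrightarrow> module_with_submodule A FX N"
  by (intro module_with_submodule.intro FX.module_axioms module_with_submodule_axioms.intro)

lemma mod_FY: "Module.submodule N A FY \<Longrightarrow> module_with_submodule A FY N"
  by (intro module_with_submodule.intro FY.module_axioms module_with_submodule_axioms.intro)

lemma FX_outside: "f \<in> carrier FX \<Longrightarrow> x \<notin> quot_index n r \<Longrightarrow> f x = \<zero>"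
  by (rule free_module_outside)

lemma FY_outside: "v \<in> carrier FY \<Longrightarrow> p \<notin> {..<n * r} \<Longrightarrow> v p = \<zero>"
  by (rule free_module_outside)

lemma FY_I:
  assumes "\<And>p. v p \<in> carrier A" "\<And>p. \<not> p < n * r \<Longrightarrow> v p = \<zero>"
  shows "v \<in> carrier FY"
proof -
  have "{p. v p \<noteq> \<zero>} \<subseteq> {..<n * r}" using assms(2) by force
  then have "finite {p. v p \<noteq> \<zero>}" by (rule finite_subset) simp
  then show ?thesis using assms unfolding free_module_carrier_iff by simp
qed

lemma lin_part_closed: "f \<in> carrier FX \<Longrightarrow> lin_part r f \<in> carrier FY"
proof (rule FY_I)
  fix p assume f: "f \<in> carrier FX" and p: "\<not> p < n * r"
  show "lin_part r f p = \<zero>" unfolding lin_part_def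
    by (rule FX_outside[OF f]) (use p lin_index_mem[OF r] in simp)
qed (simp add: lin_part_def)

lemma lin_embed_closed:
  assumes v: "v \<in> carrier FY" shows "lin_embed A n r v \<in> carrier FX"
proof -
  have "{x. lin_embed A n r v x \<noteq> \<zero>} \<subseteq> lin_index r ` {..<n * r}" using lin_embed_other[of _ r n A v] by blast
  then have "finite {x. lin_embed A n r v x \<noteq> \<zero>}" by (rule finite_subset) simp
  moreover have "lin_embed A n r v x \<in> carrier A" for x using v by (simp add: lin_embed_def)
  moreover have "lin_embed A n r v x = \<zero>" if "x \<notin> quot_index n r" for x
    by (rule lin_embed_other) (use that lin_index_mem[OF r] in blast)
  ultimately show ?thesis by (simp add: free_module_carrier_iff del: free_module_apply_closed)
qed

lemma lin_part_lin_embed: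
  assumes v: "v \<in> carrier FY" shows "lin_part r (lin_embed A n r v) = v"
proof
  fix p
  show "lin_part r (lin_embed A n r v) p = v p"
  proof (cases "p < n * r")
    case True then show ?thesis by (simp add: lin_part_def lin_embed_lin_index)
  next
    case False
    then have "lin_index r p \<notin> lin_index r ` {..<n * r}" using lin_index_inj[of r] by (auto dest: injD)
    then show ?thesis using False FY_outside[OF v, of p] by (simp add: lin_part_def lin_embed_other)
  qed
qed

lemma lin_part_add: "lin_part r (f \<oplus>\<^bsub>FX\<^esub> g) = lin_part r f \<oplus>\<^bsub>FY\<^esub> lin_part r g"
  by (simp add: lin_part_def free_module_simps)

lemma lin_part_smult: "lin_part r (a \<odot>\<^bsub>FX\<^esub> g) = a \<odot>\<^bsub>FY\<^esub> lin_part r g"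
  by (simp add: lin_part_def free_module_simps)

lemma lin_part_zero: "lin_part r \<zero>\<^bsub>FX\<^esub> = \<zero>\<^bsub>FY\<^esub>"
  by (simp add: lin_part_def free_module_simps)

lemma lin_part_uminus: "f \<in> carrier FX \<Longrightarrow> lin_part r (\<ominus>\<^bsub>FX\<^esub> f) = \<ominus>\<^bsub>FY\<^esub> lin_part r f"
  using lin_part_closed[of f] by (simp add: lin_part_def free_module_a_inv[OF A_cring])

lemma lin_part_minus: "f \<in> carrier FX \<Longrightarrow> g \<in> carrier FX \<Longrightarrow> lin_part r (f \<ominus>\<^bsub>FX\<^esub> g) = lin_part r f \<ominus>\<^bsub>FY\<^esub> lin_part r g"
  using lin_part_closed[of f] lin_part_closed[of g] by (simp add: lin_part_def free_module_minus[OF A_cring])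

lemma lin_embed_add: "lin_embed A n r (v \<oplus>\<^bsub>FY\<^esub> w) = lin_embed A n r v \<oplus>\<^bsub>FX\<^esub> lin_embed A n r w"
  by (auto simp: lin_embed_def free_module_simps)

lemma lin_embed_smult: "a \<in> carrier A \<Longrightarrow> lin_embed A n r (a \<odot>\<^bsub>FY\<^esub> v) = a \<odot>\<^bsub>FX\<^esub> lin_embed A n r v"
  by (auto simp: lin_embed_def free_module_simps)

lemma lin_part_lin_comb:
  assumes "finite J" "c \<in> J \<rightarrow> carrier A" "b \<in> J \<rightarrow> carrier FX"
  shows "lin_part r (lin_comb FX J c b) = lin_comb FY J c (\<lambda>i. lin_part r (b i))"
proof
  fix p
  have 1: "(\<lambda>i. c i \<odot>\<^bsub>FX\<^esub> b i) \<in> J \<rightarrow> carrier FX"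
    by (rule Pi_I) (rule FX.smult_closed[OF funcset_mem[OF assms(2)] funcset_mem[OF assms(3)]])
  have 2: "(\<lambda>i. c i \<odot>\<^bsub>FY\<^esub> lin_part r (b i)) \<in> J \<rightarrow> carrier FY"
    by (rule Pi_I) (rule FY.smult_closed[OF funcset_mem[OF assms(2)] lin_part_closed[OF funcset_mem[OF assms(3)]]])
  show "lin_part r (lin_comb FX J c b) p = lin_comb FY J c (\<lambda>i. lin_part r (b i)) p"
    unfolding lin_part_def[of r "lin_comb FX J c b"] free_module_finsum[OF A_cring 1] free_module_finsum[OF A_cring 2]
    by (simp add: free_module_simps lin_part_def)
qed

lemma minus_lin_embed_support:
  assumes f: "f \<in> carrier FX" and deg0: "\<forall>j. f (j, {#}) = \<zero>"
    and x: "(f \<ominus>\<^bsub>FX\<^esub> lin_embed A n r (lin_part r f)) x \<noteq> \<zero>"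
  shows "x \<in> quot_index n r \<and> size (snd x) \<ge> 2"
proof -
  let ?g = "lin_embed A n r (lin_part r f)"
  have g: "?g \<in> carrier FX" by (rule lin_embed_closed[OF lin_part_closed[OF f]])
  have fg: "f x \<ominus> ?g x \<noteq> \<zero>" using x by (simp add: free_module_minus[OF A_cring f g])
  have xX: "x \<in> quot_index n r"
  proof (rule ccontr)
    assume "x \<notin> quot_index n r"
    then show False using fg FX_outside[OF f, of x] FX_outside[OF g, of x] by simp
  qed
  moreover have "size (snd x) \<noteq> 0"
  proof
    assume s: "size (snd x) = 0"
    then have "f x = \<zero>" using deg0 by (metis prod.collapse size_eq_0_iff_empty)
    then show False using fg lin_embed_size[of x A n r "lin_part r f"] s by simp
  qed
  moreover have "size (snd x) \<noteq> 1"
  proof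
    assume s: "size (snd x) = 1"
    obtain p where "p < n * r" "x = lin_index r p" using quot_index_size_one[OF xX s] .
    then have "?g x = f x" by (simp add: lin_embed_lin_index lin_part_def)
    then show False using fg f by simp
  qed
  ultimately show ?thesis by linarith
qed

lemma lift_closed: "f \<in> lift_submodule A n r N \<Longrightarrow> f \<in> carrier FX"
  by (simp add: lift_submodule_def)

lemma lift_submodule_submodule:
  assumes N: "Module.submodule N A FY" shows "Module.submodule (lift_submodule A n r N) A FX"
proof -
  interpret N: module_with_submodule A FY N by (rule mod_FY[OF N])
  show ?thesis
  proof (rule FX.submoduleI)
    show "lift_submodule A n r N \<subseteq> carrier FX" by (auto simp: lift_submodule_def)
    show "\<zero>\<^bsub>FX\<^esub> \<in> lift_submodule A n r N"
      using N.sub_zero by (simp add: lift_submodule_def lin_part_zero) (simp add: free_module_simps)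
    fix f assume "f \<in> lift_submodule A n r N"
    then have f: "f \<in> carrier FX" "\<forall>j. f (j, {#}) = \<zero>" "lin_part r f \<in> N" by (auto simp: lift_submodule_def)
    show "\<ominus>\<^bsub>FX\<^esub> f \<in> lift_submodule A n r N"
      unfolding lift_submodule_def mem_Collect_eq lin_part_uminus[OF f(1)]
      using f N.subE(3)[OF f(3)] FX.M.a_inv_closed[OF f(1)] by (simp add: free_module_a_inv[OF A_cring f(1)])
    show "a \<odot>\<^bsub>FX\<^esub> f \<in> lift_submodule A n r N" if "a \<in> carrier A" for a
      unfolding lift_submodule_def mem_Collect_eq lin_part_smult
      using f N.subE(4)[OF that f(3)] FX.smult_closed[OF that f(1)] that by (simp add: free_module_simps)
    fix g assume "g \<in> lift_submodule A n r N"
    then have g: "g \<in> carrier FX" "\<forall>j. g (j, {#}) = \<zero>" "lin_part r g \<in> N" by (auto simp: lift_submodule_def)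
    show "f \<oplus>\<^bsub>FX\<^esub> g \<in> lift_submodule A n r N"
      unfolding lift_submodule_def mem_Collect_eq lin_part_add
      using f g N.subE(5)[OF f(3) g(3)] FX.M.a_closed[OF f(1) g(1)] by (simp add: free_module_simps)
  qed
qed

lemma var_mult_closed:
  assumes f: "f \<in> carrier FX" and i: "i < n" shows "var_mult A i f \<in> carrier FX"
proof -
  have "{x. var_mult A i f x \<noteq> \<zero>} \<subseteq> (\<lambda>(j, m). (j, add_mset i m)) ` {x. f x \<noteq> \<zero>}"
  proof
    fix x assume "x \<in> {x. var_mult A i f x \<noteq> \<zero>}"
    then obtain j m where x: "x = (j, m)" "i \<in># m" "f (j, m - {#i#}) \<noteq> \<zero>"
      by (cases x) (auto simp: var_mult_def split: if_splits)
    then show "x \<in> (\<lambda>(j, m). (j, add_mset i m)) ` {x. f x \<noteq> \<zero>}"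
      by (intro image_eqI[of _ _ "(j, m - {#i#})"]) simp_all
  qed
  then have "finite {x. var_mult A i f x \<noteq> \<zero>}"
    by (rule finite_subset) (use f in \<open>simp add: free_module_carrier_iff del: free_module_apply_closed\<close>)
  moreover have "var_mult A i f x \<in> carrier A" for x using f by (cases x) (simp add: var_mult_def)
  moreover have "var_mult A i f x = \<zero>" if x: "x \<notin> quot_index n r" for x
  proof -
    obtain j m where jm: "x = (j, m)" by fastforce
    have "(j, m - {#i#}) \<notin> quot_index n r" if im: "i \<in># m"
    proof
      assume "(j, m - {#i#}) \<in> quot_index n r"
      then have "(j, add_mset i (m - {#i#})) \<in> quot_index n r" using i by (simp add: quot_index_def)
      then show False using x jm im by simp
    qed
    then show ?thesis using FX_outside[OF f] jm by (simp add: var_mult_def)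
  qed
  ultimately show ?thesis by (simp add: free_module_carrier_iff del: free_module_apply_closed)
qed

lemma var_mult_add: "f \<in> carrier FX \<Longrightarrow> g \<in> carrier FX \<Longrightarrow> var_mult A i (f \<oplus>\<^bsub>FX\<^esub> g) = var_mult A i f \<oplus>\<^bsub>FX\<^esub> var_mult A i g"
  by (auto simp: var_mult_def free_module_simps)

lemma var_mult_smult: "f \<in> carrier FX \<Longrightarrow> a \<in> carrier A \<Longrightarrow> var_mult A i (a \<odot>\<^bsub>FX\<^esub> f) = a \<odot>\<^bsub>FX\<^esub> var_mult A i f"
  by (auto simp: var_mult_def free_module_simps)

lemma var_mult_zero: "var_mult A i \<zero>\<^bsub>FX\<^esub> = \<zero>\<^bsub>FX\<^esub>"
  by (auto simp: var_mult_def free_module_simps)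

text \<open>The terms of degree one of \<open>x_i f\<close> come from the constant terms of
  \<open>f\<close>, which vanish. So the linear part of the product is zero, and zero lies in every
  \<open>N\<close>.\<close>

lemma lift_var_mult:
  assumes N: "Module.submodule N A FY" and f: "f \<in> lift_submodule A n r N" and i: "i < n"
  shows "var_mult A i f \<in> lift_submodule A n r N"
proof -
  interpret N: module_with_submodule A FY N by (rule mod_FY[OF N])
  have "lin_part r (var_mult A i f) = \<zero>\<^bsub>FY\<^esub>"
    using f by (auto simp: lin_part_def var_mult_def lin_index_def free_module_simps lift_submodule_def)
  then show ?thesis using N.sub_zero var_mult_closed[OF lift_closed[OF f] i]
    by (simp add: lift_submodule_def var_mult_def)
qed

lemma lift_contains_high:
  assumes N: "Module.submodule N A FY" and x: "x \<in> quot_index n r" "size (snd x) \<ge> 2"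
  shows "unit_fun A x \<in> lift_submodule A n r N"
proof -
  interpret N: module_with_submodule A FY N by (rule mod_FY[OF N])
  have "lin_index r p \<noteq> x" for p using x by (auto simp: lin_index_def)
  then have "lin_part r (unit_fun A x) = \<zero>\<^bsub>FY\<^esub>" by (auto simp: lin_part_def unit_fun_def free_module_simps)
  moreover have "\<forall>j. unit_fun A x (j, {#}) = \<zero>" using x by (auto simp: unit_fun_def)
  ultimately show ?thesis using N.sub_zero unit_fun_closed[OF A_cring x(1)] by (simp add: lift_submodule_def)
qed

lemma lift_contains_embed:
  assumes "Module.submodule N A FY" "v \<in> N" shows "lin_embed A n r v \<in> lift_submodule A n r N"
proof -
  have v: "v \<in> carrier FY" using FY.submoduleE(1)[OF assms(1)] assms(2) by auto
  show ?thesis using assms(2) lin_embed_closed[OF v] lin_part_lin_embed[OF v]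
    by (simp add: lift_submodule_def lin_embed_size)
qed

lemma lin_part_image_lift:
  assumes N: "Module.submodule N A FY" shows "lin_part r ` lift_submodule A n r N = N"
proof
  show "lin_part r ` lift_submodule A n r N \<subseteq> N" by (auto simp: lift_submodule_def)
  show "N \<subseteq> lin_part r ` lift_submodule A n r N"
  proof
    fix v assume v: "v \<in> N"
    have "v \<in> carrier FY" using FY.submoduleE(1)[OF N] v by auto
    then show "v \<in> lin_part r ` lift_submodule A n r N"
      using lift_contains_embed[OF N v] lin_part_lin_embed[of v] by force
  qed
qed

text \<open>What remains of \<open>f\<close> once its linear part is removed is a combination of
  monomials of degree at least two.\<close>

lemma mem_of_lin_part:
  assumes M: "Module.submodule M A FX" and f: "f \<in> carrier FX" and deg0: "\<forall>j. f (j, {#}) = \<zero>"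
    and high: "\<And>x. x \<in> quot_index n r \<Longrightarrow> size (snd x) \<ge> 2 \<Longrightarrow> unit_fun A x \<in> M"
  shows "f \<ominus>\<^bsub>FX\<^esub> lin_embed A n r (lin_part r f) \<in> M"
proof (rule submodule_mem_units[OF A_cring M])
  show "f \<ominus>\<^bsub>FX\<^esub> lin_embed A n r (lin_part r f) \<in> carrier FX"
    by (rule FX.M.minus_closed[OF f lin_embed_closed[OF lin_part_closed[OF f]]])
  fix x assume "(f \<ominus>\<^bsub>FX\<^esub> lin_embed A n r (lin_part r f)) x \<noteq> \<zero>"
  from minus_lin_embed_support[OF f deg0 this] show "unit_fun A x \<in> M" by (intro high) auto
qed

text \<open>Since \<open>M\<close> contains every monomial of degree at least two, an element
  without constant terms is congruent modulo \<open>M\<close> to its linear part. Two such elements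
  with the same linear part are therefore congruent, so membership in \<open>M\<close> depends on
  the linear part alone.\<close>

lemma eq_lift_submodule:
  assumes M: "Module.submodule M A FX" and deg0: "\<And>f j. f \<in> M \<Longrightarrow> f (j, {#}) = \<zero>"
    and high: "\<And>x. x \<in> quot_index n r \<Longrightarrow> size (snd x) \<ge> 2 \<Longrightarrow> unit_fun A x \<in> M"
  shows "Module.submodule (lin_part r ` M) A FY" and "M = lift_submodule A n r (lin_part r ` M)"
proof -
  interpret M: module_with_submodule A FX M by (rule mod_FX[OF M])
  show "Module.submodule (lin_part r ` M) A FY"
  proof (rule FY.submoduleI)
    show "lin_part r ` M \<subseteq> carrier FY" using M.sub_closed lin_part_closed by blast
    show "\<zero>\<^bsub>FY\<^esub> \<in> lin_part r ` M" using M.sub_zero lin_part_zero by force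
    fix v assume "v \<in> lin_part r ` M"
    then obtain f where f: "f \<in> M" "v = lin_part r f" by auto
    show "\<ominus>\<^bsub>FY\<^esub> v \<in> lin_part r ` M"
      using M.subE(3)[OF f(1)] lin_part_uminus[OF M.sub_closed[OF f(1)]] f(2) by force
    show "a \<odot>\<^bsub>FY\<^esub> v \<in> lin_part r ` M" if "a \<in> carrier A" for a
      using M.subE(4)[OF that f(1)] lin_part_smult[of a f] f(2) by force
    fix w assume "w \<in> lin_part r ` M"
    then obtain g where g: "g \<in> M" "w = lin_part r g" by auto
    show "v \<oplus>\<^bsub>FY\<^esub> w \<in> lin_part r ` M"
      using M.subE(5)[OF f(1) g(1)] lin_part_add[of f g] f(2) g(2) by force
  qed
  have diff: "f \<ominus>\<^bsub>FX\<^esub> lin_embed A n r (lin_part r f) \<in> M" if "f \<in> carrier FX" "\<forall>j. f (j, {#}) = \<zero>" for f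
    by (rule mem_of_lin_part[OF M that high])
  show "M = lift_submodule A n r (lin_part r ` M)"
  proof
    show "M \<subseteq> lift_submodule A n r (lin_part r ` M)"
      using M.sub_closed deg0 by (auto simp: lift_submodule_def)
    show "lift_submodule A n r (lin_part r ` M) \<subseteq> M"
    proof
      fix f assume "f \<in> lift_submodule A n r (lin_part r ` M)"
      then obtain g where f: "f \<in> carrier FX" "\<forall>j. f (j, {#}) = \<zero>" "lin_part r f = lin_part r g" and g: "g \<in> M"
        by (auto simp: lift_submodule_def)
      have gF: "g \<in> carrier FX" by (rule M.sub_closed[OF g])
      let ?e = "lin_embed A n r (lin_part r g)"
      have e: "?e \<in> carrier FX" by (rule lin_embed_closed[OF lin_part_closed[OF gF]])
      have "f \<ominus>\<^bsub>FX\<^esub> ?e \<in> M" using diff[OF f(1,2)] f(3) by simp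
      moreover have "g \<ominus>\<^bsub>FX\<^esub> ?e \<in> M" using diff[OF gF] deg0[OF g] by simp
      ultimately have "M.mod_eq f ?e" "M.mod_eq g ?e" by (simp_all add: M.mod_eq_def)
      then have "M.mod_eq f g" by (intro M.mod_eq_trans[OF _ M.mod_eq_sym f(1) e gF]) (use e gF in auto)
      then show "f \<in> M" by (rule M.mod_eq_in[OF _ f(1) g])
    qed
  qed
qed

text \<open>The quotient is \<open>A^r \<oplus> A^{nr}/N\<close>: a local basis consists of the
  \<open>r\<close> constants \<open>e_i\<close>, followed by a local basis of
  \<open>A^{nr}/N\<close> placed in degree one. A combination of these has its first
  \<open>r\<close> coefficients as constant terms (\<open>lin0\<close>), and its linear part is
  given by the others (\<open>lin1\<close>), so the two conditions defining the lift
  separate.\<close>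

lemma lift_locally_free:
  assumes N: "Module.submodule N A FY" and d: "r \<le> d" and lf: "locally_free_quotient A FY N (d - r)"
  shows "locally_free_quotient A FX (lift_submodule A n r N) d"
proof -
  let ?L = "lift_submodule A n r N"
  note L = lift_submodule_submodule[OF N]
  interpret N: module_with_submodule A FY N by (rule mod_FY[OF N])
  interpret L: module_with_submodule A FX ?L by (rule mod_FX[OF L])
  let ?m = "d - r"
  let ?S = "{s \<in> carrier A. \<exists>b. basis_at A FY N s {..<?m} b}"
  let ?S' = "{s \<in> carrier A. \<exists>b. basis_at A FX ?L s {..<d} b}"
  have "?S \<subseteq> ?S'"
  proof
    fix s assume "s \<in> ?S"
    then obtain b where s: "s \<in> carrier A" and b: "basis_at A FY N s {..<?m} b" by auto
    define B where "B i = (if i < r then unit_fun A (i, {#}) else lin_embed A n r (b (i - r)))" for i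
    have bc: "b i \<in> carrier FY" if "i < ?m" for i using basis_at_closed[OF b] that by simp
    have Bc: "B i \<in> carrier FX" if "i < d" for i
    proof (cases "i < r")
      case True
      then show ?thesis unfolding B_def by (simp add: unit_fun_closed[OF A_cring] quot_index_def)
    next
      case False
      then have "lin_embed A n r (b (i - r)) \<in> carrier FX" using that by (intro lin_embed_closed bc) simp
      then show ?thesis using False by (simp add: B_def)
    qed
    have BF: "B \<in> {..<d} \<rightarrow> carrier FX" using Bc by auto
    have bF: "b \<in> {..<?m} \<rightarrow> carrier FY" by (rule basis_at_funcset[OF b])
    have lin0: "lin_comb FX {..<d} c B (j, {#}) = (if j < r then c j else \<zero>)" if c: "c \<in> {..<d} \<rightarrow> carrier A" for c j
    proof -
      have cB: "(\<lambda>i. c i \<odot>\<^bsub>FX\<^esub> B i) \<in> {..<d} \<rightarrow> carrier FX"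
        by (rule Pi_I) (rule FX.smult_closed[OF funcset_mem[OF c] funcset_mem[OF BF]])
      have "lin_comb FX {..<d} c B (j, {#}) = (\<Oplus>i\<in>{..<d}. c i \<otimes> B i (j, {#}))"
        unfolding free_module_finsum[OF A_cring cB] by (simp add: free_module_simps)
      also have "\<dots> = (\<Oplus>i\<in>{..<d}. if j = i then (if j < r then c i else \<zero>) else \<zero>)"
        by (rule finsum_cong') (use c in \<open>auto simp: B_def unit_fun_def lin_embed_size Pi_iff\<close>)
      also have "\<dots> = (if j < r then c j else \<zero>)"
      proof (cases "j < d")
        case True
        then show ?thesis using finsum_singleton[of j "{..<d}" "\<lambda>i. if j < r then c i else \<zero>"] c by (simp add: Pi_iff)
      next
        case False
        then have "(\<Oplus>i\<in>{..<d}. if j = i then (if j < r then c i else \<zero>) else \<zero>) = (\<Oplus>i\<in>{..<d}. \<zero>)"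
          by (intro finsum_cong') auto
        then show ?thesis using False d by simp
      qed
      finally show ?thesis .
    qed
    have lin1: "lin_part r (lin_comb FX {..<d} c B) = lin_comb FY {..<?m} (\<lambda>i. c (i + r)) b" if c: "c \<in> {..<d} \<rightarrow> carrier A" for c
    proof -
      have lB: "lin_part r (B i) = (if i < r then \<zero>\<^bsub>FY\<^esub> else b (i - r))" if "i < d" for i
      proof (cases "i < r")
        case True
        then show ?thesis by (auto simp: B_def lin_part_def unit_fun_def lin_index_def free_module_simps)
      next
        case False
        then show ?thesis using that by (simp add: B_def lin_part_lin_embed[OF bc])
      qed
      let ?g = "\<lambda>i. c i \<odot>\<^bsub>FY\<^esub> lin_part r (B i)"
      have g: "?g i \<in> carrier FY" if "i < d" for i
        using FY.smult_closed[OF _ lin_part_closed[OF Bc[OF that]], of "c i"] c that by auto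
      have "lin_part r (lin_comb FX {..<d} c B) = (\<Oplus>\<^bsub>FY\<^esub>i\<in>{..<d}. ?g i)"
        by (rule lin_part_lin_comb[OF _ c BF]) simp
      also have "\<dots> = (\<Oplus>\<^bsub>FY\<^esub>i\<in>{r..<d}. ?g i)"
        by (rule FY.add.finprod_mono_neutral_cong_right) (use g lB c FY.smult_r_null in \<open>auto simp: Pi_iff\<close>)
      also have "\<dots> = (\<Oplus>\<^bsub>FY\<^esub>i\<in>(\<lambda>i. i + r) ` {..<?m}. ?g i)"
      proof -
        have "{r..<d} = (\<lambda>i. i + r) ` {..<?m}"
          using d by (auto simp: image_iff) (metis diff_less_mono le_add_diff_inverse2 lessThan_iff)
        then show ?thesis by simp
      qed
      also have "\<dots> = (\<Oplus>\<^bsub>FY\<^esub>i\<in>{..<?m}. ?g (i + r))"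
        by (rule FY.finsum_reindex) (use g in \<open>auto simp: inj_on_def\<close>)
      also have "\<dots> = lin_comb FY {..<?m} (\<lambda>i. c (i + r)) b"
      proof (rule FY.finsum_cong')
        show "(\<lambda>i. c (i + r) \<odot>\<^bsub>FY\<^esub> b i) \<in> {..<?m} \<rightarrow> carrier FY"
          by (rule Pi_I, rule FY.smult_closed) (use c bc in auto)
      qed (use lB in auto)
      finally show ?thesis .
    qed
    have "basis_at A FX ?L s {..<d} B"
    proof (rule L.basis_atI[OF BF])
      fix f assume f: "f \<in> carrier FX"
      obtain x c where x: "x \<in> saturation A s" "x \<in> carrier A" and c: "c \<in> {..<?m} \<rightarrow> carrier A"
        "N.mod_eq (x \<odot>\<^bsub>FY\<^esub> lin_part r f) (lin_comb FY {..<?m} c b)"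
        using N.basis_at_span[OF b lin_part_closed[OF f]] .
      \<comment> \<open>The constant terms of \<open>f\<close> are exact coordinates; they are
        multiplied by the denominator \<open>x\<close> that the linear part requires.\<close>
      define c' where "c' i = (if i < r then x \<otimes> f (i, {#}) else c (i - r))" for i
      have c': "c' \<in> {..<d} \<rightarrow> carrier A" using x f c(1) by (auto simp: c'_def Pi_iff)
      let ?w = "lin_comb FX {..<d} c' B"
      have w: "?w \<in> carrier FX" by (rule FX.lin_comb_closed[OF c' BF])
      have xf: "x \<odot>\<^bsub>FX\<^esub> f \<in> carrier FX" by (rule FX.smult_closed[OF x(2) f])
      have "x \<odot>\<^bsub>FX\<^esub> f \<ominus>\<^bsub>FX\<^esub> ?w \<in> ?L" unfolding lift_submodule_def
      proof (intro CollectI conjI allI)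
        show "x \<odot>\<^bsub>FX\<^esub> f \<ominus>\<^bsub>FX\<^esub> ?w \<in> carrier FX" by (rule FX.M.minus_closed[OF xf w])
        show "(x \<odot>\<^bsub>FX\<^esub> f \<ominus>\<^bsub>FX\<^esub> ?w) (j, {#}) = \<zero>" for j
        proof (cases "j < r")
          case True
          then show ?thesis unfolding free_module_minus[OF A_cring xf w] lin0[OF c'] using x f
            by (simp add: free_module_simps c'_def)
        next
          case False
          then have "f (j, {#}) = \<zero>" by (intro FX_outside[OF f]) (simp add: quot_index_def)
          then show ?thesis unfolding free_module_minus[OF A_cring xf w] lin0[OF c'] using x False
            by (simp add: free_module_simps)
        qed
        have "lin_comb FY {..<?m} (\<lambda>i. c' (i + r)) b = lin_comb FY {..<?m} c b"
          by (rule FY.lin_comb_cong[OF bF c(1)]) (simp_all add: c'_def)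
        then show "lin_part r (x \<odot>\<^bsub>FX\<^esub> f \<ominus>\<^bsub>FX\<^esub> ?w) \<in> N"
          unfolding lin_part_minus[OF xf w] lin1[OF c'] lin_part_smult using c(2) by (simp add: N.mod_eq_def)
      qed
      then show "\<exists>x\<in>saturation A s. \<exists>c\<in>{..<d} \<rightarrow> carrier A. L.mod_eq (x \<odot>\<^bsub>FX\<^esub> f) (lin_comb FX {..<d} c B)"
        using x(1) c' unfolding L.mod_eq_def by (intro bexI[of _ x] bexI[of _ c'])
    next
      fix c assume c: "c \<in> {..<d} \<rightarrow> carrier A" and cL: "lin_comb FX {..<d} c B \<in> ?L"
      have cr: "(\<lambda>i. c (i + r)) \<in> {..<?m} \<rightarrow> carrier A" using c by (auto simp: Pi_iff)
      have "lin_comb FY {..<?m} (\<lambda>i. c (i + r)) b \<in> N" using cL lin1[OF c] by (simp add: lift_submodule_def)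
      then obtain x where x: "x \<in> saturation A s" "x \<in> carrier A" "\<And>i. i \<in> {..<?m} \<Longrightarrow> x \<otimes> c (i + r) = \<zero>"
        using N.basis_at_indep[OF b cr] by metis
      have "x \<otimes> c i = \<zero>" if i: "i \<in> {..<d}" for i
      proof (cases "i < r")
        case True
        have "lin_comb FX {..<d} c B (i, {#}) = \<zero>" using cL by (simp add: lift_submodule_def)
        then have "c i = \<zero>" using lin0[OF c, of i] True by simp
        then show ?thesis using x(2) by simp
      next
        case False
        then show ?thesis using x(3)[of "i - r"] i by auto
      qed
      then show "\<exists>x\<in>saturation A s. \<forall>i\<in>{..<d}. x \<otimes> c i = \<zero>" using x(1) by (intro bexI[of _ x] ballI)
    qed
    then show "s \<in> ?S'" using s by auto
  qed
  then have "Idl\<^bsub>A\<^esub> ?S \<subseteq> Idl\<^bsub>A\<^esub> ?S'" by (intro subset_Idl_subset) auto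
  moreover have "Idl\<^bsub>A\<^esub> ?S = carrier A" using lf by (simp add: locally_free_quotient_iff[OF FY.module_axioms N])
  moreover have "Idl\<^bsub>A\<^esub> ?S' \<subseteq> carrier A" by (rule genideal_minimal[OF oneideal]) auto
  ultimately show ?thesis unfolding locally_free_quotient_iff[OF FX.module_axioms L] by auto
qed

text \<open>Cancellation of the free summand \<open>A^r\<close>, one generator at a time. For a
  quotient that is only locally free the complement of \<open>e_j\<close> has to be found locally:
  on each member of a finer cover some coefficient of \<open>e_j\<close> in the local basis is
  invertible, there \<open>e_j\<close> is exchanged for the corresponding basis vector, and then it
  is divided out.\<close>

lemma lift_locally_free_conv:
  assumes N: "Module.submodule N A FY" and d: "r \<le> d"
    and lf: "locally_free_quotient A FX (lift_submodule A n r N) d"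
  shows "locally_free_quotient A FY N (d - r)"
proof -
  interpret N: module_with_submodule A FY N by (rule mod_FY[OF N])
  \<comment> \<open>\<open>P j\<close> allows constant terms in \<open>e_0, ..., e_{j-1}\<close>, so
    that \<open>P 0\<close> is the lift and \<open>P r\<close> is the full preimage of
    \<open>N\<close> under \<open>lin_part\<close>. Each step from \<open>P j\<close> to
    \<open>P (Suc j)\<close> divides out \<open>e_j\<close>, so the rank drops from
    \<open>d - j\<close> to \<open>d - Suc j\<close>.\<close>
  define P where "P j = {f \<in> carrier FX. (\<forall>i\<ge>j. f (i, {#}) = \<zero>) \<and> lin_part r f \<in> N}" for j
  define T where "T j = {s \<in> carrier A. \<exists>b. basis_at A FX (P j) s {..<d - j} b}" for j
  have P: "Module.submodule (P j) A FX" for j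
  proof (rule FX.submoduleI)
    show "P j \<subseteq> carrier FX" by (auto simp: P_def)
    show "\<zero>\<^bsub>FX\<^esub> \<in> P j" using N.sub_zero by (simp add: P_def lin_part_zero) (simp add: free_module_simps)
    fix f assume "f \<in> P j"
    then have f: "f \<in> carrier FX" "\<forall>i\<ge>j. f (i, {#}) = \<zero>" "lin_part r f \<in> N" by (auto simp: P_def)
    show "\<ominus>\<^bsub>FX\<^esub> f \<in> P j" unfolding P_def mem_Collect_eq lin_part_uminus[OF f(1)]
      using f N.subE(3)[OF f(3)] FX.M.a_inv_closed[OF f(1)] by (simp add: free_module_a_inv[OF A_cring f(1)])
    show "a \<odot>\<^bsub>FX\<^esub> f \<in> P j" if "a \<in> carrier A" for a unfolding P_def mem_Collect_eq lin_part_smult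
      using f N.subE(4)[OF that f(3)] FX.smult_closed[OF that f(1)] that by (simp add: free_module_simps)
    fix g assume "g \<in> P j"
    then have g: "g \<in> carrier FX" "\<forall>i\<ge>j. g (i, {#}) = \<zero>" "lin_part r g \<in> N" by (auto simp: P_def)
    show "f \<oplus>\<^bsub>FX\<^esub> g \<in> P j" unfolding P_def mem_Collect_eq lin_part_add
      using f g N.subE(5)[OF f(3) g(3)] FX.M.a_closed[OF f(1) g(1)] by (simp add: free_module_simps)
  qed
  have TA: "T j \<subseteq> carrier A" for j by (auto simp: T_def)
  have cover: "Idl\<^bsub>A\<^esub> (T j) = carrier A" if "j \<le> r" for j
    using that
  proof (induction j)
    case 0
    have "P 0 = lift_submodule A n r N" by (auto simp: P_def lift_submodule_def)
    then show ?case using lf locally_free_quotient_iff[OF FX.module_axioms lift_submodule_submodule[OF N]] by (simp add: T_def)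
  next
    case (Suc j)
    have j: "j < r" using Suc.prems by simp
    interpret Pj: module_with_submodule A FX "P j" by (rule mod_FX[OF P])
    let ?u = "unit_fun A (j, {#})"
    have u: "?u \<in> carrier FX" using j by (simp add: unit_fun_closed[OF A_cring] quot_index_def)
    let ?I = "Idl\<^bsub>A\<^esub> (T (Suc j))"
    have I: "ideal ?I A" by (rule genideal_ideal[OF TA])
    interpret I: ideal ?I A by (rule I)
    have "?I = carrier A"
    proof (rule ideal_eq_carrier_local[OF I TA Suc.IH])
      show "j \<le> r" using j by simp
      fix s assume "s \<in> T j"
      then obtain b where s: "s \<in> carrier A" and b: "basis_at A FX (P j) s {..<d - j} b" by (auto simp: T_def)
      let ?J = "{..<d - j}"
      note bF = basis_at_funcset[OF b]
      obtain x c where x: "x \<in> saturation A s" "x \<in> carrier A" and c: "c \<in> ?J \<rightarrow> carrier A"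
        "Pj.mod_eq (x \<odot>\<^bsub>FX\<^esub> ?u) (lin_comb FX ?J c b)"
        using Pj.basis_at_span[OF b u] .
      \<comment> \<open>On \<open>D(s c_i)\<close> the vector \<open>e_j\<close> takes the place of
        \<open>b i\<close> and is then removed, which leaves a basis of length
        \<open>d - Suc j\<close> modulo \<open>P (Suc j)\<close>.\<close>
      have sc: "s \<otimes> c i \<in> ?I" if i: "i \<in> ?J" for i
      proof -
        let ?b = "b(i := ?u)"
        have sci: "s \<otimes> c i \<in> carrier A" using s c(1) i by auto
        have B: "basis_at A FX (P j) (s \<otimes> c i) ?J ?b"
          by (rule Pj.basis_at_exchange[OF b s _ i u x(1) c]) simp
        have B': "basis_at A FX (P (Suc j)) (s \<otimes> c i) (?J - {i}) ?b"
        proof (rule Pj.basis_at_quotient[OF B sci _ i P])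
          show "P j \<subseteq> P (Suc j)" by (auto simp: P_def)
          have "lin_part r ?u = \<zero>\<^bsub>FY\<^esub>" by (auto simp: lin_part_def unit_fun_def lin_index_def free_module_simps)
          then show "?b i \<in> P (Suc j)" using u N.sub_zero by (auto simp: P_def unit_fun_def)
          fix w assume "w \<in> P (Suc j)"
          then have w: "w \<in> carrier FX" "\<forall>i\<ge>Suc j. w (i, {#}) = \<zero>" "lin_part r w \<in> N" by (auto simp: P_def)
          let ?a = "w (j, {#})"
          have au: "?a \<odot>\<^bsub>FX\<^esub> ?u \<in> carrier FX" using w(1) u by (intro FX.smult_closed) auto
          have "w \<ominus>\<^bsub>FX\<^esub> ?a \<odot>\<^bsub>FX\<^esub> ?u \<in> P j" unfolding P_def
          proof (intro CollectI conjI allI impI)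
            show "w \<ominus>\<^bsub>FX\<^esub> ?a \<odot>\<^bsub>FX\<^esub> ?u \<in> carrier FX" by (rule FX.M.minus_closed[OF w(1) au])
            show "(w \<ominus>\<^bsub>FX\<^esub> ?a \<odot>\<^bsub>FX\<^esub> ?u) (i, {#}) = \<zero>" if "i \<ge> j" for i
              unfolding free_module_minus[OF A_cring w(1) au] using that w(1,2)
              by (cases "i = j") (auto simp: free_module_simps unit_fun_def)
            have "lin_part r (?a \<odot>\<^bsub>FX\<^esub> ?u) = \<zero>\<^bsub>FY\<^esub>"
              using w(1) by (auto simp: lin_part_def unit_fun_def lin_index_def free_module_simps)
            then show "lin_part r (w \<ominus>\<^bsub>FX\<^esub> ?a \<odot>\<^bsub>FX\<^esub> ?u) \<in> N"
              unfolding lin_part_minus[OF w(1) au] using N.sub_diff[OF w(3) N.sub_zero] by simp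
          qed
          then show "\<exists>a\<in>carrier A. w \<ominus>\<^bsub>FX\<^esub> a \<odot>\<^bsub>FX\<^esub> ?b i \<in> P j" using w(1) by (intro bexI[of _ ?a]) simp_all
        qed simp
        interpret PS: module_with_submodule A FX "P (Suc j)" by (rule mod_FX[OF P])
        have "card (?J - {i}) = card {..<d - Suc j}" using i by simp
        then obtain h where h: "bij_betw h {..<d - Suc j} (?J - {i})"
          using finite_same_card_bij[of "{..<d - Suc j}" "?J - {i}"] by auto
        have "basis_at A FX (P (Suc j)) (s \<otimes> c i) {..<d - Suc j} (?b \<circ> h)"
          by (rule PS.basis_at_reindex[OF B' h])
        then have "s \<otimes> c i \<in> T (Suc j)" using sci by (auto simp: T_def)
        then show ?thesis using genideal_self[OF TA] by blast
      qed
      have cb: "(\<lambda>i. c i \<odot>\<^bsub>FX\<^esub> b i) \<in> ?J \<rightarrow> carrier FX"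
        by (rule Pi_I) (rule FX.smult_closed[OF funcset_mem[OF c(1)] funcset_mem[OF bF]])
      have lc: "lin_comb FX ?J c b \<in> carrier FX" by (rule FX.lin_comb_closed[OF c(1) bF])
      have xu: "x \<odot>\<^bsub>FX\<^esub> ?u \<in> carrier FX" by (rule FX.smult_closed[OF x(2) u])
      \<comment> \<open>The coefficient at \<open>(j, {#})\<close> is a linear functional that
        vanishes on \<open>P j\<close> and takes the value \<open>1\<close> on \<open>e_j\<close>.
        It expresses the denominator \<open>x\<close> through the \<open>c_i\<close>, so the sets
        \<open>D(s c_i)\<close> cover \<open>D(s)\<close>.\<close>
      have "x \<odot>\<^bsub>FX\<^esub> ?u \<ominus>\<^bsub>FX\<^esub> lin_comb FX ?J c b \<in> P j" using c(2) unfolding Pj.mod_eq_def .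
      then have "(x \<odot>\<^bsub>FX\<^esub> ?u \<ominus>\<^bsub>FX\<^esub> lin_comb FX ?J c b) (j, {#}) = \<zero>" by (simp add: P_def)
      then have "x \<ominus> lin_comb FX ?J c b (j, {#}) = \<zero>"
        unfolding free_module_minus[OF A_cring xu lc] using x(2) by (simp add: free_module_simps unit_fun_def)
      then have "x = lin_comb FX ?J c b (j, {#})" using x(2) lc by simp
      also have "\<dots> = (\<Oplus>i\<in>?J. c i \<otimes> b i (j, {#}))"
        unfolding free_module_finsum[OF A_cring cb] by (simp add: free_module_simps)
      finally have xe: "x = (\<Oplus>i\<in>?J. c i \<otimes> b i (j, {#}))" .
      have bj: "b i (j, {#}) \<in> carrier A" "c i \<in> carrier A" if "i \<in> ?J" for i
        using funcset_mem[OF bF that] funcset_mem[OF c(1) that] by simp_all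
      have "s \<otimes> x = (\<Oplus>i\<in>?J. s \<otimes> (c i \<otimes> b i (j, {#})))" unfolding xe
        by (rule finsum_rdistr) (use s bj in auto)
      also have "\<dots> = (\<Oplus>i\<in>?J. (s \<otimes> c i) \<otimes> b i (j, {#}))"
        by (rule finsum_cong') (use s bj in \<open>auto simp: m_assoc\<close>)
      also have "\<dots> \<in> ?I"
      proof -
        have "(\<Oplus>i\<in>K. (s \<otimes> c i) \<otimes> b i (j, {#})) \<in> ?I" if "finite K" "K \<subseteq> ?J" for K
          using that
        proof (induction K)
          case empty show ?case using I.zero_closed by simp
        next
          case (insert i K)
          have "(s \<otimes> c i) \<otimes> b i (j, {#}) \<in> ?I" using insert.prems by (intro I.I_r_closed sc bj) auto
          moreover have "(\<Oplus>i\<in>K. (s \<otimes> c i) \<otimes> b i (j, {#})) \<in> ?I" using insert by simp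
          moreover have "(\<Oplus>i\<in>insert i K. (s \<otimes> c i) \<otimes> b i (j, {#})) = (s \<otimes> c i) \<otimes> b i (j, {#}) \<oplus> (\<Oplus>i\<in>K. (s \<otimes> c i) \<otimes> b i (j, {#}))"
            using insert s bj by (intro finsum_insert) auto
          ultimately show ?case by simp
        qed
        from this[OF _ subset_refl] show ?thesis by simp
      qed
      finally have "s \<otimes> x \<in> ?I" .
      moreover have "s \<otimes> x \<in> saturation A s" by (rule mult_saturation[OF s self_saturation[OF s] x(1)])
      ultimately show "\<exists>x\<in>saturation A s. x \<in> ?I" by (rule bexI)
    qed
    then show ?case .
  qed
  let ?m = "d - r"
  interpret Pr: module_with_submodule A FX "P r" by (rule mod_FX[OF P])
  \<comment> \<open>All \<open>r\<close> constants are allowed in \<open>P r\<close>, so only the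
    condition on the linear part is left.\<close>
  have Pr: "f \<in> P r \<longleftrightarrow> lin_part r f \<in> N" if "f \<in> carrier FX" for f
    using that FX_outside[OF that] by (auto simp: P_def quot_index_def)
  let ?S' = "{s \<in> carrier A. \<exists>b. basis_at A FY N s {..<?m} b}"
  have "T r \<subseteq> ?S'"
  proof
    fix s assume "s \<in> T r"
    then obtain b where s: "s \<in> carrier A" and b: "basis_at A FX (P r) s {..<?m} b" by (auto simp: T_def)
    note bF = basis_at_funcset[OF b]
    let ?b = "\<lambda>i. lin_part r (b i)"
    have b'F: "?b \<in> {..<?m} \<rightarrow> carrier FY" by (rule Pi_I) (rule lin_part_closed[OF funcset_mem[OF bF]])
    have "basis_at A FY N s {..<?m} ?b"
    proof (rule N.basis_atI[OF b'F])
      fix v assume v: "v \<in> carrier FY"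
      let ?f = "lin_embed A n r v"
      have f: "?f \<in> carrier FX" by (rule lin_embed_closed[OF v])
      obtain x c where x: "x \<in> saturation A s" "x \<in> carrier A" and c: "c \<in> {..<?m} \<rightarrow> carrier A"
        "Pr.mod_eq (x \<odot>\<^bsub>FX\<^esub> ?f) (lin_comb FX {..<?m} c b)"
        using Pr.basis_at_span[OF b f] .
      have xf: "x \<odot>\<^bsub>FX\<^esub> ?f \<in> carrier FX" by (rule FX.smult_closed[OF x(2) f])
      have lc: "lin_comb FX {..<?m} c b \<in> carrier FX" by (rule FX.lin_comb_closed[OF c(1) bF])
      have "lin_part r (x \<odot>\<^bsub>FX\<^esub> ?f \<ominus>\<^bsub>FX\<^esub> lin_comb FX {..<?m} c b) \<in> N"
        using c(2) unfolding Pr.mod_eq_def Pr[OF FX.M.minus_closed[OF xf lc]] .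
      then have "N.mod_eq (x \<odot>\<^bsub>FY\<^esub> v) (lin_comb FY {..<?m} c ?b)"
        unfolding lin_part_minus[OF xf lc] lin_part_smult lin_part_lin_embed[OF v] lin_part_lin_comb[OF finite_lessThan c(1) bF] N.mod_eq_def .
      then show "\<exists>x\<in>saturation A s. \<exists>c\<in>{..<?m} \<rightarrow> carrier A. N.mod_eq (x \<odot>\<^bsub>FY\<^esub> v) (lin_comb FY {..<?m} c ?b)"
        using x(1) c(1) by (intro bexI[of _ x] bexI[of _ c])
    next
      fix c assume c: "c \<in> {..<?m} \<rightarrow> carrier A" and "lin_comb FY {..<?m} c ?b \<in> N"
      then have "lin_comb FX {..<?m} c b \<in> P r"
        unfolding Pr[OF FX.lin_comb_closed[OF c bF]] lin_part_lin_comb[OF finite_lessThan c bF] by simp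
      then obtain x where "x \<in> saturation A s" "x \<in> carrier A" "\<And>i. i \<in> {..<?m} \<Longrightarrow> x \<otimes> c i = \<zero>"
        using Pr.basis_at_indep[OF b c] by metis
      then show "\<exists>x\<in>saturation A s. \<forall>i\<in>{..<?m}. x \<otimes> c i = \<zero>" by (intro bexI[of _ x] ballI)
    qed
    then show "s \<in> ?S'" using s by auto
  qed
  then have "Idl\<^bsub>A\<^esub> (T r) \<subseteq> Idl\<^bsub>A\<^esub> ?S'" by (intro subset_Idl_subset) auto
  moreover have "Idl\<^bsub>A\<^esub> ?S' \<subseteq> carrier A" by (rule genideal_minimal[OF oneideal]) auto
  ultimately show ?thesis unfolding locally_free_quotient_iff[OF FY.module_axioms N] using cover[of r] by auto
qed

end

section \<open>Closed subschemes of the Quot scheme\<close>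

lemma (in cring) annihilator_ideal:
  assumes a: "a \<in> carrier R"
  shows "ideal {x \<in> carrier R. x \<otimes> a = \<zero>} R"
proof (rule idealI)
  show "ring R" by unfold_locales
  show "subgroup {x \<in> carrier R. x \<otimes> a = \<zero>} (add_monoid R)"
    by (rule add.subgroupI) (use a zero_closed in \<open>auto simp: l_distr l_minus intro!: exI[of _ \<zero>]\<close>)
  fix x y assume x: "x \<in> {x \<in> carrier R. x \<otimes> a = \<zero>}" and y: "y \<in> carrier R"
  show "y \<otimes> x \<in> {x \<in> carrier R. x \<otimes> a = \<zero>}" using a x y m_assoc[of y x a] by simp
  then show "x \<otimes> y \<in> {x \<in> carrier R. x \<otimes> a = \<zero>}" using a x y m_comm[of x y] by simp
qed

lemma Quot_points_iff:
  "N \<in> points (Defs.Quot n r d) A \<longleftrightarrow> Module.submodule N A (poly_tuples n r A) \<and>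
    (\<forall>i<n. \<forall>f \<in> N. var_mult A i f \<in> N) \<and> locally_free_quotient A (poly_tuples n r A) N d"
  by (simp add: Quot_def)

lemma Grassmannian_points_iff:
  "N \<in> points (Grassmannian a b) A \<longleftrightarrow> Module.submodule N A (free_module A {..<a}) \<and>
    locally_free_quotient A (free_module A {..<a}) N b"
  by (simp add: Grassmannian_def)

section \<open>Extension of scalars for lifted submodules and for points of the Quot scheme\<close>

locale tuple_extension = A: tuple_space A n r + B: tuple_space B n r
  for A :: "('k::field, 'a) module" and B :: "('l::field, 'b) module" and n r :: nat +
  fixes \<phi>
  assumes hom: "\<phi> \<in> Ring.ring_hom A B"
begin

sublocale X: scalar_extension A B \<phi> "quot_index n r"
  by (intro scalar_extension.intro scalar_extension_axioms.intro A.A_cring B.A_cring hom)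

sublocale Y: scalar_extension A B \<phi> "{..<n * r}"
  by (intro scalar_extension.intro scalar_extension_axioms.intro A.A_cring B.A_cring hom)

lemma comp_lin_part: "lin_part r (\<phi> \<circ> f) = \<phi> \<circ> lin_part r f"
  by (simp add: lin_part_def comp_def)

lemma comp_lin_embed: "\<phi> \<circ> lin_embed A n r v = lin_embed B n r (\<phi> \<circ> v)"
  by (auto simp: lin_embed_def)

lemma comp_var_mult: "\<phi> \<circ> var_mult A i f = var_mult B i (\<phi> \<circ> f)"
  by (auto simp: var_mult_def)

lemma deg0_submodule: "Module.submodule {w \<in> carrier B.FX. \<forall>j. w (j, {#}) = \<zero>\<^bsub>B\<^esub>} B B.FX"
proof (rule B.FX.submoduleI)
  let ?H = "{w \<in> carrier B.FX. \<forall>j. w (j, {#}) = \<zero>\<^bsub>B\<^esub>}"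
  show "\<zero>\<^bsub>B.FX\<^esub> \<in> ?H" using B.FX.M.zero_closed by (simp add: free_module_simps)
  fix v assume "v \<in> ?H"
  then have v: "v \<in> carrier B.FX" "\<forall>j. v (j, {#}) = \<zero>\<^bsub>B\<^esub>" by auto
  show "\<ominus>\<^bsub>B.FX\<^esub> v \<in> ?H" using v B.FX.M.a_inv_closed[OF v(1)] by (simp add: free_module_a_inv[OF B.A_cring v(1)])
  show "a \<odot>\<^bsub>B.FX\<^esub> v \<in> ?H" if "a \<in> carrier B" for a
    using v B.FX.smult_closed[OF that v(1)] that by (simp add: free_module_simps)
  fix w assume "w \<in> ?H"
  then have w: "w \<in> carrier B.FX" "\<forall>j. w (j, {#}) = \<zero>\<^bsub>B\<^esub>" by auto
  show "v \<oplus>\<^bsub>B.FX\<^esub> w \<in> ?H" using v w B.FX.M.a_closed[OF v(1) w(1)] by (simp add: free_module_simps)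
qed auto

lemma base_change_deg0:
  assumes N: "N \<subseteq> carrier A.FX" and 0: "\<And>f j. f \<in> N \<Longrightarrow> \<phi> (f (j, {#})) = \<zero>\<^bsub>B\<^esub>"
    and w: "w \<in> base_change B (quot_index n r) \<phi> N"
  shows "w (j, {#}) = \<zero>\<^bsub>B\<^esub>"
proof -
  have "base_change B (quot_index n r) \<phi> N \<subseteq> {w \<in> carrier B.FX. \<forall>j. w (j, {#}) = \<zero>\<^bsub>B\<^esub>}"
  proof (rule X.base_change_minimal[OF deg0_submodule])
    fix f assume f: "f \<in> N"
    show "\<phi> \<circ> f \<in> {w \<in> carrier B.FX. \<forall>j. w (j, {#}) = \<zero>\<^bsub>B\<^esub>}"
      using X.comp_closed[OF subsetD[OF N f]] 0[OF f] by simp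
  qed
  then show ?thesis using w by auto
qed

text \<open>Over \<open>B\<close> the lift is generated by the embedded submodule and the monomials
  of degree at least two, and these generators come from \<open>A\<close>; conversely, images of
  elements of the lift over \<open>A\<close> satisfy the defining conditions over \<open>B\<close>.
  The equality gives the naturality of the isomorphism and reduces base changes of lifts to base
  changes in \<open>A^{nr}\<close>.\<close>

lemma base_change_lift:
  assumes N: "Module.submodule N A A.FY"
  shows "base_change B (quot_index n r) \<phi> (lift_submodule A n r N) = lift_submodule B n r (base_change B {..<n * r} \<phi> N)"
    (is "?L = ?R")
proof
  have NF: "N \<subseteq> carrier A.FY" by (rule A.FY.submoduleE(1)[OF N])
  have N': "Module.submodule (base_change B {..<n * r} \<phi> N) B B.FY" by (rule Y.base_change_submodule[OF NF])
  have LF: "lift_submodule A n r N \<subseteq> carrier A.FX" by (rule subsetI) (rule A.lift_closed)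
  have L: "Module.submodule ?L B B.FX" by (rule X.base_change_submodule[OF LF])
  interpret L: module_with_submodule B B.FX ?L by (rule B.mod_FX[OF L])
  show "?L \<subseteq> ?R"
  proof (rule X.base_change_minimal[OF B.lift_submodule_submodule[OF N']])
    fix f assume "f \<in> lift_submodule A n r N"
    then have f: "f \<in> carrier A.FX" "\<forall>j. f (j, {#}) = \<zero>\<^bsub>A\<^esub>" "lin_part r f \<in> N" by (auto simp: lift_submodule_def)
    show "\<phi> \<circ> f \<in> ?R"
      using X.comp_closed[OF f(1)] f(2) Y.base_change_incl[OF f(3)] by (simp add: lift_submodule_def comp_lin_part)
  qed
  have emb: "lin_embed B n r v \<in> ?L" if "v \<in> base_change B {..<n * r} \<phi> N" for v
  proof -
    let ?H = "{v \<in> carrier B.FY. lin_embed B n r v \<in> ?L}"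
    have smult: "a \<odot>\<^bsub>B.FY\<^esub> v \<in> ?H" if a: "a \<in> carrier B" and v: "v \<in> ?H" for a v
      using B.FY.smult_closed[OF a] v L.subE(4)[OF a] B.lin_embed_smult[OF a, of v] by simp
    have "Module.submodule ?H B B.FY"
    proof (rule B.FY.submoduleI)
      have "lin_embed B n r \<zero>\<^bsub>B.FY\<^esub> = \<zero>\<^bsub>B.FX\<^esub>" by (auto simp: lin_embed_def free_module_simps)
      then show "\<zero>\<^bsub>B.FY\<^esub> \<in> ?H" using L.sub_zero B.FY.M.zero_closed by simp
      show "\<ominus>\<^bsub>B.FY\<^esub> v \<in> ?H" if v: "v \<in> ?H" for v
        using smult[OF _ v, of "\<ominus>\<^bsub>B\<^esub> \<one>\<^bsub>B\<^esub>"] v by (simp add: B.FY.smult_minus_one)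
      fix v w assume "v \<in> ?H" "w \<in> ?H"
      then show "v \<oplus>\<^bsub>B.FY\<^esub> w \<in> ?H"
        using B.FY.M.a_closed[of v w] L.subE(5)[of "lin_embed B n r v" "lin_embed B n r w"] B.lin_embed_add[of v w] by simp
    qed (use smult in auto)
    then have "base_change B {..<n * r} \<phi> N \<subseteq> ?H"
    proof (rule Y.base_change_minimal)
      fix v assume v: "v \<in> N"
      have "\<phi> \<circ> lin_embed A n r v \<in> ?L" by (rule X.base_change_incl[OF A.lift_contains_embed[OF N v]])
      then show "\<phi> \<circ> v \<in> ?H" using Y.comp_closed[OF subsetD[OF NF v]] by (simp add: comp_lin_embed)
    qed
    then show ?thesis using that by auto
  qed
  show "?R \<subseteq> ?L"
  proof
    fix w assume "w \<in> ?R"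
    then have w: "w \<in> carrier B.FX" "\<forall>j. w (j, {#}) = \<zero>\<^bsub>B\<^esub>" "lin_part r w \<in> base_change B {..<n * r} \<phi> N"
      by (auto simp: lift_submodule_def)
    have "w \<ominus>\<^bsub>B.FX\<^esub> lin_embed B n r (lin_part r w) \<in> ?L"
    proof (rule B.mem_of_lin_part[OF L w(1,2)])
      fix x :: "nat \<times> nat multiset" assume x: "x \<in> quot_index n r" "2 \<le> size (snd x)"
      have "\<phi> \<circ> unit_fun A x \<in> ?L" by (rule X.base_change_incl[OF A.lift_contains_high[OF N x]])
      then show "unit_fun B x \<in> ?L" by (simp add: X.comp_unit_fun)
    qed
    then have "L.mod_eq w (lin_embed B n r (lin_part r w))" by (simp add: L.mod_eq_def)
    then show "w \<in> ?L" by (rule L.mod_eq_in[OF _ w(1) emb[OF w(3)]])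
  qed
qed

text \<open>Stability under the variables is inherited because the vectors that a variable
  multiplies into the base change form a submodule containing the images of
  \<open>N\<close>.\<close>

lemma Quot_base_change:
  assumes N: "N \<in> points (Defs.Quot n r d) A"
  shows "base_change B (quot_index n r) \<phi> N \<in> points (Defs.Quot n r d) B"
  unfolding Quot_points_iff
proof (intro conjI allI impI ballI)
  let ?N = "base_change B (quot_index n r) \<phi> N"
  have N': "Module.submodule N A A.FX" "\<forall>i<n. \<forall>f \<in> N. var_mult A i f \<in> N" "locally_free_quotient A A.FX N d"
    using N by (simp_all add: Quot_points_iff)
  have NF: "N \<subseteq> carrier A.FX" by (rule A.FX.submoduleE(1)[OF N'(1)])
  show sub: "Module.submodule ?N B B.FX" by (rule X.base_change_submodule[OF NF])
  interpret L: module_with_submodule B B.FX ?N by (rule B.mod_FX[OF sub])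
  show "locally_free_quotient B B.FX ?N d" by (rule X.locally_free_base_change[OF N'(1,3)])
  fix i f assume i: "i < n" and f: "f \<in> ?N"
  let ?H = "{w \<in> carrier B.FX. var_mult B i w \<in> ?N}"
  have smult: "a \<odot>\<^bsub>B.FX\<^esub> w \<in> ?H" if a: "a \<in> carrier B" and w: "w \<in> ?H" for a w
    using B.FX.smult_closed[OF a] w L.subE(4)[OF a] B.var_mult_smult[OF _ a, of w i] by simp
  have "Module.submodule ?H B B.FX"
  proof (rule B.FX.submoduleI)
    show "\<zero>\<^bsub>B.FX\<^esub> \<in> ?H" using L.sub_zero B.FX.M.zero_closed B.var_mult_zero[of i] by simp
    show "\<ominus>\<^bsub>B.FX\<^esub> v \<in> ?H" if v: "v \<in> ?H" for v
      using smult[OF _ v, of "\<ominus>\<^bsub>B\<^esub> \<one>\<^bsub>B\<^esub>"] v by (simp add: B.FX.smult_minus_one)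
    fix v w assume "v \<in> ?H" "w \<in> ?H"
    then show "v \<oplus>\<^bsub>B.FX\<^esub> w \<in> ?H"
      using B.FX.M.a_closed[of v w] L.subE(5)[of "var_mult B i v" "var_mult B i w"] B.var_mult_add[of v w i] by simp
  qed (use smult in auto)
  then have "?N \<subseteq> ?H"
  proof (rule X.base_change_minimal)
    fix g assume g: "g \<in> N"
    have "\<phi> \<circ> var_mult A i g \<in> ?N" using N'(2) i g X.base_change_incl by blast
    then show "\<phi> \<circ> g \<in> ?H" using X.comp_closed[OF subsetD[OF NF g]] by (simp add: comp_var_mult)
  qed
  then show "var_mult B i f \<in> ?N" using f by auto
qed

end

lemma tuple_extension_k_algebra:
  assumes "k_algebra A" "k_algebra B" "k_algebra_hom A B \<phi>" "0 < r"
  shows "tuple_extension A B r \<phi>"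
proof -
  have "\<phi> \<in> Ring.ring_hom A B" using assms(3) by (simp add: k_algebra_hom_def)
  then show ?thesis using assms(1,2,4)
    by (intro tuple_extension.intro tuple_extension_axioms.intro tuple_space.intro tuple_space_axioms.intro k_algebra_cring)
qed

text \<open>The kernel lies in \<open>(x_0, ..., x_{n-1})\<close> times the free module;
  equivalently, the classes of the \<open>e_j\<close> form a basis of the quotient modulo the
  variables.\<close>

definition deg0_locus :: "nat \<Rightarrow> nat \<Rightarrow> nat \<Rightarrow> ('k::field, 'b) module \<Rightarrow> 'b poly_tuple set set" where
  "deg0_locus n r d A = {N \<in> points (Defs.Quot n r d) A. \<forall>f \<in> N. \<forall>j. f (j, {#}) = \<zero>\<^bsub>A\<^esub>}"

text \<open>One locus for each monomial \<open>x\<close>. A point of the reduced scheme lies in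
  every closed subscheme through the given points, so the infinitely many monomials of degree at
  least two can be treated separately.\<close>

definition vanishing_locus ::
    "nat \<Rightarrow> nat \<Rightarrow> nat \<Rightarrow> nat \<times> nat multiset \<Rightarrow> ('k::field, 'b) module \<Rightarrow> 'b poly_tuple set set" where
  "vanishing_locus n r d x A = {N \<in> points (Defs.Quot n r d) A. unit_fun A x \<in> N}"

text \<open>The ideal is generated by the constant terms of all elements of \<open>N\<close>: the
  base change is generated by the images of these elements, so its constant terms vanish exactly
  when \<open>\<phi>\<close> kills those of \<open>N\<close>.\<close>

lemma closed_deg0_locus:
  assumes r: "0 < r"
  shows "closed_subscheme (Defs.Quot n r d :: ('k::field, 'b, 'b poly_tuple set) k_functor) (deg0_locus n r d)"
  unfolding closed_subscheme_def
proof (intro allI impI conjI ballI)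
  fix A :: "('k, 'b) module" assume A: "k_algebra A"
  show "deg0_locus n r d A \<subseteq> points (Defs.Quot n r d) A" by (auto simp: deg0_locus_def)
  fix N assume N: "N \<in> points (Defs.Quot n r d) A"
  interpret A: tuple_space A n r by (intro tuple_space.intro tuple_space_axioms.intro k_algebra_cring A r)
  have NF: "N \<subseteq> carrier A.FX" using N A.FX.submoduleE(1) by (simp add: Quot_points_iff)
  let ?G = "{f (j, {#}) |f j. f \<in> N}"
  have G: "?G \<subseteq> carrier A" using NF by auto
  show "\<exists>I. ideal I A \<and> (\<forall>B \<phi>. k_algebra B \<and> k_algebra_hom A B \<phi> \<longrightarrow>
     (pull (Defs.Quot n r d) A B \<phi> N \<in> deg0_locus n r d B) = (\<forall>a\<in>I. \<phi> a = \<zero>\<^bsub>B\<^esub>))"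
  proof (intro exI[of _ "Idl\<^bsub>A\<^esub> ?G"] conjI allI impI)
    show "ideal (Idl\<^bsub>A\<^esub> ?G) A" by (rule A.genideal_ideal[OF G])
    fix B :: "('k, 'b) module" and \<phi> assume B: "k_algebra B \<and> k_algebra_hom A B \<phi>"
    interpret E: tuple_extension A B n r \<phi> by (rule tuple_extension_k_algebra) (use A B r in auto)
    have hr: "ring_hom_ring A B \<phi>"
      using E.hom A.A_cring E.B.A_cring by (simp add: ring_hom_ring_def ring_hom_ring_axioms_def cring_def)
    let ?N = "base_change B (quot_index n r) \<phi> N"
    show "(pull (Defs.Quot n r d) A B \<phi> N \<in> deg0_locus n r d B) = (\<forall>a\<in>Idl\<^bsub>A\<^esub> ?G. \<phi> a = \<zero>\<^bsub>B\<^esub>)"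
    proof
      assume "pull (Defs.Quot n r d) A B \<phi> N \<in> deg0_locus n r d B"
      then have 0: "\<And>f j. f \<in> ?N \<Longrightarrow> f (j, {#}) = \<zero>\<^bsub>B\<^esub>" by (simp add: deg0_locus_def Quot_def)
      have "?G \<subseteq> a_kernel A B \<phi>"
      proof
        fix a assume "a \<in> ?G"
        then obtain f j where f: "f \<in> N" "a = f (j, {#})" by auto
        have "\<phi> a = \<zero>\<^bsub>B\<^esub>" using 0[OF E.X.base_change_incl[OF f(1)], of j] f(2) by simp
        moreover have "a \<in> carrier A" using f NF by auto
        ultimately show "a \<in> a_kernel A B \<phi>" unfolding a_kernel_def' by (intro CollectI conjI)
      qed
      then have "Idl\<^bsub>A\<^esub> ?G \<subseteq> a_kernel A B \<phi>"
        by (rule A.genideal_minimal[OF ring_hom_ring.kernel_is_ideal[OF hr]])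
      then show "\<forall>a\<in>Idl\<^bsub>A\<^esub> ?G. \<phi> a = \<zero>\<^bsub>B\<^esub>" unfolding a_kernel_def' by blast
    next
      assume I: "\<forall>a\<in>Idl\<^bsub>A\<^esub> ?G. \<phi> a = \<zero>\<^bsub>B\<^esub>"
      have "\<phi> (f (j, {#})) = \<zero>\<^bsub>B\<^esub>" if "f \<in> N" for f j
      proof -
        have "f (j, {#}) \<in> ?G" using that by blast
        then have "f (j, {#}) \<in> Idl\<^bsub>A\<^esub> ?G" by (rule subsetD[OF A.genideal_self[OF G]])
        then show ?thesis by (rule bspec[OF I])
      qed
      then have "w (j, {#}) = \<zero>\<^bsub>B\<^esub>" if "w \<in> ?N" for w j
        by (rule E.base_change_deg0[OF NF _ that])
      then show "pull (Defs.Quot n r d) A B \<phi> N \<in> deg0_locus n r d B"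
        using E.Quot_base_change[OF N] by (simp add: deg0_locus_def) (simp add: Quot_def)
    qed
  qed
qed

text \<open>Locally, the condition is that the coordinates \<open>c\<^sub>i\<close> of the class of \<open>e\<^sub>x\<close> in a basis vanish; the
  ideals generated by these coordinates on different members of the cover agree up to
  localisation, so they glue.\<close>

lemma closed_vanishing_locus:
  assumes r: "0 < r" and x: "x \<in> quot_index n r"
  shows "closed_subscheme (Defs.Quot n r d :: ('k::field, 'b, 'b poly_tuple set) k_functor) (vanishing_locus n r d x)"
  unfolding closed_subscheme_def
proof (intro allI impI conjI ballI)
  fix A :: "('k, 'b) module" assume A: "k_algebra A"
  show "vanishing_locus n r d x A \<subseteq> points (Defs.Quot n r d) A" by (auto simp: vanishing_locus_def)
  fix N assume Nq: "N \<in> points (Defs.Quot n r d) A"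
  interpret A: tuple_space A n r by (intro tuple_space.intro tuple_space_axioms.intro k_algebra_cring A r)
  have N: "Module.submodule N A A.FX" and lf: "locally_free_quotient A A.FX N d" using Nq by (simp_all add: Quot_points_iff)
  interpret N: module_with_submodule A A.FX N by (rule A.mod_FX[OF N])
  let ?J = "{..<d}"
  let ?S = "{s \<in> carrier A. \<exists>b. basis_at A A.FX N s ?J b}"
  have "Idl\<^bsub>A\<^esub> ?S = carrier A" using lf by (simp add: locally_free_quotient_iff[OF A.FX.module_axioms N])
  then obtain T where T: "finite T" "T \<subseteq> ?S" "Idl\<^bsub>A\<^esub> T = carrier A"
    using A.genideal_finite_subset[of ?S] by auto
  have TA: "T \<subseteq> carrier A" using T(2) by auto
  let ?u = "unit_fun A x"
  have u: "?u \<in> carrier A.FX" by (rule unit_fun_closed[OF A.A_cring x])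
  have "\<forall>s\<in>T. \<exists>b. basis_at A A.FX N s ?J b" using T(2) by auto
  then obtain b where b: "\<And>s. s \<in> T \<Longrightarrow> basis_at A A.FX N s ?J (b s)" by metis
  have "\<forall>s\<in>T. \<exists>p. fst p \<in> saturation A s \<and> snd p \<in> ?J \<rightarrow> carrier A \<and> N.mod_eq (fst p \<odot>\<^bsub>A.FX\<^esub> ?u) (lin_comb A.FX ?J (snd p) (b s))"
  proof
    fix s assume s: "s \<in> T"
    obtain z e where "z \<in> saturation A s" "z \<in> carrier A" "e \<in> ?J \<rightarrow> carrier A" "N.mod_eq (z \<odot>\<^bsub>A.FX\<^esub> ?u) (lin_comb A.FX ?J e (b s))"
      using N.basis_at_span[OF b[OF s] u] .
    then show "\<exists>p. fst p \<in> saturation A s \<and> snd p \<in> ?J \<rightarrow> carrier A \<and> N.mod_eq (fst p \<odot>\<^bsub>A.FX\<^esub> ?u) (lin_comb A.FX ?J (snd p) (b s))"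
      by (intro exI[of _ "(z, e)"]) simp
  qed
  from bchoice[OF this] obtain p where p: "\<forall>s\<in>T. fst (p s) \<in> saturation A s \<and> snd (p s) \<in> ?J \<rightarrow> carrier A \<and>
    N.mod_eq (fst (p s) \<odot>\<^bsub>A.FX\<^esub> ?u) (lin_comb A.FX ?J (snd (p s)) (b s))" ..
  define y c where "y s = fst (p s)" and "c s = snd (p s)" for s
  have y: "y s \<in> saturation A s" and c: "c s \<in> ?J \<rightarrow> carrier A"
    and yc: "N.mod_eq (y s \<odot>\<^bsub>A.FX\<^esub> ?u) (lin_comb A.FX ?J (c s) (b s))" if "s \<in> T" for s
    using bspec[OF p that] unfolding y_def c_def by simp_all
  have yA: "y s \<in> carrier A" if "s \<in> T" for s by (rule A.saturation_closed[OF y[OF that]])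
  define G where "G s = Idl\<^bsub>A\<^esub> (c s ` ?J)" for s
  have cA: "c s ` ?J \<subseteq> carrier A" if "s \<in> T" for s using c[OF that] by auto
  have G: "ideal (G s) A" if "s \<in> T" for s unfolding G_def by (rule A.genideal_ideal[OF cA[OF that]])
  have cG: "c s i \<in> G s" if "s \<in> T" "i \<in> ?J" for s i
    unfolding G_def using A.genideal_self[OF cA[OF that(1)]] that(2) by blast
  \<comment> \<open>The ideal \<open>G s\<close> is the right one only on \<open>D(s)\<close>.
    \<open>I\<close> collects the elements of \<open>A\<close> that lie in \<open>G s\<close> after
    restriction to \<open>D(s)\<close>, for each of the finitely many
    \<open>s \<in> T\<close>.\<close>
  define I where "I = {a \<in> carrier A. \<forall>s\<in>T. \<exists>z\<in>saturation A s. z \<otimes>\<^bsub>A\<^esub> a \<in> G s}"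
  have I: "ideal I A"
  proof (rule idealI)
    show "ring A" by unfold_locales
    have mult: "q \<otimes>\<^bsub>A\<^esub> a \<in> I" if a: "a \<in> I" and q: "q \<in> carrier A" for a q
      unfolding I_def
    proof (intro CollectI conjI ballI)
      have aA: "a \<in> carrier A" using a by (simp add: I_def)
      show "q \<otimes>\<^bsub>A\<^esub> a \<in> carrier A" using aA q by simp
      fix s assume s: "s \<in> T"
      then obtain z where z: "z \<in> saturation A s" "z \<otimes>\<^bsub>A\<^esub> a \<in> G s" using a by (auto simp: I_def)
      note zA = A.saturation_closed[OF z(1)]
      have "q \<otimes>\<^bsub>A\<^esub> (z \<otimes>\<^bsub>A\<^esub> a) \<in> G s" by (rule ideal.I_l_closed[OF G[OF s] z(2) q])
      moreover have "q \<otimes>\<^bsub>A\<^esub> (z \<otimes>\<^bsub>A\<^esub> a) = z \<otimes>\<^bsub>A\<^esub> (q \<otimes>\<^bsub>A\<^esub> a)" using q zA aA by (simp add: A.m_lcomm)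
      ultimately show "\<exists>z\<in>saturation A s. z \<otimes>\<^bsub>A\<^esub> (q \<otimes>\<^bsub>A\<^esub> a) \<in> G s" using z(1) by (intro bexI[of _ z]) simp_all
    qed
    show "subgroup I (add_monoid A)"
    proof (rule A.add.subgroupI)
      show "I \<subseteq> carrier A" by (auto simp: I_def)
      have "\<zero>\<^bsub>A\<^esub> \<in> I" unfolding I_def
      proof (intro CollectI conjI ballI)
        fix s assume s: "s \<in> T"
        have "\<one>\<^bsub>A\<^esub> \<otimes>\<^bsub>A\<^esub> \<zero>\<^bsub>A\<^esub> \<in> G s" using additive_subgroup.zero_closed[OF ideal.axioms(1)[OF G[OF s]]] by simp
        then show "\<exists>z\<in>saturation A s. z \<otimes>\<^bsub>A\<^esub> \<zero>\<^bsub>A\<^esub> \<in> G s"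
          using A.one_saturation[of s] s TA by (intro bexI[of _ "\<one>\<^bsub>A\<^esub>"]) auto
      qed simp
      then show "I \<noteq> {}" by blast
      fix a assume a: "a \<in> I"
      then have aA: "a \<in> carrier A" by (simp add: I_def)
      show "\<ominus>\<^bsub>A\<^esub> a \<in> I" using mult[OF a, of "\<ominus>\<^bsub>A\<^esub> \<one>\<^bsub>A\<^esub>"] aA by (simp add: A.l_minus)
      fix a' assume a': "a' \<in> I"
      then have a'A: "a' \<in> carrier A" by (simp add: I_def)
      show "a \<oplus>\<^bsub>A\<^esub> a' \<in> I" unfolding I_def
      proof (intro CollectI conjI ballI)
        show "a \<oplus>\<^bsub>A\<^esub> a' \<in> carrier A" using aA a'A by simp
        fix s assume s: "s \<in> T"
        then have sA: "s \<in> carrier A" using TA by auto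
        obtain z where z: "z \<in> saturation A s" "z \<otimes>\<^bsub>A\<^esub> a \<in> G s" using a s by (auto simp: I_def)
        obtain z' where z': "z' \<in> saturation A s" "z' \<otimes>\<^bsub>A\<^esub> a' \<in> G s" using a' s by (auto simp: I_def)
        note zA = A.saturation_closed[OF z(1)] and z'A = A.saturation_closed[OF z'(1)]
        have "z' \<otimes>\<^bsub>A\<^esub> (z \<otimes>\<^bsub>A\<^esub> a) \<oplus>\<^bsub>A\<^esub> z \<otimes>\<^bsub>A\<^esub> (z' \<otimes>\<^bsub>A\<^esub> a') \<in> G s"
          by (rule additive_subgroup.a_closed[OF ideal.axioms(1)[OF G[OF s]]
            ideal.I_l_closed[OF G[OF s] z(2) z'A] ideal.I_l_closed[OF G[OF s] z'(2) zA]])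
        moreover have "z' \<otimes>\<^bsub>A\<^esub> (z \<otimes>\<^bsub>A\<^esub> a) \<oplus>\<^bsub>A\<^esub> z \<otimes>\<^bsub>A\<^esub> (z' \<otimes>\<^bsub>A\<^esub> a') = (z \<otimes>\<^bsub>A\<^esub> z') \<otimes>\<^bsub>A\<^esub> (a \<oplus>\<^bsub>A\<^esub> a')"
          using zA z'A aA a'A by (simp add: A.r_distr A.m_ac)
        ultimately have "(z \<otimes>\<^bsub>A\<^esub> z') \<otimes>\<^bsub>A\<^esub> (a \<oplus>\<^bsub>A\<^esub> a') \<in> G s" by simp
        then show "\<exists>z\<in>saturation A s. z \<otimes>\<^bsub>A\<^esub> (a \<oplus>\<^bsub>A\<^esub> a') \<in> G s"
          using A.mult_saturation[OF sA z(1) z'(1)] by (rule bexI)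
      qed
    qed
    fix a q assume a: "a \<in> I" and q: "q \<in> carrier A"
    show "q \<otimes>\<^bsub>A\<^esub> a \<in> I" by (rule mult[OF a q])
    then show "a \<otimes>\<^bsub>A\<^esub> q \<in> I" using a q by (simp add: A.m_comm I_def)
  qed
  \<comment> \<open>On \<open>D(s s')\<close> the coordinates of \<open>e_x\<close> in the basis
    belonging to \<open>s\<close> are combinations of those in the basis belonging to
    \<open>s'\<close>, by a change of basis. One denominator \<open>z\<close> for \<open>s\<close>
    serves all \<open>i\<close>; the denominators for \<open>s'\<close> may vary.\<close>
  have glue1: "\<exists>z\<in>saturation A s. \<forall>i\<in>?J. \<exists>z'\<in>saturation A s'. z' \<otimes>\<^bsub>A\<^esub> (z \<otimes>\<^bsub>A\<^esub> c s i) \<in> G s'"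
    if s: "s \<in> T" and s': "s' \<in> T" for s s'
  proof -
    have sA: "s \<in> carrier A" using s TA by auto
    note bs = basis_at_funcset[OF b[OF s]] and bs' = basis_at_funcset[OF b[OF s']]
    interpret G': ideal "G s'" A by (rule G[OF s'])
    \<comment> \<open>The vectors whose coordinates in the basis for \<open>s\<close> lie in
      \<open>G s'\<close>, up to denominators. They include \<open>N\<close> and the products of
      \<open>c s' j\<close> with \<open>b s' j\<close>, hence a multiple of
      \<open>e_x\<close>.\<close>
    let ?W = "{v \<in> carrier A.FX. \<exists>z \<in> saturation A s. \<exists>g \<in> ?J \<rightarrow> carrier A. (\<forall>i\<in>?J. g i \<in> G s') \<and>
       N.mod_eq (z \<odot>\<^bsub>A.FX\<^esub> v) (lin_comb A.FX ?J g (b s))}"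
    have W: "Module.submodule ?W A A.FX"
      by (rule N.span_submodule[OF sA _ bs G[OF s'] subset_refl]) simp
    interpret W: module_with_submodule A A.FX ?W by (rule A.mod_FX[OF W])
    have WI: "v \<in> ?W" if "v \<in> carrier A.FX" "z \<in> saturation A s" "g \<in> ?J \<rightarrow> carrier A" "\<forall>i\<in>?J. g i \<in> G s'"
        "N.mod_eq (z \<odot>\<^bsub>A.FX\<^esub> v) (lin_comb A.FX ?J g (b s))" for v z g
      using that by (intro CollectI conjI bexI[of _ z] bexI[of _ g])
    have NW: "v \<in> ?W" if v: "v \<in> N" for v
    proof (rule WI[of _ "\<one>\<^bsub>A\<^esub>" "\<lambda>_. \<zero>\<^bsub>A\<^esub>"])
      have vF: "v \<in> carrier A.FX" by (rule N.sub_closed[OF v])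
      then show "v \<in> carrier A.FX" .
      show "\<one>\<^bsub>A\<^esub> \<in> saturation A s" by (rule A.one_saturation[OF sA])
      show "N.mod_eq (\<one>\<^bsub>A\<^esub> \<odot>\<^bsub>A.FX\<^esub> v) (lin_comb A.FX ?J (\<lambda>_. \<zero>\<^bsub>A\<^esub>) (b s))"
        using vF N.sub_diff[OF v N.sub_zero] by (simp add: A.FX.lin_comb_zero[OF bs] N.mod_eq_def)
    qed (use G'.zero_closed in auto)
    have term_W: "c s' j \<odot>\<^bsub>A.FX\<^esub> b s' j \<in> ?W" if j: "j \<in> ?J" for j
    proof -
      have bj: "b s' j \<in> carrier A.FX" and cj: "c s' j \<in> carrier A" using funcset_mem[OF bs' j] funcset_mem[OF c[OF s'] j] by auto
      obtain z m where z: "z \<in> saturation A s" "z \<in> carrier A" and m: "m \<in> ?J \<rightarrow> carrier A"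
        "N.mod_eq (z \<odot>\<^bsub>A.FX\<^esub> b s' j) (lin_comb A.FX ?J m (b s))" using N.basis_at_span[OF b[OF s] bj] .
      have "N.mod_eq (c s' j \<odot>\<^bsub>A.FX\<^esub> (z \<odot>\<^bsub>A.FX\<^esub> b s' j)) (c s' j \<odot>\<^bsub>A.FX\<^esub> lin_comb A.FX ?J m (b s))"
        by (rule N.mod_eq_smult[OF m(2) cj A.FX.smult_closed[OF z(2) bj] A.FX.lin_comb_closed[OF m(1) bs]])
      moreover have "c s' j \<odot>\<^bsub>A.FX\<^esub> (z \<odot>\<^bsub>A.FX\<^esub> b s' j) = z \<odot>\<^bsub>A.FX\<^esub> (c s' j \<odot>\<^bsub>A.FX\<^esub> b s' j)"
        using A.FX.smult_assoc1[OF cj z(2) bj] A.FX.smult_assoc1[OF z(2) cj bj] cj z(2) by (simp add: A.m_comm)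
      moreover have "c s' j \<odot>\<^bsub>A.FX\<^esub> lin_comb A.FX ?J m (b s) = lin_comb A.FX ?J (\<lambda>i. c s' j \<otimes>\<^bsub>A\<^esub> m i) (b s)"
        by (rule A.FX.lin_comb_smult[symmetric]) (use cj m bs in auto)
      ultimately have e: "N.mod_eq (z \<odot>\<^bsub>A.FX\<^esub> (c s' j \<odot>\<^bsub>A.FX\<^esub> b s' j)) (lin_comb A.FX ?J (\<lambda>i. c s' j \<otimes>\<^bsub>A\<^esub> m i) (b s))" by simp
      show ?thesis
      proof (rule WI[OF A.FX.smult_closed[OF cj bj] z(1) _ _ e])
        show "(\<lambda>i. c s' j \<otimes>\<^bsub>A\<^esub> m i) \<in> ?J \<rightarrow> carrier A" using cj m(1) by (simp add: Pi_iff)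
        show "\<forall>i\<in>?J. c s' j \<otimes>\<^bsub>A\<^esub> m i \<in> G s'"
        proof
          fix i assume "i \<in> ?J"
          then show "c s' j \<otimes>\<^bsub>A\<^esub> m i \<in> G s'" using m(1) by (intro G'.I_r_closed cG[OF s' j]) auto
        qed
      qed
    qed
    have "lin_comb A.FX K (c s') (b s') \<in> ?W" if "finite K" "K \<subseteq> ?J" for K
      using that
    proof (induction K)
      case empty show ?case using W.sub_zero by simp
    next
      case (insert j K)
      have "lin_comb A.FX (insert j K) (c s') (b s') = c s' j \<odot>\<^bsub>A.FX\<^esub> b s' j \<oplus>\<^bsub>A.FX\<^esub> lin_comb A.FX K (c s') (b s')"
      proof (rule A.FX.finsum_insert[OF insert.hyps])
        show "(\<lambda>i. c s' i \<odot>\<^bsub>A.FX\<^esub> b s' i) \<in> K \<rightarrow> carrier A.FX"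
          by (rule Pi_I) (rule W.sub_closed[OF term_W], use insert.prems in auto)
        show "c s' j \<odot>\<^bsub>A.FX\<^esub> b s' j \<in> carrier A.FX" by (rule W.sub_closed[OF term_W]) (use insert.prems in auto)
      qed
      moreover have "c s' j \<odot>\<^bsub>A.FX\<^esub> b s' j \<in> ?W" by (rule term_W) (use insert.prems in auto)
      moreover have "lin_comb A.FX K (c s') (b s') \<in> ?W" by (rule insert.IH) (use insert.prems in auto)
      ultimately show ?case using W.subE(5) by simp
    qed
    from this[OF finite_lessThan subset_refl] have lW: "lin_comb A.FX ?J (c s') (b s') \<in> ?W" .
    have yu: "y s' \<odot>\<^bsub>A.FX\<^esub> ?u \<in> carrier A.FX" by (rule A.FX.smult_closed[OF yA[OF s'] u])
    have "y s' \<odot>\<^bsub>A.FX\<^esub> ?u \<ominus>\<^bsub>A.FX\<^esub> lin_comb A.FX ?J (c s') (b s') \<in> ?W"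
      using NW yc[OF s'] unfolding N.mod_eq_def by blast
    then have "W.mod_eq (y s' \<odot>\<^bsub>A.FX\<^esub> ?u) (lin_comb A.FX ?J (c s') (b s'))" unfolding W.mod_eq_def .
    then have "y s' \<odot>\<^bsub>A.FX\<^esub> ?u \<in> ?W" by (rule W.mod_eq_in[OF _ yu lW])
    then obtain z g where z: "z \<in> saturation A s" and g: "g \<in> ?J \<rightarrow> carrier A" "\<forall>i\<in>?J. g i \<in> G s'"
      "N.mod_eq (z \<odot>\<^bsub>A.FX\<^esub> (y s' \<odot>\<^bsub>A.FX\<^esub> ?u)) (lin_comb A.FX ?J g (b s))" by auto
    note zA = A.saturation_closed[OF z]
    let ?y = "y s" and ?y' = "y s'"
    note yS = yA[OF s] and yS' = yA[OF s']
    have l1: "lin_comb A.FX ?J g (b s) \<in> carrier A.FX" by (rule A.FX.lin_comb_closed[OF g(1) bs])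
    have l2: "lin_comb A.FX ?J (c s) (b s) \<in> carrier A.FX" by (rule A.FX.lin_comb_closed[OF c[OF s] bs])
    have yu': "?y \<odot>\<^bsub>A.FX\<^esub> ?u \<in> carrier A.FX" by (rule A.FX.smult_closed[OF yS u])
    have e1: "N.mod_eq (?y \<odot>\<^bsub>A.FX\<^esub> (z \<odot>\<^bsub>A.FX\<^esub> (?y' \<odot>\<^bsub>A.FX\<^esub> ?u))) (?y \<odot>\<^bsub>A.FX\<^esub> lin_comb A.FX ?J g (b s))"
      by (rule N.mod_eq_smult[OF g(3) yS A.FX.smult_closed[OF zA yu] l1])
    have e2: "N.mod_eq ((z \<otimes>\<^bsub>A\<^esub> ?y') \<odot>\<^bsub>A.FX\<^esub> (?y \<odot>\<^bsub>A.FX\<^esub> ?u)) ((z \<otimes>\<^bsub>A\<^esub> ?y') \<odot>\<^bsub>A.FX\<^esub> lin_comb A.FX ?J (c s) (b s))"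
      by (rule N.mod_eq_smult[OF yc[OF s] _ yu' l2]) (use zA yS' in simp)
    have e3: "?y \<odot>\<^bsub>A.FX\<^esub> (z \<odot>\<^bsub>A.FX\<^esub> (?y' \<odot>\<^bsub>A.FX\<^esub> ?u)) = (z \<otimes>\<^bsub>A\<^esub> ?y') \<odot>\<^bsub>A.FX\<^esub> (?y \<odot>\<^bsub>A.FX\<^esub> ?u)"
      using zA yS yS' u by (simp add: A.FX.smult_assoc1[symmetric] A.m_ac)
    have e4: "(z \<otimes>\<^bsub>A\<^esub> ?y') \<odot>\<^bsub>A.FX\<^esub> lin_comb A.FX ?J (c s) (b s) = lin_comb A.FX ?J (\<lambda>i. (z \<otimes>\<^bsub>A\<^esub> ?y') \<otimes>\<^bsub>A\<^esub> c s i) (b s)"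
      by (rule A.FX.lin_comb_smult[symmetric]) (use zA yS' c[OF s] bs in auto)
    have e5: "?y \<odot>\<^bsub>A.FX\<^esub> lin_comb A.FX ?J g (b s) = lin_comb A.FX ?J (\<lambda>i. ?y \<otimes>\<^bsub>A\<^esub> g i) (b s)"
      by (rule A.FX.lin_comb_smult[symmetric]) (use yS g bs in auto)
    have f1: "(\<lambda>i. (z \<otimes>\<^bsub>A\<^esub> ?y') \<otimes>\<^bsub>A\<^esub> c s i) \<in> ?J \<rightarrow> carrier A" using zA yS' c[OF s] by (simp add: Pi_iff)
    have f2: "(\<lambda>i. ?y \<otimes>\<^bsub>A\<^esub> g i) \<in> ?J \<rightarrow> carrier A" using yS g(1) by (simp add: Pi_iff)
    \<comment> \<open>Two coordinate vectors of one multiple of \<open>e_x\<close> in the same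
      basis: one comes from \<open>c s\<close>, the other has entries in
      \<open>G s'\<close>.\<close>
    have "N.mod_eq (lin_comb A.FX ?J (\<lambda>i. (z \<otimes>\<^bsub>A\<^esub> ?y') \<otimes>\<^bsub>A\<^esub> c s i) (b s)) (lin_comb A.FX ?J (\<lambda>i. ?y \<otimes>\<^bsub>A\<^esub> g i) (b s))"
      unfolding e4[symmetric] e5[symmetric]
      by (rule N.mod_eq_trans[OF N.mod_eq_sym[OF e2] e1[unfolded e3]])
         (use zA yS yS' yu' l1 l2 in \<open>auto intro!: A.FX.smult_closed\<close>)
    then obtain q where q: "q \<in> saturation A s" "q \<in> carrier A"
      "\<And>i. i \<in> ?J \<Longrightarrow> q \<otimes>\<^bsub>A\<^esub> ((z \<otimes>\<^bsub>A\<^esub> ?y') \<otimes>\<^bsub>A\<^esub> c s i) = q \<otimes>\<^bsub>A\<^esub> (?y \<otimes>\<^bsub>A\<^esub> g i)"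
      using N.basis_at_indep_eq[OF b[OF s] finite_lessThan f1 f2] by metis
    have "?y' \<otimes>\<^bsub>A\<^esub> ((q \<otimes>\<^bsub>A\<^esub> z) \<otimes>\<^bsub>A\<^esub> c s i) \<in> G s'" if i: "i \<in> ?J" for i
    proof -
      have ci: "c s i \<in> carrier A" and gi: "g i \<in> carrier A" using funcset_mem[OF c[OF s] i] funcset_mem[OF g(1) i] by auto
      have "?y' \<otimes>\<^bsub>A\<^esub> ((q \<otimes>\<^bsub>A\<^esub> z) \<otimes>\<^bsub>A\<^esub> c s i) = q \<otimes>\<^bsub>A\<^esub> ((z \<otimes>\<^bsub>A\<^esub> ?y') \<otimes>\<^bsub>A\<^esub> c s i)"
        using q(2) zA yS' ci by (simp add: A.m_ac)
      also have "\<dots> = (q \<otimes>\<^bsub>A\<^esub> ?y) \<otimes>\<^bsub>A\<^esub> g i" using q(3)[OF i] q(2) yS gi by (simp add: A.m_assoc)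
      also have "\<dots> \<in> G s'" using g(2) i q(2) yS by (intro G'.I_l_closed) auto
      finally show ?thesis .
    qed
    then have "\<forall>i\<in>?J. \<exists>z'\<in>saturation A s'. z' \<otimes>\<^bsub>A\<^esub> ((q \<otimes>\<^bsub>A\<^esub> z) \<otimes>\<^bsub>A\<^esub> c s i) \<in> G s'"
      by (intro ballI bexI[OF _ y[OF s']])
    then show ?thesis using A.mult_saturation[OF sA q(1) z] by (rule bexI)
  qed
  \<comment> \<open>Induction over the finite cover multiplies the denominators obtained for the
    single \<open>s'\<close>. Together with the definition of \<open>I\<close> this says that
    \<open>I\<close> restricts to \<open>G s\<close> on \<open>D(s)\<close>.\<close>
  have glue: "\<exists>z\<in>saturation A s. \<forall>i\<in>?J. z \<otimes>\<^bsub>A\<^esub> c s i \<in> I" if s: "s \<in> T" for s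
  proof -
    have sA: "s \<in> carrier A" using s TA by auto
    have cc: "c s i \<in> carrier A" if "i \<in> ?J" for i using c[OF s] that by auto
    have "\<exists>z\<in>saturation A s. \<forall>s'\<in>T'. \<forall>i\<in>?J. \<exists>z'\<in>saturation A s'. z' \<otimes>\<^bsub>A\<^esub> (z \<otimes>\<^bsub>A\<^esub> c s i) \<in> G s'" if "finite T'" "T' \<subseteq> T" for T'
      using that
    proof (induction T')
      case empty show ?case using A.one_saturation[OF sA] by blast
    next
      case (insert t T')
      then obtain z where z: "z \<in> saturation A s" "\<forall>s'\<in>T'. \<forall>i\<in>?J. \<exists>z'\<in>saturation A s'. z' \<otimes>\<^bsub>A\<^esub> (z \<otimes>\<^bsub>A\<^esub> c s i) \<in> G s'" by auto
      have t: "t \<in> T" using insert.prems by auto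
      obtain w where w: "w \<in> saturation A s" "\<forall>i\<in>?J. \<exists>z'\<in>saturation A t. z' \<otimes>\<^bsub>A\<^esub> (w \<otimes>\<^bsub>A\<^esub> c s i) \<in> G t"
        using glue1[OF s t] by blast
      note zA = A.saturation_closed[OF z(1)] and wA = A.saturation_closed[OF w(1)]
      have ext: "z' \<otimes>\<^bsub>A\<^esub> ((z \<otimes>\<^bsub>A\<^esub> w) \<otimes>\<^bsub>A\<^esub> c s i) \<in> G s'"
        if "s' \<in> T" "i \<in> ?J" "z' \<in> saturation A s'" "z' \<otimes>\<^bsub>A\<^esub> (p \<otimes>\<^bsub>A\<^esub> c s i) \<in> G s'" "p = z \<and> p' = w \<or> p = w \<and> p' = z" for s' i z' p p'
      proof -
        have pA: "p \<in> carrier A" "p' \<in> carrier A" using that(5) zA wA by auto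
        note z'A = A.saturation_closed[OF that(3)]
        have "p' \<otimes>\<^bsub>A\<^esub> (z' \<otimes>\<^bsub>A\<^esub> (p \<otimes>\<^bsub>A\<^esub> c s i)) \<in> G s'" by (rule ideal.I_l_closed[OF G[OF that(1)] that(4) pA(2)])
        moreover have "p' \<otimes>\<^bsub>A\<^esub> (z' \<otimes>\<^bsub>A\<^esub> (p \<otimes>\<^bsub>A\<^esub> c s i)) = z' \<otimes>\<^bsub>A\<^esub> ((z \<otimes>\<^bsub>A\<^esub> w) \<otimes>\<^bsub>A\<^esub> c s i)"
          using that(5) zA wA z'A cc[OF that(2)] by (auto simp: A.m_ac)
        ultimately show ?thesis by simp
      qed
      have st: "\<exists>z'\<in>saturation A s'. z' \<otimes>\<^bsub>A\<^esub> ((z \<otimes>\<^bsub>A\<^esub> w) \<otimes>\<^bsub>A\<^esub> c s i) \<in> G s'" if s': "s' \<in> insert t T'" and i: "i \<in> ?J" for s' i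
      proof (cases "s' = t")
        case True
        obtain z' where z': "z' \<in> saturation A t" "z' \<otimes>\<^bsub>A\<^esub> (w \<otimes>\<^bsub>A\<^esub> c s i) \<in> G t" using w(2) i by blast
        have "z' \<otimes>\<^bsub>A\<^esub> ((z \<otimes>\<^bsub>A\<^esub> w) \<otimes>\<^bsub>A\<^esub> c s i) \<in> G t" by (rule ext[of t i z' w z]) (use t i z' in auto)
        then show ?thesis unfolding True by (rule bexI[OF _ z'(1)])
      next
        case False
        then have s'': "s' \<in> T'" "s' \<in> T" using s' insert.prems by auto
        obtain z' where z': "z' \<in> saturation A s'" "z' \<otimes>\<^bsub>A\<^esub> (z \<otimes>\<^bsub>A\<^esub> c s i) \<in> G s'" using z(2) s''(1) i by blast
        have "z' \<otimes>\<^bsub>A\<^esub> ((z \<otimes>\<^bsub>A\<^esub> w) \<otimes>\<^bsub>A\<^esub> c s i) \<in> G s'" by (rule ext[of s' i z' z w]) (use s'' i z' in auto)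
        then show ?thesis by (rule bexI[OF _ z'(1)])
      qed
      show ?case by (rule bexI[OF _ A.mult_saturation[OF sA z(1) w(1)]]) (intro ballI st)
    qed
    from this[OF T(1) subset_refl] obtain z where z: "z \<in> saturation A s"
      "\<forall>s'\<in>T. \<forall>i\<in>?J. \<exists>z'\<in>saturation A s'. z' \<otimes>\<^bsub>A\<^esub> (z \<otimes>\<^bsub>A\<^esub> c s i) \<in> G s'" by blast
    have "z \<otimes>\<^bsub>A\<^esub> c s i \<in> I" if "i \<in> ?J" for i
      using z(2) that cc[OF that] A.saturation_closed[OF z(1)] by (simp add: I_def)
    then show ?thesis using z(1) by (intro bexI[of _ z] ballI)
  qed
  show "\<exists>I. ideal I A \<and> (\<forall>B \<phi>. k_algebra B \<and> k_algebra_hom A B \<phi> \<longrightarrow>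
     (pull (Defs.Quot n r d) A B \<phi> N \<in> vanishing_locus n r d x B) = (\<forall>a\<in>I. \<phi> a = \<zero>\<^bsub>B\<^esub>))"
  proof (intro exI[of _ I] conjI allI impI I)
    fix B :: "('k, 'b) module" and \<phi> assume B: "k_algebra B \<and> k_algebra_hom A B \<phi>"
    interpret E: tuple_extension A B n r \<phi> by (rule tuple_extension_k_algebra) (use A B r in auto)
    let ?N = "base_change B (quot_index n r) \<phi> N"
    have QN: "?N \<in> points (Defs.Quot n r d) B" by (rule E.Quot_base_change[OF Nq])
    have N': "Module.submodule ?N B E.B.FX" using QN by (simp add: Quot_points_iff)
    interpret N': module_with_submodule B E.B.FX ?N by (rule E.B.mod_FX[OF N'])
    have uB: "unit_fun B x \<in> carrier E.B.FX" by (rule unit_fun_closed[OF E.B.A_cring x])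
    have \<phi>T: "\<phi> ` T \<subseteq> carrier B" "Idl\<^bsub>B\<^esub> (\<phi> ` T) = carrier B"
      using TA ring_hom_genideal_carrier[OF A.A_cring E.B.A_cring E.hom TA T(3)] by auto
    have sat: "\<phi> z \<in> saturation B (\<phi> s)" if "s \<in> T" "z \<in> saturation A s" for s z
      by (rule ring_hom_saturation[OF A.A_cring E.B.A_cring E.hom]) (use that TA in auto)
    have bB: "(\<lambda>i. \<phi> \<circ> b s i) \<in> ?J \<rightarrow> carrier E.B.FX" if "s \<in> T" for s
      by (rule Pi_I) (rule E.X.comp_closed[OF funcset_mem[OF basis_at_funcset[OF b[OF that]]]])
    have cB: "\<phi> \<circ> c s \<in> ?J \<rightarrow> carrier B" if "s \<in> T" for s using c[OF that] by (simp add: Pi_iff)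
    have yuB: "N'.mod_eq (\<phi> (y s) \<odot>\<^bsub>E.B.FX\<^esub> unit_fun B x) (lin_comb E.B.FX ?J (\<phi> \<circ> c s) (\<lambda>i. \<phi> \<circ> b s i))" if s: "s \<in> T" for s
    proof -
      note bs = basis_at_funcset[OF b[OF s]]
      have "(\<phi> \<circ> (y s \<odot>\<^bsub>A.FX\<^esub> ?u)) \<ominus>\<^bsub>E.B.FX\<^esub> (\<phi> \<circ> lin_comb A.FX ?J (c s) (b s)) \<in> ?N"
        by (rule E.X.base_change_mod_eq[OF _ A.FX.smult_closed[OF yA[OF s] u] A.FX.lin_comb_closed[OF c[OF s] bs]])
           (use yc[OF s] in \<open>simp add: N.mod_eq_def\<close>)
      then show ?thesis
        unfolding N'.mod_eq_def E.X.comp_lin_comb[OF finite_lessThan c[OF s] bs] E.X.comp_smult[OF u yA[OF s]] E.X.comp_unit_fun .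
    qed
    have pull: "pull (Defs.Quot n r d) A B \<phi> N \<in> vanishing_locus n r d x B \<longleftrightarrow> unit_fun B x \<in> ?N"
      using QN by (simp add: vanishing_locus_def) (simp add: Quot_def)
    show "(pull (Defs.Quot n r d) A B \<phi> N \<in> vanishing_locus n r d x B) = (\<forall>a\<in>I. \<phi> a = \<zero>\<^bsub>B\<^esub>)"
      unfolding pull
    proof
      assume uN: "unit_fun B x \<in> ?N"
      show "\<forall>a\<in>I. \<phi> a = \<zero>\<^bsub>B\<^esub>"
      proof
        fix a assume a: "a \<in> I"
        then have aA: "a \<in> carrier A" by (simp add: I_def)
        \<comment> \<open>The annihilator of \<open>\<phi> a\<close> is shown to be the unit ideal,
          locally on the pulled back cover: there the coordinates of \<open>e_x\<close> vanish up to
          denominators by independence, and a multiple of \<open>a\<close> is a combination of these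
          coordinates.\<close>
        let ?K = "{\<beta> \<in> carrier B. \<beta> \<otimes>\<^bsub>B\<^esub> \<phi> a = \<zero>\<^bsub>B\<^esub>}"
        have \<phi>a: "\<phi> a \<in> carrier B" using aA by simp
        have K: "ideal ?K B" by (rule E.B.annihilator_ideal[OF \<phi>a])
        have "?K = carrier B"
        proof (rule E.B.ideal_eq_carrier_local[OF K \<phi>T])
          fix t assume "t \<in> \<phi> ` T"
          then obtain s where s: "s \<in> T" "t = \<phi> s" by auto
          have sA: "s \<in> carrier A" using s TA by auto
          note bs = basis_at_funcset[OF b[OF s(1)]]
          have "\<phi> (y s) \<odot>\<^bsub>E.B.FX\<^esub> unit_fun B x \<in> ?N" by (rule N'.subE(4)[OF _ uN]) (use yA[OF s(1)] in simp)
          then have "lin_comb E.B.FX ?J (\<phi> \<circ> c s) (\<lambda>i. \<phi> \<circ> b s i) \<in> ?N"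
            by (intro N'.mod_eq_in[OF N'.mod_eq_sym[OF yuB[OF s(1)]]])
               (use yA[OF s(1)] uB E.B.FX.lin_comb_closed[OF cB[OF s(1)] bB[OF s(1)]] in auto)
          then obtain w where w: "w \<in> saturation B (\<phi> s)" "w \<in> carrier B" "\<And>i. i \<in> ?J \<Longrightarrow> w \<otimes>\<^bsub>B\<^esub> (\<phi> \<circ> c s) i = \<zero>\<^bsub>B\<^esub>"
            using N'.basis_at_indep[OF E.X.basis_at_base_change[OF N b[OF s(1)] sA finite_lessThan] cB[OF s(1)]] by metis
          obtain z where z: "z \<in> saturation A s" "z \<otimes>\<^bsub>A\<^esub> a \<in> G s" using a s by (auto simp: I_def)
          note zA = A.saturation_closed[OF z(1)]
          let ?M = "{e \<in> carrier A. w \<otimes>\<^bsub>B\<^esub> \<phi> e = \<zero>\<^bsub>B\<^esub>}"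
          have "ideal ?M A"
          proof (rule idealI)
            show "ring A" by unfold_locales
            show "subgroup ?M (add_monoid A)"
              by (rule A.add.subgroupI) (use w(2) A.zero_closed in \<open>auto simp: E.B.r_distr E.B.r_minus intro!: exI[of _ "\<zero>\<^bsub>A\<^esub>"]\<close>)
            fix e q assume e: "e \<in> ?M" and q: "q \<in> carrier A"
            show "q \<otimes>\<^bsub>A\<^esub> e \<in> ?M" using e q w(2) E.B.m_lcomm[of w "\<phi> q" "\<phi> e"] by simp
            then show "e \<otimes>\<^bsub>A\<^esub> q \<in> ?M" using e q A.m_comm[of e q] by simp
          qed
          then have "G s \<subseteq> ?M" unfolding G_def
            by (rule A.genideal_minimal) (use w(3) cA[OF s(1)] in auto)
          then have "w \<otimes>\<^bsub>B\<^esub> \<phi> (z \<otimes>\<^bsub>A\<^esub> a) = \<zero>\<^bsub>B\<^esub>" using z(2) by blast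
          then have "(w \<otimes>\<^bsub>B\<^esub> \<phi> z) \<otimes>\<^bsub>B\<^esub> \<phi> a = \<zero>\<^bsub>B\<^esub>" using w(2) zA aA by (simp add: E.B.m_assoc)
          then have "w \<otimes>\<^bsub>B\<^esub> \<phi> z \<in> ?K" using w(2) zA by simp
          moreover have "w \<otimes>\<^bsub>B\<^esub> \<phi> z \<in> saturation B t" unfolding s(2)
            by (rule E.B.mult_saturation[OF _ w(1) sat[OF s(1) z(1)]]) (use sA in simp)
          ultimately show "\<exists>q\<in>saturation B t. q \<in> ?K" by (rule bexI)
        qed
        then have "\<one>\<^bsub>B\<^esub> \<in> ?K" by simp
        then show "\<phi> a = \<zero>\<^bsub>B\<^esub>" using \<phi>a by simp
      qed
    next
      assume 0: "\<forall>a\<in>I. \<phi> a = \<zero>\<^bsub>B\<^esub>"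
      \<comment> \<open>The scalars that multiply \<open>e_x\<close> into the base change. Over
        \<open>D(\<phi> s)\<close> the coordinates of \<open>e_x\<close>, times a denominator, are
        images of elements of \<open>I\<close> and hence zero.\<close>
      let ?K = "{\<beta> \<in> carrier B. \<beta> \<odot>\<^bsub>E.B.FX\<^esub> unit_fun B x \<in> ?N}"
      have smult: "q \<otimes>\<^bsub>B\<^esub> \<beta> \<in> ?K" if q: "q \<in> carrier B" and "\<beta> \<in> ?K" for q \<beta>
        using that N'.subE(4)[OF q, of "\<beta> \<odot>\<^bsub>E.B.FX\<^esub> unit_fun B x"] E.B.FX.smult_assoc1[OF q _ uB, of \<beta>] by simp
      have K: "ideal ?K B"
      proof (rule idealI)
        show "ring B" by unfold_locales
        show "subgroup ?K (add_monoid B)"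
        proof (rule E.B.add.subgroupI)
          have "\<zero>\<^bsub>B\<^esub> \<in> ?K" using uB N'.sub_zero by simp
          then show "?K \<noteq> {}" by blast
          fix \<beta> assume \<beta>: "\<beta> \<in> ?K"
          then show "\<ominus>\<^bsub>B\<^esub> \<beta> \<in> ?K" using smult[of "\<ominus>\<^bsub>B\<^esub> \<one>\<^bsub>B\<^esub>" \<beta>] by (simp add: E.B.l_minus)
          fix \<gamma> assume \<gamma>: "\<gamma> \<in> ?K"
          show "\<beta> \<oplus>\<^bsub>B\<^esub> \<gamma> \<in> ?K" using \<beta> \<gamma> E.B.FX.smult_l_distr[of \<beta> \<gamma> "unit_fun B x"] uB
            N'.subE(5)[of "\<beta> \<odot>\<^bsub>E.B.FX\<^esub> unit_fun B x" "\<gamma> \<odot>\<^bsub>E.B.FX\<^esub> unit_fun B x"] by simp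
        qed auto
        fix \<beta> q assume \<beta>: "\<beta> \<in> ?K" and q: "q \<in> carrier B"
        show "q \<otimes>\<^bsub>B\<^esub> \<beta> \<in> ?K" by (rule smult[OF q \<beta>])
        then show "\<beta> \<otimes>\<^bsub>B\<^esub> q \<in> ?K" using \<beta> q by (simp add: E.B.m_comm)
      qed
      have "?K = carrier B"
      proof (rule E.B.ideal_eq_carrier_local[OF K \<phi>T])
        fix t assume "t \<in> \<phi> ` T"
        then obtain s where s: "s \<in> T" "t = \<phi> s" by auto
        have sA: "s \<in> carrier A" using s TA by auto
        obtain z where z: "z \<in> saturation A s" "\<forall>i\<in>?J. z \<otimes>\<^bsub>A\<^esub> c s i \<in> I" using glue[OF s(1)] by blast
        note zA = A.saturation_closed[OF z(1)] and yS = yA[OF s(1)]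
        let ?l = "lin_comb E.B.FX ?J (\<phi> \<circ> c s) (\<lambda>i. \<phi> \<circ> b s i)"
        have l: "?l \<in> carrier E.B.FX" by (rule E.B.FX.lin_comb_closed[OF cB[OF s(1)] bB[OF s(1)]])
        have \<phi>z: "\<phi> z \<in> carrier B" and \<phi>y: "\<phi> (y s) \<in> carrier B" using zA yS by auto
        have "\<phi> z \<odot>\<^bsub>E.B.FX\<^esub> ?l = lin_comb E.B.FX ?J (\<lambda>i. \<phi> z \<otimes>\<^bsub>B\<^esub> (\<phi> \<circ> c s) i) (\<lambda>i. \<phi> \<circ> b s i)"
          by (rule E.B.FX.lin_comb_smult[symmetric, OF finite_lessThan \<phi>z cB[OF s(1)] bB[OF s(1)]])
        also have "\<dots> = \<zero>\<^bsub>E.B.FX\<^esub>"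
        proof (rule E.B.FX.lin_comb_zero[OF bB[OF s(1)]])
          fix i assume i: "i \<in> ?J"
          have "\<phi> (z \<otimes>\<^bsub>A\<^esub> c s i) = \<zero>\<^bsub>B\<^esub>" using 0 z(2) i by blast
          then show "\<phi> z \<otimes>\<^bsub>B\<^esub> (\<phi> \<circ> c s) i = \<zero>\<^bsub>B\<^esub>" using zA funcset_mem[OF c[OF s(1)] i] by simp
        qed
        finally have zl: "\<phi> z \<odot>\<^bsub>E.B.FX\<^esub> ?l \<in> ?N" using N'.sub_zero by simp
        have "N'.mod_eq (\<phi> z \<odot>\<^bsub>E.B.FX\<^esub> (\<phi> (y s) \<odot>\<^bsub>E.B.FX\<^esub> unit_fun B x)) (\<phi> z \<odot>\<^bsub>E.B.FX\<^esub> ?l)"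
          by (rule N'.mod_eq_smult[OF yuB[OF s(1)] \<phi>z E.B.FX.smult_closed[OF \<phi>y uB] l])
        then have "\<phi> z \<odot>\<^bsub>E.B.FX\<^esub> (\<phi> (y s) \<odot>\<^bsub>E.B.FX\<^esub> unit_fun B x) \<in> ?N"
          by (rule N'.mod_eq_in[OF _ E.B.FX.smult_closed[OF \<phi>z E.B.FX.smult_closed[OF \<phi>y uB]] zl])
        then have "\<phi> z \<otimes>\<^bsub>B\<^esub> \<phi> (y s) \<in> ?K" using \<phi>z \<phi>y uB by (simp add: E.B.FX.smult_assoc1)
        moreover have "\<phi> z \<otimes>\<^bsub>B\<^esub> \<phi> (y s) \<in> saturation B t" unfolding s(2)
          by (rule E.B.mult_saturation[OF _ sat[OF s(1) z(1)] sat[OF s(1) y[OF s(1)]]]) (use sA in simp)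
        ultimately show "\<exists>q\<in>saturation B t. q \<in> ?K" by (rule bexI)
      qed
      then have "\<one>\<^bsub>B\<^esub> \<in> ?K" by simp
      then show "unit_fun B x \<in> ?N" using uB by simp
    qed
  qed
qed

section \<open>Standard charts of the Grassmannian\<close>

lemma (in Module.module) basis_at_cong:
  assumes B: "basis_at R M N s J b" and eq: "\<And>i. i \<in> J \<Longrightarrow> b i = b' i"
  shows "basis_at R M N s J b'"
proof -
  have b: "b \<in> J \<rightarrow> carrier M" by (rule basis_at_funcset[OF B])
  have "lin_comb M J c b = lin_comb M J c b'" if "c \<in> J \<rightarrow> carrier R" for c
    by (rule lin_comb_cong[OF b that]) (use eq in auto)
  moreover have "b' \<in> J \<rightarrow> carrier M" using b eq by (simp add: Pi_iff)
  ultimately show ?thesis using B by (simp add: basis_at_def)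
qed

text \<open>The quotient whose class of the basis vector \<open>p\<close> has coordinates \<open>Q 0 p, \<dots>, Q (m - 1) p\<close>.\<close>

definition kernel_family :: "('k, 'b) module \<Rightarrow> nat \<Rightarrow> nat \<Rightarrow> (nat \<Rightarrow> nat \<Rightarrow> 'b) \<Rightarrow> (nat \<Rightarrow> 'b) set" where
  "kernel_family A K m Q = {v \<in> carrier (free_module A {..<K}). \<forall>i<m. pairing A (Q i) v = \<zero>\<^bsub>A\<^esub>}"

text \<open>A point of a standard chart: an \<open>m \<times> K\<close> matrix whose columns
  \<open>\<sigma> 0, ..., \<sigma> (m - 1)\<close> form the identity matrix. The other entries are
  arbitrary, so the chart is an affine space; it consists of the quotients in which the chosen
  \<open>m\<close> standard vectors form a basis.\<close>

locale kernel_chart = cring A for A :: "('k, 'b) module" (structure) +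
  fixes K m :: nat and \<sigma> :: "nat \<Rightarrow> nat" and Q :: "nat \<Rightarrow> nat \<Rightarrow> 'b"
  assumes \<sigma>: "l < m \<Longrightarrow> \<sigma> l < K"
    and Q: "i < m \<Longrightarrow> p < K \<Longrightarrow> Q i p \<in> carrier A"
    and Q\<sigma>: "i < m \<Longrightarrow> l < m \<Longrightarrow> Q i (\<sigma> l) = (if i = l then \<one> else \<zero>)"
begin

abbreviation "F \<equiv> free_module A {..<K}"
abbreviation "units \<equiv> (\<lambda>l. unit_fun A (\<sigma> l))"

sublocale F: Module.module A F by (rule free_module_module) unfold_locales

lemma A_cring: "cring A" by unfold_locales

lemma row: "i < m \<Longrightarrow> free_pairing A {..<K} (Q i)"
  by (intro free_pairing.intro free_pairing_axioms.intro A_cring Q) auto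

lemma units_closed: "units \<in> {..<m} \<rightarrow> carrier F"
  by (rule Pi_I) (rule unit_fun_closed[OF A_cring], use \<sigma> in auto)

lemma pairing_units:
  assumes i: "i < m" and c: "c \<in> {..<m} \<rightarrow> carrier A"
  shows "pairing A (Q i) (lin_comb F {..<m} c units) = c i"
proof -
  interpret P: free_pairing A "{..<K}" "Q i" by (rule row[OF i])
  have "pairing A (Q i) (lin_comb F {..<m} c units) = (\<Oplus>l\<in>{..<m}. c l \<otimes> pairing A (Q i) (units l))"
    by (rule P.pairing_lin_comb[OF finite_lessThan c units_closed])
  also have "\<dots> = (\<Oplus>l\<in>{..<m}. if i = l then c l else \<zero>)"
  proof (rule finsum_cong')
    show "c l \<otimes> pairing A (Q i) (units l) = (if i = l then c l else \<zero>)" if "l \<in> {..<m}" for l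
      using that i funcset_mem[OF c that] \<sigma>[of l] by (simp add: P.pairing_unit Q\<sigma>)
  qed (use c in auto)
  also have "\<dots> = c i" by (rule finsum_singleton[OF _ finite_lessThan c]) (use i in auto)
  finally show ?thesis .
qed

lemma kernel_family_submodule: "Module.submodule (kernel_family A K m Q) A F"
proof (rule F.submoduleI)
  have sub: "Module.submodule {w \<in> carrier F. pairing A (Q i) w = \<zero>} A F" if "i < m" for i
    by (rule free_pairing.pairing_kernel_submodule[OF row[OF that]])
  note E = F.submoduleE[OF sub]
  show "\<zero>\<^bsub>F\<^esub> \<in> kernel_family A K m Q"
    by (simp add: kernel_family_def) (use free_pairing.pairing_zero[OF row] in \<open>simp add: free_module_simps\<close>)
  show "\<ominus>\<^bsub>F\<^esub> v \<in> kernel_family A K m Q" if "v \<in> kernel_family A K m Q" for v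
    using that E(3)[of _ v] by (auto simp: kernel_family_def)
  show "v \<oplus>\<^bsub>F\<^esub> w \<in> kernel_family A K m Q" if "v \<in> kernel_family A K m Q" "w \<in> kernel_family A K m Q" for v w
    using that E(5)[of _ v w] by (auto simp: kernel_family_def)
  show "a \<odot>\<^bsub>F\<^esub> v \<in> kernel_family A K m Q" if "a \<in> carrier A" "v \<in> kernel_family A K m Q" for a v
    using that E(4)[of _ a v] by (auto simp: kernel_family_def)
qed (simp add: kernel_family_def)

sublocale N: module_with_submodule A F "kernel_family A K m Q"
  by (intro module_with_submodule.intro module_with_submodule_axioms.intro F.module_axioms kernel_family_submodule)

text \<open>Subtracting from \<open>v\<close> the combination of the chosen standard vectors with
  coefficients \<open>Q_i(v)\<close> leaves an element of the kernel, because \<open>Q\<close> is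
  the identity on these vectors. The only denominator is \<open>1\<close>, so the basis is good at
  every \<open>s\<close>.\<close>

lemma kernel_family_basis:
  assumes s: "s \<in> carrier A"
  shows "basis_at A F (kernel_family A K m Q) s {..<m} units"
proof (rule N.basis_atI[OF units_closed])
  fix v assume v: "v \<in> carrier F"
  let ?c = "\<lambda>i. pairing A (Q i) v"
  have c: "?c \<in> {..<m} \<rightarrow> carrier A"
    by (rule Pi_I) (rule free_pairing.pairing_closed[OF row v], simp)
  have l: "lin_comb F {..<m} ?c units \<in> carrier F" by (rule F.lin_comb_closed[OF c units_closed])
  have "pairing A (Q i) (v \<ominus>\<^bsub>F\<^esub> lin_comb F {..<m} ?c units) = \<zero>" if i: "i < m" for i
    unfolding free_pairing.pairing_minus[OF row[OF i] v l] pairing_units[OF i c]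
    using funcset_mem[OF c, of i] i by (simp add: a_minus_def r_neg)
  then have "N.mod_eq (\<one> \<odot>\<^bsub>F\<^esub> v) (lin_comb F {..<m} ?c units)"
    unfolding N.mod_eq_def using v l by (simp add: kernel_family_def)
  then show "\<exists>x\<in>saturation A s. \<exists>c\<in>{..<m} \<rightarrow> carrier A. N.mod_eq (x \<odot>\<^bsub>F\<^esub> v) (lin_comb F {..<m} c units)"
    by (intro bexI[of _ \<one>] bexI[of _ ?c] c one_saturation s)
next
  fix c assume c: "c \<in> {..<m} \<rightarrow> carrier A" and N: "lin_comb F {..<m} c units \<in> kernel_family A K m Q"
  have "c i = \<zero>" if "i < m" for i using N pairing_units[OF that c] that by (simp add: kernel_family_def)
  then have "\<forall>i\<in>{..<m}. \<one> \<otimes> c i = \<zero>" by simp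
  then show "\<exists>x\<in>saturation A s. \<forall>i\<in>{..<m}. x \<otimes> c i = \<zero>" by (rule bexI[OF _ one_saturation[OF s]])
qed

lemma kernel_family_locally_free: "locally_free_quotient A F (kernel_family A K m Q) m"
  unfolding locally_free_quotient_iff[OF F.module_axioms kernel_family_submodule]
proof -
  have "{s \<in> carrier A. \<exists>b. basis_at A F (kernel_family A K m Q) s {..<m} b} = carrier A"
    using kernel_family_basis by blast
  then show "Idl {s \<in> carrier A. \<exists>b. basis_at A F (kernel_family A K m Q) s {..<m} b} = carrier A"
    using genideal_self[of "carrier A"] ideal.Icarr[OF genideal_ideal[of "carrier A"]] by auto
qed

text \<open>A surjection that carries a basis to a basis is injective. So a single inclusion
  suffices to identify a submodule with a kernel family, once the chosen standard vectors form a
  basis of its quotient.\<close>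

lemma eq_kernel_family:
  assumes N: "Module.submodule N A F" and le: "N \<subseteq> kernel_family A K m Q"
    and b: "basis_at A F N s {..<m} units" and s: "s \<in> Units A"
  shows "N = kernel_family A K m Q"
proof
  interpret M: module_with_submodule A F N
    by (intro module_with_submodule.intro module_with_submodule_axioms.intro F.module_axioms N)
  show "kernel_family A K m Q \<subseteq> N"
  proof
    fix w assume w: "w \<in> kernel_family A K m Q"
    then have wF: "w \<in> carrier F" by (simp add: kernel_family_def)
    obtain x c where x: "x \<in> saturation A s" "x \<in> carrier A" and c: "c \<in> {..<m} \<rightarrow> carrier A"
      "M.mod_eq (x \<odot>\<^bsub>F\<^esub> w) (lin_comb F {..<m} c units)" using M.basis_at_span[OF b wF] .
    have l: "lin_comb F {..<m} c units \<in> carrier F" by (rule F.lin_comb_closed[OF c(1) units_closed])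
    have xw: "x \<odot>\<^bsub>F\<^esub> w \<in> carrier F" by (rule F.smult_closed[OF x(2) wF])
    have "N.mod_eq (lin_comb F {..<m} c units) (x \<odot>\<^bsub>F\<^esub> w)"
      by (rule N.mod_eq_sym[OF _ xw l]) (use c(2) le in \<open>auto simp: M.mod_eq_def N.mod_eq_def\<close>)
    then have "lin_comb F {..<m} c units \<in> kernel_family A K m Q"
      by (rule N.mod_eq_in[OF _ l N.subE(4)[OF x(2) w]])
    then have "c i = \<zero>" if "i < m" for i using pairing_units[OF that c(1)] that by (simp add: kernel_family_def)
    then have "lin_comb F {..<m} c units = \<zero>\<^bsub>F\<^esub>" by (intro F.lin_comb_zero[OF units_closed]) simp
    then have "x \<odot>\<^bsub>F\<^esub> w \<in> N" using M.mod_eq_in[OF c(2) xw] M.sub_zero by simp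
    then have "inv x \<odot>\<^bsub>F\<^esub> (x \<odot>\<^bsub>F\<^esub> w) \<in> N" by (rule M.subE(4)[rotated]) (rule Units_inv_closed[OF saturation_Units[OF s x(1)]])
    moreover have u: "x \<in> Units A" by (rule saturation_Units[OF s x(1)])
    ultimately show "w \<in> N" using wF x(2) by (simp add: F.smult_assoc1[symmetric])
  qed
qed (rule le)

end

lemma kernel_chart_hom:
  assumes C: "kernel_chart A K m \<sigma> Q" and B: "cring (B :: ('l, 'b) module)" and \<phi>: "\<phi> \<in> Ring.ring_hom A B"
  shows "kernel_chart B K m \<sigma> (\<lambda>i. \<phi> \<circ> Q i)"
proof -
  interpret kernel_chart A K m \<sigma> Q by fact
  interpret \<phi>: ring_hom_cring A B \<phi> by (rule ring_hom_cringI'[OF A_cring B \<phi>])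
  show ?thesis by (intro kernel_chart.intro B kernel_chart_axioms.intro) (use \<sigma> Q Q\<sigma> in auto)
qed

text \<open>One inclusion is checked on images of elements, bases are preserved by base change, and
  \<open>eq_kernel_family\<close> gives the rest. The global basis over \<open>A\<close> is used as
  a basis at \<open>s = 1\<close>.\<close>

lemma base_change_kernel_family:
  assumes C: "kernel_chart A K m \<sigma> Q" and B: "cring (B :: ('l, 'b) module)" and \<phi>: "\<phi> \<in> Ring.ring_hom A B"
  shows "base_change B {..<K} \<phi> (kernel_family A K m Q) = kernel_family B K m (\<lambda>i. \<phi> \<circ> Q i)"
proof -
  interpret A: kernel_chart A K m \<sigma> Q by fact
  interpret B: kernel_chart B K m \<sigma> "\<lambda>i. \<phi> \<circ> Q i" by (rule kernel_chart_hom[OF C B \<phi>])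
  interpret E: scalar_extension A B \<phi> "{..<K}"
    by (intro scalar_extension.intro scalar_extension_axioms.intro A.A_cring B \<phi>)
  have pair: "pairing B (\<phi> \<circ> Q i) (\<phi> \<circ> v) = \<phi> (pairing A (Q i) v)" if i: "i < m" and v: "v \<in> carrier A.F" for i v
  proof -
    have v': "\<phi> \<circ> v \<in> carrier B.F" by (rule E.comp_closed[OF v])
    have out: "{x. v x \<noteq> \<zero>\<^bsub>A\<^esub>} \<subseteq> {..<K}" "{x. (\<phi> \<circ> v) x \<noteq> \<zero>\<^bsub>B\<^esub>} \<subseteq> {..<K}"
      using free_module_outside[OF v] free_module_outside[OF v'] by blast+
    have "pairing A (Q i) v = (\<Oplus>\<^bsub>A\<^esub>x\<in>{..<K}. Q i x \<otimes>\<^bsub>A\<^esub> v x)"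
      by (rule A.pairing_superset[OF finite_lessThan out(1)]) (use A.Q[OF i] v in auto)
    moreover have "pairing B (\<phi> \<circ> Q i) (\<phi> \<circ> v) = (\<Oplus>\<^bsub>B\<^esub>x\<in>{..<K}. (\<phi> \<circ> Q i) x \<otimes>\<^bsub>B\<^esub> (\<phi> \<circ> v) x)"
      by (rule B.pairing_superset[OF finite_lessThan out(2)]) (use B.Q[OF i] free_module_apply_closed[OF v'] in auto)
    moreover have "(\<Oplus>\<^bsub>B\<^esub>x\<in>{..<K}. (\<phi> \<circ> Q i) x \<otimes>\<^bsub>B\<^esub> (\<phi> \<circ> v) x) = (\<Oplus>\<^bsub>B\<^esub>x\<in>{..<K}. (\<phi> \<circ> (\<lambda>x. Q i x \<otimes>\<^bsub>A\<^esub> v x)) x)"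
      by (rule B.finsum_cong') (use A.Q[OF i] v in auto)
    ultimately show ?thesis using A.Q[OF i] v E.hom_finsum[of "\<lambda>x. Q i x \<otimes>\<^bsub>A\<^esub> v x" "{..<K}"] by (simp add: Pi_iff)
  qed
  have NF: "kernel_family A K m Q \<subseteq> carrier A.F" by (auto simp: kernel_family_def)
  show ?thesis
  proof (rule B.eq_kernel_family[OF E.base_change_submodule[OF NF]])
    show "base_change B {..<K} \<phi> (kernel_family A K m Q) \<subseteq> kernel_family B K m (\<lambda>i. \<phi> \<circ> Q i)"
    proof (rule E.base_change_minimal[OF B.kernel_family_submodule])
      fix v assume v: "v \<in> kernel_family A K m Q"
      then have vF: "v \<in> carrier A.F" by (rule A.N.sub_closed)
      show "\<phi> \<circ> v \<in> kernel_family B K m (\<lambda>i. \<phi> \<circ> Q i)"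
        using E.comp_closed[OF vF] v pair[OF _ vF] by (simp add: kernel_family_def)
    qed
    show "basis_at B B.F (base_change B {..<K} \<phi> (kernel_family A K m Q)) (\<phi> \<one>\<^bsub>A\<^esub>) {..<m} B.units"
      using E.basis_at_base_change[OF A.kernel_family_submodule A.kernel_family_basis[OF A.one_closed] A.one_closed finite_lessThan]
      by (simp only: E.comp_unit_fun)
    show "\<phi> \<one>\<^bsub>A\<^esub> \<in> Units B" by simp
  qed
qed

text \<open>Where \<open>s\<close> is invertible, the coordinates with respect to the chosen
  standard vectors are honest linear functionals. Their values on all standard vectors make up the
  matrix \<open>Q\<close>, with the identity in the chosen columns.\<close>

lemma kernel_family_of_basis:
  assumes A: "cring (A :: ('k, 'a) module)" and L: "cring (L :: ('l, 'b) module)" and \<psi>: "\<psi> \<in> Ring.ring_hom A L"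
    and N: "Module.submodule N A (free_module A {..<K})" and \<sigma>: "\<And>l. l < m \<Longrightarrow> \<sigma> l < K"
    and b: "basis_at A (free_module A {..<K}) N s {..<m} (\<lambda>l. unit_fun A (\<sigma> l))"
    and s: "s \<in> carrier A" and unit: "\<psi> s \<in> Units L"
  shows "\<exists>Q. kernel_chart L K m \<sigma> Q \<and> base_change L {..<K} \<psi> N = kernel_family L K m Q"
proof -
  interpret E: scalar_extension A L \<psi> "{..<K}"
    by (intro scalar_extension.intro scalar_extension_axioms.intro A L \<psi>)
  interpret N: module_with_submodule A "free_module A {..<K}" N by (rule E.mod_FA[OF N])
  let ?F = "free_module A {..<K}" and ?e = "\<lambda>l. unit_fun A (\<sigma> l)"
  obtain q where q0: "\<forall>i \<in> {..<m}. \<forall>v \<in> carrier ?F. q i v \<in> carrier L"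
    and coord0: "\<forall>i \<in> {..<m}. \<forall>v \<in> carrier ?F. \<forall>x \<in> carrier A. \<forall>c \<in> {..<m} \<rightarrow> carrier A.
      N.mod_eq (x \<odot>\<^bsub>?F\<^esub> v) (lin_comb ?F {..<m} c ?e) \<longrightarrow> \<psi> x \<otimes>\<^bsub>L\<^esub> q i v = \<psi> (c i)"
    and add0: "\<forall>i \<in> {..<m}. \<forall>v \<in> carrier ?F. \<forall>w \<in> carrier ?F. q i (v \<oplus>\<^bsub>?F\<^esub> w) = q i v \<oplus>\<^bsub>L\<^esub> q i w"
    and smult0: "\<forall>i \<in> {..<m}. \<forall>v \<in> carrier ?F. \<forall>a \<in> carrier A. q i (a \<odot>\<^bsub>?F\<^esub> v) = \<psi> a \<otimes>\<^bsub>L\<^esub> q i v"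
    using N.basis_at_coordinates[OF b s finite_lessThan L \<psi> unit] by (elim exE conjE) (rule that)
  note q = q0[rule_format, unfolded lessThan_iff] and coord = coord0[rule_format, unfolded lessThan_iff]
    and add = add0[rule_format, unfolded lessThan_iff] and smult = smult0[rule_format, unfolded lessThan_iff]
  define Q where "Q i p = q i (unit_fun A p)" for i p
  have unit_closed: "unit_fun A p \<in> carrier ?F" if "p < K" for p by (rule unit_fun_closed[OF A]) (use that in simp)
  have e: "?e \<in> {..<m} \<rightarrow> carrier ?F" using unit_closed \<sigma> by (simp add: Pi_iff)
  interpret C: kernel_chart L K m \<sigma> Q
  proof (intro kernel_chart.intro L kernel_chart_axioms.intro)
    show "Q i p \<in> carrier L" if "i < m" "p < K" for i p unfolding Q_def by (rule q[OF that(1) unit_closed[OF that(2)]])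
    show "Q i (\<sigma> l) = (if i = l then \<one>\<^bsub>L\<^esub> else \<zero>\<^bsub>L\<^esub>)" if i: "i < m" and l: "l < m" for i l
    proof -
      let ?c = "\<lambda>j. if j = l then \<one>\<^bsub>A\<^esub> else \<zero>\<^bsub>A\<^esub>"
      have el: "?e l \<in> carrier ?F" by (rule unit_closed[OF \<sigma>[OF l]])
      have "lin_comb ?F {..<m} ?c ?e = \<one>\<^bsub>A\<^esub> \<odot>\<^bsub>?F\<^esub> ?e l" by (rule E.FA.lin_comb_single) (use l e in auto)
      then have "N.mod_eq (\<one>\<^bsub>A\<^esub> \<odot>\<^bsub>?F\<^esub> ?e l) (lin_comb ?F {..<m} ?c ?e)" using el by simp
      then have "\<psi> \<one>\<^bsub>A\<^esub> \<otimes>\<^bsub>L\<^esub> q i (?e l) = \<psi> (?c i)" by (intro coord[OF i el]) auto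
      then show ?thesis using q[OF i el] by (simp add: Q_def split: if_splits)
    qed
  qed (rule \<sigma>)
  have NF: "N \<subseteq> carrier ?F" by (rule E.sub_FA[OF N])
  have "base_change L {..<K} \<psi> N = kernel_family L K m Q"
  proof (rule C.eq_kernel_family[OF E.base_change_submodule[OF NF] _ _ unit])
    show "basis_at L C.F (base_change L {..<K} \<psi> N) (\<psi> s) {..<m} C.units"
      using E.basis_at_base_change[OF N b s finite_lessThan] by (simp only: E.comp_unit_fun)
    show "base_change L {..<K} \<psi> N \<subseteq> kernel_family L K m Q"
    proof (rule E.base_change_minimal[OF C.kernel_family_submodule])
      fix v assume v: "v \<in> N"
      then have vF: "v \<in> carrier ?F" by (rule N.sub_closed)
      have "pairing L (Q i) (\<psi> \<circ> v) = \<zero>\<^bsub>L\<^esub>" if i: "i < m" for i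
      proof -
        have "pairing L (\<lambda>x. q i (unit_fun A x)) (\<psi> \<circ> v) = q i v"
          by (rule E.semilinear_eq_pairing[OF q[OF i] add[OF i] smult[OF i] vF])
        moreover have "\<psi> \<one>\<^bsub>A\<^esub> \<otimes>\<^bsub>L\<^esub> q i v = \<psi> \<zero>\<^bsub>A\<^esub>"
        proof (rule coord[OF i vF, of _ "\<lambda>_. \<zero>\<^bsub>A\<^esub>"])
          show "N.mod_eq (\<one>\<^bsub>A\<^esub> \<odot>\<^bsub>?F\<^esub> v) (lin_comb ?F {..<m} (\<lambda>_. \<zero>\<^bsub>A\<^esub>) ?e)"
            using vF N.sub_diff[OF v N.sub_zero] by (simp add: E.FA.lin_comb_zero[OF e] N.mod_eq_def)
        qed auto
        ultimately show ?thesis using q[OF i vF] unfolding Q_def by simp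
      qed
      then show "\<psi> \<circ> v \<in> kernel_family L K m Q" using E.comp_closed[OF vF] by (simp add: kernel_family_def)
    qed
  qed
  then show ?thesis using C.kernel_chart_axioms by blast
qed

text \<open>The vectors of a local basis are exchanged for standard vectors one by one,
  \<open>G j\<close> recording that the first \<open>j\<close> have been replaced. As the standard
  vectors generate the free module, their \<open>j\<close>-th coordinates generate the unit ideal
  locally, so the corresponding sets \<open>D(s c_j)\<close> cover \<open>D(s)\<close>. The argument
  takes the place of one with maximal minors.\<close>

lemma standard_charts_cover:
  assumes A: "cring (A :: ('k, 'b) module)" and N: "Module.submodule N A (free_module A {..<K})"
    and lf: "locally_free_quotient A (free_module A {..<K}) N m"
  shows "Idl\<^bsub>A\<^esub> {s \<in> carrier A. \<exists>\<sigma>. (\<forall>l<m. \<sigma> l < K) \<and>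
    basis_at A (free_module A {..<K}) N s {..<m} (\<lambda>l. unit_fun A (\<sigma> l))} = carrier A" (is "Idl\<^bsub>A\<^esub> ?S = _")
proof -
  interpret A: cring A by fact
  let ?F = "free_module A {..<K}"
  have F: "Module.module A ?F" by (rule free_module_module[OF A])
  interpret N: module_with_submodule A ?F N
    using F N by (simp add: module_with_submodule_def module_with_submodule_axioms_def)
  define G where "G j = {s \<in> carrier A. \<exists>b. basis_at A ?F N s {..<m} b \<and> (\<forall>l<j. \<exists>p<K. b l = unit_fun A p)}" for j
  have GA: "G j \<subseteq> carrier A" for j by (auto simp: G_def)
  have "Idl\<^bsub>A\<^esub> G j = carrier A" if "j \<le> m" for j
    using that
  proof (induction j)
    case 0
    then show ?case using lf unfolding locally_free_quotient_iff[OF F N] G_def by simp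
  next
    case (Suc j)
    then have j: "j \<in> {..<m}" and IH: "Idl\<^bsub>A\<^esub> G j = carrier A" by auto
    have I: "ideal (Idl\<^bsub>A\<^esub> G (Suc j)) A" by (rule A.genideal_ideal[OF GA])
    show ?case
    proof (rule A.ideal_eq_carrier_local[OF I GA IH])
      fix s assume "s \<in> G j"
      then obtain b where sA: "s \<in> carrier A" and b: "basis_at A ?F N s {..<m} b" and bl: "\<And>l. l < j \<Longrightarrow> \<exists>p<K. b l = unit_fun A p"
        by (auto simp: G_def)
      show "\<exists>x\<in>saturation A s. x \<in> Idl\<^bsub>A\<^esub> G (Suc j)"
      proof (rule N.basis_at_span_in_ideal[OF b sA finite_lessThan j _ _ I])
        show "H = carrier ?F" if "Module.submodule H A ?F" "unit_fun A ` {..<K} \<subseteq> H" for H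
          by (rule free_module_generated[OF A that(1)]) (use that(2) in auto)
        show "unit_fun A ` {..<K} \<subseteq> carrier ?F" using unit_fun_closed[OF A, of _ "{..<K}"] by auto
        fix u x c assume u: "u \<in> unit_fun A ` {..<K}" and x: "x \<in> saturation A s" and c: "c \<in> {..<m} \<rightarrow> carrier A"
          and eq: "N.mod_eq (x \<odot>\<^bsub>?F\<^esub> u) (lin_comb ?F {..<m} c b)"
        obtain p where p: "p < K" "u = unit_fun A p" using u by auto
        have uF: "u \<in> carrier ?F" unfolding p(2) by (rule unit_fun_closed[OF A]) (use p(1) in simp)
        have "basis_at A ?F N (s \<otimes>\<^bsub>A\<^esub> c j) {..<m} (b(j := u))"
          by (rule N.basis_at_exchange[OF b sA finite_lessThan j uF x c eq])
        moreover have "\<exists>p<K. (b(j := u)) l = unit_fun A p" if "l < Suc j" for l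
          using bl[of l] p that by (cases "l = j") auto
        moreover have "s \<otimes>\<^bsub>A\<^esub> c j \<in> carrier A" using sA funcset_mem[OF c j] by simp
        ultimately have "s \<otimes>\<^bsub>A\<^esub> c j \<in> G (Suc j)" unfolding G_def by (intro CollectI conjI exI[of _ "b(j := u)"]) auto
        then show "s \<otimes>\<^bsub>A\<^esub> c j \<in> Idl\<^bsub>A\<^esub> G (Suc j)" using A.genideal_self[OF GA] by blast
      qed
    qed
  qed
  from this[OF order_refl] have Gm: "Idl\<^bsub>A\<^esub> G m = carrier A" .
  have "G m \<subseteq> ?S"
  proof
    fix s assume "s \<in> G m"
    then obtain b where sA: "s \<in> carrier A" and b: "basis_at A ?F N s {..<m} b" and bl: "\<forall>l<m. \<exists>p<K. b l = unit_fun A p"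
      by (auto simp: G_def)
    from bl obtain \<sigma> where \<sigma>: "\<And>l. l < m \<Longrightarrow> \<sigma> l < K \<and> b l = unit_fun A (\<sigma> l)" by metis
    have "basis_at A ?F N s {..<m} (\<lambda>l. unit_fun A (\<sigma> l))"
      by (rule N.basis_at_cong[OF b]) (use \<sigma> in auto)
    then show "s \<in> ?S" using sA \<sigma> by (intro CollectI conjI exI[of _ \<sigma>]) auto
  qed
  then have "Idl\<^bsub>A\<^esub> G m \<subseteq> Idl\<^bsub>A\<^esub> ?S" by (rule A.subset_Idl_subset[rotated]) auto
  then have "carrier A \<subseteq> Idl\<^bsub>A\<^esub> ?S" unfolding Gm .
  moreover have "ideal (Idl\<^bsub>A\<^esub> ?S) A" by (rule A.genideal_ideal) auto
  ultimately show ?thesis using additive_subgroup.a_subset[OF ideal.axioms(1)] by blast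
qed

section \<open>Linear algebra over the base field\<close>

context vec_space
begin

lemma subspaceI:
  assumes "W \<subseteq> carrier_vec n" "0\<^sub>v n \<in> W" "\<And>v w. v \<in> W \<Longrightarrow> w \<in> W \<Longrightarrow> v + w \<in> W" "\<And>c v. v \<in> W \<Longrightarrow> c \<cdot>\<^sub>v v \<in> W"
  shows "subspace class_ring W V"
proof (intro VectorSpace.subspace.intro LinearCombinations.submodule.intro)
  show "vectorspace class_ring V" by (rule vec_vs)
  show "Module.module class_ring V" by (rule vectorspace.axioms(1)[OF vec_vs])
qed (use assms in \<open>auto simp: module_vec_simps\<close>)

text \<open>Independent subsets of \<open>W\<close> have at most \<open>n\<close> elements, so a
  maximal one exists, and it is a basis. Independence and span mean the same in \<open>W\<close> and
  in the whole space, which relates the dimension of the subspace to vectors of the latter.\<close>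

lemma exists_basis_of_subspace:
  assumes W: "subspace class_ring W V"
  shows "\<exists>\<beta>. finite \<beta> \<and> \<beta> \<subseteq> W \<and> lin_indpt \<beta> \<and> span \<beta> = W \<and> card \<beta> = vectorspace.dim class_ring (vs W) \<and>
    vectorspace.fin_dim class_ring (vs W)"
proof -
  interpret W: vectorspace class_ring "vs W" by (rule subspace_is_vs[OF W])
  have Wm: "LinearCombinations.submodule class_ring W V" by (rule is_module[OF W])
  have WV: "W \<subseteq> carrier_vec n" using LinearCombinations.submodule.subset[OF Wm] by simp
  have ind: "W.lin_dep A = lin_dep A" if "A \<subseteq> W" for A by (rule span_li_not_depend(2)[OF that Wm])
  have "finite A \<and> card A \<le> dim" if "A \<subseteq> W \<and> W.lin_indpt A" for A
    using li_le_dim[OF fin_dim, of A] that WV ind by auto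
  moreover have "{} \<subseteq> W \<and> W.lin_indpt {}" by (simp add: W.lin_dep_def)
  ultimately have "\<exists>A. finite A \<and> maximal A (\<lambda>S. S \<subseteq> W \<and> W.lin_indpt S)" by (rule maximal_exists)
  then obtain \<beta> where \<beta>: "finite \<beta>" "maximal \<beta> (\<lambda>S. S \<subseteq> W \<and> W.lin_indpt S)" by blast
  have basis: "W.basis \<beta>" by (rule W.max_li_is_basis) (use \<beta>(2) in simp)
  then have *: "W.lin_indpt \<beta>" "W.span \<beta> = W" "\<beta> \<subseteq> W" by (auto simp: W.basis_def)
  have "W.fin_dim" unfolding W.fin_dim_def using \<beta>(1) *(2,3) by (intro exI[of _ \<beta>]) simp
  moreover have "card \<beta> = W.dim" by (rule W.dim_basis[OF \<beta>(1) basis, symmetric])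
  ultimately show ?thesis using \<beta>(1) * ind[OF *(3)] span_li_not_depend(1)[OF *(3) Wm] by (intro exI[of _ \<beta>]) simp
qed

text \<open>A basis of the smaller subspace is independent in the larger one.\<close>

lemma subspace_dim_mono:
  assumes W: "subspace class_ring W V" and U: "subspace class_ring U V" and le: "W \<subseteq> U"
  shows "vectorspace.dim class_ring (vs W) \<le> vectorspace.dim class_ring (vs U)"
proof -
  interpret U: vectorspace class_ring "vs U" by (rule subspace_is_vs[OF U])
  obtain \<beta> where \<beta>: "\<beta> \<subseteq> W" "lin_indpt \<beta>" "card \<beta> = vectorspace.dim class_ring (vs W)"
    using exists_basis_of_subspace[OF W] by auto
  have "U.fin_dim" using exists_basis_of_subspace[OF U] by auto
  moreover have "U.lin_indpt \<beta>" using span_li_not_depend(2)[OF _ is_module[OF U], of \<beta>] \<beta>(1,2) le by auto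
  ultimately have "card \<beta> \<le> U.dim" by (intro U.li_le_dim(2)) (use \<beta>(1) le in auto)
  then show ?thesis using \<beta>(3) by simp
qed

text \<open>The unit vectors with index at least \<open>r\<close> form a basis. For the matrices
  attached to a chart this subspace lies between the sum of the images and the common kernel, and so
  yields both dimension bounds in the definition of \<open>S_r\<close>.\<close>

lemma coordinate_subspace:
  assumes r: "r \<le> n"
  shows "subspace class_ring {v \<in> carrier_vec n. \<forall>i<r. v $ i = 0} V" (is "subspace _ ?U _")
    and "vectorspace.dim class_ring (vs {v \<in> carrier_vec n. \<forall>i<r. v $ i = 0}) = n - r"
proof -
  show U: "subspace class_ring ?U V" by (rule subspaceI) (use r in auto)
  interpret U: vectorspace class_ring "vs ?U" by (rule subspace_is_vs[OF U])
  let ?E = "unit_vec n ` {r..<n} :: 'a vec set"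
  have EU: "?E \<subseteq> ?U" using r by auto
  note indep = span_li_not_depend[OF EU is_module[OF U]]
  have "?E \<subseteq> set (unit_vecs n)" by (auto simp: unit_vecs_def)
  moreover have "lin_indpt (set (unit_vecs n))" using unit_vecs_basis unfolding basis_def by blast
  ultimately have "lin_indpt ?E" by (rule subset_li_is_li[rotated])
  moreover have "span ?E = ?U"
  proof
    show "span ?E \<subseteq> ?U" by (rule span_is_subset[OF EU is_module[OF U]])
    show "?U \<subseteq> span ?E"
    proof
      fix v assume v: "v \<in> ?U"
      have EV: "?E \<subseteq> carrier_vec n" by auto
      \<comment> \<open>Coefficients are indexed by the vectors themselves; the dot product with
        \<open>v\<close> returns \<open>v_i\<close> at the \<open>i\<close>-th unit vector.\<close>
      define a where "a w = (\<Sum>i<n. v $ i * w $ i)" for w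
      have au: "a (unit_vec n i) = v $ i" if "i < n" for i
      proof -
        have "a (unit_vec n i) = (\<Sum>l<n. if l = i then v $ l else 0)"
          unfolding a_def by (rule sum.cong) (use that in auto)
        then show ?thesis using that by simp
      qed
      have inj: "inj_on (unit_vec n :: nat \<Rightarrow> 'a vec) {r..<n}"
        by (rule inj_onI) (metis atLeastLessThan_iff unit_vec_eq)
      have "lincomb a ?E = v"
      proof (rule eq_vecI)
        fix i assume "i < dim_vec v"
        then have i: "i < n" using v by auto
        have "lincomb a ?E $ i = (\<Sum>w\<in>?E. a w * w $ i)" by (rule lincomb_index[OF i EV])
        also have "\<dots> = (\<Sum>l\<in>{r..<n}. a (unit_vec n l) * unit_vec n l $ i)" by (simp add: sum.reindex[OF inj])
        also have "\<dots> = (\<Sum>l\<in>{r..<n}. if l = i then v $ l else 0)" by (rule sum.cong) (use i au in auto)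
        also have "\<dots> = v $ i" using v i by (auto simp: not_le)
        finally show "lincomb a ?E $ i = v $ i" .
      next
        have "lincomb a ?E \<in> carrier_vec n" using EV by (intro lincomb_closed) auto
        then show "dim_vec (lincomb a ?E) = dim_vec v" using v by auto
      qed
      moreover have "lincomb a ?E \<in> span ?E" unfolding span_def by auto
      ultimately show "v \<in> span ?E" by simp
    qed
  qed
  ultimately have "U.basis ?E" using indep EU by (simp add: U.basis_def)
  then have "U.dim = card ?E" by (intro U.dim_basis) auto
  also have "card ?E = n - r" by (subst card_image) (auto intro!: inj_onI simp: unit_vec_eq)
  finally show "vectorspace.dim class_ring (vs ?U) = n - r" .
qed

end

section \<open>The field as an algebra over itself; images and kernels of families of
  matrices\<close>

lemma base_algebra_simps [simp]:
  "carrier base_algebra = UNIV" "mult base_algebra = (*)" "one base_algebra = 1"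
  "zero base_algebra = 0" "add base_algebra = (+)" "Module.smult base_algebra = (*)"
  by (simp_all add: base_algebra_def)

lemma base_algebra_cring: "cring (base_algebra :: ('k::field, 'k) module)"
proof (rule cringI)
  show "abelian_group (base_algebra :: ('k, 'k) module)"
    by (rule abelian_groupI) (auto simp: add.assoc add.commute intro: exI[of _ "- x" for x])
  show "comm_monoid (base_algebra :: ('k, 'k) module)"
    by (rule comm_monoidI) (auto simp: mult.assoc mult.commute)
qed (auto simp: distrib_right)

lemma finsum_base_algebra: "finsum (base_algebra :: ('k::field, 'k) module) f S = sum f S"
proof -
  interpret cring "base_algebra :: ('k, 'k) module" by (rule base_algebra_cring)
  show ?thesis by (induction S rule: infinite_finite_induct) simp_all
qed

lemma structure_map_base_algebra:
  assumes A: "k_algebra (A :: ('k::field, 'b) module)"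
  shows "structure_map A \<in> Ring.ring_hom base_algebra A"
  using structure_map_ring_hom[OF A] by (simp add: Ring.ring_hom_def)

lemma tuple_space_base_algebra: "0 < r \<Longrightarrow> tuple_space (base_algebra :: ('k::field, 'k) module) r"
  by (intro tuple_space.intro tuple_space_axioms.intro base_algebra_cring)

lemma tuple_extension_base_algebra:
  assumes A: "k_algebra (A :: ('k::field, 'b) module)" and r: "0 < r"
  shows "tuple_extension base_algebra A r (structure_map A)"
  by (intro tuple_extension.intro tuple_extension_axioms.intro tuple_space_base_algebra r
      tuple_space.intro tuple_space_axioms.intro k_algebra_cring[OF A] structure_map_base_algebra[OF A])

lemma image_sum_subspace:
  fixes X :: "nat \<Rightarrow> 'k::field mat"
  assumes X: "\<And>i. i < n \<Longrightarrow> X i \<in> carrier_mat d d"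
  shows "VectorSpace.subspace class_ring (image_sum n d X) (module_vec TYPE('k) d)"
    and "\<And>i v. i < n \<Longrightarrow> v \<in> carrier_vec d \<Longrightarrow> X i *\<^sub>v v \<in> image_sum n d X"
proof -
  interpret V: vec_space "TYPE('k)" d .
  let ?S = "\<lambda>w. finsum_vec TYPE('k) d (\<lambda>i. X i *\<^sub>v w i) {..<n}"
  have cl: "(\<lambda>i. X i *\<^sub>v w i) \<in> {..<n} \<rightarrow> carrier_vec d" if "w \<in> {..<n} \<rightarrow> carrier_vec d" for w
    by (rule Pi_I) (rule mult_mat_vec_carrier[OF X funcset_mem[OF that]], auto)
  have S: "?S w \<in> carrier_vec d" if "w \<in> {..<n} \<rightarrow> carrier_vec d" for w
    by (rule finsum_vec_closed[OF cl[OF that]])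
  have ix: "?S w $ p = (\<Sum>i<n. (X i *\<^sub>v w i) $ p)" if "p < d" "w \<in> {..<n} \<rightarrow> carrier_vec d" for w p
    by (rule index_finsum_vec[OF finite_lessThan that(1) cl[OF that(2)]])
  have eq: "x = ?S w" if "w \<in> {..<n} \<rightarrow> carrier_vec d" "x \<in> carrier_vec d" "\<And>p. p < d \<Longrightarrow> x $ p = (\<Sum>i<n. (X i *\<^sub>v w i) $ p)" for x w
    by (rule eq_vecI) (use S[OF that(1)] that ix[OF _ that(1)] in auto)
  \<comment> \<open>\<open>I\<close> and \<open>D\<close> turn membership in the image sum into
    equations between coordinates.\<close>
  have I: "x \<in> image_sum n d X" if "w \<in> {..<n} \<rightarrow> carrier_vec d" "x \<in> carrier_vec d" "\<And>p. p < d \<Longrightarrow> x $ p = (\<Sum>i<n. (X i *\<^sub>v w i) $ p)" for x w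
    unfolding image_sum_def using eq[OF that] that(1) by blast
  have D: "\<exists>w. w \<in> {..<n} \<rightarrow> carrier_vec d \<and> x \<in> carrier_vec d \<and> (\<forall>p<d. x $ p = (\<Sum>i<n. (X i *\<^sub>v w i) $ p))"
    if "x \<in> image_sum n d X" for x
  proof -
    obtain w where w: "w \<in> {..<n} \<rightarrow> carrier_vec d" "x = ?S w" using \<open>x \<in> _\<close> unfolding image_sum_def by blast
    then show ?thesis using S[OF w(1)] ix[OF _ w(1)] by (intro exI[of _ w]) simp
  qed
  show "X i *\<^sub>v v \<in> image_sum n d X" if i: "i < n" and v: "v \<in> carrier_vec d" for i v
  proof (rule I[of "\<lambda>l. if l = i then v else 0\<^sub>v d"])
    fix p assume p: "p < d"
    have "(\<Sum>l<n. (X l *\<^sub>v (if l = i then v else 0\<^sub>v d)) $ p) = (\<Sum>l<n. if l = i then (X i *\<^sub>v v) $ p else 0)"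
    proof (rule sum.cong[OF refl])
      fix l assume "l \<in> {..<n}"
      then have "X l \<in> carrier_mat d d" by (intro X) simp
      then show "(X l *\<^sub>v (if l = i then v else 0\<^sub>v d)) $ p = (if l = i then (X i *\<^sub>v v) $ p else 0)" using p by auto
    qed
    then show "(X i *\<^sub>v v) $ p = (\<Sum>l<n. (X l *\<^sub>v (if l = i then v else 0\<^sub>v d)) $ p)" using i by simp
  qed (use v X[OF i] in auto)
  show "VectorSpace.subspace class_ring (image_sum n d X) (module_vec TYPE('k) d)"
  proof (rule V.subspaceI)
    show "image_sum n d X \<subseteq> carrier_vec d" using D by blast
    show "0\<^sub>v d \<in> image_sum n d X"
    proof (rule I[of "\<lambda>_. 0\<^sub>v d"])
      fix p assume p: "p < d"
      have "(X i *\<^sub>v 0\<^sub>v d) $ p = 0" if "i < n" for i using X[OF that] p by auto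
      then show "0\<^sub>v d $ p = (\<Sum>i<n. (X i *\<^sub>v 0\<^sub>v d) $ p)" using p by simp
    qed auto
    fix x assume "x \<in> image_sum n d X"
    then obtain w where w: "w \<in> {..<n} \<rightarrow> carrier_vec d" "x \<in> carrier_vec d" "\<And>p. p < d \<Longrightarrow> x $ p = (\<Sum>i<n. (X i *\<^sub>v w i) $ p)"
      using D by blast
    show "c \<cdot>\<^sub>v x \<in> image_sum n d X" for c
    proof (rule I[of "\<lambda>i. c \<cdot>\<^sub>v w i"])
      fix p assume p: "p < d"
      have "(\<Sum>i<n. (X i *\<^sub>v (c \<cdot>\<^sub>v w i)) $ p) = (\<Sum>i<n. c * (X i *\<^sub>v w i) $ p)"
      proof (rule sum.cong[OF refl])
        fix i assume "i \<in> {..<n}"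
        then have "w i \<in> carrier_vec d" "X i \<in> carrier_mat d d" using funcset_mem[OF w(1)] X[of i] by auto
        then show "(X i *\<^sub>v (c \<cdot>\<^sub>v w i)) $ p = c * (X i *\<^sub>v w i) $ p" using p by (simp add: mult_mat_vec[of _ d d])
      qed
      then show "(c \<cdot>\<^sub>v x) $ p = (\<Sum>i<n. (X i *\<^sub>v (c \<cdot>\<^sub>v w i)) $ p)"
        using p w(2,3) by (simp add: sum_distrib_left)
    qed (use w in auto)
    fix y assume "y \<in> image_sum n d X"
    then obtain u where u: "u \<in> {..<n} \<rightarrow> carrier_vec d" "y \<in> carrier_vec d" "\<And>p. p < d \<Longrightarrow> y $ p = (\<Sum>i<n. (X i *\<^sub>v u i) $ p)"
      using D by blast
    show "x + y \<in> image_sum n d X"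
    proof (rule I[of "\<lambda>i. w i + u i"])
      fix p assume p: "p < d"
      have "(\<Sum>i<n. (X i *\<^sub>v (w i + u i)) $ p) = (\<Sum>i<n. (X i *\<^sub>v w i) $ p + (X i *\<^sub>v u i) $ p)"
      proof (rule sum.cong[OF refl])
        fix i assume "i \<in> {..<n}"
        then have "w i \<in> carrier_vec d" "u i \<in> carrier_vec d" "X i \<in> carrier_mat d d" using funcset_mem[OF w(1)] funcset_mem[OF u(1)] X[of i] by auto
        then show "(X i *\<^sub>v (w i + u i)) $ p = (X i *\<^sub>v w i) $ p + (X i *\<^sub>v u i) $ p"
          using p by (simp add: mult_add_distrib_mat_vec[of _ d d])
      qed
      then show "(x + y) $ p = (\<Sum>i<n. (X i *\<^sub>v (w i + u i)) $ p)"
        using p w(2,3) u(2,3) by (simp add: sum.distrib)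
    qed (use w u in auto)
  qed
qed

lemma common_kernel_subspace:
  fixes X :: "nat \<Rightarrow> 'k::field mat"
  assumes X: "\<And>i. i < n \<Longrightarrow> X i \<in> carrier_mat d d"
  shows "VectorSpace.subspace class_ring (common_kernel n d X) (module_vec TYPE('k) d)"
proof -
  interpret V: vec_space "TYPE('k)" d .
  have eq: "common_kernel n d X = {v \<in> carrier_vec d. \<forall>i<n. X i *\<^sub>v v = 0\<^sub>v d}"
    using X by (auto simp: common_kernel_def mat_kernel_def)
  show ?thesis unfolding eq
  proof (rule V.subspaceI)
    have "X i *\<^sub>v 0\<^sub>v d = 0\<^sub>v d" if "i < n" for i using X[OF that] by (intro eq_vecI) auto
    then show "0\<^sub>v d \<in> {v \<in> carrier_vec d. \<forall>i<n. X i *\<^sub>v v = 0\<^sub>v d}" by simp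
    fix v assume v: "v \<in> {v \<in> carrier_vec d. \<forall>i<n. X i *\<^sub>v v = 0\<^sub>v d}"
    have "X i *\<^sub>v (c \<cdot>\<^sub>v v) = 0\<^sub>v d" if "i < n" for i c using v mult_mat_vec[OF X[OF that], of v c] that by simp
    then show "c \<cdot>\<^sub>v v \<in> {v \<in> carrier_vec d. \<forall>i<n. X i *\<^sub>v v = 0\<^sub>v d}" for c using v by simp
    fix w assume w: "w \<in> {v \<in> carrier_vec d. \<forall>i<n. X i *\<^sub>v v = 0\<^sub>v d}"
    have "X i *\<^sub>v (v + w) = 0\<^sub>v d" if "i < n" for i using v w mult_add_distrib_mat_vec[OF X[OF that], of v w] that by simp
    then show "v + w \<in> {v \<in> carrier_vec d. \<forall>i<n. X i *\<^sub>v v = 0\<^sub>v d}" using v w by simp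
  qed auto
qed

section \<open>The locus \<open>S\<^sub>r\<close>\<close>

text \<open>The quotient is realised on \<open>k^r \<oplus> k^m\<close>: the \<open>e_j\<close> are
  the first \<open>r\<close> unit vectors, and \<open>X_a\<close> sends the \<open>l\<close>-th of
  them to column \<open>a r + l\<close> of \<open>Q\<close>, placed in the last \<open>m\<close>
  coordinates, and kills these coordinates. So the diagonals and all products \<open>X_a X_b\<close>
  vanish, and the subspace where the first \<open>r\<close> coordinates are zero, of dimension
  \<open>d - r\<close>, contains all images and is killed by all \<open>X_a\<close>.\<close>

lemma kernel_chart_in_S_locus:
  assumes C: "kernel_chart (base_algebra :: ('k::field, 'k) module) (n * r) m \<sigma> Q" and r: "0 < r" and d: "d = r + m"
  shows "lift_submodule base_algebra n r (kernel_family base_algebra (n * r) m Q) \<in> S_locus n r d (int r)"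
proof -
  let ?B = "base_algebra :: ('k, 'k) module"
  interpret C: kernel_chart ?B "n * r" m \<sigma> Q by (rule C)
  interpret T: tuple_space ?B n r by (rule tuple_space_base_algebra[OF r])
  interpret V: vec_space "TYPE('k)" d .
  let ?N = "lift_submodule ?B n r (kernel_family ?B (n * r) m Q)"
  note KN = C.kernel_family_submodule
  have pt: "?N \<in> points (Defs.Quot n r d) ?B"
    unfolding Quot_points_iff
    using T.lift_submodule_submodule[OF KN] T.lift_var_mult[OF KN] T.lift_locally_free[OF KN, of d] C.kernel_family_locally_free d
    by simp
  let ?P = "\<lambda>i f. pairing ?B (Q i) (lin_part r f)"
  define q where "q f = vec d (\<lambda>i. if i < r then f (i, {#}) else ?P (i - r) f)" for f :: "'k poly_tuple"
  define X where "X a = mat d d (\<lambda>(i, l). if r \<le> i \<and> l < r then Q (i - r) (a * r + l) else 0)" for a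
  have X: "X a \<in> carrier_mat d d" for a by (simp add: X_def)
  have q: "q f \<in> carrier_vec d" for f by (simp add: q_def)
  have row: "free_pairing ?B {..<n * r} (Q i)" if "i < m" for i by (rule C.row[OF that])
  have Padd: "?P i (f \<oplus>\<^bsub>T.FX\<^esub> g) = ?P i f + ?P i g" if "i < m" "f \<in> carrier T.FX" "g \<in> carrier T.FX" for i f g
    using free_pairing.pairing_add[OF row[OF that(1)] T.lin_part_closed[OF that(2)] T.lin_part_closed[OF that(3)]]
    by (simp only: T.lin_part_add) (simp add: free_module_simps)
  have Psmult: "?P i (c \<odot>\<^bsub>T.FX\<^esub> f) = c * ?P i f" if "i < m" "f \<in> carrier T.FX" for i f c
    using free_pairing.pairing_smult[OF row[OF that(1)] T.lin_part_closed[OF that(2)], of c]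
    by (simp only: T.lin_part_smult) (simp add: free_module_simps)
  have surj: "\<exists>f \<in> carrier T.FX. q f = v" if v: "v \<in> carrier_vec d" for v
  proof -
    let ?c = "\<lambda>l. v $ (r + l)"
    let ?g = "lin_embed ?B n r (lin_comb C.F {..<m} ?c C.units)"
    \<comment> \<open>A preimage of \<open>v\<close>: its first \<open>r\<close> entries as constant
      terms, the others as coefficients of the standard vectors on which \<open>Q\<close> is the
      identity.\<close>
    define f where "f x = (if snd x = {#} then (if fst x < r then v $ fst x else 0) else ?g x)" for x
    have w: "lin_comb C.F {..<m} ?c C.units \<in> carrier T.FY" by (rule C.F.lin_comb_closed[OF _ C.units_closed]) simp
    note g = T.lin_embed_closed[OF w]
    have "{x. f x \<noteq> 0} \<subseteq> {..<r} \<times> {{#}} \<union> {x. ?g x \<noteq> 0}" by (auto simp: f_def split: if_splits)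
    moreover have "finite {x. ?g x \<noteq> 0}" using g by (simp add: free_module_carrier_iff del: free_module_apply_closed)
    ultimately have "finite {x. f x \<noteq> 0}" by (elim finite_subset) simp
    moreover have "f x = 0" if "x \<notin> quot_index n r" for x
      using free_module_outside[OF g that] that by (cases x) (auto simp: f_def quot_index_def)
    ultimately have f: "f \<in> carrier T.FX" by (simp add: free_module_carrier_iff del: free_module_apply_closed)
    have "lin_part r f = lin_part r ?g" by (rule ext) (simp add: lin_part_def f_def lin_index_def)
    then have lf: "lin_part r f = lin_comb C.F {..<m} ?c C.units" using T.lin_part_lin_embed[OF w] by simp
    have "q f = v"
    proof (rule eq_vecI)
      fix i assume i: "i < dim_vec v"
      show "q f $ i = v $ i"
      proof (cases "i < r")
        case True then show ?thesis using i v by (simp add: q_def f_def)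
      next
        case False
        then have "?P (i - r) f = v $ i"
          using i v d C.pairing_units[of "i - r" ?c] unfolding lf by simp
        then show ?thesis using False i v by (simp add: q_def)
      qed
    qed (use v in \<open>simp add: q_def\<close>)
    then show ?thesis using f by blast
  qed
  have kernel: "q f = 0\<^sub>v d \<longleftrightarrow> f \<in> ?N" if f: "f \<in> carrier T.FX" for f
  proof
    assume 0: "q f = 0\<^sub>v d"
    have c: "(if i < r then f (i, {#}) else ?P (i - r) f) = 0" if "i < d" for i
      using arg_cong[OF 0, of "\<lambda>v. v $ i"] that by (simp add: q_def)
    have "f (j, {#}) = 0" for j
    proof (cases "j < r")
      case True then show ?thesis using c[of j] d by simp
    next
      case False then show ?thesis using T.FX_outside[OF f, of "(j, {#})"] by (simp add: quot_index_def)
    qed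
    moreover have "?P i f = 0" if "i < m" for i using c[of "r + i"] d that by simp
    ultimately show "f \<in> ?N" using f T.lin_part_closed[OF f] by (simp add: lift_submodule_def kernel_family_def)
  next
    assume "f \<in> ?N"
    then have "\<forall>j. f (j, {#}) = 0" "\<forall>i<m. ?P i f = 0" by (auto simp: lift_submodule_def kernel_family_def)
    then show "q f = 0\<^sub>v d" using d by (intro eq_vecI) (auto simp: q_def)
  qed
  have act: "q (var_mult ?B a f) = X a *\<^sub>v q f" if a: "a < n" and f: "f \<in> carrier T.FX" for a f
  proof (rule eq_vecI)
    fix i assume "i < dim_vec (X a *\<^sub>v q f)"
    then have i: "i < d" by (simp add: X_def)
    have Xq: "(X a *\<^sub>v q f) $ i = (\<Sum>l<d. X a $$ (i, l) * q f $ l)"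
      using i q[of f] X[of a] by (simp add: scalar_prod_def atLeast0LessThan)
    show "q (var_mult ?B a f) $ i = (X a *\<^sub>v q f) $ i"
    proof (cases "i < r")
      case True
      then show ?thesis unfolding Xq using i by (simp add: q_def X_def var_mult_def)
    next
      case False
      let ?Q = "Q (i - r)"
      have cl: "lin_part r (var_mult ?B a f) \<in> carrier T.FY" by (rule T.lin_part_closed[OF T.var_mult_closed[OF f a]])
      have "{x. lin_part r (var_mult ?B a f) x \<noteq> \<zero>\<^bsub>?B\<^esub>} \<subseteq> {..<n * r}" using free_module_outside[OF cl] by blast
      then have "?P (i - r) (var_mult ?B a f) = (\<Sum>p<n * r. ?Q p * lin_part r (var_mult ?B a f) p)"
        by (subst cring.pairing_superset[OF base_algebra_cring finite_lessThan]) (simp_all add: finsum_base_algebra)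
      \<comment> \<open>The linear part of \<open>x_a f\<close> consists of the constant terms of
        \<open>f\<close>, moved to the positions \<open>p\<close> with \<open>p div r = a\<close>.
        These are the \<open>a r + l\<close> with \<open>l < r\<close>, the indices that define
        \<open>X a\<close>.\<close>
      also have "\<dots> = (\<Sum>p<n * r. if p div r = a then ?Q p * f (p mod r, {#}) else 0)"
        by (rule sum.cong) (auto simp: lin_part_def lin_index_def var_mult_def)
      also have "\<dots> = (\<Sum>p | p < n * r \<and> p div r = a. ?Q p * f (p mod r, {#}))"
        by (simp add: sum.If_cases Int_def)
      also have "\<dots> = (\<Sum>l<r. ?Q (a * r + l) * f (l, {#}))"
      proof (rule sum.reindex_bij_witness[of _ "\<lambda>l. a * r + l" "\<lambda>p. p mod r"])
        fix l assume "l \<in> {..<r}"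
        then have l: "l < r" by simp
        have "Suc a * r \<le> n * r" using a by (intro mult_right_mono) auto
        then show "a * r + l \<in> {p. p < n * r \<and> p div r = a}" using l r by simp
      next
        fix p assume p: "p \<in> {p. p < n * r \<and> p div r = a}"
        then show e: "a * r + p mod r = p" using div_mult_mod_eq[of p r] by simp
        show "?Q (a * r + p mod r) * f (p mod r, {#}) = ?Q p * f (p mod r, {#})" unfolding e ..
      qed (use r in auto)
      also have "\<dots> = (\<Sum>l<d. if l < r then ?Q (a * r + l) * f (l, {#}) else 0)"
        using d by (intro sum.mono_neutral_cong_left) auto
      also have "\<dots> = (\<Sum>l<d. X a $$ (i, l) * q f $ l)"
        by (rule sum.cong) (use False i in \<open>auto simp: X_def q_def\<close>)
      finally show ?thesis unfolding Xq using False i by (simp add: q_def)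
    qed
  qed (simp add: q_def X_def)
  have qs: "quot_surjection n r d ?N q X"
    unfolding quot_surjection_def Let_def
  proof (intro conjI allI impI ballI)
    show "q ` carrier T.FX = carrier_vec d" using surj q by blast
    show "q (f \<oplus>\<^bsub>T.FX\<^esub> g) = q f + q g" if "f \<in> carrier T.FX" "g \<in> carrier T.FX" for f g
      using Padd[OF _ that] d by (intro eq_vecI) (auto simp: q_def free_module_simps(2)[of ?B _ f g])
    show "q (c \<odot>\<^bsub>T.FX\<^esub> f) = c \<cdot>\<^sub>v q f" if "f \<in> carrier T.FX" for c f
    proof -
      have "(c \<odot>\<^bsub>T.FX\<^esub> f) x = c * f x" for x by (simp add: free_module_simps)
      then show ?thesis using Psmult[OF _ that] d by (intro eq_vecI) (auto simp: q_def)
    qed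
    show "{f \<in> carrier T.FX. q f = 0\<^sub>v d} = ?N" using kernel T.lift_closed by blast
  qed (use X act in auto)
  have Xrow: "(X a *\<^sub>v v) $ i = 0" if "i < r" "v \<in> carrier_vec d" for a i v
    using that d by (simp add: X_def scalar_prod_def)
  have XX: "X a * X b = 0\<^sub>m d d" for a b
  proof (rule eq_matI)
    fix i j assume "i < dim_row (0\<^sub>m d d :: 'k mat)" "j < dim_col (0\<^sub>m d d :: 'k mat)"
    then have ij: "i < d" "j < d" by auto
    have "(X a * X b) $$ (i, j) = (\<Sum>l<d. X a $$ (i, l) * X b $$ (l, j))"
      using ij X[of a] X[of b] by (simp add: scalar_prod_def atLeast0LessThan)
    also have "\<dots> = 0" by (rule sum.neutral) (use ij in \<open>auto simp: X_def\<close>)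
    finally show "(X a * X b) $$ (i, j) = 0\<^sub>m d d $$ (i, j)" using ij by simp
  qed (auto simp: X_def)
  let ?U = "{v \<in> carrier_vec d. \<forall>i<r. v $ i = (0::'k)}"
  have "r \<le> d" using d by simp
  note U = V.coordinate_subspace[OF this]
  have "?U \<subseteq> common_kernel n d X"
  proof
    fix v assume v: "v \<in> ?U"
    have "X a *\<^sub>v v = 0\<^sub>v d" for a
    proof (rule eq_vecI)
      fix i assume "i < dim_vec (0\<^sub>v d :: 'k vec)"
      then have i: "i < d" by simp
      have "(X a *\<^sub>v v) $ i = (\<Sum>l<d. X a $$ (i, l) * v $ l)"
        using i v X[of a] by (auto simp: scalar_prod_def atLeast0LessThan intro!: sum.cong)
      also have "\<dots> = 0" by (rule sum.neutral) (use i v in \<open>auto simp: X_def\<close>)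
      finally show "(X a *\<^sub>v v) $ i = 0\<^sub>v d $ i" using i by simp
    qed (simp add: X_def)
    then show "v \<in> common_kernel n d X" using v by (simp add: common_kernel_def mat_kernel[OF X])
  qed
  then have "d - r \<le> subspace_dim d (common_kernel n d X)"
    using V.subspace_dim_mono[OF U(1) common_kernel_subspace[OF X]] U(2) by (simp add: Defs.subspace_dim_def)
  moreover have "image_sum n d X \<subseteq> ?U"
  proof
    fix v assume "v \<in> image_sum n d X"
    then obtain w where w: "w \<in> {..<n} \<rightarrow> carrier_vec d" "v = finsum_vec TYPE('k) d (\<lambda>i. X i *\<^sub>v w i) {..<n}"
      unfolding image_sum_def by blast
    have cl: "(\<lambda>i. X i *\<^sub>v w i) \<in> {..<n} \<rightarrow> carrier_vec d"
      by (rule Pi_I) (rule mult_mat_vec_carrier[OF X funcset_mem[OF w(1)]])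
    have "v $ p = 0" if "p < r" for p
    proof -
      have "v $ p = (\<Sum>i<n. (X i *\<^sub>v w i) $ p)"
        unfolding w(2) by (rule index_finsum_vec[OF finite_lessThan _ cl]) (use that d in simp)
      also have "\<dots> = 0" by (rule sum.neutral) (use Xrow[OF that] funcset_mem[OF w(1)] in auto)
      finally show ?thesis .
    qed
    then show "v \<in> ?U" using finsum_vec_closed[OF cl] w(2) by simp
  qed
  then have "subspace_dim d (image_sum n d X) \<le> d - r"
    using V.subspace_dim_mono[OF image_sum_subspace(1)[OF X] U(1)] U(2) by (simp add: Defs.subspace_dim_def)
  moreover have "(\<Sum>j<d. X i $$ (j, j)) = 0" for i by (rule sum.neutral) (auto simp: X_def)
  ultimately show ?thesis unfolding S_locus_def
    using pt qs XX d by (intro CollectI conjI exI[of _ q] exI[of _ X]) auto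
qed

section \<open>Points of \<open>S_r\<close> over the field satisfy the two closed conditions\<close>

lemma var_mult_unit_fun: "var_mult A i (unit_fun A (j, M)) = unit_fun A (j, add_mset i M)"
proof
  fix x
  show "var_mult A i (unit_fun A (j, M)) x = unit_fun A (j, add_mset i M) x"
    by (cases x) (auto simp: var_mult_def unit_fun_def dest: insert_DiffM)
qed

text \<open>Two variables can be split off from the monomial, so \<open>q\<close> sends it to
  \<open>X_a X_b\<close> applied to a vector.\<close>

lemma S_locus_contains_high:
  fixes N :: "'k::field poly_tuple set"
  assumes N: "N \<in> S_locus n r d k" and r: "0 < r" and x: "x \<in> quot_index n r" "size (snd x) \<ge> 2"
  shows "unit_fun base_algebra x \<in> N"
proof -
  let ?B = "base_algebra :: ('k, 'k) module"
  interpret T: tuple_space ?B n r by (rule tuple_space_base_algebra[OF r])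
  obtain q X where qs: "quot_surjection n r d N q X" and XX: "\<And>i j. i < n \<Longrightarrow> j < n \<Longrightarrow> X i * X j = 0\<^sub>m d d"
    using N by (auto simp: S_locus_def)
  obtain j M where x': "x = (j, M)" by (cases x)
  from x(2) have "M \<noteq> {#}" by (auto simp: x')
  then obtain a M1 where M1: "M = add_mset a M1" by (auto dest: multi_nonempty_split)
  with x(2) have "M1 \<noteq> {#}" by (auto simp: x')
  then obtain b M2 where M2: "M1 = add_mset b M2" by (auto dest: multi_nonempty_split)
  have ab: "a < n" "b < n" and y: "(j, M2) \<in> quot_index n r" using x(1) by (auto simp: x' M1 M2 quot_index_def)
  let ?u = "unit_fun ?B (j, M2)"
  have u: "?u \<in> carrier T.FX" by (rule unit_fun_closed[OF base_algebra_cring y])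
  have eq: "unit_fun ?B x = var_mult ?B a (var_mult ?B b ?u)" by (simp add: var_mult_unit_fun x' M1 M2)
  have qu: "q ?u \<in> carrier_vec d" and act: "q (var_mult ?B i f) = X i *\<^sub>v q f" and X: "X i \<in> carrier_mat d d"
    if "i < n" "f \<in> carrier T.FX" for i f
    using qs u that unfolding quot_surjection_def Let_def by blast+
  have "q (unit_fun ?B x) = X a *\<^sub>v (X b *\<^sub>v q ?u)"
    unfolding eq act[OF ab(1) T.var_mult_closed[OF u ab(2)]] act[OF ab(2) u] ..
  also have "\<dots> = (X a * X b) *\<^sub>v q ?u"
    by (rule assoc_mult_mat_vec[symmetric, OF X[OF ab(1) u] X[OF ab(2) u] qu[OF ab(1) u]])
  also have "\<dots> = 0\<^sub>v d" unfolding XX[OF ab] using qu[OF ab(1) u] by (intro eq_vecI) auto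
  finally have "q (unit_fun ?B x) = 0\<^sub>v d" .
  moreover have "unit_fun ?B x \<in> carrier T.FX" by (rule unit_fun_closed[OF base_algebra_cring x(1)])
  ultimately show ?thesis using qs unfolding quot_surjection_def Let_def by blast
qed

text \<open>
  Otherwise one \<open>e\<^sub>j\<close> would be superfluous: then \<open>'k\<^sup>d\<close> would be spanned by \<open>\<Sum> im X\<^sub>i\<close>, of dimension at most
  \<open>d - r\<close>, and the images of \<open>r - 1\<close> vectors.
\<close>

lemma S_locus_deg0:
  fixes N :: "'k::field poly_tuple set"
  assumes N: "N \<in> S_locus n r d (int r)" and r: "0 < r" "r \<le> d" and f: "f \<in> N"
  shows "f (j, {#}) = 0"
proof (rule ccontr)
  assume nz: "f (j, {#}) \<noteq> 0"
  let ?B = "base_algebra :: ('k, 'k) module"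
  interpret T: tuple_space ?B n r by (rule tuple_space_base_algebra[OF r(1)])
  interpret V: vec_space "TYPE('k)" d .
  obtain q X where qs: "quot_surjection n r d N q X" and dim: "subspace_dim d (image_sum n d X) \<le> d - r"
    using N r(2) by (auto simp: S_locus_def)
  have onto: "q ` carrier T.FX = carrier_vec d"
    and qadd: "\<And>f g. f \<in> carrier T.FX \<Longrightarrow> g \<in> carrier T.FX \<Longrightarrow> q (f \<oplus>\<^bsub>T.FX\<^esub> g) = q f + q g"
    and qsmult: "\<And>c f. f \<in> carrier T.FX \<Longrightarrow> q (c \<odot>\<^bsub>T.FX\<^esub> f) = c \<cdot>\<^sub>v q f"
    and ker: "{f \<in> carrier T.FX. q f = 0\<^sub>v d} = N"
    and X: "\<And>i. i < n \<Longrightarrow> X i \<in> carrier_mat d d"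
    and act: "\<And>i f. i < n \<Longrightarrow> f \<in> carrier T.FX \<Longrightarrow> q (var_mult ?B i f) = X i *\<^sub>v q f"
    using qs unfolding quot_surjection_def Let_def by blast+
  have q: "q f \<in> carrier_vec d" if "f \<in> carrier T.FX" for f using onto that by blast
  have fF: "f \<in> carrier T.FX" and qf: "q f = 0\<^sub>v d" using f ker by auto
  have j: "j < r" using nz T.FX_outside[OF fF, of "(j, {#})"] by (auto simp: quot_index_def)
  note W = image_sum_subspace[of n X d, OF X]
  obtain \<beta> where \<beta>: "finite \<beta>" "\<beta> \<subseteq> image_sum n d X" "V.span \<beta> = image_sum n d X" "card \<beta> \<le> d - r"
    using V.exists_basis_of_subspace[OF W(1)] dim by (auto simp: Defs.subspace_dim_def)
  let ?e = "\<lambda>l. unit_fun ?B (l, {#})"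
  have e: "?e l \<in> carrier T.FX" if "l < r" for l
    by (rule unit_fun_closed[OF base_algebra_cring]) (use that in \<open>simp add: quot_index_def\<close>)
  \<comment> \<open>A basis of the image sum together with the images of all \<open>e_l\<close>
    except \<open>e_j\<close>: at most \<open>(d - r) + (r - 1)\<close> vectors, one too few to
    span.\<close>
  define G where "G = \<beta> \<union> (\<lambda>l. q (?e l)) ` ({..<r} - {j})"
  have G: "G \<subseteq> carrier_vec d" using \<beta>(2) V.is_module[OF W(1), THEN LinearCombinations.submodule.subset] q e by (auto simp: G_def)
  have S: "LinearCombinations.submodule class_ring (V.span G) V.V" by (rule V.span_is_submodule) (use G in simp)
  note S' = LinearCombinations.submodule.m_closed[OF S, simplified] LinearCombinations.submodule.zero_closed[OF S, simplified]
    LinearCombinations.submodule.smult_closed[OF S, simplified]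
  have GS: "G \<subseteq> V.span G" by (rule V.in_own_span) (use G in simp)
  have WS: "image_sum n d X \<subseteq> V.span G" unfolding \<beta>(3)[symmetric] by (rule V.span_is_monotone) (auto simp: G_def)
  let ?H = "{g \<in> carrier T.FX. q g \<in> V.span G}"
  have smult: "c \<odot>\<^bsub>T.FX\<^esub> g \<in> ?H" if "g \<in> ?H" for c g
    using that S'(3)[of "q g" c] qsmult[of g c] T.FX.smult_closed[of c g] by simp
  have H: "Module.submodule ?H ?B T.FX"
  proof (rule T.FX.submoduleI)
    have "q \<zero>\<^bsub>T.FX\<^esub> = 0 \<cdot>\<^sub>v q \<zero>\<^bsub>T.FX\<^esub>" using qsmult[of "\<zero>\<^bsub>T.FX\<^esub>" 0] T.FX.M.zero_closed by (simp add: free_module_simps)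
    also have "\<dots> = 0\<^sub>v d" using q[OF T.FX.M.zero_closed] by (intro eq_vecI) auto
    finally show "\<zero>\<^bsub>T.FX\<^esub> \<in> ?H" using S'(2) T.FX.M.zero_closed by simp
    fix g assume g: "g \<in> ?H"
    show "c \<odot>\<^bsub>T.FX\<^esub> g \<in> ?H" for c by (rule smult[OF g])
    show "\<ominus>\<^bsub>T.FX\<^esub> g \<in> ?H" using smult[OF g, of "\<ominus>\<^bsub>?B\<^esub> \<one>\<^bsub>?B\<^esub>"] g T.FX.smult_minus_one[of g] by simp
    fix h assume h: "h \<in> ?H"
    show "g \<oplus>\<^bsub>T.FX\<^esub> h \<in> ?H" using g h S'(1)[of "q g" "q h"] qadd[of g h] T.FX.M.a_closed[of g h] by simp
  qed auto
  interpret H: module_with_submodule ?B T.FX ?H by (rule T.mod_FX[OF H])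
  \<comment> \<open>A monomial of positive degree is a variable times another one, so its class lies
    in the image of some \<open>X a\<close>.\<close>
  have pos: "unit_fun ?B x \<in> ?H" if x: "x \<in> quot_index n r" "snd x \<noteq> {#}" for x
  proof -
    obtain l a M where x': "x = (l, add_mset a M)" using x(2) by (metis multi_nonempty_split prod.collapse)
    have a: "a < n" and y: "(l, M) \<in> quot_index n r" using x(1) by (auto simp: x' quot_index_def)
    have u: "unit_fun ?B (l, M) \<in> carrier T.FX" by (rule unit_fun_closed[OF base_algebra_cring y])
    have "q (unit_fun ?B x) = X a *\<^sub>v q (unit_fun ?B (l, M))"
      unfolding x' var_mult_unit_fun[symmetric] by (rule act[OF a u])
    also have "\<dots> \<in> V.span G" using W(2)[OF _ a q[OF u]] X WS by blast
    finally show ?thesis using unit_fun_closed[OF base_algebra_cring x(1)] by simp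
  qed
  have other: "unit_fun ?B x \<in> ?H" if x: "x \<in> quot_index n r" "x \<noteq> (j, {#})" for x
  proof (cases "snd x = {#}")
    case True
    then obtain l where l: "x = (l, {#})" "l < r" "l \<noteq> j" using x by (cases x) (auto simp: quot_index_def)
    then have "q (?e l) \<in> G" by (auto simp: G_def)
    then show ?thesis using GS e[OF l(2)] l(1) by auto
  qed (rule pos[OF x(1)])
  \<comment> \<open>All terms of \<open>f\<close> except the one at \<open>e_j\<close> are
    combinations of vectors already in \<open>?H\<close>, and \<open>f\<close> itself is in the
    kernel of \<open>q\<close>. As the coefficient at \<open>e_j\<close> is nonzero, the class of
    \<open>e_j\<close> lies in the span too.\<close>
  have "unit_fun ?B (j, {#}) \<in> ?H"
  proof -
    let ?c = "f (j, {#})"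
    have ce: "?c \<odot>\<^bsub>T.FX\<^esub> ?e j \<in> carrier T.FX" by (rule T.FX.smult_closed[OF _ e[OF j]]) simp
    let ?g = "f \<ominus>\<^bsub>T.FX\<^esub> ?c \<odot>\<^bsub>T.FX\<^esub> ?e j"
    have g: "?g \<in> carrier T.FX" by (rule T.FX.M.minus_closed[OF fF ce])
    have "?g (j, {#}) = ?c \<ominus>\<^bsub>?B\<^esub> ?c"
      using fun_cong[OF free_module_minus[OF base_algebra_cring fF ce], of "(j, {#})"]
      by (simp add: free_module_simps unit_fun_def)
    then have "?g (j, {#}) = 0" using T.r_neg[of ?c] by (simp add: a_minus_def)
    then have "?g \<in> ?H"
      by (intro submodule_mem_units[OF base_algebra_cring H g] other) (use free_module_outside[OF g] in auto)
    moreover have "f \<in> ?H" using fF qf S'(2) by simp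
    ultimately have diff: "f \<ominus>\<^bsub>T.FX\<^esub> ?g \<in> ?H" by (rule H.sub_diff[rotated])
    have "f \<ominus>\<^bsub>T.FX\<^esub> ?g = ?c \<odot>\<^bsub>T.FX\<^esub> ?e j"
      using fF ce by (simp add: a_minus_def T.FX.M.minus_add T.FX.M.a_assoc[symmetric] T.FX.M.r_neg)
    from smult[OF diff[unfolded this], of "1 / ?c"] show ?thesis using nz e[OF j] T.FX.smult_one[OF e[OF j]] by (simp add: T.FX.smult_assoc1[symmetric])
  qed
  then have all: "?H = carrier T.FX"
    by (intro free_module_generated[OF base_algebra_cring H]) (use other in auto)
  have "V.span G = carrier_vec d"
  proof
    show "V.span G \<subseteq> carrier_vec d" using V.span_is_subset2[of G] G by simp
    show "carrier_vec d \<subseteq> V.span G" unfolding onto[symmetric] using all by blast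
  qed
  then have "d \<le> card G"
    using V.gen_ge_dim[of G] G \<beta>(1) V.dim_is_n by (simp add: G_def)
  also have "card G \<le> card \<beta> + card ((\<lambda>l. q (?e l)) ` ({..<r} - {j}))" unfolding G_def by (rule card_Un_le)
  also have "\<dots> \<le> (d - r) + (r - 1)"
  proof (rule add_mono[OF \<beta>(4)])
    have "card ((\<lambda>l. q (?e l)) ` ({..<r} - {j})) \<le> card ({..<r} - {j})" by (rule card_image_le) simp
    then show "card ((\<lambda>l. q (?e l)) ` ({..<r} - {j})) \<le> r - 1" using j by simp
  qed
  finally show False using r by simp
qed

text \<open>Carries the two conditions from points over the field to their pullbacks over every
  algebra, which is how \<open>contains_k_points\<close> is verified for the two kinds of closed
  loci.\<close>

lemma S_locus_base_change:
  fixes A :: "('k::field, 'b) module"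
  assumes N: "N \<in> S_locus n r d (int r)" and r: "0 < r" "r \<le> d" and A: "k_algebra A"
  defines "N' \<equiv> base_change A (quot_index n r) (structure_map A) N"
  shows "N' \<in> deg0_locus n r d A" and "x \<in> quot_index n r \<Longrightarrow> size (snd x) \<ge> 2 \<Longrightarrow> N' \<in> vanishing_locus n r d x A"
proof -
  interpret E: tuple_extension base_algebra A n r "structure_map A" by (rule tuple_extension_base_algebra[OF A r(1)])
  have Nq: "N \<in> points (Defs.Quot n r d) base_algebra" using N by (simp add: S_locus_def)
  then have NF: "N \<subseteq> carrier E.A.FX" using E.X.sub_FA by (simp add: Quot_points_iff)
  have N'q: "N' \<in> points (Defs.Quot n r d) A" unfolding N'_def by (rule E.Quot_base_change[OF Nq])
  have "w (j, {#}) = \<zero>\<^bsub>A\<^esub>" if "w \<in> N'" for w j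
  proof (rule E.base_change_deg0[OF NF])
    show "structure_map A (f (j, {#})) = \<zero>\<^bsub>A\<^esub>" if "f \<in> N" for f j
      using S_locus_deg0[OF N r that] E.X.hom_zero by simp
    show "w \<in> base_change A (quot_index n r) (structure_map A) N" using \<open>w \<in> N'\<close> by (simp add: N'_def)
  qed
  then show "N' \<in> deg0_locus n r d A" using N'q by (simp add: deg0_locus_def)
  show "N' \<in> vanishing_locus n r d x A" if "x \<in> quot_index n r" "size (snd x) \<ge> 2"
    using E.X.base_change_incl[OF S_locus_contains_high[OF N r(1) that]] N'q
    by (simp add: vanishing_locus_def N'_def E.X.comp_unit_fun)
qed

section \<open>Points of \<open>R\<^bsup>r,n\<^esup>\<close>\<close>

text \<open>Matrices are functions on all naturals, and those that arise in different ways may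
  disagree outside the \<open>m \<times> K\<close> range; the kernel sees only this range.\<close>

lemma kernel_family_cong:
  assumes A: "cring (A :: ('k, 'b) module)" and Q': "\<And>i p. i < m \<Longrightarrow> p < K \<Longrightarrow> Q' i p \<in> carrier A"
    and eq: "\<And>i p. i < m \<Longrightarrow> p < K \<Longrightarrow> Q i p = Q' i p"
  shows "kernel_family A K m Q = kernel_family A K m Q'"
proof -
  interpret cring A by fact
  have "pairing A (Q i) v = pairing A (Q' i) v" if i: "i < m" and v: "v \<in> carrier (free_module A {..<K})" for i v
    unfolding pairing_def
  proof (rule finsum_cong'[OF refl])
    have supp: "p < K" if "p \<in> {x. v x \<noteq> \<zero>\<^bsub>A\<^esub>}" for p using free_module_outside[OF v, of p] that by auto
    show "(\<lambda>p. Q' i p \<otimes>\<^bsub>A\<^esub> v p) \<in> {x. v x \<noteq> \<zero>\<^bsub>A\<^esub>} \<rightarrow> carrier A"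
      by (rule Pi_I) (use supp Q'[OF i] v in auto)
    show "Q i p \<otimes>\<^bsub>A\<^esub> v p = Q' i p \<otimes>\<^bsub>A\<^esub> v p" if "p \<in> {x. v x \<noteq> \<zero>\<^bsub>A\<^esub>}" for p
      using eq[OF i supp[OF that]] by simp
  qed
  then show ?thesis by (auto simp: kernel_family_def)
qed

lemma base_change_lifted_chart:
  assumes E: "tuple_extension A B r \<phi>" and C: "kernel_chart A (n * r) m \<sigma> Q"
    and Q': "\<And>i p. i < m \<Longrightarrow> p < n * r \<Longrightarrow> \<phi> (Q i p) = Q' i p"
  shows "base_change B (quot_index n r) \<phi> (lift_submodule A n r (kernel_family A (n * r) m Q)) =
    lift_submodule B n r (kernel_family B (n * r) m Q')"
proof -
  interpret E: tuple_extension A B n r \<phi> by (rule E)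
  interpret C: kernel_chart A "n * r" m \<sigma> Q by (rule C)
  interpret C': kernel_chart B "n * r" m \<sigma> "\<lambda>i. \<phi> \<circ> Q i" by (rule kernel_chart_hom[OF C E.B.A_cring E.hom])
  have "kernel_family B (n * r) m Q' = kernel_family B (n * r) m (\<lambda>i. \<phi> \<circ> Q i)"
    by (rule kernel_family_cong[OF E.B.A_cring C'.Q]) (use Q' in auto)
  then show ?thesis
    unfolding E.base_change_lift[OF C.kernel_family_submodule] base_change_kernel_family[OF C E.B.A_cring E.hom] by simp
qed

lemma structure_map_inj:
  assumes A: "k_algebra (A :: ('k::field, 'b) module)" and nz: "\<one>\<^bsub>A\<^esub> \<noteq> \<zero>\<^bsub>A\<^esub>"
  shows "inj (structure_map A)"
proof (rule injI)
  interpret \<kappa>: ring_hom_cring "base_algebra :: ('k, 'k) module" A "structure_map A"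
    by (rule ring_hom_cringI'[OF base_algebra_cring k_algebra_cring[OF A] structure_map_base_algebra[OF A]])
  fix c c' assume eq: "structure_map A c = structure_map A c'"
  show "c = c'"
  proof (rule ccontr)
    assume "c \<noteq> c'"
    have cl: "structure_map A b \<in> carrier A" for b using \<kappa>.hom_closed[of b] by simp
    have "structure_map A c = structure_map A (c - c') \<oplus>\<^bsub>A\<^esub> structure_map A c'" using \<kappa>.hom_add[of "c - c'" c'] by simp
    then have "structure_map A (c - c') = \<zero>\<^bsub>A\<^esub>"
      unfolding eq using \<kappa>.S.add.r_cancel_one'[OF cl cl, of c' "c - c'"] by simp
    then have "structure_map A ((c - c') * inverse (c - c')) = \<zero>\<^bsub>A\<^esub>"
      using \<kappa>.hom_mult[of "c - c'" "inverse (c - c')"] cl[of "inverse (c - c')"] by (simp del: right_inverse)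
    then show False using \<open>c \<noteq> c'\<close> nz \<kappa>.hom_one by simp
  qed
qed

lemma kernel_chart_in_Quot:
  assumes A: "k_algebra A" and r: "0 < r" and C: "kernel_chart A (n * r) m \<sigma> Q"
  shows "lift_submodule A n r (kernel_family A (n * r) m Q) \<in> points (Defs.Quot n r (r + m)) A"
proof -
  interpret C: kernel_chart A "n * r" m \<sigma> Q by (rule C)
  interpret T: tuple_space A n r by (intro tuple_space.intro tuple_space_axioms.intro C.A_cring r)
  note KN = C.kernel_family_submodule
  show ?thesis unfolding Quot_points_iff
    using T.lift_submodule_submodule[OF KN] T.lift_var_mult[OF KN] T.lift_locally_free[OF KN, of "r + m"] C.kernel_family_locally_free
    by simp
qed

lemma closed_subscheme_ideal:
  fixes A :: "('k::field, 'b) module"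
  assumes "closed_subscheme (Defs.Quot n r d) Z" "k_algebra A" "\<xi> \<in> points (Defs.Quot n r d) A"
  shows "\<exists>I. ideal I A \<and> (\<forall>(B :: ('k, 'b) module) \<phi>. k_algebra B \<longrightarrow> k_algebra_hom A B \<phi> \<longrightarrow>
    (base_change B (quot_index n r) \<phi> \<xi> \<in> Z B \<longleftrightarrow> (\<forall>a \<in> I. \<phi> a = \<zero>\<^bsub>B\<^esub>)))"
proof -
  have pull: "pull (Defs.Quot n r d) A B \<phi> \<xi> = base_change B (quot_index n r) \<phi> \<xi>" for B :: "('k, 'b) module" and \<phi>
    by (simp add: Quot_def)
  have "\<exists>I. ideal I A \<and> (\<forall>(B :: ('k, 'b) module) \<phi>. k_algebra B \<and> k_algebra_hom A B \<phi> \<longrightarrow>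
      (pull (Defs.Quot n r d) A B \<phi> \<xi> \<in> Z B \<longleftrightarrow> (\<forall>a \<in> I. \<phi> a = \<zero>\<^bsub>B\<^esub>)))"
    using assms unfolding closed_subscheme_def by blast
  then show ?thesis unfolding pull by blast
qed

text \<open>
  A closed subscheme containing the \<open>'k\<close>-points contains every point of a standard chart: the matrix entries
  are freed one at a time.  With the new entry a polynomial variable, the ideal cutting out \<open>Z\<close> vanishes at
  all its values in \<open>'k\<close>, hence vanishes because \<open>'k\<close> is infinite, and the variable can be specialised.
\<close>

lemma closed_subscheme_contains_charts:
  fixes A :: "('k::field_char_0, 'b) module"
  assumes Z: "closed_subscheme (Defs.Quot n r (r + m)) Z" and P: "contains_k_points n r Z (S_locus n r (r + m) (int r))"
    and r: "0 < r" and A: "k_algebra A" and nz: "\<one>\<^bsub>A\<^esub> \<noteq> \<zero>\<^bsub>A\<^esub>" and C: "kernel_chart A (n * r) m \<sigma> Q"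
  shows "lift_submodule A n r (kernel_family A (n * r) m Q) \<in> Z A"
proof -
  let ?K = "n * r"
  have Ac: "cring A" by (rule k_algebra_cring[OF A])
  \<comment> \<open>\<open>E\<close> is the set of positions whose entries may be arbitrary in
    \<open>A\<close>; all other entries are images of scalars. The induction runs over
    \<open>E\<close> with \<open>Q\<close> arbitrary and \<open>A\<close> fixed: the variable lives
    in an auxiliary algebra and is specialised back to \<open>A\<close>.\<close>
  have free: "lift_submodule A n r (kernel_family A ?K m Q) \<in> Z A"
    if "finite E" "kernel_chart A ?K m \<sigma> Q" "\<And>i p. i < m \<Longrightarrow> p < ?K \<Longrightarrow> (i, p) \<notin> E \<Longrightarrow> Q i p \<in> range (structure_map A)" for E Q
    using that
  proof (induction E arbitrary: Q)
    case empty
    interpret C: kernel_chart A ?K m \<sigma> Q by (rule empty.prems(1))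
    interpret \<kappa>: ring_hom_cring "base_algebra :: ('k, 'k) module" A "structure_map A"
      by (rule ring_hom_cringI'[OF base_algebra_cring Ac structure_map_base_algebra[OF A]])
    \<comment> \<open>All entries are scalars, so the point is the pullback of a point of
      \<open>S_r\<close> over the field, and \<open>Z\<close> contains it by assumption.\<close>
    define Qk where "Qk i p = inv_into UNIV (structure_map A) (Q i p)" for i p
    have Qk: "structure_map A (Qk i p) = Q i p" if "i < m" "p < ?K" for i p
      unfolding Qk_def by (rule f_inv_into_f[OF empty.prems(2)]) (use that in auto)
    have Ck: "kernel_chart (base_algebra :: ('k, 'k) module) ?K m \<sigma> Qk"
    proof (intro kernel_chart.intro kernel_chart_axioms.intro base_algebra_cring C.\<sigma>)
      fix i l assume il: "i < m" "l < m"
      have "structure_map A (Qk i (\<sigma> l)) = structure_map A (if i = l then 1 else 0)"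
        using Qk[OF il(1) C.\<sigma>[OF il(2)]] C.Q\<sigma>[OF il] \<kappa>.hom_one \<kappa>.hom_zero by simp
      then show "Qk i (\<sigma> l) = (if i = l then \<one>\<^bsub>base_algebra\<^esub> else \<zero>\<^bsub>base_algebra\<^esub>)"
        using injD[OF structure_map_inj[OF A nz]] by simp
    qed auto
    have "base_change A (quot_index n r) (structure_map A) (lift_submodule base_algebra n r (kernel_family base_algebra ?K m Qk)) \<in> Z A"
      using P kernel_chart_in_S_locus[OF Ck r refl] A unfolding contains_k_points_def by blast
    moreover have "base_change A (quot_index n r) (structure_map A) (lift_submodule base_algebra n r (kernel_family base_algebra ?K m Qk)) =
        lift_submodule A n r (kernel_family A ?K m Q)"
      by (rule base_change_lifted_chart[OF tuple_extension_base_algebra[OF A r] Ck]) (rule Qk)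
    ultimately show ?case by simp
  next
    case (insert e E)
    interpret C: kernel_chart A ?K m \<sigma> Q by (rule insert.prems(1))
    interpret \<kappa>: ring_hom_cring "base_algebra :: ('k, 'k) module" A "structure_map A"
      by (rule ring_hom_cringI'[OF base_algebra_cring Ac structure_map_base_algebra[OF A]])
    obtain i0 p0 where e: "e = (i0, p0)" by (cases e)
    \<comment> \<open>Entries in the columns \<open>\<sigma> l\<close> are \<open>0\<close> or
      \<open>1\<close> and so are scalars anyway; only a position within range and outside these
      columns has an entry to be freed.\<close>
    show ?case
    proof (cases "i0 < m \<and> p0 < ?K \<and> p0 \<notin> \<sigma> ` {..<m}")
      case False
      have str: "\<one>\<^bsub>A\<^esub> \<in> range (structure_map A)" "\<zero>\<^bsub>A\<^esub> \<in> range (structure_map A)"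
        using rangeI[of "structure_map A" 1, folded base_algebra_simps(3)] rangeI[of "structure_map A" 0, folded base_algebra_simps(4)]
        by (simp_all only: \<kappa>.hom_one \<kappa>.hom_zero)
      show ?thesis
      proof (rule insert.IH[OF insert.prems(1)])
        fix i p assume ip: "i < m" "p < ?K" "(i, p) \<notin> E"
        show "Q i p \<in> range (structure_map A)"
        proof (cases "(i, p) = e")
          case True
          then obtain l where "l < m" "p = \<sigma> l" using False ip e by auto
          then show ?thesis using C.Q\<sigma>[OF ip(1)] str by simp
        next
          case False then show ?thesis by (intro insert.prems(2)) (use ip in auto)
        qed
      qed
    next
      case True
      obtain U :: "('k, 'b) module" and \<iota> x ev where U: "k_algebra U" and \<iota>: "k_algebra_hom A U \<iota>" and x: "x \<in> carrier U"
        and ev: "\<forall>t \<in> carrier A. k_algebra_hom U A (ev t) \<and> (\<forall>a \<in> carrier A. ev t (\<iota> a) = a) \<and> ev t x = t"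
        and sep: "\<forall>u \<in> carrier U. (\<forall>c. ev (structure_map A c) u = \<zero>\<^bsub>A\<^esub>) \<longrightarrow> u = \<zero>\<^bsub>U\<^esub>"
        using exists_polynomial_algebra[OF A nz] by (elim exE conjE) (rule that)
      note ev = ev[THEN bspec, THEN conjunct1] ev[THEN bspec, THEN conjunct2, THEN conjunct1, THEN bspec]
        ev[THEN bspec, THEN conjunct2, THEN conjunct2]
      have Uc: "cring U" by (rule k_algebra_cring[OF U])
      interpret \<iota>: ring_hom_cring A U \<iota> by (rule ring_hom_cringI'[OF Ac Uc]) (use \<iota> in \<open>simp add: k_algebra_hom_def\<close>)
      \<comment> \<open>The entry at \<open>e\<close> becomes the variable \<open>x\<close>, all
        others are carried over to \<open>U\<close>; evaluating \<open>x\<close> at \<open>t\<close>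
        then puts \<open>t\<close> at this position.\<close>
      define QU where "QU i p = (if (i, p) = e then x else \<iota> (Q i p))" for i p
      have CU: "kernel_chart U ?K m \<sigma> QU"
      proof (intro kernel_chart.intro kernel_chart_axioms.intro Uc C.\<sigma>)
        show "QU i p \<in> carrier U" if "i < m" "p < ?K" for i p using x C.Q[OF that] by (simp add: QU_def)
        show "QU i (\<sigma> l) = (if i = l then \<one>\<^bsub>U\<^esub> else \<zero>\<^bsub>U\<^esub>)" if "i < m" "l < m" for i l
          using True that C.Q\<sigma>[OF that] by (auto simp: QU_def e)
      qed
      let ?\<xi> = "lift_submodule U n r (kernel_family U ?K m QU)"
      obtain J where J: "ideal J U" and JZ: "\<forall>B \<phi>. k_algebra B \<longrightarrow> k_algebra_hom U B \<phi> \<longrightarrow>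
          (base_change B (quot_index n r) \<phi> ?\<xi> \<in> Z B \<longleftrightarrow> (\<forall>a \<in> J. \<phi> a = \<zero>\<^bsub>B\<^esub>))"
        using closed_subscheme_ideal[OF Z U kernel_chart_in_Quot[OF U r CU]] by blast
      note JZ = JZ[THEN spec, THEN spec, THEN mp, THEN mp]
      have spec': "lift_submodule A n r (kernel_family A ?K m (\<lambda>i p. if (i, p) = e then t else Q i p)) \<in> Z A \<longleftrightarrow>
          (\<forall>u \<in> J. ev t u = \<zero>\<^bsub>A\<^esub>)" if t: "t \<in> carrier A" for t
      proof -
        have evt: "k_algebra_hom U A (ev t)" by (rule ev(1)[OF t])
        have "base_change A (quot_index n r) (ev t) ?\<xi> =
            lift_submodule A n r (kernel_family A ?K m (\<lambda>i p. if (i, p) = e then t else Q i p))"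
          by (rule base_change_lifted_chart[OF tuple_extension_k_algebra[OF U A evt r] CU])
             (use ev(2)[OF t C.Q] ev(3)[OF t] in \<open>simp add: QU_def\<close>)
        then show ?thesis using JZ[OF A evt] by simp
      qed
      \<comment> \<open>At a scalar value of the variable the position \<open>e\<close> leaves the
        free set, so the induction hypothesis applies. An element of \<open>J\<close> thus vanishes
        at all scalars and is zero.\<close>
      have "u = \<zero>\<^bsub>U\<^esub>" if u: "u \<in> J" for u
      proof (rule sep[THEN bspec, THEN mp, OF ideal.Icarr[OF J u]], rule allI)
        fix c
        let ?t = "structure_map A c"
        have t: "?t \<in> carrier A" using \<kappa>.hom_closed[of c] by simp
        have "lift_submodule A n r (kernel_family A ?K m (\<lambda>i p. if (i, p) = e then ?t else Q i p)) \<in> Z A"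
        proof (rule insert.IH)
          show "kernel_chart A ?K m \<sigma> (\<lambda>i p. if (i, p) = e then ?t else Q i p)"
          proof (intro kernel_chart.intro kernel_chart_axioms.intro Ac C.\<sigma>)
            show "(if (i, p) = e then ?t else Q i p) \<in> carrier A" if "i < m" "p < ?K" for i p using t C.Q[OF that] by simp
            show "(if (i, \<sigma> l) = e then ?t else Q i (\<sigma> l)) = (if i = l then \<one>\<^bsub>A\<^esub> else \<zero>\<^bsub>A\<^esub>)" if "i < m" "l < m" for i l
              using True that C.Q\<sigma>[OF that] by (auto simp: e)
          qed
          show "(if (i, p) = e then ?t else Q i p) \<in> range (structure_map A)" if "i < m" "p < ?K" "(i, p) \<notin> E" for i p
            using insert.prems(2)[OF that(1,2)] that(3) by auto
        qed
        then show "ev ?t u = \<zero>\<^bsub>A\<^esub>" using spec'[OF t] u by blast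
      qed
      then have J0: "J \<subseteq> {\<zero>\<^bsub>U\<^esub>}" by blast
      \<comment> \<open>With \<open>J = 0\<close> the specialisation lies in \<open>Z\<close> for
        every value of the variable, in particular for the original entry.\<close>
      have t: "Q i0 p0 \<in> carrier A" using C.Q[of i0 p0] True by blast
      have "ev (Q i0 p0) \<zero>\<^bsub>U\<^esub> = \<zero>\<^bsub>A\<^esub>"
        by (rule ring_hom_cring.hom_zero[OF ring_hom_cringI'[OF Uc Ac]]) (use ev(1)[OF t] in \<open>simp add: k_algebra_hom_def\<close>)
      then have "lift_submodule A n r (kernel_family A ?K m (\<lambda>i p. if (i, p) = e then Q i0 p0 else Q i p)) \<in> Z A"
        unfolding spec'[OF t] using J0 by blast
      moreover have "(\<lambda>i p. if (i, p) = e then Q i0 p0 else Q i p) = Q" by (auto simp: e fun_eq_iff)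
      ultimately show ?thesis by simp
    qed
  qed
  show ?thesis by (rule free[of "{..<m} \<times> {..<?K}", OF _ C]) auto
qed

lemma base_change_id:
  fixes A :: "('k, 'b) module"
  assumes "Module.submodule N A (free_module A X)"
  shows "base_change A X (\<lambda>a. a) N = N"
  using assms by (auto simp: base_change_def comp_def)

lemma k_algebra_hom_id: "k_algebra A \<Longrightarrow> k_algebra_hom A A (\<lambda>a. a)"
  by (auto simp: k_algebra_hom_def Ring.ring_hom_def)

text \<open>For the inclusion from right to left, \<open>Z\<close> is known only through the ideal
  \<open>I\<close> of its pullback along \<open>\<xi>\<close>. Each \<open>a \<in> I\<close> has the
  unit ideal as annihilator, because \<open>a\<close> vanishes in the localisations where
  \<open>\<xi>\<close> lies in a standard chart. So \<open>I = 0\<close>, and the identity of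
  \<open>A\<close> then puts \<open>\<xi>\<close> into \<open>Z A\<close>.\<close>

lemma R_scheme_points:
  fixes A :: "('k::field_char_0, 'b) module"
  assumes A: "k_algebra A" and r: "0 < r" "r \<le> d"
  shows "points (R_scheme n r d) A = lift_submodule A n r ` points (Grassmannian (n * r) (d - r)) A"
proof
  interpret T: tuple_space A n r by (intro tuple_space.intro tuple_space_axioms.intro k_algebra_cring[OF A] r)
  let ?S = "S_locus n r d (int r) :: 'k poly_tuple set set"
  show "points (R_scheme n r d) A \<subseteq> lift_submodule A n r ` points (Grassmannian (n * r) (d - r)) A"
  proof
    fix \<xi> assume "\<xi> \<in> points (R_scheme n r d) A"
    then have \<xi>q: "\<xi> \<in> points (Defs.Quot n r d) A"
      and \<xi>Z: "\<And>Z. closed_subscheme (Defs.Quot n r d :: ('k, 'b, 'b poly_tuple set) k_functor) Z \<Longrightarrow> contains_k_points n r Z ?S \<Longrightarrow> \<xi> \<in> Z A"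
      by (auto simp: R_scheme_def reduced_subscheme_def)
    have \<xi>: "Module.submodule \<xi> A T.FX" "locally_free_quotient A T.FX \<xi> d" using \<xi>q by (auto simp: Quot_points_iff)
    have "\<xi> \<in> deg0_locus n r d A"
      by (rule \<xi>Z[OF closed_deg0_locus[OF r(1)]]) (use S_locus_base_change(1)[OF _ r] in \<open>auto simp: contains_k_points_def\<close>)
    then have deg0: "f (j, {#}) = \<zero>\<^bsub>A\<^esub>" if "f \<in> \<xi>" for f j using that by (simp add: deg0_locus_def)
    have high: "unit_fun A x \<in> \<xi>" if x: "x \<in> quot_index n r" "size (snd x) \<ge> 2" for x
    proof -
      have "\<xi> \<in> vanishing_locus n r d x A"
        by (rule \<xi>Z[OF closed_vanishing_locus[OF r(1) x(1)]]) (use S_locus_base_change(2)[OF _ r _ x] in \<open>auto simp: contains_k_points_def\<close>)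
      then show ?thesis by (simp add: vanishing_locus_def)
    qed
    have L: "Module.submodule (lin_part r ` \<xi>) A T.FY" "\<xi> = lift_submodule A n r (lin_part r ` \<xi>)"
      by (rule T.eq_lift_submodule[OF \<xi>(1)]; use deg0 high in blast)+
    have "locally_free_quotient A T.FY (lin_part r ` \<xi>) (d - r)"
      by (rule T.lift_locally_free_conv[OF L(1) r(2)]) (use \<xi>(2) L(2) in simp)
    then have "lin_part r ` \<xi> \<in> points (Grassmannian (n * r) (d - r)) A" using L(1) by (simp add: Grassmannian_points_iff)
    then show "\<xi> \<in> lift_submodule A n r ` points (Grassmannian (n * r) (d - r)) A" using L(2) by blast
  qed
  show "lift_submodule A n r ` points (Grassmannian (n * r) (d - r)) A \<subseteq> points (R_scheme n r d) A"
  proof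
    fix \<xi> assume "\<xi> \<in> lift_submodule A n r ` points (Grassmannian (n * r) (d - r)) A"
    then obtain N where \<xi>: "\<xi> = lift_submodule A n r N" and N: "Module.submodule N A T.FY"
      and lf: "locally_free_quotient A T.FY N (d - r)" by (auto simp: Grassmannian_points_iff)
    have \<xi>s: "Module.submodule \<xi> A T.FX" unfolding \<xi> by (rule T.lift_submodule_submodule[OF N])
    have \<xi>q: "\<xi> \<in> points (Defs.Quot n r d) A" unfolding Quot_points_iff
      using \<xi>s T.lift_var_mult[OF N] T.lift_locally_free[OF N r(2) lf] by (simp add: \<xi>)
    have "\<xi> \<in> Z A" if Z: "closed_subscheme (Defs.Quot n r d :: ('k, 'b, 'b poly_tuple set) k_functor) Z" and P: "contains_k_points n r Z ?S" for Z
    proof -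
      obtain I where I: "ideal I A" and IZ: "\<forall>B \<phi>. k_algebra B \<longrightarrow> k_algebra_hom A B \<phi> \<longrightarrow>
          (base_change B (quot_index n r) \<phi> \<xi> \<in> Z B \<longleftrightarrow> (\<forall>a \<in> I. \<phi> a = \<zero>\<^bsub>B\<^esub>))"
        using closed_subscheme_ideal[OF Z A \<xi>q] by blast
      note IZ = IZ[THEN spec, THEN spec, THEN mp, THEN mp]
      have d: "r + (d - r) = d" using r by simp
      have "a = \<zero>\<^bsub>A\<^esub>" if a: "a \<in> I" for a
      proof (cases "\<one>\<^bsub>A\<^esub> = \<zero>\<^bsub>A\<^esub>")
        \<comment> \<open>The coding of auxiliary algebras relies on an infinite carrier, hence on
          \<open>1 \<noteq> 0\<close>; over the zero ring every element is \<open>0\<close>.\<close>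
        case True
        then show ?thesis using T.l_one[OF ideal.Icarr[OF I a]] T.l_null[OF ideal.Icarr[OF I a]] by simp
      next
        case nz: False
        have aA: "a \<in> carrier A" by (rule ideal.Icarr[OF I a])
        let ?T = "{s \<in> carrier A. \<exists>\<sigma>. (\<forall>l<d - r. \<sigma> l < n * r) \<and> basis_at A T.FY N s {..<d - r} (\<lambda>l. unit_fun A (\<sigma> l))}"
        have "{x \<in> carrier A. x \<otimes>\<^bsub>A\<^esub> a = \<zero>\<^bsub>A\<^esub>} = carrier A" (is "?Ann = _")
        proof (rule T.ideal_eq_carrier_local[OF T.annihilator_ideal[OF aA] _ standard_charts_cover[OF T.A_cring N lf]])
          fix s assume "s \<in> ?T"
          then obtain \<sigma> where s: "s \<in> carrier A" and \<sigma>: "\<And>l. l < d - r \<Longrightarrow> \<sigma> l < n * r"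
            and b: "basis_at A T.FY N s {..<d - r} (\<lambda>l. unit_fun A (\<sigma> l))" by auto
          obtain L :: "('k, 'b) module" and \<psi> where L: "k_algebra L" and \<psi>: "k_algebra_hom A L \<psi>" and unit: "\<psi> s \<in> Units L"
            and ker: "\<forall>a \<in> carrier A. \<psi> a = \<zero>\<^bsub>L\<^esub> \<longrightarrow> (\<exists>e::nat. s [^]\<^bsub>A\<^esub> e \<otimes>\<^bsub>A\<^esub> a = \<zero>\<^bsub>A\<^esub>)"
            using exists_localization_algebra[OF A nz s] by (elim exE conjE) (rule that)
          have \<psi>h: "\<psi> \<in> Ring.ring_hom A L" using \<psi> by (simp add: k_algebra_hom_def)
          interpret E: tuple_extension A L n r \<psi> by (rule tuple_extension_k_algebra[OF A L \<psi> r(1)])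
          have "\<psi> a = \<zero>\<^bsub>L\<^esub>"
          proof (cases "\<one>\<^bsub>L\<^esub> = \<zero>\<^bsub>L\<^esub>")
            \<comment> \<open>A nilpotent \<open>s\<close> gives the zero ring as
              localisation.\<close>
            case True
            have "\<psi> a \<in> carrier L" using aA by simp
            then show ?thesis using E.B.l_one[of "\<psi> a"] E.B.l_null[of "\<psi> a"] True by simp
          next
            case nzL: False
            obtain Q where Q: "kernel_chart L (n * r) (d - r) \<sigma> Q"
              "base_change L {..<n * r} \<psi> N = kernel_family L (n * r) (d - r) Q"
              using kernel_family_of_basis[OF T.A_cring E.B.A_cring \<psi>h N \<sigma> b s unit] by blast
            have "base_change L (quot_index n r) \<psi> \<xi> \<in> Z L"
              unfolding \<xi> E.base_change_lift[OF N] Q(2)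
              by (rule closed_subscheme_contains_charts[of n r "d - r" Z, unfolded d, OF Z P r(1) L nzL Q(1)])
            then show ?thesis using IZ[OF L \<psi>] a by blast
          qed
          then obtain e :: nat where "s [^]\<^bsub>A\<^esub> e \<otimes>\<^bsub>A\<^esub> a = \<zero>\<^bsub>A\<^esub>" using ker aA by blast
          then have "s [^]\<^bsub>A\<^esub> e \<in> ?Ann" using s by simp
          then show "\<exists>x\<in>saturation A s. x \<in> ?Ann" using T.pow_saturation[OF s] by (rule bexI)
        qed auto
        then have "\<one>\<^bsub>A\<^esub> \<in> ?Ann" by simp
        then show ?thesis using aA by simp
      qed
      then have "base_change A (quot_index n r) (\<lambda>a. a) \<xi> \<in> Z A" using IZ[OF A k_algebra_hom_id[OF A]] by blast
      then show ?thesis unfolding base_change_id[OF \<xi>s] .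
    qed
    then show "\<xi> \<in> points (R_scheme n r d) A" using \<xi>q by (simp add: R_scheme_def reduced_subscheme_def)
  qed
qed

theorem theorem5p3:
  fixes n r d :: nat
  assumes "1 \<le> n" and "1 < r" and "real r < (real d + 1) / 2"
  shows "(R_scheme n r d ::
            ('k :: {alg_closed_field, field_char_0}, 'b, 'b poly_tuple set) k_functor)
         \<simeq>\<^sub>S (Grassmannian (n * r) (d - r) :: ('k, 'b, (nat \<Rightarrow> 'b) set) k_functor)"
proof -
  let ?R = "R_scheme n r d :: ('k, 'b, 'b poly_tuple set) k_functor"
  let ?G = "Grassmannian (n * r) (d - r) :: ('k, 'b, (nat \<Rightarrow> 'b) set) k_functor"
  \<comment> \<open>The upper bound on \<open>r\<close> enters through \<open>r \<le> d\<close>,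
    which makes \<open>d - r\<close> the true difference of natural numbers.\<close>
  have "real (2 * r) < real (d + 1)" using assms(3) by simp
  then have "2 * r < d + 1" by (simp only: of_nat_less_iff)
  with assms(2) have r: "0 < r" "r \<le> d" by auto
  have lin: "lin_part r ` lift_submodule A n r N = N" if "k_algebra A" "Module.submodule N A (free_module A {..<n * r})" for A :: "('k, 'b) module" and N
    by (rule tuple_space.lin_part_image_lift[OF _ that(2)])
       (intro tuple_space.intro tuple_space_axioms.intro k_algebra_cring[OF that(1)] r(1))
  \<comment> \<open>The isomorphism takes a kernel to the set of linear parts of its elements; the
    inverse is \<open>lift_submodule\<close>, and naturality is the compatibility of the lift with
    base change.\<close>
  show ?thesis unfolding scheme_iso_def
  proof (intro exI[of _ "\<lambda>A. (`) (lin_part r)"] conjI allI impI ballI)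
    fix A :: "('k, 'b) module" assume A: "k_algebra A"
    have G: "lin_part r ` lift_submodule A n r N = N" if "N \<in> points ?G A" for N
      by (rule lin[OF A]) (use that in \<open>simp add: Grassmannian_points_iff\<close>)
    show "bij_betw ((`) (lin_part r)) (points ?R A) (points ?G A)"
      by (rule bij_betw_byWitness[where f' = "lift_submodule A n r"]) (auto simp: R_scheme_points[OF A r] G)
  next
    fix A B :: "('k, 'b) module" and \<phi> \<xi>
    assume AB: "k_algebra A \<and> k_algebra B \<and> k_algebra_hom A B \<phi>" and \<xi>: "\<xi> \<in> points ?R A"
    then obtain N where N: "\<xi> = lift_submodule A n r N" "Module.submodule N A (free_module A {..<n * r})"
      by (auto simp: R_scheme_points[OF _ r] Grassmannian_points_iff)
    interpret E: tuple_extension A B n r \<phi> by (rule tuple_extension_k_algebra) (use AB r in auto)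
    have "lin_part r ` base_change B (quot_index n r) \<phi> \<xi> = base_change B {..<n * r} \<phi> N"
      unfolding N(1) E.base_change_lift[OF N(2)]
      by (rule lin[OF _ E.Y.base_change_submodule[OF E.Y.sub_FA[OF N(2)]]]) (use AB in blast)
    then show "lin_part r ` pull ?R A B \<phi> \<xi> = pull ?G A B \<phi> (lin_part r ` \<xi>)"
      using lin[OF _ N(2)] AB N(1) by (simp add: R_scheme_def reduced_subscheme_def Quot_def Grassmannian_def)
  qed
qed

end
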